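(* Let $f\in L_p^0(\mathbb{T}^2)$, $1<p<\infty$, $\alpha_i>0$, $0<\delta_i\le\pi$, $i=1,2$. Then $$\omega_{\alpha_1,\alpha_2}(f,\delta_1,\delta_2)_{L_p(\mathbb{T}^2)}\asymp K(f,\delta_1,\delta_2,\alpha_1,\alpha_2,p).$$
   Context: $L_p(\mathbb{T}^2)$, $1<p<\infty$, is the space of measurable functions $f(x,y)$ that are $2\pi$-periodic in each variable with $\|f\|_{L_p(\mathbb{T}^2)}=\big(\int_0^{2\pi}\int_0^{2\pi}|f(x,y)|^p\,dx\,dy\big)^{1/p}<\infty$; $L_p^0(\mathbb{T}^2)$ is the set of $f\in L_p(\mathbb{T}^2)$ with $\int_0^{2\pi}f(x,y)\,dy=0$ for a.e. $x$ and $\int_0^{2\pi}f(x,y)\,dx=0$ for a.e. $y$. For $\alpha_1,\alpha_2>0$ the (fractional) differences are $\Delta_{h_1}^{\alpha_1}(f)=\sum_{\nu=0}^\infty(-1)^\nu\binom{\alpha_1}{\nu}f(x+(\alpha_1-\nu)h_1,y)$ and $\Delta_{h_2}^{\alpha_2}(f)=\sum_{\nu=0}^\infty(-1)^\nu\binom{\alpha_2}{\nu}f(x,y+(\alpha_2-\nu)h_2)$, where $\binom{\alpha}{0}=1$, $\binom{\alpha}{\nu}=\frac{\alpha(\alpha-1)\cdots(\alpha-\nu+1)}{\nu!}$ for $\nu\ge1$. The mixed modulus of smoothness is $\omega_{\alpha_1,\alpha_2}(f,\delta_1,\delta_2)_{L_p(\mathbb{T}^2)}=\sup_{|h_i|\le\delta_i,\,i=1,2}\|\Delta_{h_1}^{\alpha_1}(\Delta_{h_2}^{\alpha_2}(f))\|_{L_p(\mathbb{T}^2)}$.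 Weyl derivative: for $f$ with zero mean in each variable and Fourier series $\sum_{n_1,n_2\ne0}c_{n_1,n_2}e^{i(n_1x+n_2y)}$, and $\rho_1,\rho_2\ge0$, $f^{(\rho_1,\rho_2)}$ (order $\rho_1$ in $x$, $\rho_2$ in $y$) is the function with Fourier series $\sum_{n_1,n_2\neq0}(in_1)^{\rho_1}(in_2)^{\rho_2}c_{n_1,n_2}e^{i(n_1x+n_2y)}$, where $(in)^{\rho}=|n|^\rho e^{i\pi\rho\,\mathrm{sign}(n)/2}$. The Weyl classes are $W_p^{(\rho_1,\rho_2)}=\{g\in L_p^0(\mathbb{T}^2): g^{(\rho_1,\rho_2)}\in L_p^0(\mathbb{T}^2)\}$ (used for $(\rho_1,\rho_2)=(\alpha_1,0),(0,\alpha_2),(\alpha_1,\alpha_2)$). The mixed $K$-functional of $f\in L_p^0(\mathbb{T}^2)$ is $$K(f,t_1,t_2,\alpha_1,\alpha_2,p)=\inf\Big[\|f-g_1-g_2-g\|_{L_p(\mathbb{T}^2)}+t_1^{\alpha_1}\|g_1^{(\alpha_1,0)}\|_{L_p(\mathbb{T}^2)}+t_2^{\alpha_2}\|g_2^{(0,\alpha_2)}\|_{L_p(\mathbb{T}^2)}+t_1^{\alpha_1}t_2^{\alpha_2}\|g^{(\alpha_1,\alpha_2)}\|_{L_p(\mathbb{T}^2)}\Big],$$ the infimum over $g_1\in W_p^{(\alpha_1,0)}$, $g_2\in W_p^{(0,\alpha_2)}$, $g\in W_p^{(\alpha_1,\alpha_2)}$. $A\asymp B$ means $C^{-1}B\le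 A\le CB$ with a constant $C>0$ independent of $f,\delta_1,\delta_2$ ($C$ may depend on $p,\alpha_1,\alpha_2$). *)

theory Defs
  imports "HOL-Analysis.Analysis"
begin

text \<open>Functions on the torus are complex-valued functions on the plane that are
  \<open>2\<pi>\<close>-periodic in each variable. They are not identified up to null sets.\<close>

definition T2 :: "(real \<times> real) measure" where
  "T2 = lebesgue_on ({0..2 * pi} \<times> {0..2 * pi})"

definition periodic2 :: "(real \<times> real \<Rightarrow> complex) \<Rightarrow> bool" where
  "periodic2 f \<longleftrightarrow>
     (\<forall>x y. f (x + 2 * pi, y) = f (x, y) \<and> f (x, y + 2 * pi) = f (x, y))"

definition Lp :: "real \<Rightarrow> (real \<times> real \<Rightarrow> complex) set" where
  "Lp p = {f. f \<in> borel_measurable lebesgue \<and> periodic2 f \<and>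
              integrable T2 (\<lambda>z. norm (f z) powr p)}"

definition Lp_norm :: "real \<Rightarrow> (real \<times> real \<Rightarrow> complex) \<Rightarrow> real" where
  "Lp_norm p f = (\<integral>z. norm (f z) powr p \<partial>T2) powr (1 / p)"

text \<open>For \<open>f \<in> Lp p\<close> with \<open>p \<ge> 1\<close> almost every section is integrable, so the
  default value 0 of the integral of a non-integrable function only matters on a null set.\<close>

definition Lp0 :: "real \<Rightarrow> (real \<times> real \<Rightarrow> complex) set" where
  "Lp0 p = {f \<in> Lp p.
     (AE x in lebesgue. (\<integral>y. f (x, y) \<partial>lebesgue_on {0..2 * pi}) = 0) \<and>
     (AE y in lebesgue. (\<integral>x. f (x, y) \<partial>lebesgue_on {0..2 * pi}) = 0)}"

text \<open>Since the series of the \<open>\<bar>\<alpha> gchoose \<nu>\<bar>\<close> converges for \<open>\<alpha> > 0\<close>, the series below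
  converge absolutely almost everywhere for \<open>f \<in> Lp p\<close>, \<open>p \<ge> 1\<close>, and the sums are again
  in \<open>Lp p\<close>, with norm bounded uniformly in \<open>h\<close>. Hence the supremum in
  \<open>mixed_modulus\<close> is that of a bounded set.\<close>

definition diff1 :: "real \<Rightarrow> real \<Rightarrow> (real \<times> real \<Rightarrow> complex) \<Rightarrow> (real \<times> real \<Rightarrow> complex)" where
  "diff1 \<alpha> h f = (\<lambda>(x, y). \<Sum>\<nu>. ((- 1) ^ \<nu> * (\<alpha> gchoose \<nu>)) *\<^sub>R f (x + (\<alpha> - real \<nu>) * h, y))"

definition diff2 :: "real \<Rightarrow> real \<Rightarrow> (real \<times> real \<Rightarrow> complex) \<Rightarrow> (real \<times> real \<Rightarrow> complex)" where
  "diff2 \<alpha> h f = (\<lambda>(x, y). \<Sum>\<nu>. ((- 1) ^ \<nu> * (\<alpha> gchoose \<nu>)) *\<^sub>R f (x, y + (\<alpha> - real \<nu>) * h))"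

definition mixed_modulus ::
  "real \<Rightarrow> real \<Rightarrow> (real \<times> real \<Rightarrow> complex) \<Rightarrow> real \<Rightarrow> real \<Rightarrow> real \<Rightarrow> real" where
  "mixed_modulus \<alpha>1 \<alpha>2 f \<delta>1 \<delta>2 p =
     (SUP (h1, h2) \<in> {h1. \<bar>h1\<bar> \<le> \<delta>1} \<times> {h2. \<bar>h2\<bar> \<le> \<delta>2}.
        Lp_norm p (diff1 \<alpha>1 h1 (diff2 \<alpha>2 h2 f)))"

definition fourier_coeff :: "(real \<times> real \<Rightarrow> complex) \<Rightarrow> int \<Rightarrow> int \<Rightarrow> complex" where
  "fourier_coeff f n1 n2 =
     (\<integral>(x, y). f (x, y) * exp (- \<i> * complex_of_real (of_int n1 * x + of_int n2 * y)) \<partial>T2)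
       / complex_of_real (4 * pi\<^sup>2)"

text \<open>The power \<open>(i n)\<^sup>\<rho>\<close>, for \<open>n \<noteq> 0\<close>.\<close>

definition ipow :: "int \<Rightarrow> real \<Rightarrow> complex" where
  "ipow n \<rho> = complex_of_real (\<bar>of_int n\<bar> powr \<rho>) * exp (\<i> * complex_of_real (pi * \<rho> * of_int (sgn n) / 2))"

text \<open>Coefficients determine an integrable function only up to a null set, so the Weyl
  derivative is a relation first; \<open>weyl_deriv\<close> picks one representative,
  whose norm and membership in \<open>Lp0 p\<close> do not depend on the choice.\<close>

definition has_weyl_deriv ::
  "real \<Rightarrow> real \<Rightarrow> (real \<times> real \<Rightarrow> complex) \<Rightarrow> (real \<times> real \<Rightarrow> complex) \<Rightarrow> bool" where
  "has_weyl_deriv \<rho>1 \<rho>2 f d \<longleftrightarrow> d \<in> Lp 1 \<and>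
     (\<forall>n1 n2. fourier_coeff d n1 n2 =
        (if n1 \<noteq> 0 \<and> n2 \<noteq> 0 then ipow n1 \<rho>1 * ipow n2 \<rho>2 * fourier_coeff f n1 n2 else 0))"

definition weyl_deriv ::
  "real \<Rightarrow> real \<Rightarrow> (real \<times> real \<Rightarrow> complex) \<Rightarrow> (real \<times> real \<Rightarrow> complex)" where
  "weyl_deriv \<rho>1 \<rho>2 f = (SOME d. has_weyl_deriv \<rho>1 \<rho>2 f d)"

definition weyl_class :: "real \<Rightarrow> real \<Rightarrow> real \<Rightarrow> (real \<times> real \<Rightarrow> complex) set" where
  "weyl_class p \<rho>1 \<rho>2 =
     {g \<in> Lp0 p. (\<exists>d. has_weyl_deriv \<rho>1 \<rho>2 g d) \<and> weyl_deriv \<rho>1 \<rho>2 g \<in> Lp0 p}"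

definition K_functional ::
  "(real \<times> real \<Rightarrow> complex) \<Rightarrow> real \<Rightarrow> real \<Rightarrow> real \<Rightarrow> real \<Rightarrow> real \<Rightarrow> real" where
  "K_functional f t1 t2 \<alpha>1 \<alpha>2 p =
     (INF (g1, g2, g) \<in> weyl_class p \<alpha>1 0 \<times> weyl_class p 0 \<alpha>2 \<times> weyl_class p \<alpha>1 \<alpha>2.
        Lp_norm p (\<lambda>z. f z - g1 z - g2 z - g z)
        + t1 powr \<alpha>1 * Lp_norm p (weyl_deriv \<alpha>1 0 g1)
        + t2 powr \<alpha>2 * Lp_norm p (weyl_deriv 0 \<alpha>2 g2)
        + t1 powr \<alpha>1 * t2 powr \<alpha>2 * Lp_norm p (weyl_deriv \<alpha>1 \<alpha>2 g))"

end

theory Submission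
  imports Defs
begin

text \<open>Both the differences and the Weyl derivatives are Fourier multipliers, so the theorem
  compares multipliers on trigonometric polynomials, uniformly in the steps and with respect to the
  \<open>L\<^sub>p\<close> norm; Fejer means transfer the resulting inequalities to all functions. M. Riesz's theorem
  bounds the half-line multipliers, since \<open>2/(p-1) \<bar>Re w\<bar>\<^sup>p - \<bar>w\<bar>\<^sup>p\<close> for \<open>p \<le> 2\<close>
  and \<open>p\<^sup>2/2 (Re w)\<^sup>2 \<bar>w\<bar>\<close> to the power \<open>p - 2\<close> minus \<open>\<bar>w\<bar>\<^sup>p\<close> for \<open>p \<ge> 2\<close> are subharmonic up to a
  regularisation. Abel summation then gives all multipliers of bounded variation.

  With \<open>u = n h\<close> the symbol of the difference of order \<open>\<alpha>\<close> is \<open>\<bar>2 sin (u/2)\<bar>\<close> to the power \<open>\<alpha>\<close> times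
  phases for \<open>\<bar>u\<bar> < 2\<pi>\<close>, so on low frequencies it differs from the symbol of the derivative by a
  monotone factor. This bounds differences by derivatives, and derivatives of sharply
  truncated functions by differences. High frequencies are controlled by averaging
  \<open>(2 - 2 cos (n h))\<^sup>m\<close> over \<open>h\<close>, which is bounded below there.\<close>

section \<open>The M. Riesz inequality on the circle\<close>

text \<open>The modulus bounds every single step h, but no single symbol can be inverted on all high
  frequencies: it vanishes whenever n h is a multiple of 2 \<pi>. Hence the averaging over h, shaped
  by three choices. The order 2 m is an even integer above \<alpha>, so that the average is a finite
  sum of exponentials, while the surplus order 2 m - \<alpha> is a bounded multiplier. The steps are
  differences a - b of two equidistributed parameters: with u = n \<delta>, each oscillating
  exponential averages to a square of size 1/u^2 whose derivative is again of order 1/u^2, so its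
  variation is bounded uniformly in \<delta>; a single mean behaves like sin u / u, which has
  infinite variation. The border between low and high frequencies is 3: below 2 \<pi>, so that sin
  (u/2) stays positive on the low side, and above the square root of 8, so that 4/u^2 is below 1/2
  and the averaged symbol is at least 1 on the high side. A sharp cut at the border is harmless
  because half-line projections are bounded for 1 < p < \<infinity>. Multiplier norms are taken over
  finite frequency sets, where limits can be formed coefficient by coefficient.\<close>

lemma convex_bounded_above_mono:
  fixes \<Phi> \<Phi>' \<Phi>'' :: "real \<Rightarrow> real"
  assumes d1: "\<And>t. (\<Phi> has_real_derivative \<Phi>' t) (at t)"
    and d2: "\<And>t. (\<Phi>' has_real_derivative \<Phi>'' t) (at t)"
    and nn: "\<And>t. 0 \<le> \<Phi>'' t"
    and bdd: "\<And>t. t \<le> 0 \<Longrightarrow> \<Phi> t \<le> M"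
    and "t \<le> 0"
  shows "\<Phi> t \<le> \<Phi> 0"
proof -
  have mono: "\<Phi>' s \<le> \<Phi>' t" if "s \<le> t" for s t
    by (rule DERIV_nonneg_imp_nondecreasing[OF that]) (use d2 nn in blast)
  \<comment> \<open>A convex function lies above its tangents. A tangent of negative slope grows
    without bound to the left, which contradicts the upper bound \<open>M\<close>.\<close>
  have nonneg: "0 \<le> \<Phi>' s" if s: "s \<le> 0" for s
  proof (rule ccontr)
    assume "\<not> 0 \<le> \<Phi>' s"
    then have c: "0 < - \<Phi>' s" by simp
    \<comment> \<open>The point at which the tangent at \<open>s\<close> has height
      \<open>M + 1\<close>.\<close>
    define r where "r = s - (M - \<Phi> s + 1) / (- \<Phi>' s)"
    have M: "\<Phi> s \<le> M" using bdd s by blast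
    then have "r < s" unfolding r_def using c by (simp add: divide_pos_neg)
    have "\<Phi> s - \<Phi>' s * s \<le> \<Phi> r - \<Phi>' s * r"
    proof (rule DERIV_nonpos_imp_nonincreasing[of r s "\<lambda>x. \<Phi> x - \<Phi>' s * x"])
      fix x assume "r \<le> x" "x \<le> s"
      have "((\<lambda>x. \<Phi> x - \<Phi>' s * x) has_real_derivative \<Phi>' x - \<Phi>' s) (at x)"
        by (auto intro!: derivative_eq_intros d1)
      then show "\<exists>y. ((\<lambda>x. \<Phi> x - \<Phi>' s * x) has_real_derivative y) (at x) \<and> y \<le> 0"
        using mono[OF \<open>x \<le> s\<close>] by (auto intro!: exI[of _ "\<Phi>' x - \<Phi>' s"])
    qed (use \<open>r < s\<close> in auto)
    then have "\<Phi> s + (- \<Phi>' s) * (s - r) \<le> \<Phi> r" by (simp add: algebra_simps)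
    moreover have "(- \<Phi>' s) * (s - r) = M - \<Phi> s + 1" unfolding r_def using c by simp
    ultimately have "M + 1 \<le> \<Phi> r" by simp
    with bdd[of r] \<open>r < s\<close> s show False by simp
  qed
  show ?thesis
    by (rule DERIV_nonneg_imp_nondecreasing[OF \<open>t \<le> 0\<close>]) (use d1 nonneg in blast)
qed

text \<open>In the coordinate \<open>s = t + \<i> x\<close> the average of \<open>G \<circ> F\<close> over \<open>x\<close> is a convex function of
  \<open>t\<close>, because its second derivative is the average of \<open>\<Delta>(G \<circ> F) = (\<Delta>G \<circ> F) \<bar>F'\<bar>\<^sup>2\<close>.\<close>

lemma subharmonic_average_mono:
  fixes F F' F'' :: "complex \<Rightarrow> complex" and G Gu Gv Guu Guv Gvv :: "complex \<Rightarrow> real"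
  assumes F: "\<And>s. (F has_field_derivative F' s) (at s)"
    and F': "\<And>s. (F' has_field_derivative F'' s) (at s)"
    and F'': "continuous_on UNIV F''"
    and per: "\<And>s. F' (s + 2 * pi * \<i>) = F' s" "\<And>s. F (s + 2 * pi * \<i>) = F s"
    and G: "\<And>w. (G has_derivative (\<lambda>h. Gu w * Re h + Gv w * Im h)) (at w)"
    and Gu: "\<And>w. (Gu has_derivative (\<lambda>h. Guu w * Re h + Guv w * Im h)) (at w)"
    and Gv: "\<And>w. (Gv has_derivative (\<lambda>h. Guv w * Re h + Gvv w * Im h)) (at w)"
    and cont: "continuous_on UNIV Guu" "continuous_on UNIV Guv" "continuous_on UNIV Gvv"
    and lap: "\<And>w. 0 \<le> Guu w + Gvv w"
    and bdd: "\<And>t. t \<le> 0 \<Longrightarrow> integral {0..2 * pi} (\<lambda>x. G (F (Complex t x))) \<le> M"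
    and "t \<le> 0"
  shows "integral {0..2 * pi} (\<lambda>x. G (F (Complex t x))) \<le> integral {0..2 * pi} (\<lambda>x. G (F (Complex 0 x)))"
proof -
  have cF: "continuous_on UNIV F" "continuous_on UNIV F'"
    using F F' by (auto intro!: continuous_at_imp_continuous_on DERIV_isCont)
  have cG: "continuous_on UNIV G" "continuous_on UNIV Gu" "continuous_on UNIV Gv"
    using has_derivative_continuous[OF G] has_derivative_continuous[OF Gu] has_derivative_continuous[OF Gv]
    by (auto intro!: continuous_at_imp_continuous_on)
  define S where "S = (\<lambda>p::real\<times>real. Complex (fst p) (snd p))"
  have cS: "continuous_on UNIV S" unfolding S_def by (intro continuous_intros)
  define \<phi>t where "\<phi>t = (\<lambda>t x. Gu (F (Complex t x)) * Re (F' (Complex t x)) + Gv (F (Complex t x)) * Im (F' (Complex t x)))"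
  define \<phi>x where "\<phi>x = (\<lambda>t x. - Gu (F (Complex t x)) * Im (F' (Complex t x)) + Gv (F (Complex t x)) * Re (F' (Complex t x)))"
  define \<phi>tt where "\<phi>tt = (\<lambda>t x. (let w = F (Complex t x); a = F' (Complex t x); b = F'' (Complex t x)
     in Guu w * (Re a)\<^sup>2 + 2 * Guv w * Re a * Im a + Gvv w * (Im a)\<^sup>2 + Gu w * Re b + Gv w * Im b))"
  define \<phi>xx where "\<phi>xx = (\<lambda>t x. (let w = F (Complex t x); a = F' (Complex t x); b = F'' (Complex t x)
     in Guu w * (Im a)\<^sup>2 - 2 * Guv w * Re a * Im a + Gvv w * (Re a)\<^sup>2 - Gu w * Re b - Gv w * Im b))"
  have St: "((\<lambda>t. Complex t x) has_vector_derivative 1) (at t)" for t x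
  proof -
    have "((\<lambda>t. complex_of_real t + \<i> * of_real x) has_vector_derivative 1) (at t)"
      by (auto intro!: derivative_eq_intros)
    then show ?thesis by (simp add: Complex_eq)
  qed
  have Sx: "((\<lambda>x. Complex t x) has_vector_derivative \<i>) (at x)" for t x
  proof -
    have "((\<lambda>x. complex_of_real t + \<i> * of_real x) has_vector_derivative \<i>) (at x)"
      by (auto intro!: derivative_eq_intros)
    then show ?thesis by (simp add: Complex_eq)
  qed
  have ch: "((\<lambda>t. H (c t)) has_vector_derivative c' * H' (c t)) (at t)"
    if "\<And>s. (H has_field_derivative H' s) (at s)" "(c has_vector_derivative c') (at t)"
    for H H' :: "complex \<Rightarrow> complex" and c c' t
    using field_vector_diff_chain_at[OF that(2) that(1)] by (simp add: o_def)
  have chG: "((\<lambda>t. H (c t)) has_real_derivative Hu (c t) * Re c' + Hv (c t) * Im c') (at t)"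
    if H: "\<And>w. (H has_derivative (\<lambda>h. Hu w * Re h + Hv w * Im h)) (at w)" and c: "(c has_vector_derivative c') (at t)"
    for H Hu Hv :: "complex \<Rightarrow> real" and c c' t
  proof -
    have "((\<lambda>t. H (c t)) has_derivative (\<lambda>h. Hu (c t) * Re (h *\<^sub>R c') + Hv (c t) * Im (h *\<^sub>R c'))) (at t)"
      using has_derivative_compose[OF c[unfolded has_vector_derivative_def] H[of "c t"]] by simp
    moreover have "(\<lambda>h. Hu (c t) * Re (h *\<^sub>R c') + Hv (c t) * Im (h *\<^sub>R c')) = (*) (Hu (c t) * Re c' + Hv (c t) * Im c')"
      by (rule ext) (simp add: algebra_simps)
    ultimately show ?thesis by (simp only: has_field_derivative_def)
  qed
  have reim: "((\<lambda>t. Re (c t)) has_real_derivative Re c') (at t)" "((\<lambda>t. Im (c t)) has_real_derivative Im c') (at t)"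
    if "(c has_vector_derivative c') (at t)" for c c' t
    using that by (auto simp: has_vector_derivative_complex_iff)
  have d_t: "((\<lambda>t. G (F (Complex t x))) has_real_derivative \<phi>t t x) (at t)" for t x
    using chG[OF G ch[OF F St]] by (simp add: \<phi>t_def)
  have d_x: "((\<lambda>x. G (F (Complex t x))) has_real_derivative \<phi>x t x) (at x)" for t x
    using chG[OF G ch[OF F Sx]] by (simp add: \<phi>x_def)
  have d_tt: "((\<lambda>t. \<phi>t t x) has_real_derivative \<phi>tt t x) (at t)" for t x
    unfolding \<phi>t_def
    by (rule derivative_eq_intros chG[OF Gu ch[OF F St]] chG[OF Gv ch[OF F St]] reim[OF ch[OF F' St]] refl)+
       (simp add: \<phi>tt_def Let_def power2_eq_square algebra_simps)
  have d_xx: "((\<lambda>x. \<phi>x t x) has_real_derivative \<phi>xx t x) (at x)" for t x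
    unfolding \<phi>x_def
    by (rule derivative_eq_intros chG[OF Gu ch[OF F Sx]] chG[OF Gv ch[OF F Sx]] reim[OF ch[OF F' Sx]] refl)+
       (simp add: \<phi>xx_def Let_def power2_eq_square algebra_simps)
  have comp: "continuous_on T (\<lambda>p. H (c p))" if "continuous_on UNIV H" "continuous_on T c"
    for H :: "'x::topological_space \<Rightarrow> 'y::topological_space" and c :: "'z::topological_space \<Rightarrow> 'x" and T
    using continuous_on_compose2[OF that(1) that(2)] by auto
  note cc = comp[OF cF(1)] comp[OF cF(2)] comp[OF F''] comp[OF cG(1)] comp[OF cG(2)] comp[OF cG(3)]
     comp[OF cont(1)] comp[OF cont(2)] comp[OF cont(3)]
  have c\<phi>: "continuous_on UNIV (\<lambda>(t,x). G (F (Complex t x)))"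
    unfolding case_prod_unfold by (intro continuous_intros cc)
  have c\<phi>t: "continuous_on UNIV (\<lambda>(t,x). \<phi>t t x)"
    unfolding case_prod_unfold \<phi>t_def by (intro continuous_intros cc)
  have c\<phi>tt: "continuous_on UNIV (\<lambda>(t,x). \<phi>tt t x)"
    unfolding case_prod_unfold \<phi>tt_def Let_def by (intro continuous_intros cc)
  have c\<phi>xx: "continuous_on UNIV (\<lambda>(t,x). \<phi>xx t x)"
    unfolding case_prod_unfold \<phi>xx_def Let_def by (intro continuous_intros cc)
  have slice: "continuous_on T (\<lambda>x. f t x)" if "continuous_on UNIV (\<lambda>(t,x). f t x)"
    for f :: "real \<Rightarrow> real \<Rightarrow> real" and t T
  proof -
    have "continuous_on T (\<lambda>x. (t,x))" by (intro continuous_intros)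
    from comp[OF that this] show ?thesis by simp
  qed
  have slicei: "f t integrable_on {0..2*pi}" if "continuous_on UNIV (\<lambda>(t,x). f t x)"
    for f :: "real \<Rightarrow> real \<Rightarrow> real" and t
    using slice[OF that] by (intro integrable_continuous_real)
  define \<Phi> where "\<Phi> = (\<lambda>t. integral {0..2*pi} (\<lambda>x. G (F (Complex t x))))"
  have D1: "(\<Phi> has_real_derivative integral {0..2*pi} (\<phi>t t)) (at t)" for t
    using leibniz_rule_field_derivative[of UNIV 0 "2*pi" "\<lambda>t x. G (F (Complex t x))" "\<phi>t" t]
      d_t slicei[OF c\<phi>] continuous_on_subset[OF c\<phi>t] unfolding \<Phi>_def by simp
  have D2: "((\<lambda>t. integral {0..2*pi} (\<phi>t t)) has_real_derivative integral {0..2*pi} (\<phi>tt t)) (at t)" for t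
    using leibniz_rule_field_derivative[of UNIV 0 "2*pi" "\<phi>t" "\<phi>tt" t]
      d_tt slicei[OF c\<phi>t] continuous_on_subset[OF c\<phi>tt] by simp
  \<comment> \<open>\<open>\<phi>x\<close> is periodic in \<open>x\<close>, so
    \<open>\<phi>xx\<close> integrates to zero and may be added for free. In the sum the terms with
    F'' and with the mixed derivative \<open>Guv\<close> cancel, by the Cauchy-Riemann equations,
    and only the Laplacian of \<open>G\<close> times |F'|^2 is left.\<close>
  have D2nn: "0 \<le> integral {0..2*pi} (\<phi>tt t)" for t
  proof -
    have "(\<phi>xx t has_integral (\<phi>x t (2*pi) - \<phi>x t 0)) {0..2*pi}"
      by (rule fundamental_theorem_of_calculus)
         (auto simp: has_real_derivative_iff_has_vector_derivative[symmetric] intro!: has_field_derivative_at_within d_xx)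
    moreover have "\<phi>x t (2*pi) = \<phi>x t 0"
    proof -
      have "Complex t (2*pi) = Complex t 0 + 2*pi*\<i>" by (simp add: complex_eq_iff)
      then show ?thesis unfolding \<phi>x_def by (simp only: per)
    qed
    ultimately have "integral {0..2*pi} (\<phi>xx t) = 0" by auto
    then have "integral {0..2*pi} (\<phi>tt t) = integral {0..2*pi} (\<lambda>x. \<phi>tt t x + \<phi>xx t x)"
      using slicei[OF c\<phi>tt, of t] slicei[OF c\<phi>xx, of t] by (subst integral_add) auto
    also have "\<dots> = integral {0..2*pi} (\<lambda>x. (Guu (F (Complex t x)) + Gvv (F (Complex t x))) * ((Re (F' (Complex t x)))\<^sup>2 + (Im (F' (Complex t x)))\<^sup>2))"
      by (simp add: \<phi>tt_def \<phi>xx_def Let_def algebra_simps)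
    also have "\<dots> \<ge> 0"
      by (rule Henstock_Kurzweil_Integration.integral_nonneg)
         (auto intro!: integrable_continuous_real continuous_intros cc mult_nonneg_nonneg lap)
    finally show ?thesis .
  qed
  show ?thesis
    using convex_bounded_above_mono[of \<Phi>, OF D1 D2 D2nn _ \<open>t \<le> 0\<close>] bdd unfolding \<Phi>_def by blast
qed

text \<open>The sub-mean value property at the centre of the disc. The substitution r = exp t turns
  the circle of radius r into a vertical segment, so the means \<open>h\<close> increase with r by
  the previous lemma. Continuity of \<open>h\<close> on [0,1] supplies the upper bound needed as t
  tends to minus infinity, and it identifies the limit at r = 0 with the value at the
  centre.\<close>

lemma subharmonic_mean_value:
  fixes b :: "nat \<Rightarrow> complex" and G Gu Gv Guu Guv Gvv :: "complex \<Rightarrow> real"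
  assumes G: "\<And>w. (G has_derivative (\<lambda>h. Gu w * Re h + Gv w * Im h)) (at w)"
    and Gu: "\<And>w. (Gu has_derivative (\<lambda>h. Guu w * Re h + Guv w * Im h)) (at w)"
    and Gv: "\<And>w. (Gv has_derivative (\<lambda>h. Guv w * Re h + Gvv w * Im h)) (at w)"
    and cont: "continuous_on UNIV Guu" "continuous_on UNIV Guv" "continuous_on UNIV Gvv"
    and lap: "\<And>w. 0 \<le> Guu w + Gvv w"
  shows "2 * pi * G (b 0) \<le> integral {0..2 * pi} (\<lambda>x. G (\<Sum>n\<le>N. b n * cis (real n * x)))"
proof -
  define F where "F = (\<lambda>s. \<Sum>n\<le>N. b n * exp (of_nat n * s))"
  define F' where "F' = (\<lambda>s. \<Sum>n\<le>N. of_nat n * b n * exp (of_nat n * s))"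
  define F'' where "F'' = (\<lambda>s. \<Sum>n\<le>N. (of_nat n)\<^sup>2 * b n * exp (of_nat n * s))"
  define h where "h = (\<lambda>r. integral {0..2 * pi} (\<lambda>x. G (\<Sum>n\<le>N. b n * of_real r ^ n * cis (real n * x))))"
  have cG: "continuous_on UNIV G"
    using has_derivative_continuous[OF G] by (auto intro!: continuous_at_imp_continuous_on)
  have dF: "(F has_field_derivative F' s) (at s)" for s
    unfolding F_def F'_def by (auto intro!: derivative_eq_intros sum.cong)
  have dF': "(F' has_field_derivative F'' s) (at s)" for s
    unfolding F'_def F''_def by (auto intro!: derivative_eq_intros sum.cong simp: power2_eq_square)
  have exp_per: "exp (of_nat n * (s + 2 * pi * \<i>)) = exp (of_nat n * s)" for n s
  proof -
    have "of_nat n * (s + 2 * pi * \<i>) = of_nat n * s + 2 * of_int (int n) * (of_real pi * \<i>)" by (simp add: algebra_simps)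
    moreover have "exp (2 * of_int (int n) * (of_real pi * \<i>)) = 1" using exp_plus_2pin[of 0 "int n"] by (simp add: mult_ac)
    ultimately show ?thesis by (simp only: exp_add) simp
  qed
  have FC: "F (Complex t x) = (\<Sum>n\<le>N. b n * of_real (exp t) ^ n * cis (real n * x))" for t x
  proof -
    have "exp (of_nat n * Complex t x) = of_real (exp t) ^ n * cis (real n * x)" for n
    proof -
      have "of_nat n * Complex t x = of_real (real n * t) + \<i> * of_real (real n * x)"
        by (simp add: complex_eq_iff)
      then show ?thesis by (simp add: exp_add cis_conv_exp exp_of_real[symmetric] exp_of_nat_mult[symmetric])
    qed
    then show ?thesis unfolding F_def by (simp add: mult.assoc)
  qed
  have hF: "h (exp t) = integral {0..2 * pi} (\<lambda>x. G (F (Complex t x)))" for t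
    unfolding h_def FC ..
  have ch: "continuous_on {0..1} h"
  proof -
    have "continuous_on ({0..1} \<times> cbox 0 (2 * pi)) (\<lambda>(r,x). G (\<Sum>n\<le>N. b n * of_real r ^ n * cis (real n * x)))"
      unfolding case_prod_unfold cis_conv_exp
      by (rule continuous_on_compose2[OF cG]) (auto intro!: continuous_intros)
    from integral_continuous_on_param[OF this] show ?thesis unfolding h_def by simp
  qed
  then obtain M where M: "\<And>r. r \<in> {0..1} \<Longrightarrow> h r \<le> M"
    using continuous_attains_sup[of "{0..1}" h] by fastforce
  have le1: "h (exp t) \<le> h 1" if "t \<le> 0" for t
  proof -
    have "h (exp t) \<le> h (exp 0)"
      unfolding hF
    proof (rule subharmonic_average_mono[OF dF dF' _ _ _ G Gu Gv cont lap _ that])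
      show "continuous_on UNIV F''" unfolding F''_def by (intro continuous_intros)
      show "F' (s + complex_of_real (2 * pi) * \<i>) = F' s" "F (s + complex_of_real (2 * pi) * \<i>) = F s" for s
        unfolding F_def F'_def using exp_per by simp_all
      show "integral {0..2 * pi} (\<lambda>x. G (F (Complex t x))) \<le> M" if "t \<le> 0" for t
        using M[of "exp t"] that unfolding hF by simp
    qed
    then show ?thesis by simp
  qed
  have "h 0 \<le> h 1"
  proof (rule tendsto_upperbound)
    have "(h \<longlongrightarrow> h 0) (at 0 within {0..1})" using ch by (simp add: continuous_on_def)
    then show "(h \<longlongrightarrow> h 0) (at_right 0)"
      by (rule filterlim_mono) (auto simp: at_within_Icc_at_right)
    have "\<forall>\<^sub>F r::real in at_right 0. 0 < r \<and> r < 1"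
      unfolding eventually_at_right_field by (intro exI[of _ 1]) auto
    then show "\<forall>\<^sub>F r in at_right 0. h r \<le> h 1"
    proof eventually_elim
      case (elim r)
      then show ?case using le1[of "ln r"] by simp
    qed
  qed auto
  moreover have "h 0 = 2 * pi * G (b 0)"
  proof -
    have "(\<Sum>n\<le>N. b n * of_real 0 ^ n * cis (real n * x)) = b 0" for x
      using sum.atMost_shift[of "\<lambda>n. b n * 0 ^ n * cis (real n * x)" N] by simp
    then show ?thesis unfolding h_def by simp
  qed
  ultimately show ?thesis unfolding h_def by simp
qed

text \<open>A total derivative written in the coordinates \<open>Re\<close> and \<open>Im\<close>.
  With rules for sums, products and powers, the first and second partial derivatives of the test
  functions below are obtained by applying rules and comparing the outcome algebraically.\<close>

definition grad :: "(complex \<Rightarrow> real) \<Rightarrow> real \<Rightarrow> real \<Rightarrow> complex \<Rightarrow> bool" where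
  "grad f fu fv w \<longleftrightarrow> (f has_derivative (\<lambda>h. fu * Re h + fv * Im h)) (at w)"

lemma grad_const: "grad (\<lambda>w. c) 0 0 w"
  by (simp add: grad_def)

lemma grad_Re: "grad Re 1 0 w" and grad_Im: "grad Im 0 1 w"
  by (auto simp: grad_def intro!: derivative_eq_intros)

lemma grad_add: "grad f a b w \<Longrightarrow> grad g c d w \<Longrightarrow> grad (\<lambda>w. f w + g w) (a + c) (b + d) w"
  unfolding grad_def by (auto intro!: derivative_eq_intros simp: algebra_simps)

lemma grad_diff: "grad f a b w \<Longrightarrow> grad g c d w \<Longrightarrow> grad (\<lambda>w. f w - g w) (a - c) (b - d) w"
  unfolding grad_def by (auto intro!: derivative_eq_intros simp: algebra_simps)

lemma grad_mult: "grad f a b w \<Longrightarrow> grad g c d w \<Longrightarrow>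
    grad (\<lambda>w. f w * g w) (a * g w + f w * c) (b * g w + f w * d) w"
  unfolding grad_def by (auto intro!: derivative_eq_intros simp: algebra_simps)

lemma grad_powr:
  assumes "grad f a b w" "0 < f w"
  shows "grad (\<lambda>w. f w powr r) (r * f w powr (r - 1) * a) (r * f w powr (r - 1) * b) w"
proof -
  have "((\<lambda>x. x powr r) has_derivative (*) (r * f w powr (r - 1))) (at (f w))"
    using has_real_derivative_powr[OF assms(2), of r] by (simp add: has_field_derivative_def)
  from has_derivative_compose[OF assms(1)[unfolded grad_def] this]
  show ?thesis by (simp add: grad_def algebra_simps)
qed

lemmas grad_intros = grad_const grad_Re grad_Im grad_add grad_diff grad_mult grad_powr

lemma grad_eqI: "grad f a b w \<Longrightarrow> a = c \<Longrightarrow> b = d \<Longrightarrow> grad f c d w"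
  by simp

text \<open>The mean value property is applied to \<open>G\<close>, a multiple of (u^2 + \<epsilon>)
  to the power p/2 minus (|w|^2 + \<epsilon>) to the same power, where w = u + i v. The shift by
  \<epsilon> removes the singularity that the second derivatives have at zero for p < 2.\<close>

lemma conjugate_mean_le_2:
  fixes b :: "nat \<Rightarrow> complex" and N :: nat
  assumes p: "1 < p" "p \<le> 2" and "0 < \<epsilon>" and "Im (b 0) = 0"
  defines "W \<equiv> \<lambda>x. \<Sum>n\<le>N. b n * cis (real n * x)"
  shows "integral {0..2 * pi} (\<lambda>x. ((Re (W x))\<^sup>2 + (Im (W x))\<^sup>2 + \<epsilon>) powr (p / 2))
     \<le> 2 / (p - 1) * integral {0..2 * pi} (\<lambda>x. ((Re (W x))\<^sup>2 + \<epsilon>) powr (p / 2))"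
proof -
  define c where "c = p / 2"
  define A where "A = 2 / (p - 1)"
  define q where "q = (\<lambda>w. Re w * Re w + \<epsilon>)"
  define s where "s = (\<lambda>w. Re w * Re w + Im w * Im w + \<epsilon>)"
  have pos: "0 < q w" "0 < s w" for w
    unfolding q_def s_def using \<open>0 < \<epsilon>\<close> by (intro add_nonneg_pos; simp)+
  have gq: "grad q (2 * Re w) 0 w" and gs: "grad s (2 * Re w) (2 * Im w) w" for w
    unfolding q_def s_def by (rule grad_eqI, (rule grad_intros)+, simp, simp)+
  define G where "G = (\<lambda>w. A * q w powr c - s w powr c)"
  define Gu where "Gu = (\<lambda>w. A * (c * q w powr (c-1) * (2 * Re w)) - c * s w powr (c-1) * (2 * Re w))"
  define Gv where "Gv = (\<lambda>w. 0 - c * s w powr (c-1) * (2 * Im w))"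
  define Guu where "Guu = (\<lambda>w. A * (2 * c * q w powr (c-1) + 4 * c * (c-1) * (Re w)\<^sup>2 * q w powr (c-1-1))
     - (2 * c * s w powr (c-1) + 4 * c * (c-1) * (Re w)\<^sup>2 * s w powr (c-1-1)))"
  define Guv where "Guv = (\<lambda>w. - 4 * c * (c-1) * Re w * Im w * s w powr (c-1-1))"
  define Gvv where "Gvv = (\<lambda>w. - (2 * c * s w powr (c-1) + 4 * c * (c-1) * (Im w)\<^sup>2 * s w powr (c-1-1)))"
  have g: "grad G (Gu w) (Gv w) w" for w
    unfolding G_def Gu_def Gv_def
    by (rule grad_eqI, (rule grad_intros gq gs pos)+) simp_all
  have gu: "grad Gu (Guu w) (Guv w) w" for w
    unfolding Gu_def Guu_def Guv_def
    by (rule grad_eqI, (rule grad_intros gq gs pos)+) (simp_all add: power2_eq_square algebra_simps)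
  have gv: "grad Gv (Guv w) (Gvv w) w" for w
    unfolding Gv_def Gvv_def Guv_def
    by (rule grad_eqI, (rule grad_intros gq gs pos)+) (simp_all add: power2_eq_square algebra_simps)
  have cq: "continuous_on UNIV q" "continuous_on UNIV s" unfolding q_def s_def by (intro continuous_intros)+
  have pos': "q w \<noteq> 0" "s w \<noteq> 0" for w using pos[of w] by auto
  \<comment> \<open>The Laplacian of the first power is at least
    \<open>2 * c * (2 * c - 1) * (q w * X)\<close>, that of the second at most
    \<open>4 * c * (s w * Y)\<close>, and \<open>s w * Y \<le> q w * X\<close> because the exponent
    \<open>c - 1\<close> is not positive. As \<open>2 * c - 1\<close> equals \<open>p - 1\<close>,
    the factor \<open>A = 2 / (p - 1)\<close> makes the first bound exactly
    \<open>4 * c * (q w * X)\<close>.\<close>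
  have lap: "0 \<le> Guu w + Gvv w" for w
  proof -
    define X where "X = q w powr (c-1-1)"
    define Y where "Y = s w powr (c-1-1)"
    have X: "q w powr (c-1) = q w * X" and Y: "s w powr (c-1) = s w * Y"
      unfolding X_def Y_def using pos[of w] powr_add[of "q w" 1 "c-1-1"] powr_add[of "s w" 1 "c-1-1"] by simp_all
    have XY: "0 \<le> X" "0 \<le> Y" by (auto simp: X_def Y_def)
    have "s w * Y \<le> q w * X"
      unfolding X[symmetric] Y[symmetric] by (rule powr_mono2') (use p pos in \<open>auto simp: c_def q_def s_def\<close>)
    have "A * (2 * c * (q w * X) + 4 * c * (c-1) * (Re w)\<^sup>2 * X) = A * (2 * c * X * ((2*c-1) * q w + (2 - 2 * c) * \<epsilon>))"
      by (simp add: q_def power2_eq_square algebra_simps)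
    also have "\<dots> \<ge> A * (2 * c * X * ((2*c-1) * q w))"
      using p XY \<open>0 < \<epsilon>\<close> by (intro mult_left_mono mult_nonneg_nonneg) (auto simp: c_def A_def)
    also have "A * (2 * c * X * ((2*c-1) * q w)) = 4 * c * (q w * X)"
      using p by (simp add: A_def c_def)
    finally have 1: "4 * c * (q w * X) \<le> A * (2 * c * (q w * X) + 4 * c * (c-1) * (Re w)\<^sup>2 * X)" .
    have "4 * c * (c-1) * ((Re w)\<^sup>2 + (Im w)\<^sup>2) * Y \<le> 0"
      using p XY by (intro mult_nonpos_nonneg mult_nonneg_nonpos) (auto simp: c_def)
    then have 2: "4 * c * (s w * Y) + 4 * c * (c-1) * ((Re w)\<^sup>2 + (Im w)\<^sup>2) * Y \<le> 4 * c * (q w * X)"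
    proof -
      have "4 * c * (s w * Y) \<le> 4 * c * (q w * X)"
        using \<open>s w * Y \<le> q w * X\<close> p by (intro mult_left_mono) (auto simp: c_def)
      with \<open>4 * c * (c-1) * ((Re w)\<^sup>2 + (Im w)\<^sup>2) * Y \<le> 0\<close> show ?thesis by linarith
    qed
    have "Guu w + Gvv w = A * (2 * c * (q w * X) + 4 * c * (c-1) * (Re w)\<^sup>2 * X) - (4 * c * (s w * Y) + 4 * c * (c-1) * ((Re w)\<^sup>2 + (Im w)\<^sup>2) * Y)"
      unfolding Guu_def Gvv_def X Y X_def[symmetric] Y_def[symmetric] by (simp add: algebra_simps)
    with 1 2 show ?thesis by linarith
  qed
  have "2 * pi * G (b 0) \<le> integral {0..2 * pi} (\<lambda>x. G (W x))"
    unfolding W_def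
    by (rule subharmonic_mean_value[OF g[unfolded grad_def] gu[unfolded grad_def] gv[unfolded grad_def] _ _ _ lap])
       (use pos' in \<open>auto simp: Guu_def Guv_def Gvv_def intro!: continuous_intros cq\<close>)
  \<comment> \<open>A real constant term makes both powers agree at the centre, and \<open>A\<close>
    is at least 1.\<close>
  moreover have "0 \<le> G (b 0)"
  proof -
    have "1 \<le> A" using p by (simp add: A_def)
    then have "1 * q (b 0) powr c \<le> A * q (b 0) powr c" by (intro mult_right_mono) auto
    moreover have "s (b 0) = q (b 0)" using assms by (simp add: s_def q_def)
    ultimately show ?thesis by (simp add: G_def)
  qed
  moreover have "integral {0..2 * pi} (\<lambda>x. G (W x)) = A * integral {0..2 * pi} (\<lambda>x. q (W x) powr c) - integral {0..2 * pi} (\<lambda>x. s (W x) powr c)"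
  proof -
    have cW: "continuous_on UNIV W" unfolding W_def cis_conv_exp by (intro continuous_intros)
    have "continuous_on {0..2*pi} (\<lambda>x. q (W x) powr c)" "continuous_on {0..2*pi} (\<lambda>x. s (W x) powr c)"
      using pos' by (auto intro!: continuous_intros continuous_on_compose2[OF cq(1)] continuous_on_compose2[OF cq(2)] continuous_on_subset[OF cW])
    then show ?thesis unfolding G_def
      by (subst integral_diff) (auto intro!: integrable_continuous_real continuous_intros)
  qed
  ultimately have "integral {0..2 * pi} (\<lambda>x. s (W x) powr c) \<le> A * integral {0..2 * pi} (\<lambda>x. q (W x) powr c)"
    using mult_nonneg_nonneg[of "2 * pi" "G (b 0)"] pi_ge_zero by linarith
  then show ?thesis by (simp add: A_def q_def s_def c_def power2_eq_square)
qed

text \<open>For p > 2 the Laplacian of |u|^p vanishes on the line u = 0, where that of |w|^p does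
  not, so a multiple of |u|^p cannot be used. The factor u^2 |w|^(p-2) keeps a Laplacian comparable
  with |w|^(p-2) there; the price is a right-hand side that still involves |w| and is untangled in
  the next lemma but a few.\<close>

lemma conjugate_mean_ge_2:
  fixes b :: "nat \<Rightarrow> complex" and N :: nat
  assumes p: "2 \<le> p" and \<epsilon>: "0 < \<epsilon>" and "Im (b 0) = 0"
  defines "W \<equiv> \<lambda>x. \<Sum>n\<le>N. b n * cis (real n * x)"
  shows "integral {0..2 * pi} (\<lambda>x. ((Re (W x))\<^sup>2 + (Im (W x))\<^sup>2 + \<epsilon>) powr (p / 2))
     \<le> p\<^sup>2 / 2 * integral {0..2 * pi} (\<lambda>x. (Re (W x))\<^sup>2 * ((Re (W x))\<^sup>2 + (Im (W x))\<^sup>2 + \<epsilon>) powr (p / 2 - 1))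
       + 2 * pi * \<epsilon> * ((Re (b 0))\<^sup>2 + \<epsilon>) powr (p / 2 - 1)"
proof -
  define c where "c = p / 2"
  define d where "d = c - 1"
  \<comment> \<open>The least value for which \<open>2 * K * s w\<close> dominates
    \<open>c * (4 * s w + 4 * d * r)\<close> for all \<open>r \<le> s w\<close>; recall
    \<open>1 + d = c\<close>.\<close>
  define K where "K = 2 * c\<^sup>2"
  define s where "s = (\<lambda>w. Re w * Re w + Im w * Im w + \<epsilon>)"
  have pos: "0 < s w" for w
    unfolding s_def using \<open>0 < \<epsilon>\<close> by (intro add_nonneg_pos) simp_all
  have pos': "s w \<noteq> 0" for w using pos[of w] by auto
  have gs: "grad s (2 * Re w) (2 * Im w) w" for w
    unfolding s_def by (rule grad_eqI, (rule grad_intros)+, simp, simp)+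
  define G where "G = (\<lambda>w. K * (Re w * Re w * s w powr d) - s w powr c)"
  define Gu where "Gu = (\<lambda>w. K * (2 * (Re w * s w powr d) + 2 * d * (Re w * Re w * Re w * s w powr (d-1))) - c * s w powr d * (2 * Re w))"
  define Gv where "Gv = (\<lambda>w. K * (2 * d * (Re w * Re w * Im w * s w powr (d-1))) - c * s w powr d * (2 * Im w))"
  define Guu where "Guu = (\<lambda>w. K * (2 * s w powr d + 10 * d * (Re w)^2 * s w powr (d-1) + 4 * d * (d-1) * (Re w)^4 * s w powr (d-1-1))
     - c * (2 * s w powr d + 4 * d * (Re w)\<^sup>2 * s w powr (d-1)))"
  define Guv where "Guv = (\<lambda>w. K * (4 * d * Re w * Im w * s w powr (d-1) + 4 * d * (d-1) * (Re w)^3 * Im w * s w powr (d-1-1))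
     - 4 * c * d * Re w * Im w * s w powr (d-1))"
  define Gvv where "Gvv = (\<lambda>w. K * (2 * d * (Re w)^2 * s w powr (d-1) + 4 * d * (d-1) * (Re w)^2 * (Im w)^2 * s w powr (d-1-1))
     - c * (2 * s w powr d + 4 * d * (Im w)\<^sup>2 * s w powr (d-1)))"
  have g: "grad G (Gu w) (Gv w) w" for w
    unfolding G_def Gu_def Gv_def
    by (rule grad_eqI, (rule grad_intros gs pos)+) (simp_all add: d_def algebra_simps)
  have gu: "grad Gu (Guu w) (Guv w) w" for w
    unfolding Gu_def Guu_def Guv_def
    by (rule grad_eqI, (rule grad_intros gs pos)+) (simp_all add: power2_eq_square power3_eq_cube power4_eq_xxxx algebra_simps)
  have gv: "grad Gv (Guv w) (Gvv w) w" for w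
    unfolding Gv_def Gvv_def Guv_def
    by (rule grad_eqI, (rule grad_intros gs pos)+) (simp_all add: power2_eq_square power3_eq_cube algebra_simps)
  have cq: "continuous_on UNIV s" unfolding s_def by (intro continuous_intros)+
  have lap: "0 \<le> Guu w + Gvv w" for w
  proof -
    define Y where "Y = s w powr (d-1-1)"
    have Y: "s w powr (d-1) = s w * Y"
      unfolding Y_def using pos[of w] powr_add[of "s w" 1 "d-1-1"] by simp_all
    have Y2: "s w powr d = s w * (s w * Y)"
      unfolding Y[symmetric] using pos[of w] powr_add[of "s w" 1 "d-1"] by simp_all
    have Y0: "0 \<le> Y" by (auto simp: Y_def)
    define r where "r = (Re w)\<^sup>2 + (Im w)\<^sup>2"
    have r: "0 \<le> r" "r \<le> s w" using \<epsilon> by (auto simp: r_def s_def power2_eq_square)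
    have d: "0 \<le> d" using p by (simp add: d_def c_def)
    have eq: "Guu w + Gvv w = 4 * d * (Re w)\<^sup>2 * Y * K * (3 * s w + (d - 1) * r) + Y * s w * (2 * K * s w - c * (4 * s w + 4 * d * r))"
      unfolding Guu_def Gvv_def Y Y2 Y_def[symmetric] r_def by (simp add: algebra_simps power2_eq_square power4_eq_xxxx)
    have "d * r \<ge> 0" using d r by auto
    then have "0 \<le> 3 * s w + (d - 1) * r" using r pos[of w] by (simp add: algebra_simps)
    moreover have "0 \<le> 2 * K * s w - c * (4 * s w + 4 * d * r)"
    proof -
      have "c * (4 * s w + 4 * d * r) \<le> c * (4 * s w + 4 * d * s w)"
        using d r p by (intro mult_left_mono add_left_mono) (auto simp: c_def)
      also have "\<dots> = 2 * K * s w" by (simp add: K_def d_def algebra_simps power2_eq_square)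
      finally show ?thesis by simp
    qed
    moreover have "0 \<le> K" by (simp add: K_def)
    ultimately have "0 \<le> 4 * d * (Re w)\<^sup>2 * Y * K * (3 * s w + (d - 1) * r)" "0 \<le> Y * s w * (2 * K * s w - c * (4 * s w + 4 * d * r))"
      using d Y0 pos[of w] by simp_all
    then show ?thesis unfolding eq by simp
  qed
  have "2 * pi * G (b 0) \<le> integral {0..2 * pi} (\<lambda>x. G (W x))"
    unfolding W_def
    by (rule subharmonic_mean_value[OF g[unfolded grad_def] gu[unfolded grad_def] gv[unfolded grad_def] _ _ _ lap])
       (use pos' in \<open>auto simp: Guu_def Guv_def Gvv_def intro!: continuous_intros cq\<close>)
  \<comment> \<open>At the centre the two terms of \<open>G\<close> differ by the regularisation, so
    \<open>G (b 0)\<close> may be slightly negative. This is the source of the last summand in the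
    statement.\<close>
  moreover have "- (\<epsilon> * s (b 0) powr d) \<le> G (b 0)"
  proof -
    have "1 \<le> c" using p by (simp add: c_def)
    then have "1 \<le> c\<^sup>2" by simp
    then have "1 \<le> K" unfolding K_def by linarith
    have "s (b 0) powr c = s (b 0) * s (b 0) powr d"
      using pos[of "b 0"] powr_add[of "s (b 0)" 1 d] by (simp add: d_def)
    then have "G (b 0) + \<epsilon> * s (b 0) powr d = (K - 1) * (Re (b 0) * Re (b 0)) * s (b 0) powr d"
      using assms by (simp add: G_def s_def algebra_simps)
    also have "\<dots> \<ge> 0" using \<open>1 \<le> K\<close> by simp
    finally show ?thesis by simp
  qed
  then have "- (2 * pi * \<epsilon> * s (b 0) powr d) \<le> 2 * pi * G (b 0)"
    using mult_left_mono[of "- (\<epsilon> * s (b 0) powr d)" "G (b 0)" "2 * pi"] by simp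
  moreover have "integral {0..2 * pi} (\<lambda>x. G (W x)) = K * integral {0..2 * pi} (\<lambda>x. Re (W x) * Re (W x) * s (W x) powr d) - integral {0..2 * pi} (\<lambda>x. s (W x) powr c)"
  proof -
    have cW: "continuous_on UNIV W" unfolding W_def cis_conv_exp by (intro continuous_intros)
    have "continuous_on {0..2*pi} (\<lambda>x. Re (W x) * Re (W x) * s (W x) powr d)" "continuous_on {0..2*pi} (\<lambda>x. s (W x) powr c)"
      using pos' by (auto intro!: continuous_intros continuous_on_compose2[OF cq] continuous_on_subset[OF cW])
    then show ?thesis unfolding G_def
      by (subst integral_diff) (auto intro!: integrable_continuous_real continuous_intros)
  qed
  moreover have "s (b 0) = (Re (b 0))\<^sup>2 + \<epsilon>" "K = p\<^sup>2 / 2" using assms by (auto simp: s_def K_def c_def power2_eq_square)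
  ultimately show ?thesis
    by (simp add: s_def c_def d_def power2_eq_square)
qed

lemma powr_add_le:
  fixes a b c :: real
  assumes "0 \<le> a" "0 \<le> b" "0 < c" "c \<le> 1"
  shows "(a + b) powr c \<le> a powr c + b powr c"
proof (cases "a + b = 0")
  case False
  then have pos: "0 < a + b" using assms by auto
  have le: "t \<le> t powr c" if "0 \<le> t" "t \<le> 1" for t :: real
  proof (cases "t = 0")
    case False
    then show ?thesis using powr_mono'[of c 1 t] assms that by simp
  qed simp
  have "1 = a / (a + b) + b / (a + b)" using pos by (simp add: add_divide_distrib[symmetric])
  also have "\<dots> \<le> (a / (a + b)) powr c + (b / (a + b)) powr c"
    using assms pos by (intro add_mono le) (auto simp: divide_simps)
  also have "\<dots> = (a powr c + b powr c) / (a + b) powr c"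
    using assms pos by (simp add: powr_divide add_divide_distrib)
  finally show ?thesis using pos by (simp add: field_simps)
qed (use assms in auto)

lemma norm_powr_eq: "norm w powr p = ((Re w)\<^sup>2 + (Im w)\<^sup>2) powr (p / 2)"
  by (simp add: cmod_def powr_half_sqrt[symmetric] powr_powr)

lemma abs_powr_eq: "\<bar>u::real\<bar> powr p = (u\<^sup>2) powr (p / 2)"
  using powr_powr[of "u\<^sup>2" "1/2" p] by (simp add: powr_half_sqrt)

lemma integral_conjugate_le:
  assumes p: "1 < p"
  shows "\<exists>C\<ge>0. \<forall>N (b :: nat \<Rightarrow> complex). Im (b 0) = 0 \<longrightarrow>
    integral {0..2 * pi} (\<lambda>x. norm (\<Sum>n\<le>N. b n * cis (real n * x)) powr p)
    \<le> C * integral {0..2 * pi} (\<lambda>x. \<bar>Re (\<Sum>n\<le>N. b n * cis (real n * x))\<bar> powr p)"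
proof (cases "p \<le> 2")
  case True
  define A where "A = 2 / (p - 1)"
  have "0 < A" using p by (simp add: A_def)
  show ?thesis
  proof (intro exI[of _ A] conjI allI impI)
    fix N and b :: "nat \<Rightarrow> complex" assume b: "Im (b 0) = 0"
    define W where "W = (\<lambda>x. \<Sum>n\<le>N. b n * cis (real n * x))"
    have cW: "continuous_on UNIV W" unfolding W_def cis_conv_exp by (intro continuous_intros)
    note cW' = continuous_on_subset[OF cW]
    have cu: "continuous_on S (\<lambda>x. \<bar>Re (W x)\<bar> powr p)" for S
      using p by (intro continuous_on_powr' continuous_intros cW') auto
    have "integral {0..2 * pi} (\<lambda>x. norm (W x) powr p) \<le> A * integral {0..2 * pi} (\<lambda>x. \<bar>Re (W x)\<bar> powr p) + e" if "0 < e" for e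
    proof -
      \<comment> \<open>Chosen so that the total contribution of \<epsilon> after splitting the
        power by \<open>powr_add_le\<close>, namely A times 2 \<pi> times \<epsilon> to the power
        p/2, equals \<open>e\<close>.\<close>
      define \<epsilon> where "\<epsilon> = (e / (A * (2 * pi))) powr (2 / p)"
      have \<epsilon>: "0 < \<epsilon>" "\<epsilon> powr (p / 2) = e / (A * (2 * pi))" using that \<open>0 < A\<close> p by (auto simp: \<epsilon>_def powr_powr)
      have "0 < (Re w)\<^sup>2 + (Im w)\<^sup>2 + \<epsilon>" "0 < (Re w)\<^sup>2 + \<epsilon>" for w
        using \<epsilon>(1) by (intro add_nonneg_pos; simp)+
      then have sum_pos: "(Re w)\<^sup>2 + (Im w)\<^sup>2 + \<epsilon> \<noteq> 0" "(Re w)\<^sup>2 + \<epsilon> \<noteq> 0" for w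
        by (metis less_irrefl)+
      have "integral {0..2 * pi} (\<lambda>x. norm (W x) powr p) \<le> integral {0..2 * pi} (\<lambda>x. ((Re (W x))\<^sup>2 + (Im (W x))\<^sup>2 + \<epsilon>) powr (p / 2))"
        unfolding norm_powr_eq using p \<epsilon> sum_pos
        by (intro integral_le integrable_continuous_real continuous_on_powr' continuous_intros cW' powr_mono2) auto
      also have "\<dots> \<le> A * integral {0..2 * pi} (\<lambda>x. ((Re (W x))\<^sup>2 + \<epsilon>) powr (p / 2))"
        unfolding A_def W_def by (rule conjugate_mean_le_2[of p \<epsilon> b N, OF p True \<epsilon>(1) b])
      also have "\<dots> \<le> A * integral {0..2 * pi} (\<lambda>x. \<bar>Re (W x)\<bar> powr p + \<epsilon> powr (p / 2))"
        unfolding abs_powr_eq using p \<epsilon> sum_pos \<open>0 < A\<close> True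
        by (intro mult_left_mono integral_le integrable_continuous_real continuous_on_powr' continuous_intros cW' powr_add_le) auto
      also have "\<dots> = A * (integral {0..2 * pi} (\<lambda>x. \<bar>Re (W x)\<bar> powr p) + 2 * pi * \<epsilon> powr (p / 2))"
        by (subst integral_add) (use cu in \<open>auto intro!: integrable_continuous_real\<close>)
      also have "\<dots> = A * integral {0..2 * pi} (\<lambda>x. \<bar>Re (W x)\<bar> powr p) + e"
        using \<open>0 < A\<close> by (simp add: \<epsilon>(2) algebra_simps)
      finally show ?thesis .
    qed
    then show "integral {0..2 * pi} (\<lambda>x. norm (\<Sum>n\<le>N. b n * cis (real n * x)) powr p)
      \<le> A * integral {0..2 * pi} (\<lambda>x. \<bar>Re (\<Sum>n\<le>N. b n * cis (real n * x))\<bar> powr p)"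
      unfolding W_def by (rule field_le_epsilon)
  qed (use \<open>0 < A\<close> in simp)
next
  case False
  define c where "c = p / 2 - 1"
  define K where "K = p\<^sup>2 / 2"
  define B where "B = K * (2 * K) powr c"
  have "0 < K" using p by (simp add: K_def)
  then have "0 \<le> B" by (simp add: B_def)
  have c: "0 < c" using False by (simp add: c_def)
  show ?thesis
  proof (intro exI[of _ "2 * B"] conjI allI impI)
    fix N and b :: "nat \<Rightarrow> complex" assume b: "Im (b 0) = 0"
    define W where "W = (\<lambda>x. \<Sum>n\<le>N. b n * cis (real n * x))"
    have cW: "continuous_on UNIV W" unfolding W_def cis_conv_exp by (intro continuous_intros)
    note cW' = continuous_on_subset[OF cW]
    have cu: "continuous_on S (\<lambda>x. \<bar>Re (W x)\<bar> powr p)" for S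
      using p by (intro continuous_on_powr' continuous_intros cW') auto
    \<comment> \<open>With \<epsilon> at most 1 and at most \<open>e / L\<close>, the error term at
      the centre is at most \<open>e / 2\<close>; the absorption below doubles it to
      \<open>e\<close>.\<close>
    define L where "L = 4 * pi * ((Re (b 0))\<^sup>2 + 1) powr c"
    have "0 < (Re (b 0))\<^sup>2 + 1" by (rule add_nonneg_pos) auto
    then have L: "0 < L" by (simp add: L_def)
    have "integral {0..2 * pi} (\<lambda>x. norm (W x) powr p) \<le> 2 * B * integral {0..2 * pi} (\<lambda>x. \<bar>Re (W x)\<bar> powr p) + e" if "0 < e" for e
    proof -
      define \<epsilon> where "\<epsilon> = min 1 (e / L)"
      have \<epsilon>: "0 < \<epsilon>" "\<epsilon> \<le> 1" "\<epsilon> \<le> e / L" using that L by (auto simp: \<epsilon>_def)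
      define s where "s = (\<lambda>w. (Re w)\<^sup>2 + (Im w)\<^sup>2 + \<epsilon>)"
      have s: "0 < s w" for w unfolding s_def using \<epsilon>(1) by (intro add_nonneg_pos) simp_all
      have s': "s w \<noteq> 0" for w using s[of w] by simp
      have cs: "continuous_on UNIV s" unfolding s_def by (intro continuous_intros)
      have csW: "continuous_on S (\<lambda>x. s (W x) powr r)" for S r
        using s' by (intro continuous_intros continuous_on_compose2[OF cs cW']) auto
      \<comment> \<open>A Young inequality whose weight 1/2 lets the integral \<open>I\<close> be
        absorbed into the left-hand side. Either (Re w)^2 is so small that half of the power of
        \<open>s w\<close> suffices, or \<open>s w\<close> is at most \<open>2 * K\<close> times (Re
        w)^2, which gives the constant \<open>B\<close>.\<close>
      have young: "K * ((Re w)\<^sup>2 * s w powr c) \<le> 1/2 * s w powr (p/2) + B * \<bar>Re w\<bar> powr p" for w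
      proof (cases "2 * K * (Re w)\<^sup>2 \<le> s w")
        case True
        have "s w powr (p/2) = s w * s w powr c"
          using s[of w] powr_add[of "s w" 1 c] by (simp add: c_def)
        moreover have "2 * K * (Re w)\<^sup>2 * s w powr c \<le> s w * s w powr c" using True by (intro mult_right_mono) auto
        moreover have "0 \<le> B * \<bar>Re w\<bar> powr p" using \<open>0 \<le> B\<close> by simp
        ultimately show ?thesis by (simp add: mult.assoc)
      next
        case False
        then have u: "0 < (Re w)\<^sup>2" using s[of w] by (cases "Re w = 0") auto
        have "K * ((Re w)\<^sup>2 * s w powr c) \<le> K * ((Re w)\<^sup>2 * (2 * K * (Re w)\<^sup>2) powr c)"
          using False s[of w] \<open>0 < K\<close> c by (intro mult_left_mono powr_mono2) auto
        also have "\<dots> = B * ((Re w)\<^sup>2 * ((Re w)\<^sup>2) powr c)" using \<open>0 < K\<close> by (simp add: B_def powr_mult)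
        also have "(Re w)\<^sup>2 * ((Re w)\<^sup>2) powr c = \<bar>Re w\<bar> powr p"
          using u powr_add[of "(Re w)\<^sup>2" 1 c] by (simp add: abs_powr_eq c_def)
        finally have "K * ((Re w)\<^sup>2 * s w powr c) \<le> B * \<bar>Re w\<bar> powr p" .
        moreover have "0 \<le> 1/2 * s w powr (p/2)" by simp
        ultimately show ?thesis by linarith
      qed
      define I where "I = integral {0..2 * pi} (\<lambda>x. s (W x) powr (p / 2))"
      have "integral {0..2 * pi} (\<lambda>x. norm (W x) powr p) \<le> I"
        unfolding norm_powr_eq I_def using p \<epsilon>
        by (intro integral_le integrable_continuous_real csW continuous_on_powr' continuous_intros cW' powr_mono2)
           (auto simp: s_def)
      moreover have "I \<le> K * integral {0..2 * pi} (\<lambda>x. (Re (W x))\<^sup>2 * s (W x) powr c) + 2 * pi * \<epsilon> * ((Re (b 0))\<^sup>2 + \<epsilon>) powr c"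
        unfolding I_def W_def K_def s_def c_def using conjugate_mean_ge_2[of p \<epsilon> b N, OF _ \<epsilon>(1) b] False by simp
      moreover have "K * integral {0..2 * pi} (\<lambda>x. (Re (W x))\<^sup>2 * s (W x) powr c) \<le> 1/2 * I + B * integral {0..2 * pi} (\<lambda>x. \<bar>Re (W x)\<bar> powr p)"
      proof -
        have "K * integral {0..2 * pi} (\<lambda>x. (Re (W x))\<^sup>2 * s (W x) powr c) = integral {0..2 * pi} (\<lambda>x. K * ((Re (W x))\<^sup>2 * s (W x) powr c))"
          by simp
        also have "\<dots> \<le> integral {0..2 * pi} (\<lambda>x. 1/2 * s (W x) powr (p/2) + B * \<bar>Re (W x)\<bar> powr p)"
          using p by (intro integral_le young integrable_continuous_real csW continuous_on_powr' continuous_intros cW') auto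
        also have "\<dots> = 1/2 * I + B * integral {0..2 * pi} (\<lambda>x. \<bar>Re (W x)\<bar> powr p)"
          unfolding I_def
          by (subst integral_add) (intro integrable_continuous_real continuous_on_mult_left csW cu | simp)+
        finally show ?thesis .
      qed
      moreover have "2 * pi * \<epsilon> * ((Re (b 0))\<^sup>2 + \<epsilon>) powr c \<le> e / 2"
      proof -
        have "\<epsilon> * ((Re (b 0))\<^sup>2 + \<epsilon>) powr c \<le> \<epsilon> * ((Re (b 0))\<^sup>2 + 1) powr c"
          using \<epsilon> c by (intro mult_left_mono powr_mono2) auto
        then have "2 * pi * (\<epsilon> * ((Re (b 0))\<^sup>2 + \<epsilon>) powr c) \<le> 2 * pi * (\<epsilon> * ((Re (b 0))\<^sup>2 + 1) powr c)"
          by simp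
        also have "\<dots> = \<epsilon> * L / 2" by (simp add: L_def)
        also have "\<dots> \<le> e / 2" using \<epsilon>(3) L by (simp add: field_simps)
        finally show ?thesis by (simp add: mult_ac)
      qed
      ultimately show ?thesis by simp
    qed
    then show "integral {0..2 * pi} (\<lambda>x. norm (\<Sum>n\<le>N. b n * cis (real n * x)) powr p)
      \<le> 2 * B * integral {0..2 * pi} (\<lambda>x. \<bar>Re (\<Sum>n\<le>N. b n * cis (real n * x))\<bar> powr p)"
      unfolding W_def by (rule field_le_epsilon)
  qed (use \<open>0 \<le> B\<close> in simp)
qed

lemma sum_int_interval_symmetric:
  fixes g :: "int \<Rightarrow> 'a::comm_monoid_add"
  shows "sum g {- int N..int N} = g 0 + (\<Sum>n=1..N. g (int n) + g (- int n))"
proof (induction N)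
  case (Suc N)
  have "{- int (Suc N)..int (Suc N)} = insert (int (Suc N)) (insert (- int (Suc N)) {- int N..int N})" by auto
  then have "sum g {- int (Suc N)..int (Suc N)} = g (int (Suc N)) + (g (- int (Suc N)) + sum g {- int N..int N})"
    by (simp only: ) (subst sum.insert, auto)
  then show ?case using Suc by (simp add: ac_simps)
qed simp

text \<open>The factor 1 + sgn n turns f into an analytic polynomial. The conjugate inequality needs
  real data, so it is applied to the analytic completions of Re f and of Im f separately, and these
  are then recombined.\<close>

theorem riesz_projection_circle:
  assumes p: "1 < p"
  shows "\<exists>C\<ge>0. \<forall>A (a :: int \<Rightarrow> complex). finite A \<longrightarrow>
    integral {0..2 * pi} (\<lambda>x. norm (\<Sum>n\<in>A. of_int (1 + sgn n) * a n * cis (of_int n * x)) powr p)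
    \<le> C * integral {0..2 * pi} (\<lambda>x. norm (\<Sum>n\<in>A. a n * cis (of_int n * x)) powr p)"
proof -
  obtain C where C: "0 \<le> C" "\<And>N (b :: nat \<Rightarrow> complex). Im (b 0) = 0 \<Longrightarrow>
    integral {0..2 * pi} (\<lambda>x. norm (\<Sum>n\<le>N. b n * cis (real n * x)) powr p)
    \<le> C * integral {0..2 * pi} (\<lambda>x. \<bar>Re (\<Sum>n\<le>N. b n * cis (real n * x))\<bar> powr p)"
    using integral_conjugate_le[OF p] by blast
  show ?thesis
  proof (intro exI[of _ "2 powr p * (2 * C)"] conjI allI impI)
    fix A :: "int set" and a :: "int \<Rightarrow> complex" assume A: "finite A"
    define a' where "a' = (\<lambda>n::int. if n \<in> A then a n else (0::complex))"
    obtain N :: nat where N: "A \<subseteq> {- int N..int N}"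
    proof
      show "A \<subseteq> {- int (nat (\<Sum>n\<in>A. \<bar>n\<bar>))..int (nat (\<Sum>n\<in>A. \<bar>n\<bar>))}"
        using member_le_sum[of _ A "abs :: int \<Rightarrow> int"] A by (force simp: sum_nonneg)
    qed
    define f where "f = (\<lambda>x::real. \<Sum>n\<in>A. a n * cis (of_int n * x))"
    have ext: "(\<Sum>n\<in>A. m n * a n * cis (of_int n * x)) = (\<Sum>n\<in>{- int N..int N}. m n * a' n * cis (of_int n * x))" for m :: "int \<Rightarrow> complex" and x :: real
      using N A by (intro sum.mono_neutral_cong_left) (auto simp: a'_def)
    \<comment> \<open>Folds the negative frequencies onto the positive ones: c e^(-inx) and cnj c
      e^(inx) have the same real part. The constant term is made real, as the conjugate inequality
      requires.\<close>
    define bb :: "(int \<Rightarrow> complex) \<Rightarrow> nat \<Rightarrow> complex"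
      where "bb = (\<lambda>\<alpha> n. if n = 0 then of_real (Re (\<alpha> 0)) else \<alpha> (int n) + cnj (\<alpha> (- int n)))"
    define W where "W = (\<lambda>\<alpha> x. \<Sum>n\<le>N. bb \<alpha> n * cis (real n * x))"
    have W_eq: "W \<alpha> x = of_real (Re (\<alpha> 0)) + (\<Sum>n=1..N. (\<alpha> (int n) + cnj (\<alpha> (- int n))) * cis (real n * x))" for \<alpha> x
    proof -
      have "{..N} = insert 0 {1..N}" by auto
      then show ?thesis unfolding W_def by (simp add: bb_def)
    qed
    have ReW: "Re (W \<alpha> x) = Re (\<Sum>n\<in>{- int N..int N}. \<alpha> n * cis (of_int n * x))" for \<alpha> x
      unfolding W_eq sum_int_interval_symmetric by (simp add: algebra_simps)
    \<comment> \<open>Multiplication by -i turns the imaginary part of f into the real part.\<close>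
    define ia where "ia = (\<lambda>n. - \<i> * a' n)"
    have R1: "Re (W a' x) = Re (f x)" for x
      unfolding ReW f_def using ext[of "\<lambda>_. 1" x] by simp
    have R2: "Re (W ia x) = Im (f x)" for x
    proof -
      have "(\<Sum>n\<in>{- int N..int N}. ia n * cis (of_int n * x)) = - \<i> * f x"
        unfolding f_def ia_def using ext[of "\<lambda>_. - \<i>" x] by (simp add: sum_distrib_left mult.assoc sum_negf)
      then show ?thesis unfolding ReW by simp
    qed
    have W_sum: "W a' x + \<i> * W ia x = (\<Sum>n\<in>A. of_int (1 + sgn n) * a n * cis (of_int n * x))" for x
    proof -
      have "W a' x + \<i> * W ia x = a' 0 + (\<Sum>n=1..N. ((a' (int n) + cnj (a' (- int n))) + \<i> * (ia (int n) + cnj (ia (- int n)))) * cis (real n * x))"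
      proof -
        have "complex_of_real (Re (a' 0)) + \<i> * of_real (Re (ia 0)) = a' 0" by (simp add: complex_eq_iff ia_def)
        moreover have "W a' x + \<i> * W ia x = (complex_of_real (Re (a' 0)) + \<i> * of_real (Re (ia 0)))
          + (\<Sum>n=1..N. ((a' (int n) + cnj (a' (- int n))) + \<i> * (ia (int n) + cnj (ia (- int n)))) * cis (real n * x))"
          unfolding W_eq distrib_left distrib_right sum_distrib_left sum.distrib by (simp add: mult.assoc)
        ultimately show ?thesis by simp
      qed
      also have "\<dots> = (\<Sum>n\<in>{- int N..int N}. of_int (1 + sgn n) * a' n * cis (of_int n * x))"
        unfolding sum_int_interval_symmetric by (auto simp: ia_def algebra_simps intro!: sum.cong)
      also have "\<dots> = (\<Sum>n\<in>A. of_int (1 + sgn n) * a n * cis (of_int n * x))"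
        using ext[of "\<lambda>n. of_int (1 + sgn n)"] by simp
      finally show ?thesis .
    qed
    have cW: "continuous_on S (W \<alpha>)" for S \<alpha> unfolding W_def cis_conv_exp by (intro continuous_intros)
    have cn: "continuous_on S (\<lambda>x. norm (W \<alpha> x) powr p)" for S \<alpha>
      using p by (intro continuous_on_powr' continuous_intros cW) auto
    have cf: "continuous_on S f" for S unfolding f_def cis_conv_exp by (intro continuous_intros)
    have bnd: "integral {0..2 * pi} (\<lambda>x. norm (W \<alpha> x) powr p) \<le> C * integral {0..2 * pi} (\<lambda>x. norm (f x) powr p)"
      if "\<And>x. \<bar>Re (W \<alpha> x)\<bar> \<le> norm (f x)" for \<alpha>
    proof -
      have "integral {0..2 * pi} (\<lambda>x. norm (W \<alpha> x) powr p) \<le> C * integral {0..2 * pi} (\<lambda>x. \<bar>Re (W \<alpha> x)\<bar> powr p)"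
        unfolding W_def by (rule C(2)) (simp add: bb_def)
      also have "\<dots> \<le> C * integral {0..2 * pi} (\<lambda>x. norm (f x) powr p)"
        using p that C(1)
        by (intro mult_left_mono integral_le integrable_continuous_real continuous_on_powr' continuous_intros cW cf powr_mono2) auto
      finally show ?thesis .
    qed
    have pow: "norm (z + \<i> * w) powr p \<le> 2 powr p * (norm z powr p + norm w powr p)" for z w
    proof -
      have "norm (z + \<i> * w) \<le> 2 * max (norm z) (norm w)"
        using norm_triangle_ineq[of z "\<i> * w"] by (simp add: norm_mult)
      then have "norm (z + \<i> * w) powr p \<le> (2 * max (norm z) (norm w)) powr p"
        using p by (intro powr_mono2) auto
      also have "\<dots> = 2 powr p * max (norm z) (norm w) powr p" by (simp add: powr_mult)
      also have "\<dots> \<le> 2 powr p * (norm z powr p + norm w powr p)"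
        by (intro mult_left_mono) (auto simp: max_def)
      finally show ?thesis .
    qed
    have "integral {0..2 * pi} (\<lambda>x. norm (W a' x + \<i> * W ia x) powr p)
        \<le> integral {0..2 * pi} (\<lambda>x. 2 powr p * (norm (W a' x) powr p + norm (W ia x) powr p))"
      using p by (intro integral_le pow integrable_continuous_real continuous_on_powr' continuous_intros cW) auto
    also have "\<dots> = 2 powr p * (integral {0..2 * pi} (\<lambda>x. norm (W a' x) powr p) + integral {0..2 * pi} (\<lambda>x. norm (W ia x) powr p))"
      using cn by (subst integral_add[symmetric]) (auto intro!: integrable_continuous_real)
    also have "\<dots> \<le> 2 powr p * (C * integral {0..2 * pi} (\<lambda>x. norm (f x) powr p) + C * integral {0..2 * pi} (\<lambda>x. norm (f x) powr p))"
      by (intro mult_left_mono add_mono bnd) (auto simp: R1 R2 abs_Re_le_cmod abs_Im_le_cmod)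
    finally show "integral {0..2 * pi} (\<lambda>x. norm (\<Sum>n\<in>A. of_int (1 + sgn n) * a n * cis (of_int n * x)) powr p)
      \<le> 2 powr p * (2 * C) * integral {0..2 * pi} (\<lambda>x. norm (\<Sum>n\<in>A. a n * cis (of_int n * x)) powr p)"
      unfolding W_sum f_def by (simp add: algebra_simps)
  qed (use C(1) in simp)
qed

section \<open>Functions on the torus and trigonometric polynomials\<close>

abbreviation "closed_square \<equiv> {0..2 * pi} \<times> {0..2 * pi::real}"

lemma closed_square_eq: "closed_square = cbox (0,0) (2*pi,2*pi)"
  by (simp add: cbox_Pair_eq)

lemma closed_square_sets [measurable, simp]: "closed_square \<in> sets lebesgue"
  unfolding closed_square_eq by simp

lemma emeasure_closed_square: "emeasure lebesgue closed_square < \<infinity>"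
  unfolding closed_square_eq using emeasure_lborel_cbox_finite by simp

lemma space_T2 [simp]: "space T2 = closed_square"
  by (simp add: T2_def)

lemma finite_measure_T2: "finite_measure T2"
  using emeasure_closed_square by (intro finite_measureI) (simp add: T2_def emeasure_restrict_space)

lemma borel_measurable_T2: "f \<in> borel_measurable lebesgue \<Longrightarrow> f \<in> borel_measurable T2"
  unfolding T2_def by (rule measurable_restrict_space1)

lemma measurable_norm_powr:
  fixes f :: "'a \<Rightarrow> complex"
  assumes [measurable]: "f \<in> borel_measurable M"
  shows "(\<lambda>z. norm (f z) powr p) \<in> borel_measurable M"
  by measurable

lemma AE_T2: "AE z in lebesgue. P z \<Longrightarrow> AE z in T2. P z"
  unfolding T2_def by (subst AE_restrict_space_iff) auto

lemma Lp_measurable: "f \<in> Lp p \<Longrightarrow> f \<in> borel_measurable lebesgue"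
  by (simp add: Lp_def)

lemma Lp_periodic: "f \<in> Lp p \<Longrightarrow> periodic2 f"
  by (simp add: Lp_def)

lemma Lp_integrable: "f \<in> Lp p \<Longrightarrow> integrable T2 (\<lambda>z. norm (f z) powr p)"
  by (simp add: Lp_def)

lemma convex_powr:
  fixes a b u v :: real
  assumes "1 \<le> p" "0 \<le> a" "0 \<le> b" "0 \<le> u" "0 \<le> v" "u + v = 1"
  shows "(u * a + v * b) powr p \<le> u * a powr p + v * b powr p"
proof -
  have u: "u = 1 - v" using assms by simp
  have le: "t powr p \<le> t" if "0 \<le> t" "t \<le> 1" for t :: real
    using powr_mono'[of 1 p t] that assms by (cases "t = 0") auto
  consider "a = 0" | "b = 0" | "0 < a" "0 < b" using assms by linarith
  then show ?thesis
  proof cases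
    case 1
    then show ?thesis using assms le[of v] by (auto simp: powr_mult intro!: mult_right_mono)
  next
    case 2
    then show ?thesis using assms le[of u] by (auto simp: powr_mult intro!: mult_right_mono)
  next
    case 3
    then show ?thesis
      unfolding u using convex_onD[OF powr_convex[OF assms(1)], of v a b] assms by simp
  qed
qed

lemma norm_add_powr_le:
  assumes "0 \<le> p"
  shows "norm (z + w) powr p \<le> 2 powr p * (norm z powr p + norm w powr p)"
proof -
  have "norm (z + w) powr p \<le> (2 * max (norm z) (norm w)) powr p"
    using assms norm_triangle_ineq[of z w] by (intro powr_mono2) auto
  also have "\<dots> = 2 powr p * max (norm z) (norm w) powr p" by (simp add: powr_mult)
  also have "\<dots> \<le> 2 powr p * (norm z powr p + norm w powr p)"
    by (intro mult_left_mono) (auto simp: max_def)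
  finally show ?thesis .
qed

lemma Lp_add:
  assumes "f \<in> Lp p" "g \<in> Lp p" "0 \<le> p"
  shows "(\<lambda>z. f z + g z) \<in> Lp p"
proof -
  have m: "(\<lambda>z. f z + g z) \<in> borel_measurable lebesgue"
    using assms by (intro borel_measurable_add) (auto dest: Lp_measurable)
  moreover have "integrable T2 (\<lambda>z. norm (f z + g z) powr p)"
  proof (rule Bochner_Integration.integrable_bound)
    show "integrable T2 (\<lambda>z. 2 powr p * (norm (f z) powr p + norm (g z) powr p))"
      using assms by (intro integrable_mult_right Bochner_Integration.integrable_add Lp_integrable)
    show "(\<lambda>z. norm (f z + g z) powr p) \<in> borel_measurable T2"
      using borel_measurable_T2[OF m] by measurable
    show "AE z in T2. norm (norm (f z + g z) powr p) \<le> norm (2 powr p * (norm (f z) powr p + norm (g z) powr p))"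
      using norm_add_powr_le[OF assms(3)] by (auto intro!: AE_I2)
  qed
  ultimately show ?thesis using assms by (auto simp: Lp_def periodic2_def)
qed

lemma Lp_cmult:
  assumes "f \<in> Lp p"
  shows "(\<lambda>z. c * f z) \<in> Lp p"
proof -
  have "(\<lambda>z. norm (c * f z) powr p) = (\<lambda>z. norm c powr p * norm (f z) powr p)"
    by (simp add: norm_mult powr_mult)
  then show ?thesis using assms
    by (auto simp: Lp_def periodic2_def intro!: borel_measurable_times)
qed

lemma Lp_diff: "f \<in> Lp p \<Longrightarrow> g \<in> Lp p \<Longrightarrow> 0 \<le> p \<Longrightarrow> (\<lambda>z. f z - g z) \<in> Lp p"
  using Lp_add[of f p "\<lambda>z. (-1) * g z"] Lp_cmult[of g p "-1"] by simp

lemma Lp_norm_nonneg [simp]: "0 \<le> Lp_norm p f"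
  by (simp add: Lp_norm_def)

lemma Lp_norm_powr: "0 < p \<Longrightarrow> Lp_norm p f powr p = (\<integral>z. norm (f z) powr p \<partial>T2)"
  by (simp add: Lp_norm_def powr_powr)

lemma Lp_norm_leI:
  assumes "(\<integral>z. norm (f z) powr p \<partial>T2) \<le> c powr p" "0 < p" "0 \<le> c"
  shows "Lp_norm p f \<le> c"
proof -
  have "Lp_norm p f \<le> (c powr p) powr (1/p)"
    unfolding Lp_norm_def using assms by (intro powr_mono2) auto
  then show ?thesis using assms by (simp add: powr_powr)
qed

lemma Lp_norm_cmult: "0 < p \<Longrightarrow> Lp_norm p (\<lambda>z. c * f z) = norm c * Lp_norm p f"
  by (simp add: Lp_norm_def norm_mult powr_mult powr_powr)

lemma Lp_norm_cong_AE:
  assumes "AE z in T2. f z = g z" "f \<in> borel_measurable T2" "g \<in> borel_measurable T2"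
  shows "Lp_norm p f = Lp_norm p g"
proof -
  have "(\<integral>z. norm (f z) powr p \<partial>T2) = (\<integral>z. norm (g z) powr p \<partial>T2)"
    using assms by (intro integral_cong_AE measurable_norm_powr) auto
  then show ?thesis by (simp add: Lp_norm_def)
qed

text \<open>Minkowski's inequality from convexity of t^p: f + g is S times the convex combination of
  f/a and g/b with weights a/S and b/S. Taking \<open>a\<close> and \<open>b\<close> slightly above
  the norms keeps them positive, so vanishing norms need no separate case.\<close>

lemma Lp_norm_triangle:
  assumes f: "f \<in> Lp p" and g: "g \<in> Lp p" and p: "1 \<le> p"
  shows "Lp_norm p (\<lambda>z. f z + g z) \<le> Lp_norm p f + Lp_norm p g"
proof (rule field_le_epsilon)
  fix e :: real assume "0 < e"
  define a where "a = Lp_norm p f + e / 2"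
  define b where "b = Lp_norm p g + e / 2"
  have ab: "0 < a" "0 < b" using \<open>0 < e\<close> by (auto simp: a_def b_def add_nonneg_pos)
  define S where "S = a + b"
  have S: "0 < S" using ab by (simp add: S_def)
  have I: "(\<integral>z. norm (f z) powr p \<partial>T2) \<le> a powr p" "(\<integral>z. norm (g z) powr p \<partial>T2) \<le> b powr p"
    using p \<open>0 < e\<close> by (auto simp: a_def b_def Lp_norm_powr[symmetric] intro!: powr_mono2)
  have pt: "norm (f z + g z) powr p \<le> S powr p * (a / S * (norm (f z) powr p / a powr p) + b / S * (norm (g z) powr p / b powr p))" for z
  proof -
    have "norm (f z + g z) powr p \<le> (norm (f z) + norm (g z)) powr p"
      using p by (intro powr_mono2 norm_triangle_ineq) auto
    also have "norm (f z) + norm (g z) = S * (a / S * (norm (f z) / a) + b / S * (norm (g z) / b))"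
      using ab S by (simp add: field_simps)
    also have "\<dots> powr p = S powr p * (a / S * (norm (f z) / a) + b / S * (norm (g z) / b)) powr p"
      using ab S by (simp add: powr_mult)
    also have "\<dots> \<le> S powr p * (a / S * (norm (f z) / a) powr p + b / S * (norm (g z) / b) powr p)"
      using ab S p by (intro mult_left_mono convex_powr) (auto simp: add_divide_distrib[symmetric] S_def)
    finally show ?thesis using ab by (simp add: powr_divide)
  qed
  show "Lp_norm p (\<lambda>z. f z + g z) \<le> Lp_norm p f + Lp_norm p g + e"
  proof (rule Lp_norm_leI)
    have "(\<integral>z. norm (f z + g z) powr p \<partial>T2)
       \<le> (\<integral>z. S powr p * (a / S * (norm (f z) powr p / a powr p) + b / S * (norm (g z) powr p / b powr p)) \<partial>T2)"
      by (rule integral_mono)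
         (use Lp_integrable[OF Lp_add[OF f g]] Lp_integrable[OF f] Lp_integrable[OF g] pt p in auto)
    also have "\<dots> = S powr p * (a / S * ((\<integral>z. norm (f z) powr p \<partial>T2) / a powr p) + b / S * ((\<integral>z. norm (g z) powr p \<partial>T2) / b powr p))"
      using Lp_integrable[OF f] Lp_integrable[OF g] by simp
    also have "\<dots> \<le> S powr p * (a / S * 1 + b / S * 1)"
      using I ab S by (intro mult_left_mono add_mono) auto
    also have "\<dots> = S powr p" using S by (simp add: add_divide_distrib[symmetric] S_def)
    finally show "(\<integral>z. norm (f z + g z) powr p \<partial>T2) \<le> (Lp_norm p f + Lp_norm p g + e) powr p"
      by (simp add: S_def a_def b_def algebra_simps)
  qed (use p \<open>0 < e\<close> in \<open>auto simp: add_nonneg_nonneg\<close>)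
qed

lemma Lp_norm_triangle_diff:
  assumes "f \<in> Lp p" "g \<in> Lp p" "1 \<le> p"
  shows "Lp_norm p (\<lambda>z. f z - g z) \<le> Lp_norm p f + Lp_norm p g"
  using Lp_norm_triangle[OF assms(1) Lp_cmult[OF assms(2), of "-1"] assms(3)]
    Lp_norm_cmult[of p "-1" g] assms(3) by simp

lemma continuous_Lp:
  assumes c: "continuous_on UNIV f" and per: "periodic2 f" and "0 < p"
  shows "f \<in> Lp p"
proof -
  have m: "f \<in> borel_measurable lebesgue"
    using borel_measurable_continuous_onI[OF c] by (simp add: measurable_completion)
  have "compact (f ` closed_square)"
    unfolding closed_square_eq by (intro compact_continuous_image continuous_on_subset[OF c]) auto
  then obtain B where B: "\<And>z. z \<in> closed_square \<Longrightarrow> norm (f z) \<le> B"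
    using compact_imp_bounded[of "f ` closed_square"] unfolding bounded_iff by blast
  interpret finite_measure T2 by (rule finite_measure_T2)
  have "integrable T2 (\<lambda>z. norm (f z) powr p)"
    by (rule integrable_const_bound[of _ "B powr p"])
       (use borel_measurable_T2[OF m] B \<open>0 < p\<close> in \<open>auto intro!: AE_I2 powr_mono2 measurable_norm_powr\<close>)
  with m per show ?thesis by (simp add: Lp_def)
qed

section \<open>Translation invariance of integrals over a period square\<close>

lemma measurable_lebesgue_shift: "(\<lambda>z::real\<times>real. z + v) \<in> lebesgue \<rightarrow>\<^sub>M lebesgue"
  using lebesgue_affine_measurable[of "\<lambda>_. 1" v] by (simp add: euclidean_representation add.commute)

lemma lebesgue_shift: "distr lebesgue lebesgue (\<lambda>z::real\<times>real. z + v) = lebesgue"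
  using lebesgue_affine_euclidean[of "\<lambda>_. 1" v]
  by (simp add: euclidean_representation add.commute density_1)

lemma nn_integral_lebesgue_shift:
  fixes g :: "real \<times> real \<Rightarrow> ennreal"
  assumes [measurable]: "g \<in> borel_measurable lebesgue"
  shows "(\<integral>\<^sup>+z. g (z + v) \<partial>lebesgue) = (\<integral>\<^sup>+z. g z \<partial>lebesgue)"
proof -
  have "(\<integral>\<^sup>+z. g z \<partial>lebesgue) = (\<integral>\<^sup>+z. g z \<partial>distr lebesgue lebesgue (\<lambda>z. z + v))"
    by (simp only: lebesgue_shift)
  also have "\<dots> = (\<integral>\<^sup>+z. g (z + v) \<partial>lebesgue)"
    by (intro nn_integral_distr measurable_lebesgue_shift) (simp add: assms)
  finally show ?thesis by simp
qed

lemma borel_measurable_lebesgue_shift: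
  "f \<in> borel_measurable lebesgue \<Longrightarrow> (\<lambda>z::real\<times>real. f (z + v)) \<in> borel_measurable lebesgue"
  using measurable_compose[OF measurable_lebesgue_shift] .

lemma AE_lebesgue_shift:
  assumes "AE z in lebesgue. P z"
  shows "AE z::real\<times>real in lebesgue. P (z + v)"
proof -
  have "AE z in distr lebesgue lebesgue (\<lambda>z. z + v). P z"
    using assms by (simp only: lebesgue_shift)
  then show ?thesis
    by (rule AE_distrD[OF measurable_lebesgue_shift])
qed

abbreviation "half_open_square \<equiv> {0..<2 * pi} \<times> {0..<2 * pi::real}"

text \<open>\<open>T2\<close> lives on the closed square, but only half-open squares tile the plane;
  cutting and moving pieces is done with the latter.\<close>

lemma AE_closed_square_half_open_square: "AE z in lebesgue. z \<in> closed_square \<longleftrightarrow> z \<in> half_open_square"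
proof -
  have "negligible {z::real\<times>real. z \<bullet> (1,0) = 2*pi}" "negligible {z::real\<times>real. z \<bullet> (0,1) = 2*pi}"
    by (rule negligible_standard_hyperplane; simp add: Basis_prod_def)+
  then have "negligible ({z::real\<times>real. z \<bullet> (1,0) = 2*pi} \<union> {z. z \<bullet> (0,1) = 2*pi})"
    by (rule negligible_Un)
  then have "AE z in lebesgue. z \<notin> {z::real\<times>real. z \<bullet> (1,0) = 2*pi} \<union> {z. z \<bullet> (0,1) = 2*pi}"
    by (simp only: negligible_iff_null_sets AE_not_in)
  then show ?thesis by eventually_elim auto
qed

lemma half_open_square_sets [measurable]: "{a..<b} \<times> {c..<d::real} \<in> sets lebesgue" for a b :: real
proof -
  have "{a..<b} \<times> {c..<d} \<in> sets (borel :: (real\<times>real) measure)"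
    unfolding borel_prod[symmetric] by measurable
  then show ?thesis by (simp add: sets_completionI_sets)
qed

lemma nn_integral_T2:
  fixes g :: "real \<times> real \<Rightarrow> ennreal"
  shows "(\<integral>\<^sup>+z. g z \<partial>T2) = (\<integral>\<^sup>+z. g z * indicator half_open_square z \<partial>lebesgue)"
proof -
  have "(\<integral>\<^sup>+z. g z \<partial>T2) = (\<integral>\<^sup>+z. g z * indicator closed_square z \<partial>lebesgue)"
    unfolding T2_def by (subst nn_integral_restrict_space) auto
  also have "\<dots> = (\<integral>\<^sup>+z. g z * indicator half_open_square z \<partial>lebesgue)"
    by (rule nn_integral_cong_AE) (use AE_closed_square_half_open_square in \<open>eventually_elim, auto simp: indicator_def\<close>)
  finally show ?thesis .
qed

text \<open>The translate of \<open>B\<close> by \<open>v\<close> falls into the pieces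
  \<open>B1\<close> and \<open>B2\<close>, and moving \<open>B2\<close> back by the period
  \<open>w\<close> completes \<open>B1\<close> to \<open>B\<close>. Equations between sums of
  indicators express both partitions together with their disjointness.\<close>

lemma nn_integral_fundamental_domain_shift:
  fixes g :: "real \<times> real \<Rightarrow> ennreal"
  assumes g[measurable]: "g \<in> borel_measurable lebesgue" and per: "\<And>z. g (z + w) = g z"
    and B[measurable]: "B \<in> sets lebesgue" "B1 \<in> sets lebesgue" "B2 \<in> sets lebesgue"
    and 1: "\<And>z. (indicator B (z - v) :: ennreal) = indicator B1 z + indicator B2 z"
    and 2: "\<And>z. (indicator B z :: ennreal) = indicator B1 z + indicator B2 (z + w)"
  shows "(\<integral>\<^sup>+z. g (z + v) * indicator B z \<partial>lebesgue) = (\<integral>\<^sup>+z. g z * indicator B z \<partial>lebesgue)"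
proof -
  have m: "(\<lambda>z. indicator B (z - v) :: ennreal) \<in> borel_measurable lebesgue"
    using borel_measurable_lebesgue_shift[of "indicator B" "- v"] by simp
  have m2: "(\<lambda>z. indicator B2 (z + w) :: ennreal) \<in> borel_measurable lebesgue"
    using borel_measurable_lebesgue_shift[of "indicator B2" w] by simp
  have "(\<integral>\<^sup>+z. g (z + v) * indicator B z \<partial>lebesgue) = (\<integral>\<^sup>+z. g (z + v) * indicator B (z + v - v) \<partial>lebesgue)"
    by simp
  also have "\<dots> = (\<integral>\<^sup>+z. g z * indicator B (z - v) \<partial>lebesgue)"
    by (rule nn_integral_lebesgue_shift[of "\<lambda>z. g z * indicator B (z - v)"]) (use m in measurable)
  also have "\<dots> = (\<integral>\<^sup>+z. g z * indicator B1 z \<partial>lebesgue) + (\<integral>\<^sup>+z. g z * indicator B2 z \<partial>lebesgue)"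
    unfolding 1 distrib_left by (rule nn_integral_add) measurable
  also have "(\<integral>\<^sup>+z. g z * indicator B2 z \<partial>lebesgue) = (\<integral>\<^sup>+z. g (z + w) * indicator B2 (z + w) \<partial>lebesgue)"
    by (rule nn_integral_lebesgue_shift[symmetric]) measurable
  also have "(\<integral>\<^sup>+z. g z * indicator B1 z \<partial>lebesgue) + \<dots> = (\<integral>\<^sup>+z. g z * indicator B z \<partial>lebesgue)"
    unfolding 2 per distrib_left by (rule nn_integral_add[symmetric]) (use m2 in measurable)
  finally show ?thesis .
qed

lemma mod_2pi: "\<exists>s (m::int). 0 \<le> s \<and> s < 2 * pi \<and> v = s + of_int m * (2 * pi)" for v :: real
proof -
  have "v = 2 * pi * frac (v / (2*pi)) + of_int \<lfloor>v / (2 * pi)\<rfloor> * (2 * pi)"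
    by (simp add: frac_def field_simps)
  moreover have "0 \<le> 2 * pi * frac (v / (2*pi))" "2 * pi * frac (v / (2*pi)) < 2 * pi"
    using frac_lt_1[of "v / (2*pi)"] by (auto simp: frac_ge_0)
  ultimately show ?thesis by blast
qed

lemma periodic_int_multiple:
  fixes h :: "real \<Rightarrow> 'a"
  assumes "\<And>x. h (x + 2 * pi) = h x"
  shows "h (x + of_int m * (2 * pi)) = h x"
proof (induction m rule: int_induct[of _ 0])
  case (step1 i)
  then show ?case using assms[of "x + of_int i * (2 * pi)"] by (simp add: algebra_simps)
next
  case (step2 i)
  then show ?case using assms[of "x + of_int (i - 1) * (2 * pi)"] by (simp add: algebra_simps)
qed simp

text \<open>The shift is reduced modulo 2 \<pi> to (s, t) in the half-open square, and the cutting
  argument is applied once in each coordinate.\<close>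

lemma nn_integral_T2_shift:
  fixes g :: "real \<times> real \<Rightarrow> ennreal"
  assumes g[measurable]: "g \<in> borel_measurable lebesgue"
    and per: "\<And>x y. g (x + 2 * pi, y) = g (x, y)" "\<And>x y. g (x, y + 2 * pi) = g (x, y)"
  shows "(\<integral>\<^sup>+z. g (z + v) \<partial>T2) = (\<integral>\<^sup>+z. g z \<partial>T2)"
proof -
  obtain v1 v2 where v: "v = (v1, v2)" by force
  obtain s m where s: "0 \<le> s" "s < 2 * pi" "v1 = s + of_int m * (2 * pi)" using mod_2pi by blast
  obtain t n where t: "0 \<le> t" "t < 2 * pi" "v2 = t + of_int n * (2 * pi)" using mod_2pi by blast
  have gv: "g (z + v) = g ((z + (s, 0)) + (0, t))" for z
    using periodic_int_multiple[of "\<lambda>x. g (x, snd z + v2)" "fst z + s" m] per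
      periodic_int_multiple[of "\<lambda>y. g (fst z + s, y)" "snd z + t" n]
    by (cases z) (simp add: v s(3) t(3) add.assoc[symmetric])
  have m: "(\<lambda>z. g (z + (0, t))) \<in> borel_measurable lebesgue" by (rule borel_measurable_lebesgue_shift[OF g])
  have "(\<integral>\<^sup>+z. g (z + v) * indicator half_open_square z \<partial>lebesgue) = (\<integral>\<^sup>+z. g (z + (s,0) + (0,t)) * indicator half_open_square z \<partial>lebesgue)"
    unfolding gv ..
  also have "\<dots> = (\<integral>\<^sup>+z. g (z + (0,t)) * indicator half_open_square z \<partial>lebesgue)"
    by (rule nn_integral_fundamental_domain_shift[where w = "(2*pi,0)" and ?B1.0 = "{s..<2*pi} \<times> {0..<2*pi}"
          and ?B2.0 = "{2*pi..<2*pi+s} \<times> {0..<2*pi}"])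
       (use s(1,2) m per in \<open>auto simp: indicator_def algebra_simps split_paired_all\<close>)
  also have "\<dots> = (\<integral>\<^sup>+z. g z * indicator half_open_square z \<partial>lebesgue)"
    by (rule nn_integral_fundamental_domain_shift[where w = "(0,2*pi)" and ?B1.0 = "{0..<2*pi} \<times> {t..<2*pi}"
          and ?B2.0 = "{0..<2*pi} \<times> {2*pi..<2*pi+t}"])
       (use t(1,2) per in \<open>auto simp: indicator_def algebra_simps split_paired_all\<close>)
  finally show ?thesis unfolding nn_integral_T2 .
qed

lemma Lp_iff_nn_integral:
  "f \<in> Lp p \<longleftrightarrow> f \<in> borel_measurable lebesgue \<and> periodic2 f \<and> (\<integral>\<^sup>+z. ennreal (norm (f z) powr p) \<partial>T2) < \<infinity>"
proof -
  have "integrable T2 (\<lambda>z. norm (f z) powr p) \<longleftrightarrow> (\<integral>\<^sup>+z. ennreal (norm (f z) powr p) \<partial>T2) < \<infinity>"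
    if "f \<in> borel_measurable lebesgue"
    using measurable_norm_powr[OF borel_measurable_T2[OF that]] by (simp add: integrable_iff_bounded)
  then show ?thesis by (auto simp: Lp_def)
qed

lemma integral_norm_powr:
  fixes f :: "real \<times> real \<Rightarrow> complex"
  assumes "f \<in> borel_measurable lebesgue"
  shows "(\<integral>z. norm (f z) powr p \<partial>T2) = enn2real (\<integral>\<^sup>+z. ennreal (norm (f z) powr p) \<partial>T2)"
  using measurable_norm_powr[OF borel_measurable_T2[OF assms]] by (intro integral_eq_nn_integral) auto

lemma nn_integral_norm_powr:
  assumes "f \<in> Lp p" "0 < p"
  shows "(\<integral>\<^sup>+z. ennreal (norm (f z) powr p) \<partial>T2) = ennreal (Lp_norm p f powr p)"
  using assms nn_integral_eq_integral[OF Lp_integrable[OF assms(1)]] by (simp add: Lp_norm_powr)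

lemma nn_integral_norm_powr_shift:
  assumes f: "f \<in> borel_measurable lebesgue" and per: "periodic2 f"
  shows "(\<integral>\<^sup>+z. ennreal (norm (f (z + v)) powr p) \<partial>T2) = (\<integral>\<^sup>+z. ennreal (norm (f z) powr p) \<partial>T2)"
  using measurable_norm_powr[OF f] per
  by (intro nn_integral_T2_shift[of "\<lambda>z. ennreal (norm (f z) powr p)"]) (auto simp: periodic2_def)

lemma Lp_shift:
  assumes f: "f \<in> Lp p"
  shows "(\<lambda>z. f (z + v)) \<in> Lp p" and "Lp_norm p (\<lambda>z. f (z + v)) = Lp_norm p f"
proof -
  have m: "(\<lambda>z. f (z + v)) \<in> borel_measurable lebesgue"
    using f by (intro borel_measurable_lebesgue_shift Lp_measurable)
  have "periodic2 (\<lambda>z. f (z + v))"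
    unfolding periodic2_def
  proof (intro allI conjI)
    fix x y
    show "f ((x + 2 * pi, y) + v) = f ((x, y) + v)"
      using Lp_periodic[OF f, unfolded periodic2_def, rule_format, of "x + fst v" "y + snd v"]
      by (cases v) (simp add: algebra_simps)
    show "f ((x, y + 2 * pi) + v) = f ((x, y) + v)"
      using Lp_periodic[OF f, unfolded periodic2_def, rule_format, of "x + fst v" "y + snd v"]
      by (cases v) (simp add: algebra_simps)
  qed
  with f m show "(\<lambda>z. f (z + v)) \<in> Lp p"
    by (simp add: Lp_iff_nn_integral nn_integral_norm_powr_shift)
  show "Lp_norm p (\<lambda>z. f (z + v)) = Lp_norm p f"
    using f m by (simp add: Lp_norm_def integral_norm_powr Lp_iff_nn_integral nn_integral_norm_powr_shift)
qed

section \<open>Characters, trigonometric polynomials and Fourier coefficients\<close>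

definition character :: "int \<times> int \<Rightarrow> real \<times> real \<Rightarrow> complex" where
  "character k z = cis (of_int (fst k) * fst z + of_int (snd k) * snd z)"

definition trig_poly :: "(int \<times> int) set \<Rightarrow> (int \<times> int \<Rightarrow> complex) \<Rightarrow> real \<times> real \<Rightarrow> complex" where
  "trig_poly A a z = (\<Sum>k\<in>A. a k * character k z)"

lemma norm_character [simp]: "norm (character k z) = 1"
  by (simp add: character_def)

lemma character_add: "character k (z + w) = character k z * character k w"
  by (simp add: character_def cis_mult algebra_simps)

lemma character_index_add: "character (k + l) z = character k z * character l z"
  by (simp add: character_def cis_mult algebra_simps)

lemma character_0 [simp]: "character 0 z = 1"
  by (simp add: character_def)

lemma character_periodic: "character k (x + 2 * pi, y) = character k (x, y)" "character k (x, y + 2 * pi) = character k (x, y)"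
proof -
  have "cis (of_int m * (2 * pi)) = 1" for m
    using cis_multiple_2pi[of "of_int m"] by (simp add: mult_ac)
  then show "character k (x + 2 * pi, y) = character k (x, y)" "character k (x, y + 2 * pi) = character k (x, y)"
    by (simp_all add: character_def distrib_left add.assoc[symmetric] cis_mult[symmetric])
qed

lemma continuous_character: "continuous_on S (character k)"
  unfolding character_def cis_conv_exp by (intro continuous_intros)

lemma continuous_trig_poly: "continuous_on S (trig_poly A a)"
  unfolding trig_poly_def by (intro continuous_intros continuous_character)

lemma periodic2_trig_poly: "periodic2 (trig_poly A a)"
  by (simp add: periodic2_def trig_poly_def character_periodic)

lemma trig_poly_Lp: "0 < p \<Longrightarrow> trig_poly A a \<in> Lp p"
  by (rule continuous_Lp[OF continuous_trig_poly periodic2_trig_poly])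

lemma trig_poly_add: "trig_poly A (\<lambda>k. a k + b k) z = trig_poly A a z + trig_poly A b z"
  by (simp add: trig_poly_def sum.distrib distrib_right)

lemma trig_poly_diff: "trig_poly A (\<lambda>k. a k - b k) z = trig_poly A a z - trig_poly A b z"
  by (simp add: trig_poly_def sum_subtractf left_diff_distrib)

lemma trig_poly_cmult: "trig_poly A (\<lambda>k. c * a k) z = c * trig_poly A a z"
  by (simp add: trig_poly_def sum_distrib_left mult.assoc)

lemma trig_poly_cong: "(\<And>k. k \<in> A \<Longrightarrow> a k = b k) \<Longrightarrow> trig_poly A a = trig_poly A b"
  unfolding trig_poly_def by (intro ext sum.cong) auto

lemma trig_poly_shift: "trig_poly A (\<lambda>k. character k v * a k) z = trig_poly A a (z + v)"
  by (simp add: trig_poly_def character_add mult_ac)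

lemma trig_poly_mono_neutral:
  assumes "finite B" "A \<subseteq> B" "\<And>k. k \<in> B - A \<Longrightarrow> a k = 0"
  shows "trig_poly A a = trig_poly B a"
  unfolding trig_poly_def using assms by (intro ext sum.mono_neutral_left) auto

lemma integral_T2_continuous:
  fixes f :: "real \<times> real \<Rightarrow> 'a::euclidean_space"
  assumes "continuous_on UNIV f"
  shows "integrable T2 f" and "(\<integral>z. f z \<partial>T2) = integral {0..2*pi} (\<lambda>x. integral {0..2*pi} (\<lambda>y. f (x, y)))"
proof -
  have c: "continuous_on closed_square f" using assms continuous_on_subset by blast
  have "f absolutely_integrable_on closed_square"
    unfolding closed_square_eq by (rule absolutely_integrable_continuous) (use c closed_square_eq in simp)
  then show i: "integrable T2 f" unfolding T2_def set_integrable_def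
    by (simp add: integrable_restrict_space)
  then have "(\<integral>z. f z \<partial>T2) = integral closed_square f"
    unfolding T2_def by (rule lebesgue_integral_eq_integral[OF _ closed_square_sets])
  also have "\<dots> = integral {0..2*pi} (\<lambda>x. integral {0..2*pi} (\<lambda>y. f (x, y)))"
    unfolding closed_square_eq using integral_prod_continuous[of 0 0 "2*pi" "2*pi" f] c by (simp add: closed_square_eq)
  finally show "(\<integral>z. f z \<partial>T2) = integral {0..2*pi} (\<lambda>x. integral {0..2*pi} (\<lambda>y. f (x, y)))" .
qed

lemma integral_cis: "integral {0..2*pi} (\<lambda>x. cis (of_int n * x)) = (if n = 0 then of_real (2 * pi) else 0)"
proof (cases "n = 0")
  case False
  have "((\<lambda>x. cis (of_int n * x)) has_integral (cis (of_int n * (2*pi)) / (\<i> * of_int n) - cis (of_int n * 0) / (\<i> * of_int n))) {0..2*pi}"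
  proof (rule fundamental_theorem_of_calculus)
    fix x assume "x \<in> {0..2*pi}"
    have "((\<lambda>x. exp (\<i> * of_int n * of_real x) / (\<i> * of_int n)) has_vector_derivative exp (\<i> * of_int n * of_real x)) (at x within {0..2*pi})"
    proof -
      have "((\<lambda>z. exp (\<i> * of_int n * z) / (\<i> * of_int n)) has_field_derivative exp (\<i> * of_int n * of_real x)) (at (of_real x))"
        using False by (auto intro!: derivative_eq_intros)
      from has_vector_derivative_real_field[OF this] show ?thesis by simp
    qed
    then show "((\<lambda>x. cis (of_int n * x) / (\<i> * of_int n)) has_vector_derivative cis (of_int n * x)) (at x within {0..2*pi})"
      by (simp add: cis_conv_exp mult.assoc)
  qed simp
  moreover have "cis (of_int n * (2*pi)) = 1"
    using cis_multiple_2pi[of "of_int n"] by (simp add: mult_ac)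
  ultimately show ?thesis using False by (simp add: has_integral_iff)
qed (simp add: scaleR_conv_of_real)

lemma integral_character: "(\<integral>z. character k z \<partial>T2) = (if k = 0 then 4 * of_real (pi\<^sup>2) else 0)"
proof -
  have "(\<integral>z. character k z \<partial>T2) = integral {0..2*pi} (\<lambda>x. integral {0..2*pi} (\<lambda>y. cis (of_int (fst k) * x) * cis (of_int (snd k) * y)))"
    by (simp only: integral_T2_continuous(2)[OF continuous_character]) (simp only: character_def cis_mult fst_conv snd_conv)
  also have "\<dots> = integral {0..2*pi} (\<lambda>x. cis (of_int (fst k) * x)) * integral {0..2*pi} (\<lambda>y. cis (of_int (snd k) * y))"
    by (simp only: integral_mult_right integral_mult_left)
  also have "\<dots> = (if k = 0 then 4 * of_real (pi\<^sup>2) else 0)"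
    unfolding integral_cis by (auto simp: prod_eq_iff power2_eq_square)
  finally show ?thesis .
qed

lemma fourier_coeff_character: "fourier_coeff f n1 n2 = (\<integral>z. f z * character (- (n1, n2)) z \<partial>T2) / of_real (4 * pi\<^sup>2)"
  by (simp add: fourier_coeff_def character_def cis_conv_exp case_prod_unfold algebra_simps)

abbreviation fcoeff :: "(real \<times> real \<Rightarrow> complex) \<Rightarrow> int \<times> int \<Rightarrow> complex" where
  "fcoeff f k \<equiv> fourier_coeff f (fst k) (snd k)"

lemma fcoeff_character: "fcoeff f k = (\<integral>z. f z * character (- k) z \<partial>T2) / of_real (4 * pi\<^sup>2)"
  using fourier_coeff_character[of f "fst k" "snd k"] by simp

lemma fcoeff_trig_poly:
  assumes "finite A"
  shows "fcoeff (trig_poly A a) k = (if k \<in> A then a k else 0)"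
proof -
  have "(\<integral>z. trig_poly A a z * character (- k) z \<partial>T2) = (\<integral>z. (\<Sum>l\<in>A. a l * character (l - k) z) \<partial>T2)"
    using character_index_add[of _ "- k"] by (simp add: trig_poly_def sum_distrib_right mult.assoc)
  also have "\<dots> = (\<Sum>l\<in>A. a l * (\<integral>z. character (l - k) z \<partial>T2))"
    by (subst Bochner_Integration.integral_sum) (auto intro!: integral_T2_continuous(1) continuous_intros continuous_character)
  also have "\<dots> = (\<Sum>l\<in>A. if l = k then a l * (4 * of_real (pi\<^sup>2)) else 0)"
    by (intro sum.cong) (auto simp: integral_character)
  also have "\<dots> = (if k \<in> A then a k else 0) * (4 * of_real (pi\<^sup>2))"
    using assms by (simp add: sum.delta)
  finally show ?thesis unfolding fcoeff_character by simp
qed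

lemma measure_T2: "measure T2 (space T2) = 4 * pi\<^sup>2"
proof -
  have "measure T2 (space T2) = measure lebesgue closed_square"
    by (simp add: T2_def measure_restrict_space)
  also have "\<dots> = 4 * pi\<^sup>2"
    unfolding closed_square_eq by (simp add: content_Pair power2_eq_square)
  finally show ?thesis .
qed

text \<open>In place of Hoelder's inequality, the pointwise bound t \<le> \<epsilon> +
  \<epsilon>^(1-p) t^p is integrated with \<epsilon> just above the norm. The constant is the area
  of the square plus 1; its size is irrelevant, as it only yields continuity of the Fourier
  coefficients.\<close>

lemma Lp_integral_norm_le:
  assumes f: "f \<in> Lp p" and p: "1 \<le> p"
  shows "integrable T2 f" and "(\<integral>z. norm (f z) \<partial>T2) \<le> (4 * pi\<^sup>2 + 1) * Lp_norm p f"
proof -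
  interpret finite_measure T2 by (rule finite_measure_T2)
  have pt: "t \<le> \<epsilon> + \<epsilon> powr (1 - p) * t powr p" if "0 < \<epsilon>" "0 \<le> t" for t \<epsilon> :: real
  proof (cases "t \<le> \<epsilon>")
    case True
    then show ?thesis by (simp add: add_increasing2)
  next
    case False
    then have t: "0 < t" using that by simp
    have "t = \<epsilon> powr (1 - p) * (t * \<epsilon> powr (p - 1))"
      using that by (simp add: powr_add[symmetric])
    also have "\<dots> \<le> \<epsilon> powr (1 - p) * (t * t powr (p - 1))"
      using False that p by (intro mult_left_mono powr_mono2) auto
    also have "t * t powr (p - 1) = t powr p" using t powr_add[of t 1 "p - 1"] by simp
    finally show ?thesis using that by simp
  qed
  have m: "f \<in> borel_measurable T2" using f by (intro borel_measurable_T2 Lp_measurable)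
  show i: "integrable T2 f"
  proof (rule Bochner_Integration.integrable_bound[OF _ m])
    show "integrable T2 (\<lambda>z. 1 + 1 powr (1 - p) * norm (f z) powr p)"
      using Lp_integrable[OF f] by auto
    show "AE z in T2. norm (f z) \<le> norm (1 + 1 powr (1 - p) * norm (f z) powr p)"
      using pt[of 1 "norm (f _)"] by (auto intro!: AE_I2)
  qed
  show "(\<integral>z. norm (f z) \<partial>T2) \<le> (4 * pi\<^sup>2 + 1) * Lp_norm p f"
  proof (rule field_le_epsilon)
    fix e :: real assume "0 < e"
    define \<epsilon> where "\<epsilon> = Lp_norm p f + e / (4 * pi\<^sup>2 + 1)"
    have c: "0 < 4 * pi\<^sup>2 + 1" by (rule add_nonneg_pos) auto
    then have \<epsilon>: "0 < \<epsilon>" using \<open>0 < e\<close> by (auto simp: \<epsilon>_def add_nonneg_pos)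
    have "(\<integral>z. norm (f z) \<partial>T2) \<le> (\<integral>z. \<epsilon> + \<epsilon> powr (1 - p) * norm (f z) powr p \<partial>T2)"
      by (rule integral_mono) (use i Lp_integrable[OF f] pt[OF \<epsilon>] in auto)
    also have "\<dots> = 4 * pi\<^sup>2 * \<epsilon> + \<epsilon> powr (1 - p) * Lp_norm p f powr p"
      using Lp_integrable[OF f] p by (simp add: Lp_norm_powr measure_T2[simplified])
    also have "\<dots> \<le> 4 * pi\<^sup>2 * \<epsilon> + \<epsilon> powr (1 - p) * \<epsilon> powr p"
      using p \<open>0 < e\<close> c by (intro add_left_mono mult_left_mono powr_mono2) (auto simp: \<epsilon>_def)
    also have "\<epsilon> powr (1 - p) * \<epsilon> powr p = \<epsilon>"
      using \<epsilon> by (simp add: powr_add[symmetric])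
    also have "4 * pi\<^sup>2 * \<epsilon> + \<epsilon> = (4 * pi\<^sup>2 + 1) * \<epsilon>" by (simp add: algebra_simps)
    also have "\<dots> = (4 * pi\<^sup>2 + 1) * Lp_norm p f + e"
      using c by (simp add: \<epsilon>_def distrib_left)
    finally show "(\<integral>z. norm (f z) \<partial>T2) \<le> (4 * pi\<^sup>2 + 1) * Lp_norm p f + e" .
  qed
qed

lemma integrable_mult_character:
  assumes "f \<in> Lp p" "1 \<le> p"
  shows "integrable T2 (\<lambda>z. f z * character k z)"
  by (rule Bochner_Integration.integrable_bound[OF Lp_integral_norm_le(1)[OF assms]])
     (use Lp_integral_norm_le(1)[OF assms] integral_T2_continuous(1)[OF continuous_character, of k] in
       \<open>auto simp: norm_mult intro!: borel_measurable_times\<close>)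

lemma fcoeff_diff:
  assumes "f \<in> Lp p" "g \<in> Lp p" "1 \<le> p"
  shows "fcoeff (\<lambda>z. f z - g z) k = fcoeff f k - fcoeff g k"
  unfolding fcoeff_character using integrable_mult_character[OF assms(1,3)] integrable_mult_character[OF assms(2,3)]
  by (simp add: left_diff_distrib diff_divide_distrib)

lemma norm_fcoeff_le:
  assumes "f \<in> Lp p" "1 \<le> p"
  shows "norm (fcoeff f k) \<le> (1 + 1 / (4 * pi\<^sup>2)) * Lp_norm p f"
proof -
  have "norm (\<integral>z. f z * character (- k) z \<partial>T2) \<le> (\<integral>z. norm (f z) \<partial>T2)"
    using integral_norm_bound[of T2 "\<lambda>z. f z * character (- k) z"] by (simp add: norm_mult)
  also have "\<dots> \<le> (4 * pi\<^sup>2 + 1) * Lp_norm p f" by (rule Lp_integral_norm_le(2)[OF assms])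
  finally show ?thesis unfolding fcoeff_character by (simp add: norm_divide norm_power field_simps)
qed

section \<open>Density of trigonometric polynomials\<close>

definition is_trig_poly :: "(real \<times> real \<Rightarrow> complex) \<Rightarrow> bool" where
  "is_trig_poly g \<longleftrightarrow> (\<exists>A a. finite A \<and> g = trig_poly A a)"

lemma is_trig_poly_trig_poly: "finite A \<Longrightarrow> is_trig_poly (trig_poly A a)"
  unfolding is_trig_poly_def by blast

lemma is_trig_poly_character: "is_trig_poly (\<lambda>z. c * character k z)"
  unfolding is_trig_poly_def by (rule exI[of _ "{k}"], rule exI[of _ "\<lambda>_. c"]) (auto simp: trig_poly_def)

lemma is_trig_poly_const: "is_trig_poly (\<lambda>z. c)"
  using is_trig_poly_character[of c 0] by simp

lemma is_trig_poly_add: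
  assumes "is_trig_poly g" "is_trig_poly h"
  shows "is_trig_poly (\<lambda>z. g z + h z)"
proof -
  obtain A a B b where A: "finite A" "g = trig_poly A a" and B: "finite B" "h = trig_poly B b"
    using assms unfolding is_trig_poly_def by blast
  have "g = trig_poly (A \<union> B) (\<lambda>k. if k \<in> A then a k else 0)" "h = trig_poly (A \<union> B) (\<lambda>k. if k \<in> B then b k else 0)"
    using A B trig_poly_mono_neutral[of "A \<union> B" A "\<lambda>k. if k \<in> A then a k else 0"]
      trig_poly_mono_neutral[of "A \<union> B" B "\<lambda>k. if k \<in> B then b k else 0"]
      trig_poly_cong[of A a "\<lambda>k. if k \<in> A then a k else 0"] trig_poly_cong[of B b "\<lambda>k. if k \<in> B then b k else 0"]
    by auto
  then have "(\<lambda>z. g z + h z) = trig_poly (A \<union> B) (\<lambda>k. (if k \<in> A then a k else 0) + (if k \<in> B then b k else 0))"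
    by (auto simp: trig_poly_add)
  then show ?thesis using A(1) B(1) is_trig_poly_trig_poly by auto
qed

lemma is_trig_poly_sum: "finite I \<Longrightarrow> (\<And>i. i \<in> I \<Longrightarrow> is_trig_poly (g i)) \<Longrightarrow> is_trig_poly (\<lambda>z. \<Sum>i\<in>I. g i z)"
  by (induction I rule: finite_induct) (auto intro: is_trig_poly_const is_trig_poly_add)

lemma is_trig_poly_mult:
  assumes "is_trig_poly g" "is_trig_poly h"
  shows "is_trig_poly (\<lambda>z. g z * h z)"
proof -
  obtain A a B b where A: "finite A" "g = trig_poly A a" and B: "finite B" "h = trig_poly B b"
    using assms unfolding is_trig_poly_def by blast
  have "(\<lambda>z. g z * h z) = (\<lambda>z. \<Sum>k\<in>A. \<Sum>l\<in>B. (a k * b l) * character (k + l) z)"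
    unfolding A B trig_poly_def by (simp add: sum_product character_index_add mult_ac)
  then show ?thesis using A(1) B(1) by (auto intro!: is_trig_poly_sum is_trig_poly_character)
qed

text \<open>Since trigonometric polynomials form an algebra, only real-linear forms on C^2 need
  work. Such a form is a combination of the cosines and sines of the two angles, hence of four
  characters.\<close>

lemma is_trig_poly_real_polynomial:
  fixes r :: "complex \<times> complex \<Rightarrow> real"
  assumes "real_polynomial_function r"
  shows "is_trig_poly (\<lambda>z. of_real (r (cis (fst z), cis (snd z))))"
  using assms
proof (induction rule: real_polynomial_function.induct)
  case (linear f)
  interpret bounded_linear f by fact
  have cis_sum: "of_real (cos x) = (cis x + cis (- x)) / 2" "of_real (sin x) = (cis x - cis (- x)) / (2 * \<i>)" for x
    by (auto simp: complex_eq_iff)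
  have "f (cis x, cis y) = f (cos x *\<^sub>R (1,0) + sin x *\<^sub>R (\<i>,0) + (cos y *\<^sub>R (0,1) + sin y *\<^sub>R (0,\<i>)))" for x y
    by (rule arg_cong[of _ _ f]) (simp add: complex_eq_iff)
  then have "f (cis x, cis y) = cos x * f (1,0) + sin x * f (\<i>,0) + (cos y * f (0,1) + sin y * f (0,\<i>))" for x y
    by (simp only: add scaleR real_scaleR_def)
  then have "(\<lambda>z. of_real (f (cis (fst z), cis (snd z)))) =
     (\<lambda>z. ((of_real (f (1,0)) / 2 + of_real (f (\<i>,0)) / (2 * \<i>)) * character (1,0) z
        + (of_real (f (1,0)) / 2 - of_real (f (\<i>,0)) / (2 * \<i>)) * character (-1,0) z)
      + ((of_real (f (0,1)) / 2 + of_real (f (0,\<i>)) / (2 * \<i>)) * character (0,1) z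
        + (of_real (f (0,1)) / 2 - of_real (f (0,\<i>)) / (2 * \<i>)) * character (0,-1) z))"
    by (simp add: character_def cis_sum fun_eq_iff field_simps)
  moreover have "is_trig_poly \<dots>" by (intro is_trig_poly_add is_trig_poly_character)
  ultimately show ?case by simp
next
  case (const c)
  then show ?case by (rule is_trig_poly_const)
next
  case (add f g)
  then show ?case using is_trig_poly_add by auto
next
  case (mult f g)
  then show ?case using is_trig_poly_mult by auto
qed

text \<open>Stone-Weierstrass on the torus, seen as a compact subset of C^2. Real and imaginary
  parts of the approximating polynomial are treated separately because polynomial functions are
  defined over the reals.\<close>

lemma trig_poly_uniform_approx:
  fixes \<psi> :: "complex \<times> complex \<Rightarrow> complex"
  assumes "continuous_on (sphere 0 1 \<times> sphere 0 1) \<psi>" "0 < e"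
  obtains A a where "finite A" "\<And>x y. norm (\<psi> (cis x, cis y) - trig_poly A a (x, y)) < e"
proof -
  have "compact (sphere (0::complex) 1 \<times> sphere (0::complex) 1)" by (intro compact_Times compact_sphere)
  then obtain g where g: "polynomial_function g" "\<And>z. z \<in> sphere 0 1 \<times> sphere 0 1 \<Longrightarrow> norm (\<psi> z - g z) < e"
    using Stone_Weierstrass_polynomial_function[OF _ assms] by metis
  have "real_polynomial_function (Re \<circ> g)" "real_polynomial_function (Im \<circ> g)"
    using g(1) bounded_linear_Re bounded_linear_Im unfolding polynomial_function_def by blast+
  then have "is_trig_poly (\<lambda>z. of_real ((Re \<circ> g) (cis (fst z), cis (snd z))) + \<i> * of_real ((Im \<circ> g) (cis (fst z), cis (snd z))))"
    by (intro is_trig_poly_add is_trig_poly_mult is_trig_poly_const is_trig_poly_real_polynomial)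
  then have "is_trig_poly (\<lambda>z. g (cis (fst z), cis (snd z)))"
    by (simp add: complex_eq[symmetric])
  then obtain A a where A: "finite A" "(\<lambda>z. g (cis (fst z), cis (snd z))) = trig_poly A a"
    unfolding is_trig_poly_def by blast
  have "norm (\<psi> (cis x, cis y) - trig_poly A a (x, y)) < e" for x y
    using g(2)[of "(cis x, cis y)"] fun_cong[OF A(2), of "(x,y)"] by simp
  with A(1) show ?thesis by (rule that)
qed

text \<open>A continuous function on the circle that vanishes near z = 1, where
  \<open>Arg2pi\<close> jumps, and equals 1 as soon as \<open>n * (1 - Re z)\<close> reaches
  2.\<close>

definition cutoff :: "nat \<Rightarrow> complex \<Rightarrow> real" where
  "cutoff n z = max 0 (min 1 (real n * (1 - Re z) - 1))"

text \<open>Lets a continuous function on the plane that need not be periodic be carried over to the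
  torus. Near a point with a coordinate equal to 1 the product is identically zero; at all other
  points both arguments are continuous.\<close>

lemma continuous_on_torus_cutoff:
  fixes \<phi> :: "real \<times> real \<Rightarrow> complex"
  assumes "continuous_on UNIV \<phi>"
  shows "continuous_on (sphere 0 1 \<times> sphere 0 1)
    (\<lambda>p. (cutoff n (fst p) * cutoff n (snd p)) *\<^sub>R \<phi> (Arg2pi (fst p), Arg2pi (snd p)))" (is "continuous_on _ ?\<psi>")
proof (rule continuous_at_imp_continuous_on, rule ballI)
  fix p assume "p \<in> sphere (0::complex) 1 \<times> sphere (0::complex) 1"
  obtain z w where p: "p = (z, w)" by force
  consider "Re z = 1 \<or> Re w = 1" | "Re z \<noteq> 1" "Re w \<noteq> 1" by blast
  then show "continuous (at p) ?\<psi>"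
  proof cases
    case 1
    define U where "U = {p::complex\<times>complex. real n * (1 - Re (fst p)) < 1 \<or> real n * (1 - Re (snd p)) < 1}"
    have "open U" unfolding U_def Collect_disj_eq
      by (intro open_Un open_Collect_less continuous_intros)
    moreover have "p \<in> U" using 1 by (auto simp: U_def p)
    moreover have "0 = ?\<psi> q" if "q \<in> U" for q
      using that by (auto simp: U_def cutoff_def)
    ultimately show ?thesis
    proof -
      assume U: "open U" "p \<in> U" and eq: "\<And>q. q \<in> U \<Longrightarrow> 0 = ?\<psi> q"
      have "\<forall>\<^sub>F q in nhds p. 0 = ?\<psi> q"
        by (rule eventually_mono[OF eventually_nhds_in_open[OF U]]) (rule eq)
      from isCont_cong[OF this] show ?thesis by simp
    qed
  next
    case 2
    have nz: "z \<notin> \<real>\<^sub>\<ge>\<^sub>0" "w \<notin> \<real>\<^sub>\<ge>\<^sub>0"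
      using 2 \<open>p \<in> _\<close> unfolding p by (auto simp: nonneg_Reals_def)
    have A: "isCont (\<lambda>p. Arg2pi (fst p)) p" "isCont (\<lambda>p. Arg2pi (snd p)) p"
      by (rule isCont_o2[where g = Arg2pi], (intro continuous_intros), (simp add: p continuous_at_Arg2pi nz))+
    have "isCont \<phi> q" for q using assms continuous_on_eq_continuous_at[OF open_UNIV, of \<phi>] by blast
    then have "isCont (\<lambda>p. \<phi> (Arg2pi (fst p), Arg2pi (snd p))) p"
      by (rule isCont_o2[where g = \<phi> and f = "\<lambda>p. (Arg2pi (fst p), Arg2pi (snd p))", OF isCont_Pair[OF A(1) A(2)]])
    then show ?thesis
      unfolding cutoff_def
      by (intro continuous_intros bounded_linear.isCont[OF bounded_linear_Re]
            bounded_linear.isCont[OF bounded_linear_fst] bounded_linear.isCont[OF bounded_linear_snd])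
  qed
qed

lemma cutoff_bounds: "0 \<le> cutoff n z" "cutoff n z \<le> 1"
  by (auto simp: cutoff_def)

lemma cutoff_tendsto:
  assumes "0 < x" "x < 2 * pi"
  shows "(\<lambda>n. cutoff n (cis x)) \<longlonglongrightarrow> 1"
proof -
  have "cos x \<noteq> 1"
  proof
    assume "cos x = 1"
    then obtain m :: int where m: "x = of_int m * (2 * pi)" unfolding cos_one_2pi_int by (auto simp: mult.assoc)
    then have "0 < m" using assms(1) by (simp add: zero_less_mult_iff)
    then have "1 * (2 * pi) \<le> of_int m * (2 * pi)" by (intro mult_right_mono) auto
    with m assms(2) show False by simp
  qed
  then have c: "0 < 1 - cos x" using cos_le_one[of x] by linarith
  obtain N :: nat where N: "2 / (1 - cos x) \<le> real N" using real_arch_simple by blast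
  have "\<forall>\<^sub>F n in sequentially. cutoff n (cis x) = 1"
    using eventually_ge_at_top[of N]
  proof eventually_elim
    case (elim n)
    have "2 \<le> real N * (1 - cos x)" using N c by (simp add: field_simps)
    also have "\<dots> \<le> real n * (1 - cos x)" using elim c by (intro mult_right_mono) auto
    finally show ?case by (simp add: cutoff_def)
  qed
  then show ?thesis by (rule tendsto_eventually)
qed

text \<open>A measurable function is an almost everywhere limit of continuous ones. These are
  clipped, cut off near the boundary of the square and replaced by uniformly close trigonometric
  polynomials; boundedness by \<open>K + 1\<close> then permits dominated convergence.\<close>

lemma Lp_bounded_approx:
  assumes f: "f \<in> borel_measurable lebesgue" and bd: "\<And>z. norm (f z) \<le> K" and K: "0 < K" and p: "0 < p"
  shows "\<exists>T. (\<forall>n::nat. is_trig_poly (T n)) \<and> (\<lambda>n. \<integral>z. norm (f z - T n z) powr p \<partial>T2) \<longlonglongrightarrow> 0"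
proof -
  have "f measurable_on UNIV"
    using f measurable_on_iff_borel_measurable[of UNIV f] by simp
  then obtain N g where N: "negligible N" and g: "\<And>n. continuous_on UNIV (g n)"
    and lim: "\<And>z. z \<notin> N \<Longrightarrow> (\<lambda>n. g n z) \<longlonglongrightarrow> f z"
    unfolding measurable_on_def by auto
  \<comment> \<open>The radial retraction onto the disc of radius \<open>K\<close>. It fixes the
    values of \<open>f\<close> and bounds the continuous approximants without destroying their
    convergence.\<close>
  define clip where "clip = (\<lambda>w::complex. (K / max K (norm w)) *\<^sub>R w)"
  have clip_cont: "continuous_on S clip" for S
    unfolding clip_def using K by (intro continuous_intros) (auto simp: max_def)
  have clip_le: "norm (clip w) \<le> K" for w
    using K by (auto simp: clip_def max_def field_simps)
  have clip_f: "clip (f z) = f z" for z using K bd[of z] by (auto simp: clip_def max_def)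
  define \<psi> where "\<psi> = (\<lambda>n p. (cutoff n (fst p) * cutoff n (snd p)) *\<^sub>R clip (g n (Arg2pi (fst p), Arg2pi (snd p))))"
  have \<psi>_cont: "continuous_on (sphere 0 1 \<times> sphere 0 1) (\<psi> n)" for n
    unfolding \<psi>_def by (rule continuous_on_torus_cutoff) (rule continuous_on_compose2[OF clip_cont g], auto)
  have "\<exists>T. is_trig_poly T \<and> (\<forall>x y. norm (\<psi> n (cis x, cis y) - T (x, y)) < 1 / (real n + 1))" for n
  proof -
    have "0 < 1 / (real n + 1)" by simp
    then obtain A a where "finite A" "\<And>x y. norm (\<psi> n (cis x, cis y) - trig_poly A a (x, y)) < 1 / (real n + 1)"
      using trig_poly_uniform_approx[OF \<psi>_cont[of n]] by blast
    then show ?thesis using is_trig_poly_trig_poly by blast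
  qed
  then obtain T where T: "\<And>n. is_trig_poly (T n)" "\<And>n x y. norm (\<psi> n (cis x, cis y) - T n (x, y)) < 1 / (real n + 1)"
    by metis
  have T_lim: "(\<lambda>n. T n z) \<longlonglongrightarrow> f z" if z: "z \<notin> N" "0 < fst z" "fst z < 2*pi" "0 < snd z" "snd z < 2*pi" for z
  proof -
    have "Arg2pi (cis (fst z)) = fst z" "Arg2pi (cis (snd z)) = snd z"
      using z by (auto intro!: Arg2pi_unique[of 1] simp: cis_conv_exp)
    then have "\<psi> n (cis (fst z), cis (snd z)) = (cutoff n (cis (fst z)) * cutoff n (cis (snd z))) *\<^sub>R clip (g n z)" for n
      by (simp add: \<psi>_def)
    moreover have "(\<lambda>n. (cutoff n (cis (fst z)) * cutoff n (cis (snd z))) *\<^sub>R clip (g n z)) \<longlonglongrightarrow> (1 * 1) *\<^sub>R clip (f z)"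
      using clip_cont[of UNIV] z
      by (intro tendsto_intros cutoff_tendsto isCont_tendsto_compose[OF _ lim]) (auto simp: continuous_on_eq_continuous_at)
    ultimately have 1: "(\<lambda>n. \<psi> n (cis (fst z), cis (snd z))) \<longlonglongrightarrow> f z" by (simp add: clip_f)
    have "(\<lambda>n. \<psi> n (cis (fst z), cis (snd z)) - T n z) \<longlonglongrightarrow> 0"
    proof (rule Lim_null_comparison)
      show "(\<lambda>n. 1 / (real n + 1)) \<longlonglongrightarrow> 0"
        using LIMSEQ_inverse_real_of_nat by (simp add: inverse_eq_divide add.commute)
      show "\<forall>\<^sub>F n in sequentially. norm (\<psi> n (cis (fst z), cis (snd z)) - T n z) \<le> 1 / (real n + 1)"
        using T(2)[of _ "fst z" "snd z"] by (auto intro!: always_eventually less_imp_le)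
    qed
    from tendsto_diff[OF 1 this] show ?thesis by simp
  qed
  have T_bd: "norm (T n z) \<le> K + 1" for n z
  proof -
    have "norm (\<psi> n (cis (fst z), cis (snd z))) \<le> 1 * K"
      unfolding \<psi>_def norm_scaleR
      by (intro mult_mono clip_le) (auto simp: cutoff_bounds abs_mult intro!: mult_le_one)
    moreover have "norm (\<psi> n (cis (fst z), cis (snd z)) - T n z) \<le> 1"
    proof -
      have "norm (\<psi> n (cis (fst z), cis (snd z)) - T n z) < 1 / (real n + 1)"
        using T(2)[of n "fst z" "snd z"] by simp
      also have "\<dots> \<le> 1" by simp
      finally show ?thesis by simp
    qed
    ultimately show ?thesis using norm_triangle_sub[of "T n z" "\<psi> n (cis (fst z), cis (snd z))"] by (simp add: norm_minus_commute)
  qed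
  interpret finite_measure T2 by (rule finite_measure_T2)
  have T_m: "T n \<in> borel_measurable T2" for n
    using T(1)[of n] trig_poly_Lp[of 1] by (auto simp: is_trig_poly_def intro!: borel_measurable_T2 Lp_measurable)
  have f_m: "f \<in> borel_measurable T2" by (rule borel_measurable_T2[OF f])
  have "(\<lambda>n. \<integral>z. norm (f z - T n z) powr p \<partial>T2) \<longlonglongrightarrow> (\<integral>z. 0 \<partial>T2)"
  proof (rule integral_dominated_convergence)
    show "integrable T2 (\<lambda>z. (2 * K + 1) powr p)" by simp
    show "AE z in T2. norm (norm (f z - T n z) powr p) \<le> (2 * K + 1) powr p" for n
    proof (rule AE_I2)
      fix z
      have "norm (f z - T n z) \<le> 2 * K + 1"
        using norm_triangle_ineq4[of "f z" "T n z"] bd[of z] T_bd[of n z] by linarith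
      then show "norm (norm (f z - T n z) powr p) \<le> (2 * K + 1) powr p"
        using p by (simp add: powr_mono2)
    qed
    have "AE z in lebesgue. z \<notin> N" using N by (simp add: negligible_iff_null_sets AE_not_in)
    moreover have "AE z in lebesgue. z \<in> closed_square \<longrightarrow> z \<in> box (0,0) (2*pi,2*pi)"
    proof -
      have "negligible (frontier (cbox (0,0) (2*pi,2*pi::real)))"
        by (rule negligible_convex_frontier) (rule convex_box)
      then have "AE z in lebesgue. z \<notin> frontier (cbox (0,0) (2*pi,2*pi::real))" by (simp add: negligible_iff_null_sets AE_not_in)
      then show ?thesis by eventually_elim (auto simp: frontier_cbox closed_square_eq)
    qed
    ultimately have "AE z in lebesgue. z \<in> closed_square \<longrightarrow> (\<lambda>n. norm (f z - T n z) powr p) \<longlonglongrightarrow> 0"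
    proof eventually_elim
      case (elim z)
      show ?case
      proof
        assume "z \<in> closed_square"
        with elim have "z \<in> box (0,0) (2*pi,2*pi)" by blast
        then have "(\<lambda>n. T n z) \<longlonglongrightarrow> f z" using elim(1) by (intro T_lim) (auto simp: box_def Basis_prod_def inner_prod_def)
        then have "(\<lambda>n. norm (f z - T n z)) \<longlonglongrightarrow> norm (f z - f z)" by (intro tendsto_intros)
        then show "(\<lambda>n. norm (f z - T n z) powr p) \<longlonglongrightarrow> 0"
          using p tendsto_powr'[of "\<lambda>n. norm (f z - T n z)" 0 sequentially "\<lambda>_. p" p] by simp
      qed
    qed
    then show "AE z in T2. (\<lambda>n. norm (f z - T n z) powr p) \<longlonglongrightarrow> 0"
      unfolding T2_def by (subst AE_restrict_space_iff) auto
  qed (use f_m T_m measurable_norm_powr[of "\<lambda>z. f z - T _ z"] in auto)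
  then show ?thesis using T(1) by auto
qed

text \<open>Half of the error is spent on truncating \<open>f\<close> at a height \<open>k\<close>,
  the other half on approximating the bounded truncation.\<close>

theorem trig_poly_dense:
  assumes f: "f \<in> Lp p" and p: "1 \<le> p" and e: "0 < e"
  obtains A a where "finite A" "Lp_norm p (\<lambda>z. f z - trig_poly A a z) < e"
proof -
  have small: "Lp_norm p h < e'" if "(\<integral>z. norm (h z) powr p \<partial>T2) < e' powr p" "0 < e'" for h e'
  proof -
    have "Lp_norm p h < (e' powr p) powr (1/p)"
      unfolding Lp_norm_def using that p by (intro powr_less_mono2) auto
    then show ?thesis using p that by (simp add: powr_powr)
  qed
  define g where "g = (\<lambda>k::nat. \<lambda>z. if norm (f z) \<le> real k then f z else 0)"
  have fm: "f \<in> borel_measurable lebesgue" using f by (rule Lp_measurable)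
  have gm: "g k \<in> borel_measurable lebesgue" for k
  proof -
    have "{z \<in> space lebesgue. norm (f z) \<le> real k} \<in> sets lebesgue" using fm by measurable
    then show ?thesis unfolding g_def using fm by (intro measurable_If) auto
  qed
  have diff_meas: "(\<lambda>z. norm (f z - g k z) powr p) \<in> borel_measurable T2" for k
    using borel_measurable_T2[OF gm[of k]] borel_measurable_T2[OF fm] by (intro measurable_norm_powr) measurable
  have "(\<lambda>k. \<integral>z. norm (f z - g k z) powr p \<partial>T2) \<longlonglongrightarrow> (\<integral>z. 0 \<partial>T2)"
  proof (rule integral_dominated_convergence[OF _ diff_meas Lp_integrable[OF f]])
    show "AE z in T2. norm (norm (f z - g k z) powr p) \<le> norm (f z) powr p" for k
      using p by (auto simp: g_def)
    show "AE z in T2. (\<lambda>k. norm (f z - g k z) powr p) \<longlonglongrightarrow> 0"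
    proof (rule AE_I2)
      fix z
      obtain N :: nat where N: "norm (f z) \<le> real N" using real_arch_simple by blast
      have "\<forall>\<^sub>F k in sequentially. norm (f z - g k z) powr p = 0"
        by (rule eventually_mono[OF eventually_ge_at_top[of N]]) (use N p in \<open>auto simp: g_def\<close>)
      then show "(\<lambda>k. norm (f z - g k z) powr p) \<longlonglongrightarrow> 0" by (rule tendsto_eventually)
    qed
  qed simp
  then have "\<forall>\<^sub>F k in sequentially. (\<integral>z. norm (f z - g k z) powr p \<partial>T2) < (e/2) powr p"
    using e by (intro order_tendstoD(2)[where y = 0]) auto
  then obtain k where "(\<integral>z. norm (f z - g k z) powr p \<partial>T2) < (e/2) powr p"
    by (auto simp: eventually_sequentially)
  then have k: "Lp_norm p (\<lambda>z. f z - g k z) < e / 2" using e by (intro small) auto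
  have "norm (g k z) \<le> real k + 1" for z by (auto simp: g_def)
  from Lp_bounded_approx[OF gm this, of p] p obtain T
    where T: "\<And>n::nat. is_trig_poly (T n)" "(\<lambda>n. \<integral>z. norm (g k z - T n z) powr p \<partial>T2) \<longlonglongrightarrow> 0" by auto
  have "\<forall>\<^sub>F n in sequentially. (\<integral>z. norm (g k z - T n z) powr p \<partial>T2) < (e/2) powr p"
    using e by (intro order_tendstoD(2)[OF T(2)]) auto
  then obtain n where "(\<integral>z. norm (g k z - T n z) powr p \<partial>T2) < (e/2) powr p"
    by (auto simp: eventually_sequentially)
  then have n: "Lp_norm p (\<lambda>z. g k z - T n z) < e / 2" using e by (intro small) auto
  obtain A a where A: "finite A" "T n = trig_poly A a" using T(1) unfolding is_trig_poly_def by blast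
  have gL: "g k \<in> Lp p"
  proof -
    have "integrable T2 (\<lambda>z. norm (g k z) powr p)"
      by (rule Bochner_Integration.integrable_bound[OF Lp_integrable[OF f]])
         (use measurable_norm_powr[OF borel_measurable_T2[OF gm]] in \<open>auto simp: g_def\<close>)
    then show ?thesis using gm Lp_periodic[OF f] by (auto simp: Lp_def periodic2_def g_def)
  qed
  have TL: "T n \<in> Lp p" using A p by (simp add: trig_poly_Lp)
  have "Lp_norm p (\<lambda>z. f z - T n z) \<le> Lp_norm p (\<lambda>z. f z - g k z) + Lp_norm p (\<lambda>z. g k z - T n z)"
    using Lp_norm_triangle[OF Lp_diff[OF f gL] Lp_diff[OF gL TL] p] p by simp
  also have "\<dots> < e" using k n by simp
  finally show ?thesis using that A by simp
qed

section \<open>Fourier multipliers\<close>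

text \<open>The operator norm is tested on trigonometric polynomials only, so no operator on the
  whole space has to be constructed. The bound \<open>C\<close> is a parameter because uniformity of
  constants in the steps is the point of all later estimates.\<close>

definition multiplier :: "real \<Rightarrow> real \<Rightarrow> (int \<times> int \<Rightarrow> complex) \<Rightarrow> bool" where
  "multiplier p C m \<longleftrightarrow> 0 \<le> C \<and>
    (\<forall>A a. finite A \<longrightarrow> Lp_norm p (trig_poly A (\<lambda>k. m k * a k)) \<le> C * Lp_norm p (trig_poly A a))"

lemma multiplierI:
  assumes "0 \<le> C" "\<And>A a. finite A \<Longrightarrow> Lp_norm p (trig_poly A (\<lambda>k. m k * a k)) \<le> C * Lp_norm p (trig_poly A a)"
  shows "multiplier p C m"
  using assms unfolding multiplier_def by blast

lemma multiplierD: "multiplier p C m \<Longrightarrow> finite A \<Longrightarrow> Lp_norm p (trig_poly A (\<lambda>k. m k * a k)) \<le> C * Lp_norm p (trig_poly A a)"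
  unfolding multiplier_def by blast

lemma multiplier_nonneg: "multiplier p C m \<Longrightarrow> 0 \<le> C"
  unfolding multiplier_def by blast

lemma multiplier_mono: "multiplier p C m \<Longrightarrow> C \<le> C' \<Longrightarrow> multiplier p C' m"
  unfolding multiplier_def by (meson Lp_norm_nonneg mult_right_mono order_trans)

lemma multiplier_prod:
  assumes "multiplier p C m" "multiplier p C' m'"
  shows "multiplier p (C * C') (\<lambda>k. m k * m' k)"
proof (rule multiplierI)
  fix A :: "(int \<times> int) set" and a :: "int \<times> int \<Rightarrow> complex" assume A: "finite A"
  have "Lp_norm p (trig_poly A (\<lambda>k. m k * (m' k * a k))) \<le> C * Lp_norm p (trig_poly A (\<lambda>k. m' k * a k))"
    by (rule multiplierD[OF assms(1) A])
  also have "\<dots> \<le> C * (C' * Lp_norm p (trig_poly A a))"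
    by (intro mult_left_mono multiplierD[OF assms(2) A] multiplier_nonneg[OF assms(1)])
  finally show "Lp_norm p (trig_poly A (\<lambda>k. m k * m' k * a k)) \<le> C * C' * Lp_norm p (trig_poly A a)"
    by (simp add: mult.assoc)
qed (use assms multiplier_nonneg in auto)

lemma multiplier_const:
  assumes "0 < p"
  shows "multiplier p (norm c) (\<lambda>k. c)"
proof (rule multiplierI)
  fix A :: "(int \<times> int) set" and a :: "int \<times> int \<Rightarrow> complex" assume A: "finite A"
  have "trig_poly A (\<lambda>k. c * a k) = (\<lambda>z. c * trig_poly A a z)" by (simp add: fun_eq_iff trig_poly_cmult)
  then show "Lp_norm p (trig_poly A (\<lambda>k. c * a k)) \<le> norm c * Lp_norm p (trig_poly A a)"
    using Lp_norm_cmult[OF assms] by simp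
qed simp

lemma Lp_norm_trig_poly_add:
  assumes "1 \<le> p"
  shows "Lp_norm p (trig_poly A (\<lambda>k. a k + b k)) \<le> Lp_norm p (trig_poly A a) + Lp_norm p (trig_poly A b)"
proof -
  have "trig_poly A (\<lambda>k. a k + b k) = (\<lambda>z. trig_poly A a z + trig_poly A b z)" by (simp add: fun_eq_iff trig_poly_add)
  then show ?thesis using Lp_norm_triangle[OF trig_poly_Lp trig_poly_Lp assms] assms by simp
qed

lemma multiplier_add:
  assumes p: "1 \<le> p" and "multiplier p C m" "multiplier p C' m'"
  shows "multiplier p (C + C') (\<lambda>k. m k + m' k)"
proof (rule multiplierI)
  fix A :: "(int \<times> int) set" and a :: "int \<times> int \<Rightarrow> complex" assume A: "finite A"
  have "Lp_norm p (trig_poly A (\<lambda>k. (m k + m' k) * a k)) \<le> Lp_norm p (trig_poly A (\<lambda>k. m k * a k)) + Lp_norm p (trig_poly A (\<lambda>k. m' k * a k))"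
    using Lp_norm_trig_poly_add[OF p] by (simp add: distrib_right)
  also have "\<dots> \<le> (C + C') * Lp_norm p (trig_poly A a)"
    using multiplierD[OF assms(2) A, of a] multiplierD[OF assms(3) A, of a] by (simp add: distrib_right)
  finally show "Lp_norm p (trig_poly A (\<lambda>k. (m k + m' k) * a k)) \<le> (C + C') * Lp_norm p (trig_poly A a)" .
qed (use assms multiplier_nonneg in auto)

lemma multiplier_cmult: "0 < p \<Longrightarrow> multiplier p C m \<Longrightarrow> multiplier p (norm c * C) (\<lambda>k. c * m k)"
  using multiplier_prod[OF multiplier_const] by blast

lemma multiplier_diff:
  assumes p: "1 \<le> p" and "multiplier p C m" "multiplier p C' m'"
  shows "multiplier p (C + C') (\<lambda>k. m k - m' k)"
  using multiplier_add[OF p assms(2) multiplier_cmult[OF _ assms(3), of "-1"]] p by simp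

lemma Lp_norm_trig_poly_sum:
  assumes p: "1 \<le> p" and "finite I"
  shows "Lp_norm p (trig_poly A (\<lambda>k. \<Sum>i\<in>I. a i k)) \<le> (\<Sum>i\<in>I. Lp_norm p (trig_poly A (a i)))"
  using assms(2)
proof (induction I rule: finite_induct)
  case empty
  have "trig_poly A (\<lambda>k. 0) = (\<lambda>z. 0)" by (simp add: trig_poly_def fun_eq_iff)
  then show ?case using p by (simp add: Lp_norm_def)
next
  case (insert i I)
  then show ?case using Lp_norm_trig_poly_add[OF p, of A "a i" "\<lambda>k. \<Sum>i\<in>I. a i k"] by simp
qed

lemma Lp_norm_trig_poly_shift:
  assumes "0 < p"
  shows "Lp_norm p (trig_poly A (\<lambda>k. character k v * a k)) = Lp_norm p (trig_poly A a)"
proof -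
  have "trig_poly A (\<lambda>k. character k v * a k) = (\<lambda>z. trig_poly A a (z + v))" by (simp add: fun_eq_iff trig_poly_shift)
  then show ?thesis using Lp_shift(2)[OF trig_poly_Lp[OF assms]] by simp
qed

text \<open>Multiplication by \<open>character k v\<close> is translation by \<open>v\<close>, an
  isometry, so total mass bounds the multiplier norm. The representing sum may vary with the finite
  set \<open>A\<close>; this leaves room for discretised convolution kernels whose number of nodes
  depends on \<open>A\<close>.\<close>

lemma multiplier_combination:
  assumes p: "1 \<le> p" and C: "0 \<le> C"
    and comb: "\<And>A :: (int \<times> int) set. finite A \<Longrightarrow> \<exists>(I :: 'i set) c v. finite I \<and> (\<Sum>i\<in>I. norm (c i)) \<le> C \<and>
       (\<forall>k\<in>A. m k = (\<Sum>i\<in>I. c i * character k (v i)))"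
  shows "multiplier p C m"
proof (rule multiplierI[OF C])
  fix A :: "(int \<times> int) set" and a :: "int \<times> int \<Rightarrow> complex" assume A: "finite A"
  obtain I :: "'i set" and c v where I: "finite I" "(\<Sum>i\<in>I. norm (c i)) \<le> C" "\<And>k. k \<in> A \<Longrightarrow> m k = (\<Sum>i\<in>I. c i * character k (v i))"
    using comb[OF A] by blast
  have "trig_poly A (\<lambda>k. m k * a k) = trig_poly A (\<lambda>k. \<Sum>i\<in>I. c i * (character k (v i) * a k))"
    by (rule trig_poly_cong) (simp add: I(3) sum_distrib_right mult.assoc)
  then have "Lp_norm p (trig_poly A (\<lambda>k. m k * a k)) \<le> (\<Sum>i\<in>I. Lp_norm p (trig_poly A (\<lambda>k. c i * (character k (v i) * a k))))"
    using Lp_norm_trig_poly_sum[OF p I(1)] by simp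
  also have "\<dots> \<le> (\<Sum>i\<in>I. norm (c i) * Lp_norm p (trig_poly A a))"
  proof (rule sum_mono)
    fix i
    have "Lp_norm p (trig_poly A (\<lambda>k. c i * (character k (v i) * a k))) \<le> norm (c i) * Lp_norm p (trig_poly A (\<lambda>k. character k (v i) * a k))"
      using multiplierD[OF multiplier_const A, of p "c i"] p by simp
    then show "Lp_norm p (trig_poly A (\<lambda>k. c i * (character k (v i) * a k))) \<le> norm (c i) * Lp_norm p (trig_poly A a)"
      using p by (simp add: Lp_norm_trig_poly_shift)
  qed
  also have "\<dots> \<le> C * Lp_norm p (trig_poly A a)"
    using I(2) by (simp add: sum_distrib_right[symmetric] mult_right_mono)
  finally show "Lp_norm p (trig_poly A (\<lambda>k. m k * a k)) \<le> C * Lp_norm p (trig_poly A a)" .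
qed

lemma multiplier_character: "1 \<le> p \<Longrightarrow> multiplier p 1 (\<lambda>k. character k v)"
  by (rule multiplier_combination[where 'i = unit]) (auto intro!: exI[of _ "{()}"] exI[of _ "\<lambda>_. 1"] exI[of _ "\<lambda>_. v"])

definition Lp_norm_one :: "real \<Rightarrow> real" where
  "Lp_norm_one p = Lp_norm p (\<lambda>_. 1)"

lemma Lp_norm_trig_poly_le:
  assumes p: "1 \<le> p" and A: "finite A"
  shows "Lp_norm p (trig_poly A a) \<le> (\<Sum>k\<in>A. norm (a k)) * Lp_norm_one p"
proof -
  have "Lp_norm p (trig_poly A a) = Lp_norm p (trig_poly A (\<lambda>k. \<Sum>l\<in>A. if k = l then a l else 0))"
    using A by (intro arg_cong[where f = "Lp_norm p"] trig_poly_cong) (simp add: sum.delta')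
  also have "\<dots> \<le> (\<Sum>l\<in>A. Lp_norm p (trig_poly A (\<lambda>k. if k = l then a l else 0)))"
    by (rule Lp_norm_trig_poly_sum[OF p A])
  also have "\<dots> = (\<Sum>l\<in>A. norm (a l) * Lp_norm_one p)"
  proof (rule sum.cong[OF refl])
    fix l assume "l \<in> A"
    then have "trig_poly A (\<lambda>k. if k = l then a l else 0) = (\<lambda>z. a l * character l z)"
      using A by (simp add: trig_poly_def fun_eq_iff if_distrib[of "\<lambda>x. x * _"] sum.delta' cong: if_cong)
    moreover have "Lp_norm p (character l) = Lp_norm_one p" by (simp add: Lp_norm_def Lp_norm_one_def)
    ultimately show "Lp_norm p (trig_poly A (\<lambda>k. if k = l then a l else 0)) = norm (a l) * Lp_norm_one p"
      using Lp_norm_cmult[of p "a l" "character l"] p by simp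
  qed
  finally show ?thesis by (simp add: sum_distrib_right)
qed

lemma Lp_norm_trig_poly_perturb:
  assumes p: "1 \<le> p" and A: "finite A"
  shows "Lp_norm p (trig_poly A a) \<le> Lp_norm p (trig_poly A b) + (\<Sum>k\<in>A. norm (a k - b k)) * Lp_norm_one p"
  using Lp_norm_trig_poly_add[OF p, of A b "\<lambda>k. a k - b k"] Lp_norm_trig_poly_le[OF p A, of "\<lambda>k. a k - b k"] by simp

text \<open>On a fixed finite set of frequencies the norm depends continuously on the coefficients,
  so convergence of each coefficient suffices.\<close>

lemma Lp_norm_trig_poly_limit:
  assumes p: "1 \<le> p" and A: "finite A" and lim: "\<And>k. k \<in> A \<Longrightarrow> (\<lambda>n. b n k) \<longlonglongrightarrow> a k"
    and bd: "\<forall>\<^sub>F n in sequentially. Lp_norm p (trig_poly A (b n)) \<le> W n" and W: "W \<longlonglongrightarrow> w"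
  shows "Lp_norm p (trig_poly A a) \<le> w"
proof (rule tendsto_lowerbound)
  have "(\<lambda>n. W n + (\<Sum>k\<in>A. norm (a k - b n k)) * Lp_norm_one p) \<longlonglongrightarrow> w + (\<Sum>k\<in>A. norm (a k - a k)) * Lp_norm_one p"
    by (intro tendsto_intros W lim)
  then show "(\<lambda>n. W n + (\<Sum>k\<in>A. norm (a k - b n k)) * Lp_norm_one p) \<longlonglongrightarrow> w" by simp
  show "\<forall>\<^sub>F n in sequentially. Lp_norm p (trig_poly A a) \<le> W n + (\<Sum>k\<in>A. norm (a k - b n k)) * Lp_norm_one p"
    using bd
  proof eventually_elim
    case (elim n)
    then show ?case using Lp_norm_trig_poly_perturb[OF p A, of a "b n"] by linarith
  qed
qed simp

lemma multiplier_limit: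
  assumes p: "1 \<le> p" and m: "\<And>n::nat. multiplier p C (m n)" and lim: "\<And>k. (\<lambda>n. m n k) \<longlonglongrightarrow> m' k"
  shows "multiplier p C m'"
proof (rule multiplierI)
  show "0 \<le> C" using m multiplier_nonneg by blast
  fix A :: "(int \<times> int) set" and a :: "int \<times> int \<Rightarrow> complex" assume A: "finite A"
  show "Lp_norm p (trig_poly A (\<lambda>k. m' k * a k)) \<le> C * Lp_norm p (trig_poly A a)"
    by (rule Lp_norm_trig_poly_limit[OF p A, where b = "\<lambda>n k. m n k * a k" and W = "\<lambda>_. C * Lp_norm p (trig_poly A a)"])
       (auto intro!: tendsto_intros lim always_eventually multiplierD[OF m A])
qed

lemma multiplier_series:
  assumes p: "1 \<le> p" and c: "summable (\<lambda>\<nu>. norm (c \<nu> :: complex))"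
    and m: "\<And>k. (\<lambda>\<nu>. c \<nu> * character k (v \<nu>)) sums m k"
  shows "multiplier p (\<Sum>\<nu>. norm (c \<nu>)) m"
proof (rule multiplier_limit[OF p])
  show "multiplier p (\<Sum>\<nu>. norm (c \<nu>)) (\<lambda>k. \<Sum>\<nu><n. c \<nu> * character k (v \<nu>))" for n
    using sum_le_suminf[OF c, of "{..<n}"]
    by (intro multiplier_combination[OF p suminf_nonneg[OF c]]) (auto intro!: exI[of _ "{..<n}"] exI[of _ c] exI[of _ v])
  show "(\<lambda>n. \<Sum>\<nu><n. c \<nu> * character k (v \<nu>)) \<longlonglongrightarrow> m k" for k
    using m[of k] by (simp add: sums_def)
qed

lemma Lp_norm_trig_poly_swap:
  assumes p: "0 < p"
  shows "Lp_norm p (\<lambda>z. trig_poly A a (prod.swap z)) = Lp_norm p (trig_poly A a)"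
proof -
  define f where "f = (\<lambda>z. norm (trig_poly A a z) powr p)"
  have c: "continuous_on UNIV f" unfolding f_def
    using p by (intro continuous_on_powr' continuous_intros continuous_trig_poly) auto
  have c': "continuous_on UNIV (\<lambda>z. f (prod.swap z))"
    by (rule continuous_on_compose2[OF c]) (auto intro!: continuous_intros simp: prod.swap_def)
  have "(\<integral>z. f (prod.swap z) \<partial>T2) = (\<integral>z. f z \<partial>T2)"
    using integral_swap_continuous[of 0 0 "2*pi" "2*pi" "\<lambda>x y. f (x, y)"] continuous_on_subset[OF c]
    by (simp add: integral_T2_continuous(2)[OF c] integral_T2_continuous(2)[OF c'])
  then show ?thesis by (simp add: Lp_norm_def f_def)
qed

lemma trig_poly_image:
  assumes "inj_on h A"
  shows "trig_poly (h ` A) b z = (\<Sum>k\<in>A. b (h k) * character (h k) z)"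
  unfolding trig_poly_def using assms by (simp add: sum.reindex)

text \<open>Exchanging the variables preserves the norm. Every result proved for the first frequency
  thereby becomes available for the second.\<close>

lemma multiplier_swap:
  assumes m: "multiplier p C m" and p: "0 < p"
  shows "multiplier p C (\<lambda>k. m (prod.swap k))"
proof (rule multiplierI[OF multiplier_nonneg[OF m]])
  fix A :: "(int \<times> int) set" and a :: "int \<times> int \<Rightarrow> complex" assume A: "finite A"
  have eq: "trig_poly A a = (\<lambda>z. trig_poly (prod.swap ` A) (\<lambda>k. a (prod.swap k)) (prod.swap z))" for a
    by (subst trig_poly_image) (auto simp: trig_poly_def character_def fun_eq_iff add.commute)
  have "trig_poly A (\<lambda>k. m (prod.swap k) * a k) = (\<lambda>z. trig_poly (prod.swap ` A) (\<lambda>k. m k * a (prod.swap k)) (prod.swap z))"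
    by (subst eq) simp
  then show "Lp_norm p (trig_poly A (\<lambda>k. m (prod.swap k) * a k)) \<le> C * Lp_norm p (trig_poly A a)"
    using multiplierD[OF m finite_imageI[OF A], of prod.swap "\<lambda>k. a (prod.swap k)"] Lp_norm_trig_poly_swap[OF p]
    by (simp add: eq[of a])
qed

lemma Lp_norm_character_mult: "Lp_norm p (\<lambda>z. character l z * f z) = Lp_norm p f"
  by (simp add: Lp_norm_def norm_mult)

text \<open>Multiplying a function by a character leaves its modulus unchanged and shifts all
  frequencies. This is what makes the bounds for half-lines independent of the endpoint.\<close>

lemma multiplier_modulate:
  assumes m: "multiplier p C m"
  shows "multiplier p C (\<lambda>k. m (k + l))"
proof (rule multiplierI[OF multiplier_nonneg[OF m]])
  fix A :: "(int \<times> int) set" and a :: "int \<times> int \<Rightarrow> complex" assume A: "finite A"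
  have eq: "trig_poly A a = (\<lambda>z. character (- l) z * trig_poly ((\<lambda>k. k + l) ` A) (\<lambda>k. a (k - l)) z)" for a
    by (subst trig_poly_image) (auto simp: trig_poly_def fun_eq_iff sum_distrib_left character_index_add[symmetric] mult.left_commute[of "character _ _"])
  have "trig_poly A (\<lambda>k. m (k + l) * a k) = (\<lambda>z. character (- l) z * trig_poly ((\<lambda>k. k + l) ` A) (\<lambda>k. m k * a (k - l)) z)"
    by (subst eq) simp
  then show "Lp_norm p (trig_poly A (\<lambda>k. m (k + l) * a k)) \<le> C * Lp_norm p (trig_poly A a)"
    using multiplierD[OF m finite_imageI[OF A], of "\<lambda>k. k + l" "\<lambda>k. a (k - l)"]
    by (simp add: eq[of a] Lp_norm_character_mult)
qed

text \<open>The triangular weight max 0 (1 - |n|/N), written as an autocorrelation count. In this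
  form its Fourier transform is visibly a squared modulus, which is how positivity of the Fejer
  kernel enters.\<close>

definition fejer :: "nat \<Rightarrow> int \<Rightarrow> real" where
  "fejer N n = real (card {(i, j). i < N \<and> j < N \<and> int i + n = int j}) / real N"

lemma sum_roots_of_unity:
  assumes "\<bar>m\<bar> < int Q"
  shows "(\<Sum>q<Q. cis (of_int m * (2 * pi * real q / real Q))) = (if m = 0 then of_nat Q else 0)"
proof (cases "m = 0")
  case False
  have Q: "0 < Q" using assms by auto
  define x where "x = cis (of_int m * (2 * pi / real Q))"
  have pow: "cis (of_int m * (2 * pi * real q / real Q)) = x ^ q" for q
    unfolding x_def Complex.DeMoivre by (simp add: mult_ac)
  have "x ^ Q = 1"
    unfolding x_def Complex.DeMoivre using Q cis_multiple_2pi[of "of_int m"] by (simp add: mult_ac)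
  moreover have "x \<noteq> 1"
  proof
    assume "x = 1"
    then have "cos (of_int m * (2 * pi / real Q)) = 1" by (simp add: x_def complex_eq_iff)
    then obtain l :: int where "of_int m * (2 * pi / real Q) = of_int l * 2 * pi" unfolding cos_one_2pi_int by blast
    then have "real_of_int m = real_of_int (l * int Q)" using Q by (simp add: field_simps)
    then have "m = l * int Q" by (simp only: of_int_eq_iff)
    then have "int Q dvd m" by simp
    with False assms show False using dvd_imp_le_int[of m "int Q"] by simp
  qed
  ultimately show ?thesis unfolding pow using False by (simp add: geometric_sum)
qed simp

text \<open>Convolution with the Fejer kernel, evaluated by a quadrature with Q equidistant nodes.
  It is exact because all frequencies i - j + n that occur are smaller than Q in absolute value, so
  the sum over roots of unity detects i - j + n = 0.\<close>

lemma fejer_eq_sum: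
  assumes Q: "\<bar>n\<bar> + int N < int Q" and N: "0 < N"
  shows "of_real (fejer N n) = (\<Sum>q<Q. of_real ((norm (\<Sum>j<N. cis (real j * (2 * pi * real q / real Q))))\<^sup>2 / (real N * real Q))
            * cis (of_int n * (2 * pi * real q / real Q)))"
proof -
  have Q0: "0 < Q" using assms by auto
  define t where "t = (\<lambda>q::nat. 2 * pi * real q / real Q)"
  have sq: "of_real ((norm (\<Sum>j<N. cis (real j * t q)))\<^sup>2) = (\<Sum>i<N. \<Sum>j<N. cis (of_int (int i - int j) * t q))" for q
    unfolding complex_norm_square
    by (simp add: sum_product cis_cnj cis_mult left_diff_distrib)
  have "(\<Sum>q<Q. of_real ((norm (\<Sum>j<N. cis (real j * t q)))\<^sup>2) * cis (of_int n * t q))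
      = (\<Sum>q<Q. \<Sum>i<N. \<Sum>j<N. cis (of_int (int i - int j + n) * t q))"
    unfolding sq sum_distrib_right by (simp add: cis_mult distrib_right)
  also have "\<dots> = (\<Sum>i<N. \<Sum>j<N. \<Sum>q<Q. cis (of_int (int i - int j + n) * t q))"
    by (subst sum.swap, rule sum.cong[OF refl], rule sum.swap)
  also have "\<dots> = (\<Sum>i<N. \<Sum>j<N. if int i - int j + n = 0 then of_nat Q else 0)"
    unfolding t_def using Q by (intro sum.cong refl sum_roots_of_unity) auto
  also have "\<dots> = (\<Sum>(i,j)\<in>{..<N}\<times>{..<N}. if int i - int j + n = 0 then of_nat Q else 0)"
    by (simp add: sum.cartesian_product)
  also have "\<dots> = (\<Sum>(i,j)\<in>{(i, j). i < N \<and> j < N \<and> int i + n = int j}. of_nat Q)"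
    by (rule sum.mono_neutral_cong_right) (auto split: if_splits)
  also have "\<dots> = of_nat (card {(i, j). i < N \<and> j < N \<and> int i + n = int j}) * of_nat Q"
    by simp
  finally have *: "(\<Sum>q<Q. of_real ((norm (\<Sum>j<N. cis (real j * t q)))\<^sup>2) * cis (of_int n * t q)) = \<dots>" .
  have "(\<Sum>q<Q. of_real ((norm (\<Sum>j<N. cis (real j * t q)))\<^sup>2 / (real N * real Q)) * cis (of_int n * t q))
     = (\<Sum>q<Q. of_real ((norm (\<Sum>j<N. cis (real j * t q)))\<^sup>2) * cis (of_int n * t q)) / (of_nat N * of_nat Q)"
    by (simp add: sum_divide_distrib)
  also have "\<dots> = of_real (fejer N n)" unfolding * fejer_def using Q0 N by simp
  finally show ?thesis unfolding t_def by simp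
qed

lemma fejer_0: "0 < N \<Longrightarrow> fejer N 0 = 1"
proof -
  assume "0 < N"
  have "{(i, j). i < N \<and> j < N \<and> int i + 0 = int j} = (\<lambda>i. (i, i)) ` {..<N}" by auto
  then have "card {(i, j). i < N \<and> j < N \<and> int i + 0 = int j} = N" by (simp add: card_image inj_on_def)
  then show ?thesis using \<open>0 < N\<close> by (simp add: fejer_def)
qed

lemma fejer_eq_0: "int N \<le> \<bar>n\<bar> \<Longrightarrow> fejer N n = 0"
proof -
  assume "int N \<le> \<bar>n\<bar>"
  then have "{(i, j). i < N \<and> j < N \<and> int i + n = int j} = {}" by auto
  then show ?thesis by (simp add: fejer_def del: Collect_empty_eq Collect_case_prod_Sigma)
qed

lemma fejer_1: "fejer 1 n = (if n = 0 then 1 else 0)"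
  using fejer_0[of 1] fejer_eq_0[of 1 n] by auto

lemma fejer_tendsto: "(\<lambda>N. fejer N n) \<longlonglongrightarrow> 1"
proof -
  define d where "d = nat \<bar>n\<bar>"
  have card: "card {(i, j). i < N \<and> j < N \<and> int i + n = int j} = N - d" for N
  proof (cases "0 \<le> n")
    case True
    then have "{(i, j). i < N \<and> j < N \<and> int i + n = int j} = (\<lambda>i. (i, i + d)) ` {..<N - d}"
      by (auto simp: d_def image_iff)
    then show ?thesis by (simp add: card_image inj_on_def)
  next
    case False
    then have "{(i, j). i < N \<and> j < N \<and> int i + n = int j} = (\<lambda>j. (j + d, j)) ` {..<N - d}"
      by (auto simp: d_def image_iff)
    then show ?thesis by (simp add: card_image inj_on_def)
  qed
  have "(\<lambda>N. 1 - real d / real N) \<longlonglongrightarrow> 1 - 0"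
    by (intro tendsto_intros lim_const_over_n)
  moreover have "\<forall>\<^sub>F N in sequentially. fejer N n = 1 - real d / real N"
    using eventually_ge_at_top[of "d + 1"]
    by eventually_elim (simp add: fejer_def card of_nat_diff diff_divide_distrib)
  ultimately show ?thesis by (simp add: tendsto_cong)
qed

text \<open>The quadrature weights are nonnegative and add up to \<open>fejer N 0 = 1\<close>, so
  Fejer means are averages of translates and have norm at most 1.\<close>

lemma multiplier_fejer:
  assumes p: "1 \<le> p" and N: "0 < N"
  shows "multiplier p 1 (\<lambda>k. of_real (fejer N (fst k)))"
proof (rule multiplier_combination[OF p, where 'i = nat])
  fix A :: "(int \<times> int) set" assume A: "finite A"
  \<comment> \<open>Large enough to make the quadrature exact at every frequency in
    \<open>A\<close>, and at frequency 0, which gives the sum of the weights.\<close>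
  define Q where "Q = nat (\<Sum>k\<in>A. \<bar>fst k\<bar>) + N + 1"
  define t where "t = (\<lambda>q::nat. 2 * pi * real q / real Q)"
  define w where "w = (\<lambda>q. (norm (\<Sum>j<N. cis (real j * t q)))\<^sup>2 / (real N * real Q))"
  have big: "\<bar>fst k\<bar> + int N < int Q" if "k \<in> A" for k
    using member_le_sum[OF that, of "\<lambda>k. \<bar>fst k\<bar>"] A by (simp add: Q_def sum_nonneg)
  have eq: "of_real (fejer N n) = (\<Sum>q<Q. of_real (w q) * cis (of_int n * t q))" if "\<bar>n\<bar> + int N < int Q" for n
    using fejer_eq_sum[OF that N] unfolding w_def t_def by simp
  have "complex_of_real 1 = (\<Sum>q<Q. of_real (w q) * cis (of_int 0 * t q))"
    using eq[of 0] N by (simp add: fejer_0 Q_def del: of_nat_add)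
  then have "complex_of_real 1 = of_real (\<Sum>q<Q. w q)" by simp
  then have "(\<Sum>q<Q. w q) = 1" by (simp only: of_real_eq_iff)
  moreover have "0 \<le> w q" for q by (simp add: w_def)
  ultimately have sum: "(\<Sum>q<Q. norm (complex_of_real (w q))) \<le> 1" by simp
  show "\<exists>(I :: nat set) c v. finite I \<and> (\<Sum>i\<in>I. norm (c i)) \<le> 1 \<and>
      (\<forall>k\<in>A. of_real (fejer N (fst k)) = (\<Sum>i\<in>I. c i * character k (v i)))"
    using sum eq big by (intro exI[of _ "{..<Q}"] exI[of _ "\<lambda>q. of_real (w q)"] exI[of _ "\<lambda>q. (t q, 0)"])
      (simp add: character_def)
qed simp

definition fejer2 :: "nat \<Rightarrow> int \<times> int \<Rightarrow> complex" where
  "fejer2 N k = of_real (fejer N (fst k)) * of_real (fejer N (snd k))"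

definition freq_box :: "nat \<Rightarrow> (int \<times> int) set" where
  "freq_box N = {- int N..int N} \<times> {- int N..int N}"

lemma finite_freq_box [simp]: "finite (freq_box N)"
  by (simp add: freq_box_def)

lemma fejer2_eq_0: "k \<notin> freq_box N \<Longrightarrow> fejer2 N k = 0"
  using fejer_eq_0[of N "fst k"] fejer_eq_0[of N "snd k"] by (cases k) (auto simp: fejer2_def freq_box_def)

lemma multiplier_fejer2: "1 \<le> p \<Longrightarrow> 0 < N \<Longrightarrow> multiplier p 1 (fejer2 N)"
  using multiplier_prod[OF multiplier_fejer[of p N] multiplier_swap[OF multiplier_fejer[of p N]]] by (simp add: fejer2_def[abs_def])

lemma fejer2_tendsto: "(\<lambda>N. fejer2 N k) \<longlonglongrightarrow> 1"
proof -
  have "(\<lambda>N. fejer2 N k) \<longlonglongrightarrow> of_real 1 * of_real 1"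
    unfolding fejer2_def by (intro tendsto_intros fejer_tendsto)
  then show ?thesis by simp
qed

text \<open>A multiplier bound on trigonometric polynomials extends to the Fejer means of any
  \<open>f \<in> Lp p\<close>, by density and continuity of the finitely many coefficients involved.\<close>

lemma multiplier_fejer_mean:
  assumes p: "1 \<le> p" and N: "0 < N" and m: "multiplier p C m" and f: "f \<in> Lp p"
  shows "Lp_norm p (trig_poly (freq_box N) (\<lambda>k. m k * (fejer2 N k * fcoeff f k))) \<le> C * Lp_norm p f"
proof -
  have "\<exists>A a. finite A \<and> Lp_norm p (\<lambda>z. f z - trig_poly A a z) < 1 / real (Suc n)" for n
    by (rule trig_poly_dense[OF f p, of "1 / real (Suc n)"]) auto
  then obtain A a where A: "\<And>n. finite (A n)" "\<And>n. Lp_norm p (\<lambda>z. f z - trig_poly (A n) (a n) z) < 1 / real (Suc n)"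
    by metis
  have L: "trig_poly (A n) (a n) \<in> Lp p" for n using p by (simp add: trig_poly_Lp)
  have conv: "(\<lambda>n. Lp_norm p (\<lambda>z. f z - trig_poly (A n) (a n) z)) \<longlonglongrightarrow> 0"
    by (rule tendsto_sandwich[of "\<lambda>_. 0" _ _ "\<lambda>n. 1 / real (Suc n)"])
       (use A(2) LIMSEQ_inverse_real_of_nat in \<open>auto intro!: always_eventually less_imp_le simp: inverse_eq_divide\<close>)
  show ?thesis
  proof (rule Lp_norm_trig_poly_limit[OF p finite_freq_box, where b = "\<lambda>n k. m k * (fejer2 N k * fcoeff (trig_poly (A n) (a n)) k)"])
    fix k
    have "(\<lambda>n. fcoeff f k - fcoeff (trig_poly (A n) (a n)) k) \<longlonglongrightarrow> 0"
    proof (rule Lim_null_comparison)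
      show "\<forall>\<^sub>F n in sequentially. norm (fcoeff f k - fcoeff (trig_poly (A n) (a n)) k) \<le> (1 + 1 / (4 * pi\<^sup>2)) * Lp_norm p (\<lambda>z. f z - trig_poly (A n) (a n) z)"
        using norm_fcoeff_le[OF Lp_diff[OF f L] p, of _ k] fcoeff_diff[OF f L p, of _ k] p by (auto intro!: always_eventually)
      show "(\<lambda>n. (1 + 1 / (4 * pi\<^sup>2)) * Lp_norm p (\<lambda>z. f z - trig_poly (A n) (a n) z)) \<longlonglongrightarrow> 0"
        using tendsto_mult_left[OF conv, of "1 + 1 / (4 * pi\<^sup>2)"] by simp
    qed
    from tendsto_diff[OF tendsto_const[of "fcoeff f k"] this]
    have "(\<lambda>n. fcoeff (trig_poly (A n) (a n)) k) \<longlonglongrightarrow> fcoeff f k" by simp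
    then show "(\<lambda>n. m k * (fejer2 N k * fcoeff (trig_poly (A n) (a n)) k)) \<longlonglongrightarrow> m k * (fejer2 N k * fcoeff f k)"
      by (intro tendsto_intros)
  next
    have "Lp_norm p (trig_poly (freq_box N) (\<lambda>k. m k * (fejer2 N k * fcoeff (trig_poly (A n) (a n)) k))) \<le> C * (Lp_norm p f + Lp_norm p (\<lambda>z. f z - trig_poly (A n) (a n) z))" for n
    proof -
      \<comment> \<open>The Fejer weight vanishes off the box and the Fourier coefficients vanish
        off \<open>A n\<close>, so the sum may be taken over either set. On \<open>A n\<close> the
        multiplier bound applies to the polynomial itself.\<close>
      have "trig_poly (freq_box N) (\<lambda>k. m k * (fejer2 N k * fcoeff (trig_poly (A n) (a n)) k))
          = trig_poly (freq_box N \<union> A n) (\<lambda>k. m k * (fejer2 N k * fcoeff (trig_poly (A n) (a n)) k))"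
        by (rule trig_poly_mono_neutral) (auto simp: A(1) fejer2_eq_0)
      also have "\<dots> = trig_poly (A n) (\<lambda>k. m k * (fejer2 N k * fcoeff (trig_poly (A n) (a n)) k))"
        by (rule trig_poly_mono_neutral[symmetric]) (auto simp: A(1) fcoeff_trig_poly)
      also have "\<dots> = trig_poly (A n) (\<lambda>k. m k * (fejer2 N k * a n k))"
        by (rule trig_poly_cong) (simp add: A(1) fcoeff_trig_poly)
      finally have "Lp_norm p (trig_poly (freq_box N) (\<lambda>k. m k * (fejer2 N k * fcoeff (trig_poly (A n) (a n)) k))) \<le> C * Lp_norm p (trig_poly (A n) (\<lambda>k. fejer2 N k * a n k))"
        using multiplierD[OF m A(1)] by simp
      also have "\<dots> \<le> C * (1 * Lp_norm p (trig_poly (A n) (a n)))"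
        by (intro mult_left_mono multiplierD[OF multiplier_fejer2[OF p N] A(1)] multiplier_nonneg[OF m])
      also have "\<dots> \<le> C * (Lp_norm p f + Lp_norm p (\<lambda>z. f z - trig_poly (A n) (a n) z))"
        using Lp_norm_triangle_diff[OF f Lp_diff[OF f L] p, of n] p by (intro mult_left_mono multiplier_nonneg[OF m]) simp
      finally show ?thesis .
    qed
    then show "\<forall>\<^sub>F n in sequentially. Lp_norm p (trig_poly (freq_box N) (\<lambda>k. m k * (fejer2 N k * fcoeff (trig_poly (A n) (a n)) k))) \<le> C * (Lp_norm p f + Lp_norm p (\<lambda>z. f z - trig_poly (A n) (a n) z))"
      by (intro always_eventually allI)
    show "(\<lambda>n. C * (Lp_norm p f + Lp_norm p (\<lambda>z. f z - trig_poly (A n) (a n) z))) \<longlonglongrightarrow> C * Lp_norm p f"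
      using tendsto_mult_left[OF tendsto_add[OF tendsto_const conv], of C "Lp_norm p f"] by simp
  qed
qed

definition fejer_mean :: "nat \<Rightarrow> (real \<times> real \<Rightarrow> complex) \<Rightarrow> real \<times> real \<Rightarrow> complex" where
  "fejer_mean N f = trig_poly (freq_box N) (\<lambda>k. fejer2 N k * fcoeff f k)"

text \<open>A three-term estimate: approximate f by a polynomial P; the means of P converge because
  only finitely many coefficients are involved; the means of f - P are controlled since Fejer means
  do not increase the norm.\<close>

theorem fejer_mean_tendsto:
  assumes p: "1 \<le> p" and f: "f \<in> Lp p"
  shows "(\<lambda>N. Lp_norm p (\<lambda>z. f z - fejer_mean N f z)) \<longlonglongrightarrow> 0"
proof (rule LIMSEQ_I)
  fix r :: real assume "0 < r"
  then obtain A a where A: "finite A" "Lp_norm p (\<lambda>z. f z - trig_poly A a z) < r / 3"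
    using trig_poly_dense[OF f p, of "r / 3"] by auto
  define P where "P = trig_poly A a"
  have P: "P \<in> Lp p" using p by (simp add: P_def trig_poly_Lp)
  have "(\<lambda>N. (\<Sum>k\<in>A. norm (a k - fejer2 N k * a k)) * Lp_norm_one p) \<longlonglongrightarrow> (\<Sum>k\<in>A. norm (a k - 1 * a k)) * Lp_norm_one p"
    by (intro tendsto_intros fejer2_tendsto)
  then have "\<forall>\<^sub>F N in sequentially. (\<Sum>k\<in>A. norm (a k - fejer2 N k * a k)) * Lp_norm_one p < r / 3"
    using \<open>0 < r\<close> by (intro order_tendstoD) auto
  then have "\<forall>\<^sub>F N in sequentially. Lp_norm p (\<lambda>z. f z - fejer_mean N f z) < r"
    using eventually_gt_at_top[of 0]
  proof eventually_elim
    case (elim N)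
    have "fejer_mean N P = trig_poly (freq_box N \<union> A) (\<lambda>k. fejer2 N k * fcoeff P k)"
      unfolding fejer_mean_def by (rule trig_poly_mono_neutral) (auto simp: A(1) fejer2_eq_0)
    also have "\<dots> = trig_poly A (\<lambda>k. fejer2 N k * fcoeff P k)"
      by (rule trig_poly_mono_neutral[symmetric]) (auto simp: A(1) fcoeff_trig_poly P_def)
    also have "\<dots> = trig_poly A (\<lambda>k. fejer2 N k * a k)"
      by (rule trig_poly_cong) (simp add: A(1) fcoeff_trig_poly P_def)
    finally have "(\<lambda>z. P z - fejer_mean N P z) = trig_poly A (\<lambda>k. a k - fejer2 N k * a k)"
      by (simp add: fun_eq_iff trig_poly_diff P_def)
    then have 1: "Lp_norm p (\<lambda>z. P z - fejer_mean N P z) < r / 3"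
      using Lp_norm_trig_poly_le[OF p A(1), of "\<lambda>k. a k - fejer2 N k * a k"] elim(1) by simp
    have FL: "fejer_mean N g \<in> Lp p" for g unfolding fejer_mean_def using p by (simp add: trig_poly_Lp)
    have "Lp_norm p (trig_poly (freq_box N) (\<lambda>k. 1 * (fejer2 N k * fcoeff (\<lambda>z. f z - P z) k))) \<le> norm (1::complex) * Lp_norm p (\<lambda>z. f z - P z)"
      using p elim(2) by (intro multiplier_fejer_mean multiplier_const Lp_diff f P) auto
    then have 2: "Lp_norm p (\<lambda>z. fejer_mean N f z - fejer_mean N P z) < r / 3"
      using A(2) fcoeff_diff[OF f P p] by (simp add: fejer_mean_def P_def[symmetric] trig_poly_diff[symmetric] right_diff_distrib)
    have "Lp_norm p (\<lambda>z. (f z - P z) + ((P z - fejer_mean N P z) - (fejer_mean N f z - fejer_mean N P z)))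
      \<le> Lp_norm p (\<lambda>z. f z - P z) + (Lp_norm p (\<lambda>z. P z - fejer_mean N P z) + Lp_norm p (\<lambda>z. fejer_mean N f z - fejer_mean N P z))"
      using p by (intro order_trans[OF Lp_norm_triangle] add_left_mono Lp_norm_triangle_diff Lp_diff f P FL) auto
    then show ?case using 1 2 A(2) by (simp add: P_def)
  qed
  then show "\<exists>no. \<forall>N\<ge>no. norm (Lp_norm p (\<lambda>z. f z - fejer_mean N f z) - 0) < r"
    by (simp add: eventually_sequentially)
qed

lemma Lp_norm_eq_0_AE:
  assumes f: "f \<in> Lp p" and p: "0 < p" and "Lp_norm p f = 0"
  shows "AE z in T2. f z = 0"
proof -
  have "(\<integral>z. norm (f z) powr p \<partial>T2) = 0" using assms(3) Lp_norm_powr[OF p, of f] p by simp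
  then have "AE z in T2. norm (f z) powr p = 0"
    using integral_nonneg_eq_0_iff_AE[OF Lp_integrable[OF f]] by simp
  then show ?thesis by eventually_elim simp
qed

text \<open>All Fejer means of the difference are zero, yet they converge to it.\<close>

theorem fcoeff_unique:
  assumes f: "f \<in> Lp 1" and g: "g \<in> Lp 1" and eq: "\<And>k. fcoeff f k = fcoeff g k"
  shows "AE z in T2. f z = g z"
proof -
  define h where "h = (\<lambda>z. f z - g z)"
  have h: "h \<in> Lp 1" unfolding h_def using f g by (intro Lp_diff) auto
  have "fejer_mean N h = (\<lambda>z. 0)" for N
    using fcoeff_diff[OF f g] eq by (simp add: fejer_mean_def h_def trig_poly_def fun_eq_iff)
  then have "(\<lambda>N::nat. Lp_norm 1 h) \<longlonglongrightarrow> 0"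
    using fejer_mean_tendsto[of 1 h] h by simp
  then have "Lp_norm 1 h = 0" by (simp add: LIMSEQ_const_iff)
  from Lp_norm_eq_0_AE[OF h _ this] show ?thesis by (simp add: h_def)
qed

section \<open>Multipliers of bounded variation\<close>

text \<open>For fixed x the polynomial is a one-variable polynomial in y, so the inequality on the
  circle can be integrated over x.\<close>

lemma multiplier_riesz_snd:
  assumes p: "1 < p"
  shows "\<exists>C. multiplier p C (\<lambda>k. of_int (1 + sgn (snd k)))"
proof -
  obtain C where C: "0 \<le> C" "\<And>A (a :: int \<Rightarrow> complex). finite A \<Longrightarrow>
    integral {0..2 * pi} (\<lambda>x. norm (\<Sum>n\<in>A. of_int (1 + sgn n) * a n * cis (of_int n * x)) powr p)
    \<le> C * integral {0..2 * pi} (\<lambda>x. norm (\<Sum>n\<in>A. a n * cis (of_int n * x)) powr p)"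
    using riesz_projection_circle[OF p] by blast
  have "multiplier p (C powr (1/p)) (\<lambda>k. of_int (1 + sgn (snd k)))"
  proof (rule multiplierI)
    fix A :: "(int \<times> int) set" and a :: "int \<times> int \<Rightarrow> complex" assume A: "finite A"
    \<comment> \<open>The coefficients of the slice at \<open>x\<close>: all frequencies with the
      same second component are collected.\<close>
    define b where "b = (\<lambda>x n. \<Sum>k | k \<in> A \<and> snd k = n. a k * cis (of_int (fst k) * x))"
    have slice: "trig_poly A (\<lambda>k. m (snd k) * a k) (x, y) = (\<Sum>n\<in>snd ` A. m n * b x n * cis (of_int n * y))"
      for m :: "int \<Rightarrow> complex" and x y
    proof -
      have "trig_poly A (\<lambda>k. m (snd k) * a k) (x, y) = (\<Sum>k\<in>A. m (snd k) * (a k * cis (of_int (fst k) * x)) * cis (of_int (snd k) * y))"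
        by (simp add: trig_poly_def character_def cis_mult[symmetric] mult.assoc)
      also have "\<dots> = (\<Sum>n\<in>snd ` A. \<Sum>k | k \<in> A \<and> snd k = n. m (snd k) * (a k * cis (of_int (fst k) * x)) * cis (of_int (snd k) * y))"
        by (rule sum.image_gen[OF A])
      also have "\<dots> = (\<Sum>n\<in>snd ` A. m n * b x n * cis (of_int n * y))"
        by (rule sum.cong[OF refl]) (simp add: b_def sum_distrib_left sum_distrib_right)
      finally show ?thesis .
    qed
    define F where "F = (\<lambda>a z. norm (trig_poly A a z) powr p)"
    have cF: "continuous_on S (F a)" for S a
      unfolding F_def using p by (intro continuous_on_powr' continuous_intros continuous_trig_poly) auto
    have int: "(\<lambda>x. integral {0..2*pi} (\<lambda>y. F a (x, y))) integrable_on {0..2*pi}" for a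
    proof -
      have "continuous_on ({0..2*pi} \<times> cbox 0 (2*pi)) (\<lambda>(x, y). F a (x, y))"
        using cF by (simp add: case_prod_unfold)
      from integral_continuous_on_param[OF this] show ?thesis
        by (intro integrable_continuous_real) simp
    qed
    have "(\<integral>z. F (\<lambda>k. of_int (1 + sgn (snd k)) * a k) z \<partial>T2)
        = integral {0..2*pi} (\<lambda>x. integral {0..2*pi} (\<lambda>y. F (\<lambda>k. of_int (1 + sgn (snd k)) * a k) (x, y)))"
      by (rule integral_T2_continuous(2)[OF cF])
    also have "\<dots> \<le> integral {0..2*pi} (\<lambda>x. C * integral {0..2*pi} (\<lambda>y. F a (x, y)))"
    proof (rule integral_le[OF int])
      show "(\<lambda>x. C * integral {0..2*pi} (\<lambda>y. F a (x, y))) integrable_on {0..2*pi}"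
        using integrable_on_cmult_left[OF int[of a], of C] by simp
      fix x
      show "integral {0..2*pi} (\<lambda>y. F (\<lambda>k. of_int (1 + sgn (snd k)) * a k) (x, y)) \<le> C * integral {0..2*pi} (\<lambda>y. F a (x, y))"
        unfolding F_def using C(2)[OF finite_imageI[OF A, of snd], of "b x"]
          slice[of "\<lambda>n. of_int (1 + sgn n)" x] slice[of "\<lambda>n. 1" x] by simp
    qed
    also have "\<dots> = C * (\<integral>z. F a z \<partial>T2)"
      by (simp add: integral_T2_continuous(2)[OF cF])
    finally have le: "(\<integral>z. F (\<lambda>k. of_int (1 + sgn (snd k)) * a k) z \<partial>T2) \<le> C * (\<integral>z. F a z \<partial>T2)" .
    show "Lp_norm p (trig_poly A (\<lambda>k. of_int (1 + sgn (snd k)) * a k)) \<le> C powr (1/p) * Lp_norm p (trig_poly A a)"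
    proof (rule Lp_norm_leI)
      show "(\<integral>z. norm (trig_poly A (\<lambda>k. of_int (1 + sgn (snd k)) * a k) z) powr p \<partial>T2) \<le> (C powr (1/p) * Lp_norm p (trig_poly A a)) powr p"
        using le p C(1) by (simp add: powr_mult powr_powr Lp_norm_powr F_def)
    qed (use p in auto)
  qed simp
  then show ?thesis ..
qed

text \<open>The indicator of n \<ge> 1 is half of 1 + sgn n minus the indicator of n = 0, and the
  latter is the Fejer weight for N = 1. Modulation moves the endpoint to any \<open>j\<close> with
  the same constant.\<close>

lemma multiplier_half_line:
  assumes p: "1 < p"
  obtains R where "\<And>j. multiplier p R (\<lambda>k. if j \<le> fst k then 1 else 0)"
proof -
  obtain C where C: "multiplier p C (\<lambda>k. of_int (1 + sgn (snd k)))" using multiplier_riesz_snd[OF p] by blast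
  define R where "R = norm (1/2 :: complex) * (C + 1)"
  have "multiplier p R (\<lambda>k. (1/2) * (of_int (1 + sgn (snd k)) - of_real (fejer 1 (snd k))))"
    unfolding R_def using p C multiplier_swap[OF multiplier_fejer[of p 1]]
    by (intro multiplier_cmult multiplier_diff) auto
  moreover have "(1/2) * (of_int (1 + sgn n) - of_real (fejer 1 n)) = (if 1 \<le> n then 1 else 0 :: complex)" for n
    using fejer_1[of n] by (auto simp: sgn_if)
  ultimately have "multiplier p R (\<lambda>k. if 1 \<le> snd k then 1 else 0)" by simp
  from multiplier_swap[OF this] p have fst: "multiplier p R (\<lambda>k. if 1 \<le> fst k then 1 else 0)" by simp
  have "multiplier p R (\<lambda>k. if j \<le> fst k then 1 else 0)" for j
    using multiplier_modulate[OF fst, of "(1 - j, 0)"] by simp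
  then show ?thesis by (rule that)
qed

text \<open>Abel summation writes a multiplier of bounded variation as an absolutely convergent
  combination of the half-line indicators.\<close>

lemma multiplier_bounded_variation:
  assumes p: "1 \<le> p" and R: "\<And>j. multiplier p R (\<lambda>k. if j \<le> fst k then 1 else 0)"
    and B: "\<And>n. norm (w n :: complex) \<le> B"
    and V: "\<And>N::nat. (\<Sum>n\<in>{- int N..<int N}. norm (w (n + 1) - w n)) \<le> V"
  shows "multiplier p (B + V * R) (\<lambda>k. w (fst k))"
proof (rule multiplierI)
  have R0: "0 \<le> R" using R multiplier_nonneg by blast
  have "0 \<le> V" using V[of 0] by simp
  moreover have "0 \<le> B" using B[of 0] norm_ge_zero order_trans by blast
  ultimately show "0 \<le> B + V * R" using R0 by simp
  fix A :: "(int \<times> int) set" and a :: "int \<times> int \<Rightarrow> complex" assume A: "finite A"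
  define N where "N = nat (\<Sum>k\<in>A. \<bar>fst k\<bar>)"
  have N: "\<bar>fst k\<bar> \<le> int N" if "k \<in> A" for k
    using member_le_sum[OF that, of "\<lambda>k. \<bar>fst k\<bar>"] A by (simp add: N_def sum_nonneg)
  have tele: "w (- int N + int i) = w (- int N) + (\<Sum>n\<in>{- int N..<- int N + int i}. w (n + 1) - w n)" for i
  proof (induction i)
    case (Suc i)
    have "{- int N..<- int N + int (Suc i)} = insert (- int N + int i) {- int N..<- int N + int i}" by auto
    then show ?case using Suc by (simp add: algebra_simps)
  qed simp
  \<comment> \<open>The telescoping sum from the left end up to n is extended to the whole range;
    the indicator of \<open>j + 1 \<le> n\<close> switches off the surplus increments.\<close>
  have eq: "w n = w (- int N) + (\<Sum>j\<in>{- int N..<int N}. (w (j + 1) - w j) * (if j + 1 \<le> n then 1 else 0))" if "\<bar>n\<bar> \<le> int N" for n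
  proof -
    have "w n = w (- int N) + (\<Sum>j\<in>{- int N..<n}. w (j + 1) - w j)"
    proof -
      have "- int N + int (nat (n + int N)) = n" using that by simp
      then show ?thesis using tele[of "nat (n + int N)"] by simp
    qed
    also have "(\<Sum>j\<in>{- int N..<n}. w (j + 1) - w j) = (\<Sum>j\<in>{- int N..<int N}. (w (j + 1) - w j) * (if j + 1 \<le> n then 1 else 0))"
      using that by (intro sum.mono_neutral_cong_left) auto
    finally show ?thesis .
  qed
  have "trig_poly A (\<lambda>k. w (fst k) * a k) = trig_poly A (\<lambda>k. w (- int N) * a k
      + (\<Sum>j\<in>{- int N..<int N}. (w (j + 1) - w j) * ((if j + 1 \<le> fst k then 1 else 0) * a k)))"
    by (rule trig_poly_cong) (subst eq, use N in \<open>auto simp: distrib_right sum_distrib_right mult.assoc\<close>)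
  then have "Lp_norm p (trig_poly A (\<lambda>k. w (fst k) * a k)) \<le> Lp_norm p (trig_poly A (\<lambda>k. w (- int N) * a k))
     + (\<Sum>j\<in>{- int N..<int N}. Lp_norm p (trig_poly A (\<lambda>k. (w (j + 1) - w j) * ((if j + 1 \<le> fst k then 1 else 0) * a k))))"
    by (simp only:) (rule order_trans[OF Lp_norm_trig_poly_add[OF p]], intro add_left_mono Lp_norm_trig_poly_sum[OF p], simp)
  also have "\<dots> \<le> B * Lp_norm p (trig_poly A a) + (\<Sum>j\<in>{- int N..<int N}. norm (w (j + 1) - w j) * (R * Lp_norm p (trig_poly A a)))"
  proof (intro add_mono sum_mono)
    show "Lp_norm p (trig_poly A (\<lambda>k. w (- int N) * a k)) \<le> B * Lp_norm p (trig_poly A a)"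
      using multiplierD[OF multiplier_mono[OF multiplier_const B] A] p by simp
    fix j
    have "Lp_norm p (trig_poly A (\<lambda>k. (w (j + 1) - w j) * ((if j + 1 \<le> fst k then 1 else 0) * a k)))
      \<le> norm (w (j + 1) - w j) * Lp_norm p (trig_poly A (\<lambda>k. (if j + 1 \<le> fst k then 1 else 0) * a k))"
      using multiplierD[OF multiplier_const A] p by simp
    also have "\<dots> \<le> norm (w (j + 1) - w j) * (R * Lp_norm p (trig_poly A a))"
      by (intro mult_left_mono multiplierD[OF R A]) simp
    finally show "Lp_norm p (trig_poly A (\<lambda>k. (w (j + 1) - w j) * ((if j + 1 \<le> fst k then 1 else 0) * a k)))
      \<le> norm (w (j + 1) - w j) * (R * Lp_norm p (trig_poly A a))" .
  qed
  also have "\<dots> \<le> B * Lp_norm p (trig_poly A a) + V * (R * Lp_norm p (trig_poly A a))"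
    using V[of N] R0 by (simp add: sum_distrib_right[symmetric] mult_right_mono)
  finally show "Lp_norm p (trig_poly A (\<lambda>k. w (fst k) * a k)) \<le> (B + V * R) * Lp_norm p (trig_poly A a)"
    by (simp add: algebra_simps)
qed

text \<open>The increments of \<open>u\<close> are dominated by those of a bounded increasing
  \<open>G\<close>, which bounds the variation by telescoping. Each half-axis contributes once,
  hence the factor 2. For monotone \<open>u\<close> one takes \<open>u\<close> or its negative as
  \<open>G\<close>.\<close>

lemma multiplier_even:
  fixes u :: "nat \<Rightarrow> complex"
  assumes p: "1 \<le> p" and R: "\<And>j. multiplier p R (\<lambda>k. if j \<le> fst k then 1 else 0)"
    and B: "\<And>n. norm (u n) \<le> B"
    and G: "\<And>n. norm (u (Suc n) - u n) \<le> G (Suc n) - G n" "\<And>n. G n - G 0 \<le> V"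
  shows "multiplier p (B + 2 * V * R) (\<lambda>k. u (nat \<bar>fst k\<bar>))"
proof (rule multiplier_bounded_variation[OF p R B])
  fix N :: nat
  define w where "w = (\<lambda>n::int. u (nat \<bar>n\<bar>))"
  have "(\<Sum>n\<in>{- int N..<int N}. norm (w (n + 1) - w n)) \<le> 2 * (G N - G 0)"
  proof (induction N)
    case (Suc N)
    have "{- int (Suc N)..<int (Suc N)} = insert (- int (Suc N)) (insert (int N) {- int N..<int N})" by auto
    then have "(\<Sum>n\<in>{- int (Suc N)..<int (Suc N)}. norm (w (n + 1) - w n))
      = norm (w (- int N) - w (- int (Suc N))) + (norm (w (int (Suc N)) - w (int N)) + (\<Sum>n\<in>{- int N..<int N}. norm (w (n + 1) - w n)))"
      by (simp add: add.commute)
    moreover have "norm (w (- int N) - w (- int (Suc N))) \<le> G (Suc N) - G N" "norm (w (int (Suc N)) - w (int N)) \<le> G (Suc N) - G N"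
      using G(1)[of N] by (simp_all add: w_def norm_minus_commute nat_add_distrib)
    ultimately show ?case using Suc by simp
  qed simp
  then show "(\<Sum>n\<in>{- int N..<int N}. norm (u (nat \<bar>n + 1\<bar>) - u (nat \<bar>n\<bar>))) \<le> 2 * V"
    using G(2)[of N] by (simp add: w_def)
qed

lemma multiplier_even_antimono:
  fixes u :: "nat \<Rightarrow> real"
  assumes p: "1 \<le> p" and R: "\<And>j. multiplier p R (\<lambda>k. if j \<le> fst k then 1 else 0)"
    and u: "\<And>n. u (Suc n) \<le> u n" "\<And>n. 0 \<le> u n" "\<And>n. u n \<le> B"
  shows "multiplier p (B + 2 * B * R) (\<lambda>k. of_real (u (nat \<bar>fst k\<bar>)))"
proof (rule multiplier_even[OF p R, where G = "\<lambda>n. - u n"])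
  show "- u n - - u 0 \<le> B" for n using u(2)[of n] u(3)[of 0] by simp
qed (use u in \<open>auto simp: of_real_diff[symmetric] simp del: of_real_diff\<close>)

lemma multiplier_even_mono:
  fixes u :: "nat \<Rightarrow> real"
  assumes p: "1 \<le> p" and R: "\<And>j. multiplier p R (\<lambda>k. if j \<le> fst k then 1 else 0)"
    and u: "\<And>n. u n \<le> u (Suc n)" "\<And>n. 0 \<le> u n" "\<And>n. u n \<le> B"
  shows "multiplier p (B + 2 * B * R) (\<lambda>k. of_real (u (nat \<bar>fst k\<bar>)))"
proof (rule multiplier_even[OF p R, where G = u])
  show "u n - u 0 \<le> B" for n using u(2)[of 0] u(3)[of n] by simp
qed (use u in \<open>auto simp: of_real_diff[symmetric] simp del: of_real_diff\<close>)

text \<open>A step function of the sign with values cis (-\<theta>), 1, cis \<theta> has two jumps,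
  at 0 and at 1, each of modulus at most 2.\<close>

lemma multiplier_phase:
  assumes p: "1 \<le> p" and R: "\<And>j. multiplier p R (\<lambda>k. if j \<le> fst k then 1 else 0)"
  shows "multiplier p (1 + 4 * R) (\<lambda>k. cis (\<theta> * of_int (sgn (fst k))))"
proof -
  have R0: "0 \<le> R" using R multiplier_nonneg by blast
  have "multiplier p (norm (cis (- \<theta>)) + (norm (1 - cis (- \<theta>)) * R + norm (cis \<theta> - 1) * R))
     (\<lambda>k. cis (- \<theta>) + ((1 - cis (- \<theta>)) * (if 0 \<le> fst k then 1 else 0) + (cis \<theta> - 1) * (if 1 \<le> fst k then 1 else 0)))"
    using p by (intro multiplier_add multiplier_cmult multiplier_const R) auto
  moreover have "(\<lambda>k. cis (- \<theta>) + ((1 - cis (- \<theta>)) * (if 0 \<le> fst k then 1 else 0) + (cis \<theta> - 1) * (if 1 \<le> fst k then 1 else 0)))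
      = (\<lambda>k :: int \<times> int. cis (\<theta> * of_int (sgn (fst k))))"
    by (auto simp: fun_eq_iff sgn_if)
  moreover have "norm (cis (- \<theta>)) + (norm (1 - cis (- \<theta>)) * R + norm (cis \<theta> - 1) * R) \<le> 1 + 4 * R"
  proof -
    have "norm (1 - cis (- \<theta>)) \<le> 2" "norm (cis \<theta> - 1) \<le> 2"
      using norm_triangle_ineq4[of 1 "cis (- \<theta>)"] norm_triangle_ineq4[of "cis \<theta>" 1] by simp_all
    then have "norm (1 - cis (- \<theta>)) * R \<le> 2 * R" "norm (cis \<theta> - 1) * R \<le> 2 * R"
      using R0 by (auto intro: mult_right_mono)
    then show ?thesis by simp
  qed
  ultimately show ?thesis using multiplier_mono by auto
qed

section \<open>The symbol of the fractional difference\<close>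

definition diff_coeff :: "real \<Rightarrow> nat \<Rightarrow> real" where
  "diff_coeff \<alpha> \<nu> = (- 1) ^ \<nu> * (\<alpha> gchoose \<nu>)"

text \<open>Once n exceeds \<alpha>, the moduli of the coefficients of order \<alpha> are
  consecutive differences of the decreasing moduli of those of order \<alpha> - 1, so the tail
  telescopes and is bounded by \<open>b K\<close>.\<close>

lemma summable_gchoose:
  fixes \<alpha> :: real
  assumes "0 < \<alpha>"
  shows "summable (\<lambda>\<nu>. \<bar>\<alpha> gchoose \<nu>\<bar>)"
proof -
  obtain K :: nat where K: "\<alpha> \<le> real K" using real_arch_simple by blast
  define b where "b = (\<lambda>n. \<bar>(\<alpha> - 1) gchoose n\<bar>)"
  have step: "\<bar>\<alpha> gchoose (Suc n)\<bar> = b n - b (Suc n)" if "K \<le> n" for n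
  proof -
    have n: "\<alpha> \<le> real n + 1" using K that by linarith
    have "real (Suc n) * (\<alpha> gchoose Suc n) = \<alpha> * ((\<alpha> - 1) gchoose n)"
      using gbinomial_absorption[of n \<alpha>] by simp
    then have "\<alpha> gchoose Suc n = \<alpha> / (real n + 1) * ((\<alpha> - 1) gchoose n)"
      by (simp add: field_simps)
    then have 1: "\<bar>\<alpha> gchoose Suc n\<bar> = \<alpha> / (real n + 1) * b n"
      using assms by (simp add: b_def abs_mult)
    have "(\<alpha> - 1) gchoose (Suc n) = ((\<alpha> - 1) gchoose n) * ((\<alpha> - 1 - real n) / (real n + 1))"
      using gbinomial_mult_1[of "\<alpha> - 1" n] by (simp add: field_simps)
    then have "b (Suc n) = b n * \<bar>(\<alpha> - 1 - real n) / (real n + 1)\<bar>"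
      by (simp add: b_def abs_mult)
    moreover have "\<bar>(\<alpha> - 1 - real n) / (real n + 1)\<bar> = (real n + 1 - \<alpha>) / (real n + 1)"
    proof -
      have "\<alpha> - 1 - real n = - (real n + 1 - \<alpha>)" by simp
      then have "\<bar>\<alpha> - 1 - real n\<bar> = real n + 1 - \<alpha>" using n by (simp only: abs_minus_cancel abs_of_nonneg)
      then show ?thesis by (simp add: abs_divide)
    qed
    ultimately have "b (Suc n) = b n * ((real n + 1 - \<alpha>) / (real n + 1))" by simp
    moreover have "(real n + 1 - \<alpha>) / (real n + 1) = 1 - \<alpha> / (real n + 1)" by (simp add: field_simps)
    ultimately have 2: "b (Suc n) = b n * (1 - \<alpha> / (real n + 1))" by (simp only:)
    show ?thesis unfolding 1 2 right_diff_distrib by simp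
  qed
  have "summable (\<lambda>n. \<bar>\<alpha> gchoose (Suc n + K)\<bar>)"
  proof (rule summableI_nonneg_bounded[where x = "b K"])
    show "(\<Sum>i<n. \<bar>\<alpha> gchoose (Suc i + K)\<bar>) \<le> b K" for n
    proof -
      have "(\<Sum>i<n. \<bar>\<alpha> gchoose (Suc i + K)\<bar>) = b K - b (n + K)"
      proof (induction n)
        case (Suc n)
        then show ?case using step[of "n + K"] by simp
      qed simp
      then show ?thesis by (simp add: b_def)
    qed
  qed simp
  then show ?thesis
    using summable_iff_shift[of "\<lambda>\<nu>. \<bar>\<alpha> gchoose \<nu>\<bar>" "Suc K"] by simp
qed

lemma abs_diff_coeff: "\<bar>diff_coeff \<alpha> \<nu>\<bar> = \<bar>\<alpha> gchoose \<nu>\<bar>"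
  by (simp add: diff_coeff_def abs_mult power_abs)

lemma summable_diff_coeff: "0 < \<alpha> \<Longrightarrow> summable (\<lambda>\<nu>. \<bar>diff_coeff \<alpha> \<nu>\<bar>)"
  by (simp add: abs_diff_coeff summable_gchoose)

definition diff_coeff_norm :: "real \<Rightarrow> real" where
  "diff_coeff_norm \<alpha> = (\<Sum>\<nu>. \<bar>diff_coeff \<alpha> \<nu>\<bar>)"

definition diff_series :: "real \<Rightarrow> complex \<Rightarrow> complex" where
  "diff_series \<alpha> z = (\<Sum>\<nu>. of_real (diff_coeff \<alpha> \<nu>) * z ^ \<nu>)"

lemma diff_coeff_norm_nonneg: "0 < \<alpha> \<Longrightarrow> 0 \<le> diff_coeff_norm \<alpha>"
  unfolding diff_coeff_norm_def by (intro suminf_nonneg summable_diff_coeff) auto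

lemma summable_diff_series:
  fixes z :: complex
  assumes "0 < \<alpha>" "norm z \<le> 1"
  shows "summable (\<lambda>\<nu>. of_real (diff_coeff \<alpha> \<nu>) * z ^ \<nu>)"
proof (rule summable_comparison_test'[OF summable_diff_coeff[OF assms(1)], of 0])
  fix n
  show "norm (of_real (diff_coeff \<alpha> n) * z ^ n) \<le> \<bar>diff_coeff \<alpha> n\<bar>"
    using assms(2) by (simp add: norm_mult norm_power mult_left_le power_le_one)
qed

lemma continuous_on_diff_series:
  assumes "0 < \<alpha>"
  shows "continuous_on (cball 0 1) (diff_series \<alpha>)"
proof -
  have "uniform_limit (cball 0 1) (\<lambda>n z. \<Sum>\<nu><n. of_real (diff_coeff \<alpha> \<nu>) * z ^ \<nu>) (diff_series \<alpha>) sequentially"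
    unfolding diff_series_def
  proof (rule Weierstrass_m_test[OF _ summable_diff_coeff[OF assms]])
    fix n and z :: complex assume "z \<in> cball 0 1"
    then show "norm (of_real (diff_coeff \<alpha> n) * z ^ n) \<le> \<bar>diff_coeff \<alpha> n\<bar>"
      by (simp add: norm_mult norm_power mult_left_le power_le_one)
  qed
  then show ?thesis
    by (rule uniform_limit_theorem[rotated]) (auto intro!: always_eventually continuous_intros)
qed

lemma gbinomial_of_real: "complex_of_real (\<alpha> gchoose n) = of_real \<alpha> gchoose n"
  by (simp add: gbinomial_prod_rev)

lemma diff_series_ball:
  assumes "norm z < 1"
  shows "diff_series \<alpha> z = (1 - z) powr of_real \<alpha>"
proof -
  have "(\<lambda>n. (of_real \<alpha> gchoose n) * (- z) ^ n) sums (1 + - z) powr of_real \<alpha>"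
    by (rule gen_binomial_complex) (use assms in simp)
  moreover have "(of_real \<alpha> gchoose n) * (- z) ^ n = of_real (diff_coeff \<alpha> n) * z ^ n" for n
    by (simp add: diff_coeff_def gbinomial_of_real[symmetric] power_minus[of z] mult_ac)
  ultimately show ?thesis unfolding diff_series_def by (simp add: sums_iff)
qed

text \<open>Inside the disc the series is the binomial series of (1 - z)^\<alpha>. On the closed
  disc it converges uniformly, so boundary values are radial limits.\<close>

lemma diff_series_radial:
  assumes "0 < \<alpha>" "norm z \<le> 1"
  shows "((\<lambda>r. (1 - of_real r * z) powr of_real \<alpha>) \<longlongrightarrow> diff_series \<alpha> z) (at_left (1::real))"
proof -
  have "continuous_on {0..1::real} (\<lambda>r. diff_series \<alpha> (of_real r * z))"
    by (rule continuous_on_compose2[OF continuous_on_diff_series[OF assms(1)]])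
       (use assms(2) in \<open>auto intro!: continuous_intros mult_le_one simp: norm_mult\<close>)
  then have "((\<lambda>r. diff_series \<alpha> (of_real r * z)) \<longlongrightarrow> diff_series \<alpha> z) (at_left (1::real))"
    by (auto simp: continuous_on_def at_within_Icc_at_left dest!: bspec[of _ _ 1])
  moreover have "\<forall>\<^sub>F r in at_left (1::real). diff_series \<alpha> (of_real r * z) = (1 - of_real r * z) powr of_real \<alpha>"
    unfolding eventually_at_left_field
  proof (intro exI[of _ 0] conjI allI impI)
    fix r :: real assume "0 < r" "r < 1"
    then have "r * norm z \<le> r * 1" using assms(2) by (intro mult_left_mono) auto
    moreover have "norm (of_real r * z) = r * norm z" using \<open>0 < r\<close> by (simp add: norm_mult)
    ultimately have "norm (of_real r * z) < 1" using \<open>r < 1\<close> by linarith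
    then show "diff_series \<alpha> (of_real r * z) = (1 - of_real r * z) powr of_real \<alpha>" by (rule diff_series_ball)
  qed simp
  ultimately show ?thesis by (rule Lim_transform_eventually)
qed

text \<open>For a point z of the closed disc other than 1, the number 1 - z avoids the branch cut of
  the principal power, which is therefore continuous along the radius.\<close>

lemma diff_series_eq:
  assumes "0 < \<alpha>" "norm z \<le> 1" "z \<noteq> 1"
  shows "diff_series \<alpha> z = (1 - z) powr of_real \<alpha>"
proof (rule tendsto_unique[OF _ diff_series_radial[OF assms(1,2)]])
  have "1 - z \<notin> \<real>\<^sub>\<le>\<^sub>0"
  proof
    assume "1 - z \<in> \<real>\<^sub>\<le>\<^sub>0"
    then obtain r where r: "1 - z = of_real r" "r \<le> 0" by (auto simp: nonpos_Reals_def)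
    then have "z = of_real (1 - r)" by (simp add: algebra_simps)
    then have "norm z = \<bar>1 - r\<bar>" by (simp only: norm_of_real)
    moreover have "r \<noteq> 0" using r(1) assms(3) by auto
    ultimately show False using assms(2) r(2) by simp
  qed
  moreover have "((\<lambda>r. 1 - of_real r * z) \<longlongrightarrow> 1 - of_real 1 * z) (at_left (1::real))"
    by (intro tendsto_intros)
  ultimately show "((\<lambda>r. (1 - of_real r * z) powr of_real \<alpha>) \<longlongrightarrow> (1 - z) powr of_real \<alpha>) (at_left (1::real))"
    by (intro tendsto_powr_complex tendsto_const) auto
qed simp

text \<open>At z = 1 the radial values are the real powers (1 - r)^\<alpha>, which tend to 0. This
  is why differences annihilate constants.\<close>

lemma diff_series_1:
  assumes "0 < \<alpha>"
  shows "diff_series \<alpha> 1 = 0"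
proof (rule tendsto_unique[OF _ diff_series_radial[OF assms]])
  show "((\<lambda>r. (1 - of_real r * 1) powr of_real \<alpha>) \<longlongrightarrow> (0::complex)) (at_left (1::real))"
  proof (rule Lim_null_comparison)
    have "((\<lambda>r::real. 1 - r) \<longlongrightarrow> 1 - 1) (at_left 1)" by (intro tendsto_intros)
    then show "((\<lambda>r::real. \<bar>1 - r\<bar> powr \<alpha>) \<longlongrightarrow> 0) (at_left 1)"
      using assms by (intro tendsto_zero_powrI[where b = \<alpha>] tendsto_rabs_zero) auto
    show "\<forall>\<^sub>F r::real in at_left 1. norm ((1 - of_real r * 1) powr of_real \<alpha> :: complex) \<le> \<bar>1 - r\<bar> powr \<alpha>"
      unfolding eventually_at_left_field
    proof (intro exI[of _ 0] conjI allI impI)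
      fix r :: real assume "0 < r" "r < 1"
      then have "(1 - of_real r * 1) powr of_real \<alpha> = (of_real ((1 - r) powr \<alpha>) :: complex)"
        using powr_of_real[of "1 - r" \<alpha>] by simp
      then show "norm ((1 - of_real r * 1) powr of_real \<alpha> :: complex) \<le> \<bar>1 - r\<bar> powr \<alpha>"
        using \<open>r < 1\<close> by simp
    qed simp
  qed
qed simp_all

text \<open>The factor by which the difference of order \<alpha> with step h multiplies the
  frequency n. The first factor is the translation by \<open>\<alpha> * h\<close> that is built into
  the definition of the difference.\<close>

definition diff_symbol :: "real \<Rightarrow> real \<Rightarrow> int \<Rightarrow> complex" where
  "diff_symbol \<alpha> h n = cis (\<alpha> * (of_int n * h)) * diff_series \<alpha> (cis (- (of_int n * h)))"

lemma diff_symbol_sums: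
  assumes "0 < \<alpha>"
  shows "(\<lambda>\<nu>. of_real (diff_coeff \<alpha> \<nu>) * cis (of_int n * ((\<alpha> - real \<nu>) * h))) sums diff_symbol \<alpha> h n"
proof -
  have "(\<lambda>\<nu>. of_real (diff_coeff \<alpha> \<nu>) * cis (- (of_int n * h)) ^ \<nu>) sums diff_series \<alpha> (cis (- (of_int n * h)))"
    unfolding diff_series_def by (intro summable_sums summable_diff_series assms) simp
  from sums_mult[OF this, of "cis (\<alpha> * (of_int n * h))"]
  have "(\<lambda>\<nu>. cis (\<alpha> * (of_int n * h)) * (of_real (diff_coeff \<alpha> \<nu>) * cis (- (of_int n * h)) ^ \<nu>)) sums diff_symbol \<alpha> h n"
    unfolding diff_symbol_def .
  moreover have "cis (\<alpha> * (of_int n * h)) * (of_real (diff_coeff \<alpha> \<nu>) * cis (- (of_int n * h)) ^ \<nu>)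
      = of_real (diff_coeff \<alpha> \<nu>) * cis (of_int n * ((\<alpha> - real \<nu>) * h))" for \<nu>
  proof -
    have "cis (\<alpha> * (of_int n * h)) * cis (- (of_int n * h)) ^ \<nu> = cis (of_int n * ((\<alpha> - real \<nu>) * h))"
      unfolding Complex.DeMoivre cis_mult by (rule arg_cong[of _ _ cis]) (simp add: algebra_simps)
    then show ?thesis by (simp add: mult.left_commute)
  qed
  ultimately show ?thesis by simp
qed

lemma multiplier_diff_symbol:
  assumes p: "1 \<le> p" and \<alpha>: "0 < \<alpha>"
  shows "multiplier p (diff_coeff_norm \<alpha>) (\<lambda>k. diff_symbol \<alpha> h (fst k))"
proof -
  have "multiplier p (\<Sum>\<nu>. norm (of_real (diff_coeff \<alpha> \<nu>) :: complex)) (\<lambda>k. diff_symbol \<alpha> h (fst k))"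
    by (rule multiplier_series[OF p, where v = "\<lambda>\<nu>. ((\<alpha> - real \<nu>) * h, 0)"])
       (use summable_diff_coeff[OF \<alpha>] diff_symbol_sums[OF \<alpha>] in \<open>simp_all add: character_def\<close>)
  then show ?thesis by (simp add: diff_coeff_norm_def)
qed

lemma diff_symbol_eq_0: "0 < \<alpha> \<Longrightarrow> cis (of_int n * h) = 1 \<Longrightarrow> diff_symbol \<alpha> h n = 0"
  using diff_series_1 by (simp add: diff_symbol_def cis_cnj[symmetric])

text \<open>Polar form: for |u| < 2 \<pi> the real factor is positive and the angle lies strictly
  between -\<pi>/2 and \<pi>/2, so principal powers can be read off.\<close>

lemma one_minus_cis:
  assumes "u \<noteq> 0"
  shows "1 - cis (- u) = of_real (2 * sin (\<bar>u\<bar> / 2)) * cis (sgn u * pi / 2 - u / 2)"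
proof -
  have "cos u = 1 - 2 * (sin (u/2))\<^sup>2" "sin u = 2 * sin (u/2) * cos (u/2)"
    using cos_double_sin[of "u/2"] sin_double[of "u/2"] by simp_all
  then have "1 - cis (- u) = of_real (2 * sin (u / 2)) * cis (pi / 2 - u / 2)"
    by (simp add: complex_eq_iff cos_diff sin_diff power2_eq_square)
  also have "\<dots> = of_real (2 * sin (\<bar>u\<bar> / 2)) * cis (sgn u * pi / 2 - u / 2)"
    using assms by (cases "0 < u") (auto simp: sgn_if complex_eq_iff cos_diff sin_diff)
  finally show ?thesis .
qed

lemma cis_powr:
  assumes "0 < r" "- pi < \<theta>" "\<theta> \<le> pi"
  shows "(of_real r * cis \<theta>) powr of_real \<alpha> = of_real (r powr \<alpha>) * cis (\<alpha> * \<theta>)"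
proof -
  have "of_real r * cis \<theta> = exp (of_real (ln r) + \<i> * of_real \<theta>)"
    using assms by (simp add: exp_add cis_conv_exp exp_of_real)
  moreover have "Ln (exp (of_real (ln r) + \<i> * of_real \<theta>)) = of_real (ln r) + \<i> * of_real \<theta>"
    using assms by (intro Ln_exp) auto
  ultimately have "(of_real r * cis \<theta>) powr of_real \<alpha> = exp (of_real \<alpha> * (of_real (ln r) + \<i> * of_real \<theta>))"
    by (simp add: powr_def)
  also have "\<dots> = of_real (r powr \<alpha>) * cis (\<alpha> * \<theta>)"
    using assms by (simp add: exp_add cis_conv_exp powr_def distrib_left exp_of_real[symmetric] mult_ac)
  finally show ?thesis .
qed

text \<open>Of the two phases, the first is that of (i u)^\<alpha> and the second is a translation
  by half of \<open>\<alpha> * h\<close>. Up to these, the symbol is a positive function of |u|, and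
  this is what makes the comparison with the derivative possible.\<close>

lemma diff_symbol_eq:
  assumes \<alpha>: "0 < \<alpha>" and u: "of_int n * h = u" "u \<noteq> 0" "\<bar>u\<bar> < 2 * pi"
  shows "diff_symbol \<alpha> h n = of_real ((2 * sin (\<bar>u\<bar> / 2)) powr \<alpha>) * cis (\<alpha> * sgn u * pi / 2 + \<alpha> * u / 2)"
proof -
  have s: "0 < 2 * sin (\<bar>u\<bar> / 2)" using u by (simp add: sin_gt_zero)
  have ne: "cis (- u) \<noteq> 1"
  proof
    assume "cis (- u) = 1"
    with one_minus_cis[OF u(2)] s show False by simp
  qed
  have "diff_symbol \<alpha> h n = cis (\<alpha> * u) * (1 - cis (- u)) powr of_real \<alpha>"
    unfolding diff_symbol_def u(1) using ne by (simp add: diff_series_eq[OF \<alpha>])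
  also have "(1 - cis (- u)) powr of_real \<alpha> = of_real ((2 * sin (\<bar>u\<bar> / 2)) powr \<alpha>) * cis (\<alpha> * (sgn u * pi / 2 - u / 2))"
    unfolding one_minus_cis[OF u(2)] by (rule cis_powr[OF s]) (use u in \<open>auto simp: sgn_if abs_if split: if_splits\<close>)
  also have "cis (\<alpha> * u) * \<dots> = of_real ((2 * sin (\<bar>u\<bar> / 2)) powr \<alpha>) * (cis (\<alpha> * u) * cis (\<alpha> * (sgn u * pi / 2 - u / 2)))"
    by (simp only: mult.left_commute)
  also have "cis (\<alpha> * u) * cis (\<alpha> * (sgn u * pi / 2 - u / 2)) = cis (\<alpha> * sgn u * pi / 2 + \<alpha> * u / 2)"
    unfolding cis_mult by (rule arg_cong[of _ _ cis]) (simp add: algebra_simps)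
  finally show ?thesis .
qed

section \<open>Comparison of the difference symbol with the derivative symbol\<close>

definition sinc :: "real \<Rightarrow> real" where
  "sinc x = (if x = 0 then 1 else sin x / x)"

lemma sinc_antimono:
  assumes "0 \<le> x" "x \<le> y" "y \<le> pi"
  shows "sinc y \<le> sinc x"
proof (cases "y = 0")
  case True
  then show ?thesis using assms by simp
next
  case False
  then have y: "0 < y" using assms by simp
  define l where "l = x / y"
  have l: "0 \<le> l" "l \<le> 1" "x = l * y" using assms y by (auto simp: l_def)
  \<comment> \<open>With x = l y the claim is l sin y \<le> sin (l y). In y both sides vanish at 0,
    and the derivatives compare because the cosine decreases on [0, \<pi>].\<close>
  have "sin (l * 0) - l * sin 0 \<le> sin (l * y) - l * sin y"
  proof (rule DERIV_nonneg_imp_nondecreasing[of 0 y])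
    fix t assume t: "0 \<le> t" "t \<le> y"
    have "((\<lambda>t. sin (l * t) - l * sin t) has_real_derivative l * (cos (l * t) - cos t)) (at t)"
      by (auto intro!: derivative_eq_intros simp: algebra_simps)
    moreover have "cos t \<le> cos (l * t)"
      using t l assms by (intro cos_monotone_0_pi_le mult_nonneg_nonneg mult_left_le_one_le) auto
    ultimately show "\<exists>d. ((\<lambda>t. sin (l * t) - l * sin t) has_real_derivative d) (at t) \<and> 0 \<le> d"
      using l(1) by (intro exI[of _ "l * (cos (l * t) - cos t)"]) simp
  qed (use y in simp)
  then have le: "l * sin y \<le> sin x" by (simp add: l(3))
  show ?thesis
  proof (cases "x = 0")
    case True
    then show ?thesis using y sin_x_le_x[of y] by (simp add: sinc_def)
  next
    case False
    then have x: "0 < x" using assms by simp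
    then show ?thesis using le y False by (simp add: sinc_def l_def field_simps)
  qed
qed

lemma sinc_pos: "0 \<le> x \<Longrightarrow> x < pi \<Longrightarrow> 0 < sinc x"
  by (auto simp: sinc_def sin_gt_zero)

lemma ipow_cis: "ipow n \<rho> = of_real (\<bar>of_int n\<bar> powr \<rho>) * cis (pi * \<rho> * of_int (sgn n) / 2)"
  by (simp add: ipow_def cis_conv_exp)

lemma of_int_sgn: "of_int (sgn n) = (sgn (of_int n) :: real)"
  by (simp add: sgn_if)

lemma multiplier_cis_fst: "1 \<le> p \<Longrightarrow> multiplier p 1 (\<lambda>k. cis (of_int (fst k) * v))"
  using multiplier_character[of p "(v, 0)"] by (simp add: character_def)

text \<open>On the low frequencies \<open>\<bar>n h\<bar> \<le> 3 < 2\<pi>\<close> the quotient of the two multipliers is, up to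
  a translation and a phase, a power of \<open>sinc\<close>, hence monotone; on the high frequencies the
  difference itself is bounded and \<open>\<bar>n h\<bar>\<close> to the power \<open>- \<alpha>\<close> is monotone.\<close>

lemma diff_symbol_ipow_factor:
  assumes p: "1 < p" and \<alpha>: "0 < \<alpha>"
  shows "\<exists>C. \<forall>h. \<exists>m. multiplier p C (\<lambda>k. m (fst k)) \<and>
    (\<forall>n. diff_symbol \<alpha> h n = of_real (\<bar>h\<bar> powr \<alpha>) * m n * ipow n \<alpha>)"
proof -
  obtain R where R: "\<And>j. multiplier p R (\<lambda>k. if j \<le> fst k then 1 else 0)"
    using multiplier_half_line[OF p] by blast
  have p1: "1 \<le> p" and p0: "0 < p" using p by auto
  define M where "M = 1 + 2 * 1 * R"
  define P where "P = 1 + 4 * R"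
  show ?thesis
  proof (intro exI[of _ "M * M * 1 * P + (norm (1::complex) + M) * M * diff_coeff_norm \<alpha> * P"] allI)
    fix h :: real
    define cut where "cut = (\<lambda>j::nat. if real j * \<bar>h\<bar> \<le> 3 then 1 else 0 :: real)"
    \<comment> \<open>The argument is frozen at 3/2, its value at the border |n h| = 3, so that
      \<rho> is monotone for all j; beyond the border it is annihilated by
      \<open>cut\<close>.\<close>
    define \<rho> where "\<rho> = (\<lambda>j::nat. sinc (min (real j * \<bar>h\<bar> / 2) (3/2)) powr \<alpha>)"
    \<comment> \<open>Taking the maximum with 1 keeps the negative power bounded and monotone near
      zero. Beyond the border the maximum is |n h| itself.\<close>
    define \<tau> where "\<tau> = (\<lambda>j::nat. max 1 (real j * \<bar>h\<bar>) powr (- \<alpha>))"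
    \<comment> \<open>The difference has a phase with the sign of n h, the derivative one with the
      sign of n. The angle \<theta> corrects this for h < 0 and vanishes for h > 0.\<close>
    define \<theta> where "\<theta> = pi * \<alpha> * (sgn h - 1) / 2"
    define N where "N = (\<lambda>n::int. nat \<bar>n\<bar>)"
    have grow: "real j * \<bar>h\<bar> \<le> real (Suc j) * \<bar>h\<bar>" for j by (intro mult_right_mono) auto
    have t_mono: "min (real j * \<bar>h\<bar> / 2) (3/2) \<le> min (real (Suc j) * \<bar>h\<bar> / 2) (3/2)" for j
      using grow[of j] by (intro min.mono) auto
    have sinc: "0 < sinc (min (real j * \<bar>h\<bar> / 2) (3/2))" "sinc (min (real j * \<bar>h\<bar> / 2) (3/2)) \<le> 1" for j
    proof -
      show "0 < sinc (min (real j * \<bar>h\<bar> / 2) (3/2))"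
        using pi_gt3 by (intro sinc_pos) (auto simp: min_def)
      have "sinc (min (real j * \<bar>h\<bar> / 2) (3/2)) \<le> sinc 0"
        using pi_gt3 by (intro sinc_antimono) (auto simp: min_def)
      then show "sinc (min (real j * \<bar>h\<bar> / 2) (3/2)) \<le> 1" by (simp add: sinc_def)
    qed
    have mcut: "multiplier p M (\<lambda>k. of_real (cut (N (fst k))))"
      unfolding M_def N_def using grow
      by (intro multiplier_even_antimono[OF p1 R]) (auto simp: cut_def intro: order_trans)
    have m\<rho>: "multiplier p M (\<lambda>k. of_real (\<rho> (N (fst k))))"
      unfolding M_def N_def
    proof (rule multiplier_even_antimono[OF p1 R])
      fix n
      show "\<rho> (Suc n) \<le> \<rho> n"
        unfolding \<rho>_def using sinc[of "Suc n"] \<alpha> pi_gt3 by (intro powr_mono2 sinc_antimono t_mono) auto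
      show "\<rho> n \<le> 1" unfolding \<rho>_def using sinc[of n] \<alpha> by (intro powr_le1) auto
    qed (simp add: \<rho>_def)
    have m\<tau>: "multiplier p M (\<lambda>k. of_real (\<tau> (N (fst k))))"
      unfolding M_def N_def
    proof (rule multiplier_even_antimono[OF p1 R])
      fix n
      show "\<tau> (Suc n) \<le> \<tau> n"
        unfolding \<tau>_def using grow[of n] \<alpha> by (intro powr_mono2') auto
      show "\<tau> n \<le> 1"
        unfolding \<tau>_def using powr_mono2'[of "- \<alpha>" 1 "max 1 (real n * \<bar>h\<bar>)"] \<alpha> by simp
    qed (simp add: \<tau>_def)
    define m where "m = (\<lambda>n. of_real (cut (N n)) * of_real (\<rho> (N n)) * cis (of_int n * (\<alpha> * h / 2)) * cis (\<theta> * of_int (sgn n))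
      + (1 - of_real (cut (N n))) * of_real (\<tau> (N n)) * diff_symbol \<alpha> h n * cis (- (pi * \<alpha> / 2) * of_int (sgn n)))"
    have "multiplier p (M * M * 1 * P + (norm (1::complex) + M) * M * diff_coeff_norm \<alpha> * P) (\<lambda>k. m (fst k))"
      unfolding m_def P_def
      by (intro multiplier_add multiplier_prod multiplier_diff multiplier_const mcut m\<rho> m\<tau>
            multiplier_phase multiplier_cis_fst multiplier_diff_symbol p1 p0 R \<alpha>)
    moreover have "diff_symbol \<alpha> h n = of_real (\<bar>h\<bar> powr \<alpha>) * m n * ipow n \<alpha>" for n
    proof (cases "n = 0 \<or> h = 0")
      case True
      then have "diff_symbol \<alpha> h n = 0" using \<alpha> by (auto intro!: diff_symbol_eq_0)
      with True show ?thesis by (auto simp: ipow_cis)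
    next
      case False
      define u where "u = of_int n * h"
      have u: "u \<noteq> 0" "\<bar>u\<bar> = real (N n) * \<bar>h\<bar>" "\<bar>u\<bar> = \<bar>of_int n\<bar> * \<bar>h\<bar>"
        using False by (auto simp: u_def abs_mult N_def)
      have pw: "\<bar>h\<bar> powr \<alpha> * \<bar>of_int n\<bar> powr \<alpha> = \<bar>u\<bar> powr \<alpha>"
        unfolding u(3) by (simp add: powr_mult mult.commute)
      show ?thesis
      proof (cases "\<bar>u\<bar> \<le> 3")
        case True
        have s0: "0 < sin (\<bar>u\<bar> / 2)" using True u(1) pi_gt3 by (intro sin_gt_zero) auto
        have cut: "cut (N n) = 1" using True u(2) by (simp add: cut_def)
        have "\<rho> (N n) = sinc (\<bar>u\<bar> / 2) powr \<alpha>" using True u(2) by (simp add: \<rho>_def min_def)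
        then have rho: "\<rho> (N n) = (2 * sin (\<bar>u\<bar> / 2) / \<bar>u\<bar>) powr \<alpha>" using u(1) by (simp add: sinc_def mult.commute)
        have "\<bar>u\<bar> powr \<alpha> * \<rho> (N n) = (2 * sin (\<bar>u\<bar> / 2)) powr \<alpha>"
          unfolding rho using u(1) s0 by (simp add: powr_mult[symmetric])
        moreover have "of_real (\<bar>h\<bar> powr \<alpha>) * m n * ipow n \<alpha> = of_real (\<bar>h\<bar> powr \<alpha> * \<bar>of_int n\<bar> powr \<alpha> * \<rho> (N n))
          * (cis (of_int n * (\<alpha> * h / 2)) * cis (\<theta> * of_int (sgn n)) * cis (pi * \<alpha> * of_int (sgn n) / 2))"
          by (simp add: m_def cut ipow_cis del: cis_mult)
        moreover have "cis (of_int n * (\<alpha> * h / 2)) * cis (\<theta> * of_int (sgn n)) * cis (pi * \<alpha> * of_int (sgn n) / 2)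
          = cis (\<alpha> * sgn u * pi / 2 + \<alpha> * u / 2)"
        proof -
          have "sgn u = of_int (sgn n) * sgn h" by (simp add: u_def sgn_mult of_int_sgn)
          then show ?thesis unfolding cis_mult by (intro arg_cong[of _ _ cis]) (simp add: \<theta>_def u_def field_simps)
        qed
        ultimately show ?thesis
          using diff_symbol_eq[OF \<alpha> u_def[symmetric] u(1)] True pi_gt3 pw by simp
      next
        case False
        have cut: "cut (N n) = 0" using False u(2) by (simp add: cut_def)
        have "\<tau> (N n) = \<bar>u\<bar> powr (- \<alpha>)" using False u(2) by (simp add: \<tau>_def max_def)
        then have "\<bar>u\<bar> powr \<alpha> * \<tau> (N n) = 1" using u(1) by (simp add: powr_add[symmetric])
        moreover have "of_real (\<bar>h\<bar> powr \<alpha>) * m n * ipow n \<alpha> = of_real (\<bar>h\<bar> powr \<alpha> * \<bar>of_int n\<bar> powr \<alpha> * \<tau> (N n))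
          * diff_symbol \<alpha> h n * (cis (- (pi * \<alpha> / 2) * of_int (sgn n)) * cis (pi * \<alpha> * of_int (sgn n) / 2))"
          by (simp add: m_def cut ipow_cis del: cis_mult)
        moreover have "cis (- (pi * \<alpha> / 2) * of_int (sgn n)) * cis (pi * \<alpha> * of_int (sgn n) / 2) = 1"
          unfolding cis_mult by simp
        ultimately show ?thesis using pw by simp
      qed
    qed
    ultimately show "\<exists>m. multiplier p (M * M * 1 * P + (norm (1::complex) + M) * M * diff_coeff_norm \<alpha> * P) (\<lambda>k. m (fst k)) \<and>
       (\<forall>n. diff_symbol \<alpha> h n = of_real (\<bar>h\<bar> powr \<alpha>) * m n * ipow n \<alpha>)" by blast
  qed
qed

text \<open>The converse comparison, with the single step h = \<delta>. On |n| \<delta> \<le> 3 the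
  symbol vanishes only at n = 0, and the reciprocal power of \<open>sinc\<close> increases up to the
  bound \<open>S\<close>. It is multiplied by the cutoff as a separate multiplier, each of the two
  factors being monotone.\<close>

lemma ipow_low_factor:
  assumes p: "1 < p" and \<alpha>: "0 < \<alpha>"
  shows "\<exists>C. \<forall>\<delta>>0. \<exists>e. multiplier p C (\<lambda>k. e (fst k)) \<and>
    (\<forall>n. (if \<bar>of_int n\<bar> * \<delta> \<le> 3 then ipow n \<alpha> else 0) = of_real (\<delta> powr (- \<alpha>)) * e n * diff_symbol \<alpha> \<delta> n)"
proof -
  obtain R where R: "\<And>j. multiplier p R (\<lambda>k. if j \<le> fst k then 1 else 0)"
    using multiplier_half_line[OF p] by blast
  have p1: "1 \<le> p" and p0: "0 < p" using p by auto
  define S where "S = sinc (3/2) powr (- \<alpha>)"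
  show ?thesis
  proof (intro exI[of _ "(1 + 2 * 1 * R) * (S + 2 * S * R) * 1"] allI impI)
    fix \<delta> :: real assume \<delta>: "0 < \<delta>"
    define cut where "cut = (\<lambda>j::nat. if real j * \<delta> \<le> 3 then 1 else 0 :: real)"
    define \<sigma> where "\<sigma> = (\<lambda>j::nat. sinc (min (real j * \<delta> / 2) (3/2)) powr (- \<alpha>))"
    define N where "N = (\<lambda>n::int. nat \<bar>n\<bar>)"
    have grow: "real j * \<delta> \<le> real (Suc j) * \<delta>" for j using \<delta> by (intro mult_right_mono) auto
    have t_mono: "min (real j * \<delta> / 2) (3/2) \<le> min (real (Suc j) * \<delta> / 2) (3/2)" for j
      using grow[of j] by (intro min.mono) auto
    have sinc: "0 < sinc (min (real j * \<delta> / 2) (3/2))" for j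
      using pi_gt3 \<delta> by (intro sinc_pos) (auto simp: min_def)
    have mcut: "multiplier p (1 + 2 * 1 * R) (\<lambda>k. of_real (cut (N (fst k))))"
      unfolding N_def using grow
      by (intro multiplier_even_antimono[OF p1 R]) (auto simp: cut_def intro: order_trans)
    have m\<sigma>: "multiplier p (S + 2 * S * R) (\<lambda>k. of_real (\<sigma> (N (fst k))))"
      unfolding N_def
    proof (rule multiplier_even_mono[OF p1 R])
      fix n
      show "\<sigma> n \<le> \<sigma> (Suc n)"
        unfolding \<sigma>_def using sinc[of "Suc n"] \<alpha> pi_gt3 \<delta> by (intro powr_mono2' sinc_antimono t_mono) auto
      show "\<sigma> n \<le> S"
        unfolding \<sigma>_def S_def using \<alpha> pi_gt3 \<delta>
        by (intro powr_mono2' sinc_antimono sinc_pos) (auto simp: min_def)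
    qed (simp add: \<sigma>_def)
    define e where "e = (\<lambda>n. of_real (cut (N n)) * of_real (\<sigma> (N n)) * cis (of_int n * (- (\<alpha> * \<delta> / 2))))"
    have "multiplier p ((1 + 2 * 1 * R) * (S + 2 * S * R) * 1) (\<lambda>k. e (fst k))"
      unfolding e_def by (intro multiplier_prod mcut m\<sigma> multiplier_cis_fst p1)
    moreover have "(if \<bar>of_int n\<bar> * \<delta> \<le> 3 then ipow n \<alpha> else 0) = of_real (\<delta> powr (- \<alpha>)) * e n * diff_symbol \<alpha> \<delta> n" for n
    proof (cases "n = 0 \<or> \<not> \<bar>of_int n\<bar> * \<delta> \<le> 3")
      case True
      then show ?thesis
      proof
        assume "n = 0"
        then have "diff_symbol \<alpha> \<delta> n = 0" "ipow n \<alpha> = 0" using \<alpha> by (auto intro!: diff_symbol_eq_0 simp: ipow_cis)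
        then show ?thesis by simp
      next
        assume "\<not> \<bar>of_int n\<bar> * \<delta> \<le> 3"
        then show ?thesis by (simp add: e_def cut_def N_def)
      qed
    next
      case False
      define u where "u = of_int n * \<delta>"
      have u: "u \<noteq> 0" "\<bar>u\<bar> = real (N n) * \<delta>" "\<bar>u\<bar> = \<bar>of_int n\<bar> * \<delta>" "\<bar>u\<bar> \<le> 3" "sgn u = of_int (sgn n)"
        using False \<delta> by (auto simp: u_def abs_mult N_def sgn_mult of_int_sgn)
      have s0: "0 < sin (\<bar>u\<bar> / 2)" using u(1,4) pi_gt3 by (intro sin_gt_zero) auto
      have Nu: "real (N n) * \<delta> = \<bar>u\<bar>" by (rule u(2)[symmetric])
      have cut: "cut (N n) = 1" by (simp add: cut_def Nu u(4))
      have "\<sigma> (N n) = sinc (\<bar>u\<bar> / 2) powr (- \<alpha>)" using u(4) unfolding \<sigma>_def Nu by (simp add: min_def)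
      then have "\<sigma> (N n) = (2 * sin (\<bar>u\<bar> / 2) / \<bar>u\<bar>) powr (- \<alpha>)" using u(1) by (simp add: sinc_def mult.commute)
      also have "\<dots> = \<bar>u\<bar> powr \<alpha> * (2 * sin (\<bar>u\<bar> / 2)) powr (- \<alpha>)"
        using u(1) s0 by (simp add: powr_divide powr_minus field_simps)
      finally have "\<delta> powr (- \<alpha>) * \<sigma> (N n) * (2 * sin (\<bar>u\<bar> / 2)) powr \<alpha> = \<delta> powr (- \<alpha>) * \<bar>u\<bar> powr \<alpha>"
        using s0 by (simp add: powr_minus)
      also have "\<dots> = \<bar>of_int n\<bar> powr \<alpha>"
        unfolding u(3) using \<delta> by (simp add: powr_mult powr_minus)
      finally have pw: "\<delta> powr (- \<alpha>) * \<sigma> (N n) * (2 * sin (\<bar>u\<bar> / 2)) powr \<alpha> = \<bar>of_int n\<bar> powr \<alpha>" .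
      have "of_real (\<delta> powr (- \<alpha>)) * e n * diff_symbol \<alpha> \<delta> n
        = of_real (\<delta> powr (- \<alpha>) * \<sigma> (N n) * (2 * sin (\<bar>u\<bar> / 2)) powr \<alpha>)
          * (cis (of_int n * (- (\<alpha> * \<delta> / 2))) * cis (\<alpha> * sgn u * pi / 2 + \<alpha> * u / 2))"
        using diff_symbol_eq[OF \<alpha> u_def[symmetric] u(1)] u(4) pi_gt3 by (simp add: e_def cut del: cis_mult)
      also have "cis (of_int n * (- (\<alpha> * \<delta> / 2))) * cis (\<alpha> * sgn u * pi / 2 + \<alpha> * u / 2) = cis (pi * \<alpha> * of_int (sgn n) / 2)"
        unfolding cis_mult u(5) by (intro arg_cong[of _ _ cis]) (simp add: u_def field_simps)
      finally have eq: "of_real (\<delta> powr (- \<alpha>)) * e n * diff_symbol \<alpha> \<delta> n = of_real (\<bar>of_int n\<bar> powr \<alpha>) * cis (pi * \<alpha> * of_int (sgn n) / 2)"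
        unfolding pw .
      have "\<bar>of_int n\<bar> * \<delta> \<le> 3" using u(3,4) by simp
      then show ?thesis by (simp only: if_True ipow_cis eq)
    qed
    ultimately show "\<exists>e. multiplier p ((1 + 2 * 1 * R) * (S + 2 * S * R) * 1) (\<lambda>k. e (fst k)) \<and>
      (\<forall>n. (if \<bar>of_int n\<bar> * \<delta> \<le> 3 then ipow n \<alpha> else 0) = of_real (\<delta> powr (- \<alpha>)) * e n * diff_symbol \<alpha> \<delta> n)"
      by blast
  qed
qed

text \<open>2 - 2 cos u is |1 - e^(-iu)|^2, so its m-th power is, up to sign and translation, the
  symbol of order 2 m. That symbol splits into orders 2 m - \<alpha> and \<alpha>, both positive;
  the first is a bounded multiplier and the second is what the modulus controls.\<close>

lemma cos_power_factor:
  assumes \<alpha>: "0 < \<alpha>" "\<alpha> < 2 * real m"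
  shows "of_real ((2 - 2 * cos (of_int n * h)) ^ m)
    = (- 1) ^ m * cis (of_int n * (- (real m * h))) * diff_symbol (2 * real m - \<alpha>) h n * diff_symbol \<alpha> h n"
proof -
  define u where "u = of_int n * h"
  define \<beta> where "\<beta> = 2 * real m - \<alpha>"
  define z where "z = cis (- u)"
  have \<beta>: "0 < \<beta>" using \<alpha> by (simp add: \<beta>_def)
  show ?thesis
  proof (cases "z = 1")
    case True
    then have "cis u = 1" by (simp add: z_def complex_eq_iff)
    then have "cos u = 1" "diff_symbol \<alpha> h n = 0" using diff_symbol_eq_0[OF \<alpha>(1)] by (auto simp: complex_eq_iff u_def)
    moreover have "m \<noteq> 0" using \<alpha> by auto
    ultimately show ?thesis by (simp add: u_def)
  next
    case False
    have d: "diff_symbol \<gamma> h n = cis (\<gamma> * u) * (1 - z) powr of_real \<gamma>" if "0 < \<gamma>" for \<gamma>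
    proof -
      have "diff_series \<gamma> z = (1 - z) powr of_real \<gamma>"
        by (rule diff_series_eq[OF that _ False]) (simp add: z_def)
      then show ?thesis by (simp only: diff_symbol_def u_def[symmetric] z_def[symmetric])
    qed
    have "diff_symbol \<beta> h n * diff_symbol \<alpha> h n = cis (\<beta> * u) * cis (\<alpha> * u) * ((1 - z) powr of_real \<beta> * (1 - z) powr of_real \<alpha>)"
      unfolding d[OF \<beta>] d[OF \<alpha>(1)] by (simp only: mult_ac)
    also have "(1 - z) powr of_real \<beta> * (1 - z) powr of_real \<alpha> = (1 - z) powr of_nat (2 * m)"
      by (simp add: powr_add[symmetric] \<beta>_def of_real_diff)
    also have "\<dots> = (1 - z) ^ (2 * m)" using False by (subst powr_nat) simp
    also have "cis (\<beta> * u) * cis (\<alpha> * u) = cis u ^ (2 * m)"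
      unfolding cis_mult Complex.DeMoivre by (intro arg_cong[of _ _ cis]) (simp add: \<beta>_def algebra_simps)
    finally have "(- 1) ^ m * cis (of_int n * (- (real m * h))) * (diff_symbol \<beta> h n * diff_symbol \<alpha> h n)
       = (- 1) ^ m * cis (- u) ^ m * (cis u ^ (2 * m) * (1 - z) ^ (2 * m))"
      unfolding Complex.DeMoivre by (simp add: u_def mult_ac)
    also have "\<dots> = (- (cis (- u) * (cis u)\<^sup>2 * (1 - z)\<^sup>2)) ^ m"
      unfolding power_mult by (simp only: power_mult_distrib[symmetric], rule arg_cong[where f = "\<lambda>x. x ^ m"])
        (simp add: power2_eq_square mult_ac)
    also have "- (cis (- u) * (cis u)\<^sup>2 * (1 - z)\<^sup>2) = of_real (2 - 2 * cos u)"
    proof -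
      have 1: "cis (- u) * cis u = 1" by (simp add: cis_mult)
      have "cis (- u) * (cis u)\<^sup>2 * (1 - z)\<^sup>2 = (cis (- u) * cis u) * (cis u - 2 * (cis (- u) * cis u) + (cis (- u) * cis u) * cis (- u))"
        unfolding z_def power2_eq_square by (simp add: algebra_simps del: cis_mult)
      also have "\<dots> = cis u - 2 + cis (- u)" unfolding 1 by simp
      finally show ?thesis by (simp add: complex_eq_iff)
    qed
    finally show ?thesis by (simp add: u_def \<beta>_def mult.assoc)
  qed
qed

section \<open>High frequencies\<close>

text \<open>The square of sin (v/2) / (v/2), that is, the squared modulus of the mean of e^(ivt)
  over t in [0,1].\<close>

definition sinc_square :: "real \<Rightarrow> real" where
  "sinc_square v = (if v = 0 then 1 else (2 - 2 * cos v) / v\<^sup>2)"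

text \<open>A Riemann sum for the mean of e^(ict) over [0,1]. Finite sums of translates suffice
  throughout, so no integral of functions with values in \<open>Lp\<close> is needed.\<close>

definition exp_mean :: "nat \<Rightarrow> real \<Rightarrow> complex" where
  "exp_mean Q c = (\<Sum>a<Q. cis (c * real a / real Q)) / of_nat Q"

lemma norm_cis_minus_1: "(norm (cis c - 1))\<^sup>2 = 2 - 2 * cos c"
proof -
  have "(norm (cis c - 1))\<^sup>2 = (cos c - 1)\<^sup>2 + (sin c)\<^sup>2" by (simp add: cmod_power2)
  also have "\<dots> = 2 - 2 * cos c" using sin_cos_squared_add[of c] by (simp add: power2_eq_square algebra_simps)
  finally show ?thesis .
qed

lemma exp_mean_tendsto: "(\<lambda>Q. (norm (exp_mean Q c))\<^sup>2) \<longlonglongrightarrow> sinc_square c"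
proof (cases "c = 0")
  case True
  have "\<forall>\<^sub>F Q in sequentially. (norm (exp_mean Q c))\<^sup>2 = sinc_square c"
    using eventually_gt_at_top[of 0] by eventually_elim (simp add: exp_mean_def sinc_square_def True)
  then show ?thesis by (rule tendsto_eventually)
next
  case False
  have "((\<lambda>x::real. sin x / x) \<longlongrightarrow> 1) (at 0)"
    using DERIV_sin[of "0::real"] by (simp add: has_field_derivative_iff)
  moreover have "filterlim (\<lambda>Q. c / (2 * real Q)) (at 0) sequentially"
    unfolding filterlim_at
  proof
    have "(\<lambda>Q. (c / 2) * (1 / real Q)) \<longlonglongrightarrow> (c / 2) * 0"
      by (intro tendsto_intros lim_1_over_n)
    then show "(\<lambda>Q. c / (2 * real Q)) \<longlonglongrightarrow> 0" by simp
    show "\<forall>\<^sub>F Q in sequentially. c / (2 * real Q) \<in> UNIV \<and> c / (2 * real Q) \<noteq> 0"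
      using eventually_gt_at_top[of 0] by eventually_elim (use False in simp)
  qed
  ultimately have lim: "(\<lambda>Q. sin (c / (2 * real Q)) / (c / (2 * real Q))) \<longlonglongrightarrow> 1"
    by (rule filterlim_compose)
  have "(\<lambda>Q. (2 - 2 * cos c) / (c\<^sup>2 * (sin (c / (2 * real Q)) / (c / (2 * real Q)))\<^sup>2)) \<longlonglongrightarrow> (2 - 2 * cos c) / (c\<^sup>2 * 1\<^sup>2)"
    using False by (intro tendsto_intros lim) auto
  moreover have "\<forall>\<^sub>F Q in sequentially. (norm (exp_mean Q c))\<^sup>2 = (2 - 2 * cos c) / (c\<^sup>2 * (sin (c / (2 * real Q)) / (c / (2 * real Q)))\<^sup>2)"
  proof -
    have "\<forall>\<^sub>F Q in sequentially. sin (c / (2 * real Q)) / (c / (2 * real Q)) \<noteq> 0"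
      using lim by (rule tendsto_imp_eventually_ne) simp
    then show ?thesis
      using eventually_gt_at_top[of 0]
    proof eventually_elim
      case (elim Q)
      define x where "x = cis (c / real Q)"
      have sq: "(norm (x - 1))\<^sup>2 = 4 * (sin (c / (2 * real Q)))\<^sup>2"
        unfolding x_def norm_cis_minus_1 using cos_double_sin[of "c / (2 * real Q)"] by simp
      have "x \<noteq> 1" using sq elim by auto
      have "cis (c * real a / real Q) = x ^ a" for a
        unfolding x_def Complex.DeMoivre by (simp add: mult.commute)
      then have "exp_mean Q c = (x ^ Q - 1) / (x - 1) / of_nat Q"
        unfolding exp_mean_def using \<open>x \<noteq> 1\<close> by (simp add: geometric_sum)
      moreover have "x ^ Q = cis c" unfolding x_def Complex.DeMoivre using elim by simp
      ultimately have "(norm (exp_mean Q c))\<^sup>2 = (2 - 2 * cos c) / (4 * (sin (c / (2 * real Q)))\<^sup>2) / (real Q)\<^sup>2"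
        by (simp add: norm_divide norm_mult power_mult_distrib power_divide norm_cis_minus_1 sq)
      also have "\<dots> = (2 - 2 * cos c) / (c\<^sup>2 * (sin (c / (2 * real Q)) / (c / (2 * real Q)))\<^sup>2)"
        using False elim by (simp add: power2_eq_square field_simps)
      finally show ?case .
    qed
  qed
  ultimately show ?thesis using False by (simp add: sinc_square_def tendsto_cong)
qed

text \<open>With u = n \<delta> this averages the symbol over the steps \<delta> (a - b)/Q, all of
  which have modulus at most \<delta>. Subtracting two parameters turns the mean of each exponential
  into a squared modulus.\<close>

definition cos_power_mean :: "nat \<Rightarrow> nat \<Rightarrow> real \<Rightarrow> real" where
  "cos_power_mean m Q u = (\<Sum>a<Q. \<Sum>b<Q. (2 - 2 * cos (u * (real a - real b) / real Q)) ^ m) / (real Q)\<^sup>2"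

definition cos_power_limit :: "nat \<Rightarrow> real \<Rightarrow> real" where
  "cos_power_limit m u = (\<Sum>j\<le>2 * m. (- 1) ^ (j + m) * real (2 * m choose j) * sinc_square ((real j - real m) * u))"

text \<open>The binomial theorem for (1 - e^(iv))^(2m), recentred by the translation
  e^(-imv).\<close>

lemma cos_power_expand:
  "complex_of_real ((2 - 2 * cos v) ^ m) = (\<Sum>j\<le>2 * m. (- 1) ^ (j + m) * of_nat (2 * m choose j) * cis ((real j - real m) * v))"
proof -
  have "of_real (2 - 2 * cos v) = - (cis (- v) * (1 - cis v)\<^sup>2)"
  proof -
    have 1: "cis (- v) * cis v = 1" by (simp add: cis_mult)
    have "cis (- v) * (1 - cis v)\<^sup>2 = cis (- v) - 2 * (cis (- v) * cis v) + (cis (- v) * cis v) * cis v"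
      by (simp add: power2_eq_square algebra_simps del: cis_mult)
    then show ?thesis unfolding 1 by (simp add: complex_eq_iff)
  qed
  then have "complex_of_real ((2 - 2 * cos v) ^ m) = (- (cis (- v) * (1 - cis v)\<^sup>2)) ^ m" by simp
  also have "\<dots> = (- 1) ^ m * cis (- v) ^ m * (- cis v + 1) ^ (2 * m)"
    unfolding power_mult
    by (simp only: power_mult_distrib[symmetric], rule arg_cong[where f = "\<lambda>x. x ^ m"]) simp
  also have "(- cis v + 1) ^ (2 * m) = (\<Sum>j\<le>2 * m. of_nat (2 * m choose j) * (- cis v) ^ j)"
    using binomial_ring[of "- cis v" 1 "2 * m"] by simp
  also have "(- 1) ^ m * cis (- v) ^ m * \<dots> = (\<Sum>j\<le>2 * m. (- 1) ^ (j + m) * of_nat (2 * m choose j) * cis ((real j - real m) * v))"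
    unfolding sum_distrib_left
  proof (rule sum.cong[OF refl])
    fix j
    have "(- 1) ^ m * cis (- v) ^ m * (of_nat (2 * m choose j) * (- cis v) ^ j) = (- 1) ^ (j + m) * of_nat (2 * m choose j) * (cis (- v) ^ m * cis v ^ j)"
      by (simp add: power_minus[of "cis v"] power_add mult_ac)
    also have "cis (- v) ^ m * cis v ^ j = cis ((real j - real m) * v)"
      unfolding Complex.DeMoivre cis_mult by (intro arg_cong[of _ _ cis]) (simp add: algebra_simps)
    finally show "(- 1) ^ m * cis (- v) ^ m * (of_nat (2 * m choose j) * (- cis v) ^ j) = (- 1) ^ (j + m) * of_nat (2 * m choose j) * cis ((real j - real m) * v)" .
  qed
  finally show ?thesis .
qed

lemma sum_cis_difference:
  "(\<Sum>a<Q. \<Sum>b<Q. cis (c * (real a - real b) / real Q)) / (of_nat Q)\<^sup>2 = of_real ((norm (exp_mean Q c))\<^sup>2)"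
proof -
  have "of_real ((norm (\<Sum>a<Q. cis (c * real a / real Q)))\<^sup>2) = (\<Sum>a<Q. \<Sum>b<Q. cis (c * (real a - real b) / real Q))"
    unfolding complex_norm_square
    by (simp add: sum_product cis_cnj cis_mult right_diff_distrib diff_divide_distrib)
  then show ?thesis by (simp add: exp_mean_def norm_divide power_divide)
qed

lemma cos_power_mean_eq: "cos_power_mean m Q u = (\<Sum>j\<le>2 * m. (- 1) ^ (j + m) * real (2 * m choose j) * (norm (exp_mean Q ((real j - real m) * u)))\<^sup>2)"
proof -
  have "complex_of_real (cos_power_mean m Q u) = (\<Sum>a<Q. \<Sum>b<Q. \<Sum>j\<le>2 * m. (- 1) ^ (j + m) * of_nat (2 * m choose j) * cis ((real j - real m) * u * (real a - real b) / real Q)) / (of_nat Q)\<^sup>2"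
    unfolding cos_power_mean_def of_real_divide of_real_sum cos_power_expand by (simp add: mult.assoc)
  also have "(\<Sum>a<Q. \<Sum>b<Q. \<Sum>j\<le>2 * m. (- 1) ^ (j + m) * of_nat (2 * m choose j) * cis ((real j - real m) * u * (real a - real b) / real Q))
     = (\<Sum>j\<le>2 * m. \<Sum>a<Q. \<Sum>b<Q. (- 1) ^ (j + m) * of_nat (2 * m choose j) * cis ((real j - real m) * u * (real a - real b) / real Q))"
  proof -
    have "(\<Sum>b<Q. \<Sum>j\<le>2 * m. F b j) = (\<Sum>j\<le>2 * m. \<Sum>b<Q. F b j)" for F :: "nat \<Rightarrow> nat \<Rightarrow> complex"
      by (rule sum.swap)
    then show ?thesis by (simp only:)
  qed
  also have "\<dots> / (of_nat Q)\<^sup>2 = (\<Sum>j\<le>2 * m. (- 1) ^ (j + m) * of_nat (2 * m choose j) *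
      ((\<Sum>a<Q. \<Sum>b<Q. cis ((real j - real m) * u * (real a - real b) / real Q)) / (of_nat Q)\<^sup>2))"
    by (simp add: sum_divide_distrib sum_distrib_left)
  also have "\<dots> = of_real (\<Sum>j\<le>2 * m. (- 1) ^ (j + m) * real (2 * m choose j) * (norm (exp_mean Q ((real j - real m) * u)))\<^sup>2)"
    unfolding sum_cis_difference by simp
  finally show ?thesis by (simp only: of_real_eq_iff)
qed

lemma cos_power_mean_tendsto: "(\<lambda>Q. cos_power_mean m Q u) \<longlonglongrightarrow> cos_power_limit m u"
  unfolding cos_power_mean_eq cos_power_limit_def by (intro tendsto_intros exp_mean_tendsto)

text \<open>Bernoulli's inequality bounds the mean of the \<open>m\<close>-th powers from below by the
  plain mean.\<close>

lemma cos_power_mean_ge: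
  assumes "0 < Q"
  shows "1 + real m * (1 - 2 * (norm (exp_mean Q u))\<^sup>2) \<le> cos_power_mean m Q u"
proof -
  have avg: "(\<Sum>a<Q. \<Sum>b<Q. cos (u * (real a - real b) / real Q)) / (real Q)\<^sup>2 = (norm (exp_mean Q u))\<^sup>2"
    using arg_cong[OF sum_cis_difference[of u Q], of Re] by (simp add: Re_divide_of_real of_nat_power[symmetric] del: of_nat_power)
  have "(\<Sum>a<Q. \<Sum>b<Q. 1 + real m * (1 - 2 * cos (u * (real a - real b) / real Q))) \<le> (\<Sum>a<Q. \<Sum>b<Q. (2 - 2 * cos (u * (real a - real b) / real Q)) ^ m)"
  proof (intro sum_mono)
    fix a b
    have "1 + real m * (1 - 2 * cos (u * (real a - real b) / real Q)) \<le> (1 + (1 - 2 * cos (u * (real a - real b) / real Q))) ^ m"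
      by (rule Bernoulli_inequality) simp
    then show "1 + real m * (1 - 2 * cos (u * (real a - real b) / real Q)) \<le> (2 - 2 * cos (u * (real a - real b) / real Q)) ^ m"
      by simp
  qed
  then have "(\<Sum>a<Q. \<Sum>b<Q. 1 + real m * (1 - 2 * cos (u * (real a - real b) / real Q))) / (real Q)\<^sup>2 \<le> cos_power_mean m Q u"
    unfolding cos_power_mean_def by (rule divide_right_mono) simp
  moreover have "(\<Sum>a<Q. \<Sum>b<Q. 1 + real m * (1 - 2 * cos (u * (real a - real b) / real Q)))
      = (1 + real m) * (real Q)\<^sup>2 - 2 * real m * (\<Sum>a<Q. \<Sum>b<Q. cos (u * (real a - real b) / real Q))"
    by (simp add: sum.distrib sum_subtractf sum_distrib_left algebra_simps power2_eq_square)
  moreover have "((1 + real m) * (real Q)\<^sup>2 - 2 * real m * S) / (real Q)\<^sup>2 = (1 + real m) - 2 * real m * (S / (real Q)\<^sup>2)" for S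
    using assms by (simp add: diff_divide_distrib)
  ultimately have "(1 + real m) - 2 * real m * (norm (exp_mean Q u))\<^sup>2 \<le> cos_power_mean m Q u"
    using avg by (simp only:)
  then show ?thesis by (simp add: algebra_simps)
qed

text \<open>For u at least 3, \<open>sinc_square u\<close> is at most 4/9, so the correction in the
  Bernoulli bound is nonnegative for every m.\<close>

lemma cos_power_limit_ge_1:
  assumes "3 \<le> u"
  shows "1 \<le> cos_power_limit m u"
proof -
  have "1 + real m * (1 - 2 * sinc_square u) \<le> cos_power_limit m u"
  proof (rule tendsto_le[OF _ cos_power_mean_tendsto])
    show "(\<lambda>Q. 1 + real m * (1 - 2 * (norm (exp_mean Q u))\<^sup>2)) \<longlonglongrightarrow> 1 + real m * (1 - 2 * sinc_square u)"
      by (intro tendsto_intros exp_mean_tendsto)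
    show "\<forall>\<^sub>F Q in sequentially. 1 + real m * (1 - 2 * (norm (exp_mean Q u))\<^sup>2) \<le> cos_power_mean m Q u"
      using eventually_gt_at_top[of 0] by eventually_elim (rule cos_power_mean_ge)
  qed simp
  moreover have "sinc_square u \<le> 1 / 2"
  proof -
    have "3\<^sup>2 \<le> u\<^sup>2" using assms by (intro power_mono) auto
    moreover have "2 - 2 * cos u \<le> 4" using cos_ge_minus_one[of u] by linarith
    ultimately show ?thesis using assms by (simp add: sinc_square_def divide_simps)
  qed
  then have "0 \<le> real m * (1 - 2 * sinc_square u)" by simp
  ultimately show ?thesis by linarith
qed

text \<open>The bound is a difference of consecutive values of 9/u, so it telescopes along u = n
  \<delta> with a total independent of \<delta>. The factor l stands for the integer frequencies of
  the expansion; the gap between 0 and 1 keeps the bound uniform in it.\<close>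

lemma sinc_square_diff:
  assumes u: "3 \<le> u" and \<delta>: "0 < \<delta>" "\<delta> \<le> pi" and l: "l = 0 \<or> 1 \<le> \<bar>l\<bar>"
  shows "\<bar>sinc_square (l * (u + \<delta>)) - sinc_square (l * u)\<bar> \<le> 9 * (1 / u - 1 / (u + \<delta>))"
proof (cases "l = 0")
  case True
  then show ?thesis using u \<delta> by (simp add: sinc_square_def frac_le)
next
  case False
  define v where "v = u + \<delta>"
  define D where "D = 1 / u - 1 / v"
  have uv: "0 < u" "0 < v" "u < v" using u \<delta> by (auto simp: v_def)
  have D: "0 < D" using uv by (simp add: D_def frac_less2)
  have l1: "1 \<le> \<bar>l\<bar>" using l False by simp
  have l2: "1 \<le> l\<^sup>2" using power_mono[OF l1, of 2] by simp
  \<comment> \<open>First the numerator changes over the old denominator, then the denominator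
    changes. The two parts are bounded by 6 and 3 times \<open>D\<close>, which gives the constant
    9.\<close>
  have eq: "sinc_square (l * v) - sinc_square (l * u) = (2 * cos (l * u) - 2 * cos (l * v)) / (l\<^sup>2 * u\<^sup>2) - (2 - 2 * cos (l * v)) * ((1 / u\<^sup>2 - 1 / v\<^sup>2) / l\<^sup>2)"
    using False uv by (simp add: sinc_square_def power_mult_distrib field_simps)
  have A: "\<bar>(2 - 2 * cos (l * v)) * ((1 / u\<^sup>2 - 1 / v\<^sup>2) / l\<^sup>2)\<bar> \<le> 3 * D"
  proof -
    have f: "1 / u\<^sup>2 - 1 / v\<^sup>2 = D * (1 / u + 1 / v)"
      using uv by (simp add: D_def power2_eq_square field_simps)
    have "1 / u \<le> 1 / 3" "1 / v \<le> 1 / 3" using u uv by (auto intro!: frac_le)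
    then have "1 / u\<^sup>2 - 1 / v\<^sup>2 \<le> D * (2 / 3)" unfolding f using D by (intro mult_left_mono) auto
    moreover have nn: "0 \<le> 1 / u\<^sup>2 - 1 / v\<^sup>2" unfolding f using D uv by simp
    ultimately have "(1 / u\<^sup>2 - 1 / v\<^sup>2) / l\<^sup>2 \<le> D * (2 / 3) / 1"
      using l2 by (intro frac_le) auto
    then have "(1 / u\<^sup>2 - 1 / v\<^sup>2) / l\<^sup>2 \<le> D * (2 / 3)" by simp
    moreover have "0 \<le> 2 - 2 * cos (l * v)" "2 - 2 * cos (l * v) \<le> 4"
      using cos_ge_minus_one[of "l * v"] cos_le_one[of "l * v"] by linarith+
    ultimately have "(2 - 2 * cos (l * v)) * ((1 / u\<^sup>2 - 1 / v\<^sup>2) / l\<^sup>2) \<le> 4 * (D * (2 / 3))"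
      using nn D by (intro mult_mono) auto
    moreover have "0 \<le> (2 - 2 * cos (l * v)) * ((1 / u\<^sup>2 - 1 / v\<^sup>2) / l\<^sup>2)"
      using nn \<open>0 \<le> 2 - 2 * cos (l * v)\<close> by simp
    ultimately show ?thesis using D by simp
  qed
  have B: "\<bar>(2 * cos (l * u) - 2 * cos (l * v)) / (l\<^sup>2 * u\<^sup>2)\<bar> \<le> 6 * D"
  proof -
    have "\<bar>cos (l * u) - cos (l * v)\<bar> \<le> \<bar>l * u - l * v\<bar>"
    proof -
      have "cos (l * u) - cos (l * v) = 2 * sin ((l * u + l * v) / 2) * sin ((l * v - l * u) / 2)"
        by (rule cos_diff_cos)
      then have "\<bar>cos (l * u) - cos (l * v)\<bar> = 2 * (\<bar>sin ((l * u + l * v) / 2)\<bar> * \<bar>sin ((l * v - l * u) / 2)\<bar>)"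
        by (simp add: abs_mult)
      also have "\<dots> \<le> 2 * (1 * \<bar>(l * v - l * u) / 2\<bar>)"
        by (intro mult_left_mono mult_mono abs_sin_x_le_abs_x) auto
      finally show ?thesis by simp
    qed
    also have "\<bar>l * u - l * v\<bar> = \<bar>l\<bar> * \<delta>" using \<delta> by (simp add: v_def right_diff_distrib[symmetric] abs_mult)
    finally have 1: "\<bar>2 * cos (l * u) - 2 * cos (l * v)\<bar> \<le> 2 * (\<bar>l\<bar> * \<delta>)" by linarith
    have "\<bar>(2 * cos (l * u) - 2 * cos (l * v)) / (l\<^sup>2 * u\<^sup>2)\<bar> = \<bar>2 * cos (l * u) - 2 * cos (l * v)\<bar> / (l\<^sup>2 * u\<^sup>2)"
      by (simp add: abs_mult)
    also have "\<dots> \<le> 2 * (\<bar>l\<bar> * \<delta>) / (l\<^sup>2 * u\<^sup>2)" by (intro divide_right_mono 1) simp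
    also have "\<dots> = 2 * \<delta> / u\<^sup>2 * (1 / \<bar>l\<bar>)" using False by (simp add: power2_eq_square abs_mult_self_eq[of l, symmetric] del: abs_mult_self_eq)
    also have "\<dots> \<le> 2 * \<delta> / u\<^sup>2 * 1" using l1 \<delta> by (intro mult_left_mono) auto
    also have "\<dots> = 2 * D * (v / u)"
    proof -
      have "D = \<delta> / (u * v)" using uv by (simp add: D_def diff_frac_eq) (simp add: v_def)
      then show ?thesis using uv by (simp add: power2_eq_square)
    qed
    also have "\<dots> \<le> 2 * D * 3"
    proof -
      have "v \<le> 3 * u" using u \<delta> pi_less_4 by (simp add: v_def)
      then have "v / u \<le> 3" using uv by (simp add: field_simps)
      then show ?thesis using D by (intro mult_left_mono) auto
    qed
    finally show ?thesis by simp
  qed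
  have "\<bar>sinc_square (l * v) - sinc_square (l * u)\<bar> \<le> \<bar>(2 * cos (l * u) - 2 * cos (l * v)) / (l\<^sup>2 * u\<^sup>2)\<bar> + \<bar>(2 - 2 * cos (l * v)) * ((1 / u\<^sup>2 - 1 / v\<^sup>2) / l\<^sup>2)\<bar>"
    unfolding eq by (rule abs_triangle_ineq4)
  with A B show ?thesis unfolding v_def[symmetric] D_def[symmetric] by linarith
qed

lemma cos_power_limit_diff:
  assumes u: "3 \<le> u" and \<delta>: "0 < \<delta>" "\<delta> \<le> pi"
  shows "\<bar>cos_power_limit m (u + \<delta>) - cos_power_limit m u\<bar> \<le> 9 * 4 ^ m * (1 / u - 1 / (u + \<delta>))"
proof -
  have "cos_power_limit m (u + \<delta>) - cos_power_limit m u = (\<Sum>j\<le>2 * m. (- 1) ^ (j + m) * real (2 * m choose j) * (sinc_square ((real j - real m) * (u + \<delta>)) - sinc_square ((real j - real m) * u)))"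
    unfolding cos_power_limit_def by (simp add: sum_subtractf right_diff_distrib)
  also have "\<bar>\<dots>\<bar> \<le> (\<Sum>j\<le>2 * m. real (2 * m choose j) * (9 * (1 / u - 1 / (u + \<delta>))))"
  proof (rule order_trans[OF sum_abs], rule sum_mono)
    fix j
    have "real j - real m = 0 \<or> 1 \<le> \<bar>real j - real m\<bar>"
    proof (cases j m rule: linorder_cases)
      case less
      then have "real (Suc j) \<le> real m" by (simp only: of_nat_le_iff Suc_le_eq)
      then show ?thesis by simp
    next
      case greater
      then have "real (Suc m) \<le> real j" by (simp only: of_nat_le_iff Suc_le_eq)
      then show ?thesis by simp
    qed simp
    from sinc_square_diff[OF u \<delta> this]
    show "\<bar>(- 1) ^ (j + m) * real (2 * m choose j) * (sinc_square ((real j - real m) * (u + \<delta>)) - sinc_square ((real j - real m) * u))\<bar>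
      \<le> real (2 * m choose j) * (9 * (1 / u - 1 / (u + \<delta>)))"
      by (simp add: abs_mult power_abs mult_left_mono)
  qed
  also have "\<dots> = real (\<Sum>j\<le>2 * m. 2 * m choose j) * (9 * (1 / u - 1 / (u + \<delta>)))"
    by (simp add: sum_distrib_right)
  also have "(\<Sum>j\<le>2 * m. 2 * m choose j) = 4 ^ m" by (simp only: choose_row_sum) (simp add: power_mult)
  finally show ?thesis by (simp only: of_nat_power of_nat_numeral mult_ac)
qed

text \<open>A discrete form of Jackson's theorem: averaging the powers \<open>(2 - 2 cos (n h))\<^sup>m\<close> over the
  steps \<open>h = \<delta> (a - b) / Q\<close> yields a multiplier whose reciprocal has bounded variation off the
  low frequencies.\<close>

theorem high_frequency_bound:
  assumes p: "1 < p" and \<alpha>: "0 < \<alpha>"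
  shows "\<exists>C. 0 \<le> C \<and> (\<forall>\<delta> A c W. 0 < \<delta> \<and> \<delta> \<le> pi \<and> finite A \<and>
     (\<forall>h. \<bar>h\<bar> \<le> \<delta> \<longrightarrow> Lp_norm p (trig_poly A (\<lambda>k. diff_symbol \<alpha> h (fst k) * c k)) \<le> W) \<longrightarrow>
     Lp_norm p (trig_poly A (\<lambda>k. (if \<bar>of_int (fst k)\<bar> * \<delta> \<le> 3 then 0 else 1) * c k)) \<le> C * W)"
proof -
  obtain R where R: "\<And>j. multiplier p R (\<lambda>k. if j \<le> fst k then 1 else 0)"
    using multiplier_half_line[OF p] by blast
  have p1: "1 \<le> p" using p by auto
  have R0: "0 \<le> R" using R multiplier_nonneg by blast
  \<comment> \<open>The complementary order \<open>\<beta> = 2 * m - \<alpha>\<close> has to be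
    positive for its difference series to converge absolutely.\<close>
  obtain m :: nat where m: "\<alpha> < real m" using reals_Archimedean2 by blast
  then have m2: "\<alpha> < 2 * real m" using \<alpha> by linarith
  define \<beta> where "\<beta> = 2 * real m - \<alpha>"
  have \<beta>: "0 < \<beta>" using m2 by (simp add: \<beta>_def)
  define L where "L = (9 * 4 ^ m :: real)"
  define C where "C = 1 + 2 * (L / 3 + 1) * R"
  have C0: "0 \<le> C" using R0 by (simp add: C_def L_def)
  show ?thesis
  proof (intro exI[of _ "C * diff_coeff_norm \<beta>"] conjI allI impI)
    show "0 \<le> C * diff_coeff_norm \<beta>" using C0 diff_coeff_norm_nonneg[OF \<beta>] by simp
    fix \<delta> A c W
    assume *: "0 < \<delta> \<and> \<delta> \<le> pi \<and> finite A \<and>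
     (\<forall>h. \<bar>h\<bar> \<le> \<delta> \<longrightarrow> Lp_norm p (trig_poly A (\<lambda>k. diff_symbol \<alpha> h (fst k) * c k)) \<le> W)"
    then have \<delta>: "0 < \<delta>" "\<delta> \<le> pi" and A: "finite A"
      and W: "\<And>h. \<bar>h\<bar> \<le> \<delta> \<Longrightarrow> Lp_norm p (trig_poly A (\<lambda>k. diff_symbol \<alpha> h (fst k) * c k)) \<le> W" by auto
    define v where "v = (\<lambda>j::nat. if real j * \<delta> \<le> 3 then 0 else 1 / cos_power_limit m (real j * \<delta>))"
    \<comment> \<open>A monotone majorant of the variation of \<open>v\<close>: constant on the low
      side, a jump of at least 1 at the border to cover the jump of \<open>v\<close> from 0 to a
      value at most 1, and the telescoping bound -L/u beyond. Its total rise is below L/3 +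
      1.\<close>
    define G where "G = (\<lambda>j::nat. if real j * \<delta> \<le> 3 then - (L / 3) - 1 else - (L / (real j * \<delta>)))"
    have L: "0 < L" by (simp add: L_def)
    have vb: "0 \<le> v j" "v j \<le> 1" for j
      using cos_power_limit_ge_1[of "real j * \<delta>" m] by (auto simp: v_def)
    have mv: "multiplier p C (\<lambda>k. of_real (v (nat \<bar>fst k\<bar>)))"
      unfolding C_def
    proof (rule multiplier_even[OF p1 R, where G = G])
      show "norm (complex_of_real (v n)) \<le> 1" for n using vb[of n] by simp
      show "G n - G 0 \<le> L / 3 + 1" for n
        using L \<delta> by (auto simp: G_def)
      fix n
      define u where "u = real n * \<delta>"
      have Su: "real (Suc n) * \<delta> = u + \<delta>" by (simp add: u_def algebra_simps)
      have "\<bar>v (Suc n) - v n\<bar> \<le> G (Suc n) - G n"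
      proof (cases "u \<le> 3")
        case True
        show ?thesis
        proof (cases "u + \<delta> \<le> 3")
          case True
          then show ?thesis using \<open>u \<le> 3\<close> unfolding v_def G_def Su u_def[symmetric] by simp
        next
          case False
          have "L / (u + \<delta>) \<le> L / 3" using False L by (intro divide_left_mono) auto
          moreover have "\<bar>v (Suc n) - v n\<bar> \<le> 1" using vb[of n] vb[of "Suc n"] by linarith
          ultimately show ?thesis using True False unfolding G_def Su u_def[symmetric] by simp
        qed
      next
        case False
        then have u: "3 \<le> u" "\<not> u + \<delta> \<le> 3" using \<delta> by auto
        have q: "1 \<le> cos_power_limit m u" "1 \<le> cos_power_limit m (u + \<delta>)" using u \<delta> by (auto intro!: cos_power_limit_ge_1)
        have "\<bar>v (Suc n) - v n\<bar> = \<bar>1 / cos_power_limit m (u + \<delta>) - 1 / cos_power_limit m u\<bar>"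
          using False u unfolding v_def Su u_def[symmetric] by simp
        also have "\<dots> = \<bar>cos_power_limit m (u + \<delta>) - cos_power_limit m u\<bar> / (cos_power_limit m (u + \<delta>) * cos_power_limit m u)"
        proof -
          have "1 / cos_power_limit m (u + \<delta>) - 1 / cos_power_limit m u = - ((cos_power_limit m (u + \<delta>) - cos_power_limit m u) / (cos_power_limit m (u + \<delta>) * cos_power_limit m u))"
            using q by (simp add: field_simps)
          then show ?thesis using q by (simp add: abs_mult)
        qed
        also have "\<dots> \<le> \<bar>cos_power_limit m (u + \<delta>) - cos_power_limit m u\<bar> / 1"
          using q mult_mono[of 1 "cos_power_limit m (u + \<delta>)" 1 "cos_power_limit m u"] by (intro divide_left_mono) auto
        also have "\<dots> \<le> L * (1 / u - 1 / (u + \<delta>))"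
          unfolding L_def using cos_power_limit_diff[OF u(1) \<delta>, of m] by simp
        finally show ?thesis using False u unfolding G_def Su u_def[symmetric] by (simp add: right_diff_distrib)
      qed
      then show "norm (complex_of_real (v (Suc n)) - complex_of_real (v n)) \<le> G (Suc n) - G n"
        by (simp only: of_real_diff[symmetric] norm_of_real)
    qed
    define q where "q = (\<lambda>k::int\<times>int. cos_power_limit m (real (nat \<bar>fst k\<bar>) * \<delta>))"
    \<comment> \<open>The high-frequency cutoff is the averaged symbol \<open>q\<close> times its
      truncated reciprocal \<open>v\<close>: the first factor is controlled by the hypothesis on the
      differences, the second by bounded variation.\<close>
    have split: "(if \<bar>of_int (fst k)\<bar> * \<delta> \<le> 3 then 0 else 1) = complex_of_real (v (nat \<bar>fst k\<bar>)) * of_real (q k)" for k :: "int \<times> int"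
    proof (cases "\<bar>of_int (fst k)\<bar> * \<delta> \<le> 3")
      case False
      then have "1 \<le> cos_power_limit m (\<bar>of_int (fst k)\<bar> * \<delta>)" by (intro cos_power_limit_ge_1) simp
      with False show ?thesis by (simp add: v_def q_def)
    qed (simp add: v_def)
    \<comment> \<open>For one step h the bound \<open>W\<close> on the difference of order \<alpha>
      passes to order 2 m, at the cost of the bounded multiplier of order \<beta>.\<close>
    have bX: "Lp_norm p (trig_poly A (\<lambda>k. of_real ((2 - 2 * cos (of_int (fst k) * h)) ^ m) * c k)) \<le> diff_coeff_norm \<beta> * W" if "\<bar>h\<bar> \<le> \<delta>" for h
    proof -
      have "multiplier p (norm ((- 1 :: complex) ^ m) * 1 * diff_coeff_norm \<beta>) (\<lambda>k. (- 1) ^ m * cis (of_int (fst k) * (- (real m * h))) * diff_symbol \<beta> h (fst k))"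
        using p by (intro multiplier_prod multiplier_const multiplier_cis_fst multiplier_diff_symbol \<beta>) auto
      from multiplierD[OF this A, of "\<lambda>k. diff_symbol \<alpha> h (fst k) * c k"]
      have "Lp_norm p (trig_poly A (\<lambda>k. of_real ((2 - 2 * cos (of_int (fst k) * h)) ^ m) * c k))
          \<le> diff_coeff_norm \<beta> * Lp_norm p (trig_poly A (\<lambda>k. diff_symbol \<alpha> h (fst k) * c k))"
        unfolding cos_power_factor[OF \<alpha> m2] \<beta>_def by (simp add: norm_power mult.assoc)
      also have "\<dots> \<le> diff_coeff_norm \<beta> * W" by (intro mult_left_mono W that diff_coeff_norm_nonneg \<beta>)
      finally show ?thesis .
    qed
    have "Lp_norm p (trig_poly A (\<lambda>k. of_real (q k) * c k)) \<le> diff_coeff_norm \<beta> * W"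
    proof (rule Lp_norm_trig_poly_limit[OF p1 A, where W = "\<lambda>_. diff_coeff_norm \<beta> * W"
          and b = "\<lambda>Q k. of_real (cos_power_mean m Q (real (nat \<bar>fst k\<bar>) * \<delta>)) * c k"])
      show "(\<lambda>Q. of_real (cos_power_mean m Q (real (nat \<bar>fst k\<bar>) * \<delta>)) * c k) \<longlonglongrightarrow> of_real (q k) * c k" for k
        unfolding q_def by (intro tendsto_intros cos_power_mean_tendsto)
      show "\<forall>\<^sub>F Q in sequentially. Lp_norm p (trig_poly A (\<lambda>k. of_real (cos_power_mean m Q (real (nat \<bar>fst k\<bar>) * \<delta>)) * c k)) \<le> diff_coeff_norm \<beta> * W"
        using eventually_gt_at_top[of 0]
      proof eventually_elim
        case (elim Q)
        \<comment> \<open>The steps of the average; since a and b are below Q they stay within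
          [-\<delta>, \<delta>], the range in which \<open>W\<close> is available.\<close>
        define h where "h = (\<lambda>a b. \<delta> * (real a - real b) / real Q)"
        have h: "\<bar>h a b\<bar> \<le> \<delta>" if "a < Q" "b < Q" for a b
        proof -
          have "\<bar>real a - real b\<bar> \<le> real Q" using that by linarith
          then have "\<delta> * (\<bar>real a - real b\<bar> / real Q) \<le> \<delta> * 1" using \<delta> elim by (intro mult_left_mono) auto
          then show ?thesis using \<delta> by (simp add: h_def abs_mult)
        qed
        have cosabs: "cos (real (nat \<bar>n\<bar>) * x) = cos (of_int n * x)" for n :: int and x
          by (cases "0 \<le> n") simp_all
        have "of_real (cos_power_mean m Q (real (nat \<bar>fst k\<bar>) * \<delta>)) * c k
          = of_real (1 / (real Q)\<^sup>2) * (\<Sum>ab\<in>{..<Q}\<times>{..<Q}. of_real ((2 - 2 * cos (of_int (fst k) * h (fst ab) (snd ab))) ^ m) * c k)" for k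
        proof -
          have "cos (real (nat \<bar>fst k\<bar>) * \<delta> * (real a - real b) / real Q) = cos (of_int (fst k) * h a b)" for a b
            using cosabs[of "fst k" "h a b"] by (simp add: h_def mult.assoc)
          then have "cos_power_mean m Q (real (nat \<bar>fst k\<bar>) * \<delta>) = (1 / (real Q)\<^sup>2) * (\<Sum>ab\<in>{..<Q}\<times>{..<Q}. (2 - 2 * cos (of_int (fst k) * h (fst ab) (snd ab))) ^ m)"
            by (simp add: cos_power_mean_def sum.cartesian_product case_prod_unfold)
          then show ?thesis by (simp add: sum_distrib_right mult.assoc)
        qed
        then have "Lp_norm p (trig_poly A (\<lambda>k. of_real (cos_power_mean m Q (real (nat \<bar>fst k\<bar>) * \<delta>)) * c k))
          = Lp_norm p (trig_poly A (\<lambda>k. of_real (1 / (real Q)\<^sup>2) * (\<Sum>ab\<in>{..<Q}\<times>{..<Q}. of_real ((2 - 2 * cos (of_int (fst k) * h (fst ab) (snd ab))) ^ m) * c k)))"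
          by (simp only:)
        also have "\<dots> \<le> norm (complex_of_real (1 / (real Q)\<^sup>2)) * Lp_norm p (trig_poly A (\<lambda>k. \<Sum>ab\<in>{..<Q}\<times>{..<Q}. of_real ((2 - 2 * cos (of_int (fst k) * h (fst ab) (snd ab))) ^ m) * c k))"
          using p by (intro multiplierD[OF multiplier_const A]) auto
        also have "\<dots> \<le> 1 / (real Q)\<^sup>2 * (\<Sum>ab\<in>{..<Q}\<times>{..<Q}. diff_coeff_norm \<beta> * W)"
        proof (rule mult_mono)
          have "Lp_norm p (trig_poly A (\<lambda>k. \<Sum>ab\<in>{..<Q}\<times>{..<Q}. of_real ((2 - 2 * cos (of_int (fst k) * h (fst ab) (snd ab))) ^ m) * c k))
            \<le> (\<Sum>ab\<in>{..<Q}\<times>{..<Q}. Lp_norm p (trig_poly A (\<lambda>k. of_real ((2 - 2 * cos (of_int (fst k) * h (fst ab) (snd ab))) ^ m) * c k)))"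
            by (rule Lp_norm_trig_poly_sum[OF p1]) simp
          also have "\<dots> \<le> (\<Sum>ab\<in>{..<Q}\<times>{..<Q}. diff_coeff_norm \<beta> * W)"
            by (intro sum_mono bX h) auto
          finally show "Lp_norm p (trig_poly A (\<lambda>k. \<Sum>ab\<in>{..<Q}\<times>{..<Q}. of_real ((2 - 2 * cos (of_int (fst k) * h (fst ab) (snd ab))) ^ m) * c k)) \<le> (\<Sum>ab\<in>{..<Q}\<times>{..<Q}. diff_coeff_norm \<beta> * W)" .
        qed (auto simp: norm_divide norm_power)
        also have "\<dots> = diff_coeff_norm \<beta> * W" using elim by (simp add: power2_eq_square)
        finally show ?case .
      qed
    qed simp
    moreover have "Lp_norm p (trig_poly A (\<lambda>k. of_real (v (nat \<bar>fst k\<bar>)) * (of_real (q k) * c k))) \<le> C * Lp_norm p (trig_poly A (\<lambda>k. of_real (q k) * c k))"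
      by (rule multiplierD[OF mv A])
    ultimately have "Lp_norm p (trig_poly A (\<lambda>k. of_real (v (nat \<bar>fst k\<bar>)) * (of_real (q k) * c k))) \<le> C * (diff_coeff_norm \<beta> * W)"
      using C0 by (meson mult_left_mono order_trans)
    then show "Lp_norm p (trig_poly A (\<lambda>k. (if \<bar>of_int (fst k)\<bar> * \<delta> \<le> 3 then 0 else 1) * c k)) \<le> C * diff_coeff_norm \<beta> * W"
      unfolding split by (simp add: mult.assoc)
  qed
qed

section \<open>Fractional differences of functions in Lp\<close>

text \<open>The plane is covered by countably many translates of the closed square, so the
  exceptional sets still form a null set. Null sets on the whole plane are what remain null under
  arbitrary shifts.\<close>

lemma AE_T2_periodic:
  assumes ae: "AE z in T2. P z"
    and per: "\<And>x y. P (x + 2 * pi, y) = P (x, y)" "\<And>x y. P (x, y + 2 * pi) = P (x, y)"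
  shows "AE z in lebesgue. P z"
proof -
  have "AE z in lebesgue. z \<in> closed_square \<longrightarrow> P z"
    using ae unfolding T2_def by (subst (asm) AE_restrict_space_iff) auto
  then have "AE z in lebesgue. \<forall>(m::int) (n::int). z + (- (of_int m * (2 * pi)), - (of_int n * (2 * pi))) \<in> closed_square \<longrightarrow>
       P (z + (- (of_int m * (2 * pi)), - (of_int n * (2 * pi))))"
    unfolding AE_all_countable by (intro allI AE_lebesgue_shift)
  then show ?thesis
  proof eventually_elim
    case (elim z)
    obtain s m where s: "0 \<le> s" "s < 2 * pi" "fst z = s + of_int m * (2 * pi)" using mod_2pi by blast
    obtain t n where t: "0 \<le> t" "t < 2 * pi" "snd z = t + of_int n * (2 * pi)" using mod_2pi by blast
    have "z + (- (of_int m * (2 * pi)), - (of_int n * (2 * pi))) = (s, t)"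
      using s(3) t(3) by (cases z) simp
    then have "P (s, t)" using elim[rule_format, of m n] s t by simp
    then have "P (fst z, snd z)"
      unfolding s(3) t(3)
      using periodic_int_multiple[of "\<lambda>x. P (x, t + of_int n * (2 * pi))" s m] per
        periodic_int_multiple[of "\<lambda>y. P (s, y)" t n] by simp
    then show ?case by simp
  qed
qed

lemma Lp_eq_AE:
  assumes "AE z in T2. f z = g z" "periodic2 f" "periodic2 g"
  shows "AE z in lebesgue. f z = g z"
  using assms by (intro AE_T2_periodic) (auto simp: periodic2_def)

lemma powr_tangent:
  fixes p s :: real
  assumes p: "1 \<le> p" and s: "0 \<le> s"
  shows "p * s \<le> s powr p + (p - 1)"
proof (cases "p = 1 \<or> s = 0")
  case True
  then show ?thesis using assms by auto
next
  case False
  have "((s powr p) powr (1/p)) * (1 powr (1 - 1/p)) \<le> (1/p) * s powr p + (1 - 1/p) * 1"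
    using False assms by (intro Youngs_inequality_0) auto
  then have "s \<le> (1/p) * s powr p + (1 - 1/p)" using s False p by (simp add: powr_powr)
  then have "p * s \<le> p * ((1/p) * s powr p + (1 - 1/p))" using p by (intro mult_left_mono) auto
  then show ?thesis using p by (simp add: distrib_left right_diff_distrib)
qed

text \<open>Jensen's inequality for a series with weights c: the tangent bound
  \<open>powr_tangent\<close> is applied to a_n / t, where t = S/B is the weighted mean, and
  summed.\<close>

lemma suminf_powr_le:
  fixes c a :: "nat \<Rightarrow> real"
  assumes p: "1 \<le> p" and c: "summable c" "\<And>n. 0 \<le> c n" and a: "\<And>n. 0 \<le> a n"
    and sm: "summable (\<lambda>n. c n * a n powr p)" "summable (\<lambda>n. c n * a n)"
  shows "(\<Sum>n. c n * a n) powr p \<le> suminf c powr (p - 1) * (\<Sum>n. c n * a n powr p)"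
proof -
  define S where "S = (\<Sum>n. c n * a n)"
  define B where "B = suminf c"
  define T where "T = (\<Sum>n. c n * a n powr p)"
  have S0: "0 \<le> S" unfolding S_def using c a by (intro suminf_nonneg sm) auto
  have B0: "0 \<le> B" unfolding B_def using c by (intro suminf_nonneg) auto
  have T0: "0 \<le> T" unfolding T_def using c by (intro suminf_nonneg sm) auto
  show ?thesis
  proof (cases "S = 0")
    case True
    then show ?thesis using T0 p unfolding S_def[symmetric] T_def[symmetric] by simp
  next
    case False
    then have S: "0 < S" using S0 by simp
    have "B \<noteq> 0"
    proof
      assume "B = 0"
      then have "c = (\<lambda>n. 0)" using suminf_eq_zero_iff[OF c(1)] c(2) by (auto simp: B_def)
      then show False using False by (simp add: S_def)
    qed
    then have B: "0 < B" using B0 by simp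
    define t where "t = S / B"
    have t: "0 < t" using S B by (simp add: t_def)
    have pt: "c n * (p * (a n / t)) \<le> c n * ((a n / t) powr p + (p - 1))" for n
      using a t c by (intro mult_left_mono powr_tangent[OF p]) auto
    have s1: "(\<lambda>n. p / t * (c n * a n)) sums (p / t * S)"
      unfolding S_def using sm(2) by (intro sums_mult summable_sums)
    have s2: "(\<lambda>n. t powr (- p) * (c n * a n powr p) + (p - 1) * c n) sums (t powr (- p) * T + (p - 1) * B)"
      unfolding T_def B_def using sm(1) c(1) by (intro sums_add sums_mult summable_sums)
    have "p / t * S \<le> t powr (- p) * T + (p - 1) * B"
    proof (rule sums_le[OF _ s1 s2])
      fix n
      show "p / t * (c n * a n) \<le> t powr (- p) * (c n * a n powr p) + (p - 1) * c n"
        using pt[of n] a t by (simp add: powr_divide powr_minus field_simps)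
    qed
    moreover have "p / t * S = p * B" using S B by (simp add: t_def)
    ultimately have "B \<le> t powr (- p) * T" by (simp add: algebra_simps)
    then have "t powr p * B \<le> t powr p * (t powr (- p) * T)" by (intro mult_left_mono) auto
    then have "t powr p * B \<le> T" using t by (simp add: mult.assoc[symmetric] powr_add[symmetric])
    then have "B powr (p - 1) * (t powr p * B) \<le> B powr (p - 1) * T" by (intro mult_left_mono) auto
    moreover have "B powr (p - 1) * (t powr p * B) = S powr p"
      using S B powr_add[of B "p - 1" 1] by (simp add: t_def powr_divide mult_ac)
    ultimately show ?thesis unfolding S_def B_def T_def by simp
  qed
qed

text \<open>The direction w is arbitrary, so that the differences in x and in y are treated at once.
  Where the series diverges the value is that of \<open>suminf\<close>, which affects only a null
  set for functions in \<open>Lp\<close>.\<close>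

definition frac_diff :: "real \<Rightarrow> real \<times> real \<Rightarrow> (real \<times> real \<Rightarrow> complex) \<Rightarrow> real \<times> real \<Rightarrow> complex" where
  "frac_diff \<alpha> w f z = (\<Sum>\<nu>. diff_coeff \<alpha> \<nu> *\<^sub>R f (z + (\<alpha> - real \<nu>) *\<^sub>R w))"

lemma diff1_frac_diff: "diff1 \<alpha> h f = frac_diff \<alpha> (h, 0) f"
  by (auto simp: diff1_def frac_diff_def diff_coeff_def fun_eq_iff)

lemma diff2_frac_diff: "diff2 \<alpha> h f = frac_diff \<alpha> (0, h) f"
  by (auto simp: diff2_def frac_diff_def diff_coeff_def fun_eq_iff)

lemma periodic2_frac_diff:
  assumes "periodic2 f"
  shows "periodic2 (frac_diff \<alpha> w f)"
proof -
  have "f ((x + 2 * pi, y) + v) = f ((x, y) + v)" "f ((x, y + 2 * pi) + v) = f ((x, y) + v)" for x y v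
    using assms unfolding periodic2_def
    by (cases v, simp add: add.assoc add.commute[of "2*pi"] add.left_commute[of "2*pi"];
        simp add: add.assoc[symmetric])+
  then show ?thesis unfolding periodic2_def frac_diff_def by simp
qed

lemma measurable_frac_diff:
  assumes "f \<in> borel_measurable lebesgue"
  shows "frac_diff \<alpha> w f \<in> borel_measurable lebesgue"
proof -
  have "(\<lambda>z. diff_coeff \<alpha> \<nu> *\<^sub>R f (z + (\<alpha> - real \<nu>) *\<^sub>R w)) \<in> borel_measurable lebesgue" for \<nu>
    by (rule borel_measurable_scaleR[OF borel_measurable_const borel_measurable_lebesgue_shift[OF assms]])
  then have "(\<lambda>z. \<Sum>\<nu>. diff_coeff \<alpha> \<nu> *\<^sub>R f (z + (\<alpha> - real \<nu>) *\<^sub>R w)) \<in> borel_measurable lebesgue"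
    by (rule borel_measurable_suminf)
  then show ?thesis by (simp add: frac_diff_def[abs_def])
qed

text \<open>Sum and integral are exchanged for nonnegative terms, and translation invariance makes
  all integrals equal. Finiteness gives convergence almost everywhere as well as the norm
  bound.\<close>

lemma frac_diff_nn_integral:
  assumes f: "f \<in> Lp p" and p: "1 \<le> p" and \<alpha>: "0 < \<alpha>"
  shows "(\<integral>\<^sup>+z. (\<Sum>\<nu>. ennreal (\<bar>diff_coeff \<alpha> \<nu>\<bar> * norm (f (z + (\<alpha> - real \<nu>) *\<^sub>R w)) powr p)) \<partial>T2)
     = ennreal (diff_coeff_norm \<alpha> * Lp_norm p f powr p)"
proof -
  have m: "(\<lambda>z. ennreal (norm (f (z + v)) powr p)) \<in> borel_measurable T2" for v
    using measurable_norm_powr[OF borel_measurable_T2[OF borel_measurable_lebesgue_shift[OF Lp_measurable[OF f]]]] by simp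
  have "(\<integral>\<^sup>+z. (\<Sum>\<nu>. ennreal (\<bar>diff_coeff \<alpha> \<nu>\<bar> * norm (f (z + (\<alpha> - real \<nu>) *\<^sub>R w)) powr p)) \<partial>T2)
    = (\<Sum>\<nu>. \<integral>\<^sup>+z. ennreal \<bar>diff_coeff \<alpha> \<nu>\<bar> * ennreal (norm (f (z + (\<alpha> - real \<nu>) *\<^sub>R w)) powr p) \<partial>T2)"
    by (subst nn_integral_suminf[symmetric]) (use m in \<open>auto simp: ennreal_mult\<close>)
  also have "\<dots> = (\<Sum>\<nu>. ennreal \<bar>diff_coeff \<alpha> \<nu>\<bar> * ennreal (Lp_norm p f powr p))"
    using f p m by (simp add: nn_integral_cmult nn_integral_norm_powr_shift Lp_measurable Lp_periodic nn_integral_norm_powr)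
  also have "\<dots> = ennreal (diff_coeff_norm \<alpha> * Lp_norm p f powr p)"
    using summable_diff_coeff[OF \<alpha>] diff_coeff_norm_nonneg[OF \<alpha>] by (simp add: ennreal_mult diff_coeff_norm_def suminf_ennreal_eq[OF _ summable_sums])
  finally show ?thesis .
qed

text \<open>Summability with the power p follows from the finite integral; the one without it from s
  \<le> 1 + s^p and the summability of the coefficients.\<close>

lemma frac_diff_summable:
  assumes f: "f \<in> Lp p" and p: "1 \<le> p" and \<alpha>: "0 < \<alpha>"
  shows "AE z in T2. summable (\<lambda>\<nu>. \<bar>diff_coeff \<alpha> \<nu>\<bar> * norm (f (z + (\<alpha> - real \<nu>) *\<^sub>R w)) powr p)
     \<and> summable (\<lambda>\<nu>. \<bar>diff_coeff \<alpha> \<nu>\<bar> * norm (f (z + (\<alpha> - real \<nu>) *\<^sub>R w)))"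
proof -
  have m: "(\<lambda>z. ennreal (\<bar>diff_coeff \<alpha> \<nu>\<bar> * norm (f (z + (\<alpha> - real \<nu>) *\<^sub>R w)) powr p)) \<in> borel_measurable T2" for \<nu>
    using measurable_norm_powr[OF borel_measurable_T2[OF borel_measurable_lebesgue_shift[OF Lp_measurable[OF f]]]] by measurable
  have "AE z in T2. (\<Sum>\<nu>. ennreal (\<bar>diff_coeff \<alpha> \<nu>\<bar> * norm (f (z + (\<alpha> - real \<nu>) *\<^sub>R w)) powr p)) \<noteq> \<infinity>"
    by (rule nn_integral_PInf_AE) (use m frac_diff_nn_integral[OF f p \<alpha>, of w] in auto)
  then show ?thesis
  proof eventually_elim
    case (elim z)
    have 1: "summable (\<lambda>\<nu>. \<bar>diff_coeff \<alpha> \<nu>\<bar> * norm (f (z + (\<alpha> - real \<nu>) *\<^sub>R w)) powr p)"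
      using elim by (intro summable_suminf_not_top) auto
    have "summable (\<lambda>\<nu>. \<bar>diff_coeff \<alpha> \<nu>\<bar> + \<bar>diff_coeff \<alpha> \<nu>\<bar> * norm (f (z + (\<alpha> - real \<nu>) *\<^sub>R w)) powr p)"
      by (intro summable_add summable_diff_coeff[OF \<alpha>] 1)
    then have "summable (\<lambda>\<nu>. \<bar>diff_coeff \<alpha> \<nu>\<bar> * norm (f (z + (\<alpha> - real \<nu>) *\<^sub>R w)))"
    proof (rule summable_comparison_test'[of _ 0])
      fix n
      define s where "s = norm (f (z + (\<alpha> - real n) *\<^sub>R w))"
      have "s \<le> 1 + s powr p"
      proof (cases "s \<le> 1")
        case False
        then have "s powr 1 \<le> s powr p" using p by (intro powr_mono) auto
        then show ?thesis using False by simp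
      qed (simp add: add_increasing2)
      then have "\<bar>diff_coeff \<alpha> n\<bar> * s \<le> \<bar>diff_coeff \<alpha> n\<bar> * (1 + s powr p)" by (intro mult_left_mono) auto
      then show "norm (\<bar>diff_coeff \<alpha> n\<bar> * norm (f (z + (\<alpha> - real n) *\<^sub>R w))) \<le> \<bar>diff_coeff \<alpha> n\<bar> + \<bar>diff_coeff \<alpha> n\<bar> * norm (f (z + (\<alpha> - real n) *\<^sub>R w)) powr p"
        by (simp add: s_def distrib_left abs_mult)
    qed
    with 1 show ?case by blast
  qed
qed

text \<open>The pointwise Jensen inequality is integrated: the factor
  \<open>diff_coeff_norm \<alpha>\<close> to the power p - 1 combines with the one from the integral
  to the full power p.\<close>

lemma frac_diff_Lp:
  assumes f: "f \<in> Lp p" and p: "1 \<le> p" and \<alpha>: "0 < \<alpha>"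
  shows "frac_diff \<alpha> w f \<in> Lp p" and "Lp_norm p (frac_diff \<alpha> w f) \<le> diff_coeff_norm \<alpha> * Lp_norm p f"
proof -
  have m: "frac_diff \<alpha> w f \<in> borel_measurable lebesgue" by (rule measurable_frac_diff[OF Lp_measurable[OF f]])
  have "(\<integral>\<^sup>+z. ennreal (norm (frac_diff \<alpha> w f z) powr p) \<partial>T2)
    \<le> (\<integral>\<^sup>+z. ennreal (diff_coeff_norm \<alpha> powr (p - 1)) * (\<Sum>\<nu>. ennreal (\<bar>diff_coeff \<alpha> \<nu>\<bar> * norm (f (z + (\<alpha> - real \<nu>) *\<^sub>R w)) powr p)) \<partial>T2)"
  proof (rule nn_integral_mono_AE)
    show "AE z in T2. ennreal (norm (frac_diff \<alpha> w f z) powr p)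
      \<le> ennreal (diff_coeff_norm \<alpha> powr (p - 1)) * (\<Sum>\<nu>. ennreal (\<bar>diff_coeff \<alpha> \<nu>\<bar> * norm (f (z + (\<alpha> - real \<nu>) *\<^sub>R w)) powr p))"
      using frac_diff_summable[OF f p \<alpha>, of w]
    proof eventually_elim
      case (elim z)
      define a where "a = (\<lambda>\<nu>. norm (f (z + (\<alpha> - real \<nu>) *\<^sub>R w)))"
      have s: "summable (\<lambda>\<nu>. \<bar>diff_coeff \<alpha> \<nu>\<bar> * a \<nu> powr p)" "summable (\<lambda>\<nu>. \<bar>diff_coeff \<alpha> \<nu>\<bar> * a \<nu>)"
        using elim by (auto simp: a_def)
      have "norm (frac_diff \<alpha> w f z) \<le> (\<Sum>\<nu>. norm (diff_coeff \<alpha> \<nu> *\<^sub>R f (z + (\<alpha> - real \<nu>) *\<^sub>R w)))"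
        unfolding frac_diff_def using s(2) by (intro summable_norm) (simp add: a_def)
      then have "norm (frac_diff \<alpha> w f z) powr p \<le> (\<Sum>\<nu>. \<bar>diff_coeff \<alpha> \<nu>\<bar> * a \<nu>) powr p"
        using p by (intro powr_mono2) (auto simp: a_def)
      also have "\<dots> \<le> diff_coeff_norm \<alpha> powr (p - 1) * (\<Sum>\<nu>. \<bar>diff_coeff \<alpha> \<nu>\<bar> * a \<nu> powr p)"
        unfolding diff_coeff_norm_def using s by (intro suminf_powr_le p summable_diff_coeff \<alpha>) (auto simp: a_def)
      finally have "ennreal (norm (frac_diff \<alpha> w f z) powr p) \<le> ennreal (diff_coeff_norm \<alpha> powr (p - 1)) * ennreal (\<Sum>\<nu>. \<bar>diff_coeff \<alpha> \<nu>\<bar> * a \<nu> powr p)"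
        by (simp add: ennreal_mult'[symmetric] ennreal_leI)
      also have "ennreal (\<Sum>\<nu>. \<bar>diff_coeff \<alpha> \<nu>\<bar> * a \<nu> powr p) = (\<Sum>\<nu>. ennreal (\<bar>diff_coeff \<alpha> \<nu>\<bar> * a \<nu> powr p))"
        using s(1) by (subst suminf_ennreal_eq[OF _ summable_sums]) auto
      finally show ?case by (simp add: a_def)
    qed
  qed
  also have "\<dots> = ennreal (diff_coeff_norm \<alpha> powr (p - 1)) * ennreal (diff_coeff_norm \<alpha> * Lp_norm p f powr p)"
  proof -
    have "(\<lambda>z. ennreal (\<bar>diff_coeff \<alpha> \<nu>\<bar> * norm (f (z + (\<alpha> - real \<nu>) *\<^sub>R w)) powr p)) \<in> borel_measurable T2" for \<nu>
      using measurable_norm_powr[OF borel_measurable_T2[OF borel_measurable_lebesgue_shift[OF Lp_measurable[OF f]]]] by measurable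
    then show ?thesis by (subst nn_integral_cmult) (auto simp: frac_diff_nn_integral[OF f p \<alpha>])
  qed
  also have "\<dots> = ennreal ((diff_coeff_norm \<alpha> * Lp_norm p f) powr p)"
  proof -
    have "diff_coeff_norm \<alpha> powr (p - 1) * (diff_coeff_norm \<alpha> * Lp_norm p f powr p) = (diff_coeff_norm \<alpha> * Lp_norm p f) powr p"
      using diff_coeff_norm_nonneg[OF \<alpha>] powr_add[of "diff_coeff_norm \<alpha>" "p - 1" 1] p
      by (cases "diff_coeff_norm \<alpha> = 0") (auto simp: powr_mult)
    then show ?thesis using diff_coeff_norm_nonneg[OF \<alpha>] by (simp add: ennreal_mult'[symmetric])
  qed
  finally have le: "(\<integral>\<^sup>+z. ennreal (norm (frac_diff \<alpha> w f z) powr p) \<partial>T2) \<le> ennreal ((diff_coeff_norm \<alpha> * Lp_norm p f) powr p)" .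
  then show L: "frac_diff \<alpha> w f \<in> Lp p"
    using m periodic2_frac_diff[OF Lp_periodic[OF f]] by (auto simp: Lp_iff_nn_integral intro: le_less_trans)
  show "Lp_norm p (frac_diff \<alpha> w f) \<le> diff_coeff_norm \<alpha> * Lp_norm p f"
  proof (rule Lp_norm_leI)
    have "ennreal (Lp_norm p (frac_diff \<alpha> w f) powr p) \<le> ennreal ((diff_coeff_norm \<alpha> * Lp_norm p f) powr p)"
      using le nn_integral_norm_powr[OF L] p by simp
    then show "(\<integral>z. norm (frac_diff \<alpha> w f z) powr p \<partial>T2) \<le> (diff_coeff_norm \<alpha> * Lp_norm p f) powr p"
      using p by (simp add: Lp_norm_powr)
  qed (use p diff_coeff_norm_nonneg[OF \<alpha>] in auto)
qed

text \<open>A value of the difference involves countably many shifted points, and almost every point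
  has all its shifts outside the exceptional null set.\<close>

lemma frac_diff_cong_AE:
  assumes "AE z in lebesgue. f z = g z"
  shows "AE z in lebesgue. frac_diff \<alpha> w f z = frac_diff \<alpha> w g z"
proof -
  have "AE z in lebesgue. \<forall>\<nu>. f (z + (\<alpha> - real \<nu>) *\<^sub>R w) = g (z + (\<alpha> - real \<nu>) *\<^sub>R w)"
    unfolding AE_all_countable by (intro allI AE_lebesgue_shift assms)
  then show ?thesis by eventually_elim (simp add: frac_diff_def)
qed

text \<open>Only almost everywhere, since \<open>suminf\<close> is additive where both series
  converge.\<close>

lemma frac_diff_add_AE:
  assumes f: "f \<in> Lp p" and g: "g \<in> Lp p" and p: "1 \<le> p" and \<alpha>: "0 < \<alpha>"
  shows "AE z in lebesgue. frac_diff \<alpha> w (\<lambda>z. f z + g z) z = frac_diff \<alpha> w f z + frac_diff \<alpha> w g z"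
proof -
  have "AE z in T2. frac_diff \<alpha> w (\<lambda>z. f z + g z) z = frac_diff \<alpha> w f z + frac_diff \<alpha> w g z"
    using frac_diff_summable[OF f p \<alpha>, of w] frac_diff_summable[OF g p \<alpha>, of w]
  proof eventually_elim
    case (elim z)
    have "summable (\<lambda>\<nu>. diff_coeff \<alpha> \<nu> *\<^sub>R f (z + (\<alpha> - real \<nu>) *\<^sub>R w))" "summable (\<lambda>\<nu>. diff_coeff \<alpha> \<nu> *\<^sub>R g (z + (\<alpha> - real \<nu>) *\<^sub>R w))"
      by (rule summable_norm_cancel, use elim in simp)+
    then show ?case unfolding frac_diff_def by (simp add: suminf_add scaleR_add_right)
  qed
  then show ?thesis
  proof (rule Lp_eq_AE)
    have "periodic2 (\<lambda>z. f z + g z)"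
      using Lp_periodic[OF f] Lp_periodic[OF g] by (simp add: periodic2_def)
    then show "periodic2 (frac_diff \<alpha> w (\<lambda>z. f z + g z))" by (rule periodic2_frac_diff)
    show "periodic2 (\<lambda>z. frac_diff \<alpha> w f z + frac_diff \<alpha> w g z)"
      using periodic2_frac_diff[OF Lp_periodic[OF f]] periodic2_frac_diff[OF Lp_periodic[OF g]] by (simp add: periodic2_def)
  qed
qed

lemma frac_diff_trig_poly:
  assumes \<alpha>: "0 < \<alpha>"
    and d: "\<And>k. (\<lambda>\<nu>. of_real (diff_coeff \<alpha> \<nu>) * character k ((\<alpha> - real \<nu>) *\<^sub>R w)) sums d k"
  shows "frac_diff \<alpha> w (trig_poly A a) = trig_poly A (\<lambda>k. d k * a k)"
proof
  fix z
  have "(\<lambda>\<nu>. \<Sum>k\<in>A. a k * character k z * (of_real (diff_coeff \<alpha> \<nu>) * character k ((\<alpha> - real \<nu>) *\<^sub>R w))) sums (\<Sum>k\<in>A. a k * character k z * d k)"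
    by (intro sums_sum sums_mult d)
  moreover have "(\<Sum>k\<in>A. a k * character k z * (of_real (diff_coeff \<alpha> \<nu>) * character k ((\<alpha> - real \<nu>) *\<^sub>R w))) = diff_coeff \<alpha> \<nu> *\<^sub>R trig_poly A a (z + (\<alpha> - real \<nu>) *\<^sub>R w)" for \<nu>
    by (simp add: trig_poly_def character_add scaleR_conv_of_real sum_distrib_left mult_ac)
  ultimately show "frac_diff \<alpha> w (trig_poly A a) z = trig_poly A (\<lambda>k. d k * a k) z"
    by (simp add: frac_diff_def sums_iff trig_poly_def mult_ac)
qed

lemma diff1_trig_poly: "0 < \<alpha> \<Longrightarrow> diff1 \<alpha> h (trig_poly A a) = trig_poly A (\<lambda>k. diff_symbol \<alpha> h (fst k) * a k)"
  unfolding diff1_frac_diff using diff_symbol_sums by (intro frac_diff_trig_poly) (simp_all add: character_def)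

lemma diff2_trig_poly: "0 < \<alpha> \<Longrightarrow> diff2 \<alpha> h (trig_poly A a) = trig_poly A (\<lambda>k. diff_symbol \<alpha> h (snd k) * a k)"
  unfolding diff2_frac_diff using diff_symbol_sums by (intro frac_diff_trig_poly) (simp_all add: character_def)

section \<open>Weyl derivatives of trigonometric polynomials\<close>

text \<open>Fubini holds for the product of Borel measures, so the exceptional set is first enclosed
  in a Borel null set; the statement for almost every section then returns to the completed
  measures.\<close>

lemma AE_sections:
  assumes "AE z in lebesgue. P (z :: real \<times> real)"
  shows "AE x in lebesgue. AE y in lebesgue. P (x, y)" and "AE y in lebesgue. AE x in lebesgue. P (x, y)"
proof -
  have "AE z in lborel. P z" using assms by (simp add: AE_completion_iff)
  then obtain N where N: "N \<in> null_sets lborel" "{z \<in> space lborel. \<not> P z} \<subseteq> N"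
    unfolding eventually_ae_filter by blast
  have imp: "P z" if "z \<notin> N" for z using N(2) that by auto
  have "AE z in lborel \<Otimes>\<^sub>M lborel. z \<notin> N"
    unfolding lborel_prod using N(1) by (rule AE_not_in)
  then have 1: "AE x in lborel. AE y in lborel. (x, y) \<notin> N"
    by (rule lborel_pair.AE_pair)
  have "N \<in> sets (borel :: (real \<times> real) measure)" using N(1) by auto
  then have "{z \<in> space (lborel \<Otimes>\<^sub>M lborel). (fst z, snd z) \<notin> N} \<in> sets (lborel \<Otimes>\<^sub>M lborel)"
    unfolding lborel_prod by (simp add: Collect_neg_eq)
  then have 2: "AE y in lborel. AE x in lborel. (x, y) \<notin> N"
    using 1 lborel_pair.AE_commute[of "\<lambda>x y. (x, y) \<notin> N"] by simp
  show "AE x in lebesgue. AE y in lebesgue. P (x, y)"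
    unfolding AE_completion_iff using 1 by eventually_elim (auto elim!: eventually_mono intro: imp)
  show "AE y in lebesgue. AE x in lebesgue. P (x, y)"
    unfolding AE_completion_iff using 2 by eventually_elim (auto elim!: eventually_mono intro: imp)
qed

lemma completion_ex_borel_measurable_complex:
  fixes g :: "'a \<Rightarrow> complex"
  assumes "g \<in> borel_measurable (completion M)"
  shows "\<exists>g'\<in>borel_measurable M. AE x in M. g x = g' x"
proof -
  have "(\<lambda>x. Re (g x)) \<in> borel_measurable (completion M)" "(\<lambda>x. Im (g x)) \<in> borel_measurable (completion M)"
    using assms by measurable
  then obtain r s where r: "r \<in> borel_measurable M" "AE x in M. Re (g x) = r x"
    and s: "s \<in> borel_measurable M" "AE x in M. Im (g x) = s x"
    using completion_ex_borel_measurable_real by blast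
  show ?thesis
  proof (rule bexI[of _ "\<lambda>x. complex_of_real (r x) + \<i> * of_real (s x)"])
    show "(\<lambda>x. complex_of_real (r x) + \<i> * of_real (s x)) \<in> borel_measurable M"
      using r(1) s(1) by measurable
    show "AE x in M. g x = complex_of_real (r x) + \<i> * of_real (s x)"
      using r(2) s(2) by eventually_elim (simp add: complex_eq_iff)
  qed
qed

lemma integral_section_zero:
  fixes g g' :: "real \<Rightarrow> complex"
  assumes z: "(\<integral>y. g y \<partial>lebesgue_on {0..2*pi}) = 0" and g': "g' \<in> borel_measurable lborel"
    and ae: "AE y in lebesgue. g y = g' y"
  shows "(\<integral>y. indicator {0..2*pi} y *\<^sub>R g' y \<partial>lborel) = 0"
proof -
  have m': "g' \<in> borel_measurable lebesgue" using g' by (rule measurable_completion)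
  have m: "g \<in> borel_measurable lebesgue"
    by (rule borel_measurable_AE[OF m']) (use ae in \<open>auto elim: eventually_mono\<close>)
  have ms: "(\<lambda>y. indicator {0..2*pi} y *\<^sub>R h y) \<in> borel_measurable lebesgue"
    if "h \<in> borel_measurable lebesgue" for h :: "real \<Rightarrow> complex"
    by (intro borel_measurable_scaleR borel_measurable_indicator that) auto
  have "(\<integral>y. indicator {0..2*pi} y *\<^sub>R g' y \<partial>lborel) = (\<integral>y. indicator {0..2*pi} y *\<^sub>R g' y \<partial>lebesgue)"
    using g' by (subst integral_completion) auto
  also have "\<dots> = (\<integral>y. indicator {0..2*pi} y *\<^sub>R g y \<partial>lebesgue)"
    by (rule integral_cong_AE[OF ms[OF m'] ms[OF m]]) (use ae in \<open>auto elim: eventually_mono\<close>)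
  also have "\<dots> = (\<integral>y. g y \<partial>lebesgue_on {0..2*pi})"
    by (subst integral_restrict_space) auto
  finally show ?thesis using z by simp
qed

text \<open>\<open>g\<close> is replaced by a Borel function g', to which Fubini on the product of
  Borel measures applies. Almost every section of g' agrees almost everywhere with that of
  \<open>g\<close>, so the vanishing inner integrals carry over.\<close>

lemma integral_T2_zero:
  fixes g :: "real \<times> real \<Rightarrow> complex"
  assumes i: "integrable T2 g" and m: "g \<in> borel_measurable lebesgue"
    and z: "(AE x in lebesgue. (\<integral>y. g (x, y) \<partial>lebesgue_on {0..2*pi}) = 0) \<or>
            (AE y in lebesgue. (\<integral>x. g (x, y) \<partial>lebesgue_on {0..2*pi}) = 0)"
  shows "(\<integral>z. g z \<partial>T2) = 0"
proof -
  obtain g' where g': "g' \<in> borel_measurable lborel" "AE z in lborel. g z = g' z"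
    using completion_ex_borel_measurable_complex[OF m] by blast
  have ae: "AE z in lebesgue. g z = g' z" using g'(2) by (rule AE_completion)
  have m': "g' \<in> borel_measurable lebesgue" using g'(1) by (rule measurable_completion)
  have Tb: "closed_square \<in> sets borel" unfolding closed_square_eq by simp
  have ms: "(\<lambda>z. indicator closed_square z *\<^sub>R h z) \<in> borel_measurable lebesgue"
    if "h \<in> borel_measurable lebesgue" for h :: "real \<times> real \<Rightarrow> complex"
    by (intro borel_measurable_scaleR borel_measurable_indicator that) auto
  define G where "G = (\<lambda>z. indicator closed_square z *\<^sub>R g' z)"
  have Gm: "G \<in> borel_measurable lborel" unfolding G_def using g'(1) Tb by (intro borel_measurable_scaleR) auto
  have "integrable lebesgue (\<lambda>z. indicator closed_square z *\<^sub>R g z)"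
    using i unfolding T2_def by (subst (asm) integrable_restrict_space) auto
  then have "integrable lebesgue G"
    by (rule integrable_cong_AE_imp) (use measurable_completion[OF Gm] ae in \<open>auto simp: G_def elim: eventually_mono\<close>)
  then have Gi: "integrable (lborel \<Otimes>\<^sub>M lborel) G"
    unfolding lborel_prod using integrable_completion[OF Gm] by simp
  have "(\<integral>z. g z \<partial>T2) = (\<integral>z. indicator closed_square z *\<^sub>R g z \<partial>lebesgue)"
    unfolding T2_def by (subst integral_restrict_space) auto
  also have "\<dots> = (\<integral>z. G z \<partial>lebesgue)"
    unfolding G_def by (rule integral_cong_AE[OF ms[OF m] ms[OF m']]) (use ae in \<open>auto elim: eventually_mono\<close>)
  also have "\<dots> = (\<integral>z. G z \<partial>(lborel \<Otimes>\<^sub>M lborel))"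
    unfolding lborel_prod by (rule integral_completion[OF Gm])
  also have "\<dots> = 0"
    using z
  proof
    assume zx: "AE x in lebesgue. (\<integral>y. g (x, y) \<partial>lebesgue_on {0..2*pi}) = 0"
    have "AE x in lebesgue. (\<integral>y. G (x, y) \<partial>lborel) = 0"
      using zx AE_sections(1)[OF ae]
    proof eventually_elim
      case (elim x)
      have "(\<integral>y. G (x, y) \<partial>lborel) = indicator {0..2*pi} x *\<^sub>R (\<integral>y. indicator {0..2*pi} y *\<^sub>R g' (x, y) \<partial>lborel)"
        by (cases "x \<in> {0..2*pi}") (simp_all add: G_def indicator_times)
      moreover have "(\<lambda>y. g' (x, y)) \<in> borel_measurable lborel"
        using g'(1) by (intro measurable_compose[OF _ g'(1), of "\<lambda>y. (x, y)"]) measurable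
      ultimately show ?case using integral_section_zero[OF elim(1) _ elim(2)] by simp
    qed
    then have "AE x in lborel. (\<integral>y. G (x, y) \<partial>lborel) = 0" by (simp only: AE_completion_iff)
    then have "(\<integral>x. (\<integral>y. G (x, y) \<partial>lborel) \<partial>lborel) = 0" by (rule integral_eq_zero_AE)
    then show ?thesis using lborel_pair.integral_fst'[OF Gi] by simp
  next
    assume zy: "AE y in lebesgue. (\<integral>x. g (x, y) \<partial>lebesgue_on {0..2*pi}) = 0"
    have "AE y in lebesgue. (\<integral>x. G (x, y) \<partial>lborel) = 0"
      using zy AE_sections(2)[OF ae]
    proof eventually_elim
      case (elim y)
      have "(\<integral>x. G (x, y) \<partial>lborel) = indicator {0..2*pi} y *\<^sub>R (\<integral>x. indicator {0..2*pi} x *\<^sub>R g' (x, y) \<partial>lborel)"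
        by (cases "y \<in> {0..2*pi}") (simp_all add: G_def indicator_times)
      moreover have "(\<lambda>x. g' (x, y)) \<in> borel_measurable lborel"
        using g'(1) by (intro measurable_compose[OF _ g'(1), of "\<lambda>x. (x, y)"]) measurable
      ultimately show ?case using integral_section_zero[OF elim(1) _ elim(2)] by simp
    qed
    then have "AE y in lborel. (\<integral>x. G (x, y) \<partial>lborel) = 0" by (simp only: AE_completion_iff)
    then have "(\<integral>y. (\<integral>x. G (x, y) \<partial>lborel) \<partial>lborel) = 0" by (rule integral_eq_zero_AE)
    then show ?thesis using lborel_pair.integral_snd[of "\<lambda>x y. G (x, y)"] Gi by simp
  qed
  finally show ?thesis .
qed

text \<open>If one frequency is zero, the character depends on the other variable alone and leaves
  the inner integral, which vanishes by the zero-mean condition.\<close>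

lemma fcoeff_Lp0_eq_0:
  assumes f: "f \<in> Lp0 p" and p: "1 \<le> p" and k: "fst k = 0 \<or> snd k = 0"
  shows "fcoeff f k = 0"
proof -
  have fL: "f \<in> Lp p" using f by (simp add: Lp0_def)
  have e2m: "character (- k) \<in> borel_measurable lebesgue"
    using borel_measurable_continuous_onI[OF continuous_character] by (intro measurable_completion) simp
  have "(\<integral>z. f z * character (- k) z \<partial>T2) = 0"
  proof (rule integral_T2_zero[OF integrable_mult_character[OF fL p]])
    show "(\<lambda>z. f z * character (- k) z) \<in> borel_measurable lebesgue"
      by (rule borel_measurable_times[OF Lp_measurable[OF fL] e2m])
    show "(AE x in lebesgue. (\<integral>y. f (x, y) * character (- k) (x, y) \<partial>lebesgue_on {0..2*pi}) = 0) \<or>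
      (AE y in lebesgue. (\<integral>x. f (x, y) * character (- k) (x, y) \<partial>lebesgue_on {0..2*pi}) = 0)"
      using k
    proof
      assume "fst k = 0"
      then have "character (- k) (x, y) = cis (- of_int (snd k) * y)" for x y by (simp add: character_def)
      moreover have "AE y in lebesgue. (\<integral>x. f (x, y) \<partial>lebesgue_on {0..2*pi}) = 0" using f by (simp add: Lp0_def)
      ultimately show ?thesis by (intro disjI2) (auto elim!: eventually_mono)
    next
      assume "snd k = 0"
      then have "character (- k) (x, y) = cis (- of_int (fst k) * x)" for x y by (simp add: character_def)
      moreover have "AE x in lebesgue. (\<integral>y. f (x, y) \<partial>lebesgue_on {0..2*pi}) = 0" using f by (simp add: Lp0_def)
      ultimately show ?thesis by (intro disjI1) (auto elim!: eventually_mono)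
    qed
  qed
  then show ?thesis by (simp add: fcoeff_character)
qed

lemma integral_lebesgue_on_cis:
  fixes c :: "int \<times> int \<Rightarrow> complex" and n :: "int \<times> int \<Rightarrow> int"
  assumes "finite A" and "\<And>k. k \<in> A \<Longrightarrow> n k \<noteq> 0"
  shows "(\<integral>x. (\<Sum>k\<in>A. c k * cis (of_int (n k) * x)) \<partial>lebesgue_on {0..2*pi}) = 0"
proof -
  have "continuous_on {0..2*pi} (\<lambda>x. \<Sum>k\<in>A. c k * cis (of_int (n k) * x))"
    unfolding cis_conv_exp by (intro continuous_intros)
  then have "(\<lambda>x. \<Sum>k\<in>A. c k * cis (of_int (n k) * x)) absolutely_integrable_on {0..2*pi}"
    by (rule absolutely_integrable_continuous_real)
  then have "(\<integral>x. (\<Sum>k\<in>A. c k * cis (of_int (n k) * x)) \<partial>lebesgue_on {0..2*pi}) = integral {0..2*pi} (\<lambda>x. \<Sum>k\<in>A. c k * cis (of_int (n k) * x))"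
    by (intro lebesgue_integral_eq_integral) (auto simp: set_integrable_def integrable_restrict_space)
  also have "\<dots> = (\<Sum>k\<in>A. integral {0..2*pi} (\<lambda>x. c k * cis (of_int (n k) * x)))"
    by (rule Henstock_Kurzweil_Integration.integral_sum[OF assms(1)])
       (auto simp: cis_conv_exp intro!: integrable_continuous_real continuous_intros)
  also have "\<dots> = 0" using assms(2) by (simp add: integral_cis)
  finally show ?thesis .
qed

lemma trig_poly_section_integral_zero:
  assumes A: "finite A" "\<And>k. k \<in> A \<Longrightarrow> fst k \<noteq> 0 \<and> snd k \<noteq> 0"
  shows "(\<integral>y. trig_poly A a (x, y) \<partial>lebesgue_on {0..2*pi}) = 0" and "(\<integral>x. trig_poly A a (x, y) \<partial>lebesgue_on {0..2*pi}) = 0"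
proof -
  have "trig_poly A a (x, y) = (\<Sum>k\<in>A. (a k * cis (of_int (fst k) * x)) * cis (of_int (snd k) * y))"
    "trig_poly A a (x, y) = (\<Sum>k\<in>A. (a k * cis (of_int (snd k) * y)) * cis (of_int (fst k) * x))" for x y
    by (simp_all add: trig_poly_def character_def cis_mult[symmetric] mult_ac)
  then show "(\<integral>y. trig_poly A a (x, y) \<partial>lebesgue_on {0..2*pi}) = 0" "(\<integral>x. trig_poly A a (x, y) \<partial>lebesgue_on {0..2*pi}) = 0"
    using integral_lebesgue_on_cis[OF A(1), of snd "\<lambda>k. a k * cis (of_int (fst k) * x)"]
      integral_lebesgue_on_cis[OF A(1), of fst "\<lambda>k. a k * cis (of_int (snd k) * y)"] A(2) by simp_all
qed

text \<open>Phrased for any function agreeing almost everywhere with the polynomial, because the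
  Weyl derivative is an unspecified representative.\<close>

lemma Lp0_if_eq_trig_poly_AE:
  assumes A: "finite A" "\<And>k. k \<in> A \<Longrightarrow> fst k \<noteq> 0 \<and> snd k \<noteq> 0" and p: "0 < p"
    and d: "d \<in> borel_measurable lebesgue" "periodic2 d" and eq: "AE z in T2. d z = trig_poly A a z"
  shows "d \<in> Lp0 p"
proof -
  have tL: "trig_poly A a \<in> Lp p" using p by (rule trig_poly_Lp)
  have "integrable T2 (\<lambda>z. norm (d z) powr p)"
    by (rule integrable_cong_AE_imp[OF Lp_integrable[OF tL]])
       (use eq measurable_norm_powr[OF borel_measurable_T2[OF d(1)]] in \<open>auto elim: eventually_mono\<close>)
  then have "d \<in> Lp p" using d by (simp add: Lp_def)
  have ae: "AE z in lebesgue. d z = trig_poly A a z"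
    by (rule Lp_eq_AE[OF eq d(2) periodic2_trig_poly])
  have sec: "(\<integral>y. g y \<partial>lebesgue_on {0..2*pi}) = 0"
    if "AE y in lebesgue. g y = h y" "continuous_on UNIV h" "(\<integral>y. h y \<partial>lebesgue_on {0..2*pi}) = 0" for g h :: "real \<Rightarrow> complex"
  proof -
    have h: "h \<in> borel_measurable lebesgue"
      using borel_measurable_continuous_onI[OF that(2)] by (intro measurable_completion) simp
    have g: "g \<in> borel_measurable lebesgue"
      by (rule borel_measurable_AE[OF h]) (use that(1) in \<open>auto elim: eventually_mono\<close>)
    have "(\<integral>y. g y \<partial>lebesgue_on {0..2*pi}) = (\<integral>y. h y \<partial>lebesgue_on {0..2*pi})"
      by (rule integral_cong_AE)
         (use g h that(1) in \<open>auto intro!: measurable_restrict_space1 simp: AE_restrict_space_iff elim: eventually_mono\<close>)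
    then show ?thesis using that(3) by simp
  qed
  have c: "continuous_on UNIV (\<lambda>y. trig_poly A a (x, y))" "continuous_on UNIV (\<lambda>x. trig_poly A a (x, y))" for x y
    by (rule continuous_on_compose2[OF continuous_trig_poly[of UNIV A a]]; auto intro!: continuous_intros)+
  have "AE x in lebesgue. (\<integral>y. d (x, y) \<partial>lebesgue_on {0..2*pi}) = 0"
    using AE_sections(1)[OF ae]
  proof eventually_elim
    case (elim x)
    show ?case by (rule sec[OF elim c(1) trig_poly_section_integral_zero(1)[OF A]])
  qed
  moreover have "AE y in lebesgue. (\<integral>x. d (x, y) \<partial>lebesgue_on {0..2*pi}) = 0"
    using AE_sections(2)[OF ae]
  proof eventually_elim
    case (elim y)
    show ?case by (rule sec[OF elim c(2) trig_poly_section_integral_zero(2)[OF A]])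
  qed
  ultimately show ?thesis using \<open>d \<in> Lp p\<close> by (simp add: Lp0_def)
qed

text \<open>The chosen derivative has the same Fourier coefficients as the explicit polynomial,
  hence equals it almost everywhere by uniqueness. Membership in the Weyl class and the norm do not
  depend on the representative.\<close>

lemma weyl_deriv_trig_poly:
  assumes A: "finite A" "\<And>k. k \<in> A \<Longrightarrow> fst k \<noteq> 0 \<and> snd k \<noteq> 0" and p: "1 \<le> p"
  shows "trig_poly A a \<in> weyl_class p \<rho>1 \<rho>2"
    and "Lp_norm p (weyl_deriv \<rho>1 \<rho>2 (trig_poly A a)) = Lp_norm p (trig_poly A (\<lambda>k. ipow (fst k) \<rho>1 * ipow (snd k) \<rho>2 * a k))"
proof -
  define d0 where "d0 = trig_poly A (\<lambda>k. ipow (fst k) \<rho>1 * ipow (snd k) \<rho>2 * a k)"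
  have fc0: "fcoeff d0 k = (if fst k \<noteq> 0 \<and> snd k \<noteq> 0 then ipow (fst k) \<rho>1 * ipow (snd k) \<rho>2 * fcoeff (trig_poly A a) k else 0)" for k
    using A by (auto simp: d0_def fcoeff_trig_poly)
  have hw: "has_weyl_deriv \<rho>1 \<rho>2 (trig_poly A a) d0"
    unfolding has_weyl_deriv_def using fc0[of "(_, _)"] by (simp add: d0_def trig_poly_Lp)
  define d where "d = weyl_deriv \<rho>1 \<rho>2 (trig_poly A a)"
  have hd: "has_weyl_deriv \<rho>1 \<rho>2 (trig_poly A a) d"
    unfolding d_def weyl_deriv_def by (rule someI[of _ d0]) (rule hw)
  have dL: "d \<in> Lp 1" using hd by (simp add: has_weyl_deriv_def)
  have ae: "AE z in T2. d z = d0 z"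
  proof (rule fcoeff_unique[OF dL])
    show "d0 \<in> Lp 1" by (simp add: d0_def trig_poly_Lp)
    show "fcoeff d k = fcoeff d0 k" for k
      using hd fc0[of k] by (simp add: has_weyl_deriv_def)
  qed
  have "d \<in> Lp0 p"
    by (rule Lp0_if_eq_trig_poly_AE[OF A _ Lp_measurable[OF dL] Lp_periodic[OF dL] ae[unfolded d0_def]]) (use p in auto)
  moreover have "trig_poly A a \<in> Lp0 p"
    by (rule Lp0_if_eq_trig_poly_AE[OF A _ Lp_measurable[OF trig_poly_Lp[of 1]] periodic2_trig_poly]) (use p in auto)
  ultimately show "trig_poly A a \<in> weyl_class p \<rho>1 \<rho>2"
    using hw by (auto simp: weyl_class_def d_def)
  show "Lp_norm p (weyl_deriv \<rho>1 \<rho>2 (trig_poly A a)) = Lp_norm p (trig_poly A (\<lambda>k. ipow (fst k) \<rho>1 * ipow (snd k) \<rho>2 * a k))"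
    unfolding d_def[symmetric] d0_def[symmetric]
    by (rule Lp_norm_cong_AE[OF ae])
       (use dL in \<open>auto intro!: borel_measurable_T2 intro: Lp_measurable Lp_measurable[OF trig_poly_Lp[of 1]] simp: d0_def\<close>)
qed

lemma weyl_classD:
  assumes "g \<in> weyl_class p \<rho>1 \<rho>2"
  shows "g \<in> Lp p" and "weyl_deriv \<rho>1 \<rho>2 g \<in> Lp p"
    and "fcoeff (weyl_deriv \<rho>1 \<rho>2 g) k = (if fst k \<noteq> 0 \<and> snd k \<noteq> 0 then ipow (fst k) \<rho>1 * ipow (snd k) \<rho>2 * fcoeff g k else 0)"
proof -
  show "g \<in> Lp p" "weyl_deriv \<rho>1 \<rho>2 g \<in> Lp p" using assms by (auto simp: weyl_class_def Lp0_def)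
  have "\<exists>d. has_weyl_deriv \<rho>1 \<rho>2 g d" using assms by (simp add: weyl_class_def)
  then have "has_weyl_deriv \<rho>1 \<rho>2 g (weyl_deriv \<rho>1 \<rho>2 g)"
    unfolding weyl_deriv_def by (rule someI_ex)
  then show "fcoeff (weyl_deriv \<rho>1 \<rho>2 g) k = (if fst k \<noteq> 0 \<and> snd k \<noteq> 0 then ipow (fst k) \<rho>1 * ipow (snd k) \<rho>2 * fcoeff g k else 0)"
    by (simp add: has_weyl_deriv_def)
qed

section \<open>The modulus of smoothness and the K-functional\<close>

definition mixed_diff :: "real \<Rightarrow> real \<Rightarrow> real \<Rightarrow> real \<Rightarrow> (real \<times> real \<Rightarrow> complex) \<Rightarrow> real \<times> real \<Rightarrow> complex" where
  "mixed_diff \<alpha>1 \<alpha>2 h1 h2 f = diff1 \<alpha>1 h1 (diff2 \<alpha>2 h2 f)"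

lemma mixed_diff_Lp:
  assumes f: "f \<in> Lp p" and p: "1 \<le> p" and \<alpha>: "0 < \<alpha>1" "0 < \<alpha>2"
  shows "mixed_diff \<alpha>1 \<alpha>2 h1 h2 f \<in> Lp p"
    and "Lp_norm p (mixed_diff \<alpha>1 \<alpha>2 h1 h2 f) \<le> diff_coeff_norm \<alpha>1 * diff_coeff_norm \<alpha>2 * Lp_norm p f"
proof -
  have 2: "diff2 \<alpha>2 h2 f \<in> Lp p" "Lp_norm p (diff2 \<alpha>2 h2 f) \<le> diff_coeff_norm \<alpha>2 * Lp_norm p f"
    unfolding diff2_frac_diff by (rule frac_diff_Lp[OF f p \<alpha>(2)])+
  have 1: "diff1 \<alpha>1 h1 (diff2 \<alpha>2 h2 f) \<in> Lp p" "Lp_norm p (diff1 \<alpha>1 h1 (diff2 \<alpha>2 h2 f)) \<le> diff_coeff_norm \<alpha>1 * Lp_norm p (diff2 \<alpha>2 h2 f)"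
    unfolding diff1_frac_diff by (rule frac_diff_Lp[OF 2(1) p \<alpha>(1)])+
  show "mixed_diff \<alpha>1 \<alpha>2 h1 h2 f \<in> Lp p" using 1(1) by (simp add: mixed_diff_def)
  show "Lp_norm p (mixed_diff \<alpha>1 \<alpha>2 h1 h2 f) \<le> diff_coeff_norm \<alpha>1 * diff_coeff_norm \<alpha>2 * Lp_norm p f"
    using 1(2) mult_left_mono[OF 2(2) diff_coeff_norm_nonneg[OF \<alpha>(1)]] by (simp add: mixed_diff_def mult.assoc)
qed

lemma mixed_diff_add_le:
  assumes f: "f \<in> Lp p" and g: "g \<in> Lp p" and p: "1 \<le> p" and \<alpha>: "0 < \<alpha>1" "0 < \<alpha>2"
  shows "Lp_norm p (mixed_diff \<alpha>1 \<alpha>2 h1 h2 (\<lambda>z. f z + g z))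
    \<le> Lp_norm p (mixed_diff \<alpha>1 \<alpha>2 h1 h2 f) + Lp_norm p (mixed_diff \<alpha>1 \<alpha>2 h1 h2 g)"
proof -
  have L: "frac_diff \<alpha>2 (0, h2) f \<in> Lp p" "frac_diff \<alpha>2 (0, h2) g \<in> Lp p"
    by (rule frac_diff_Lp(1)[OF f p \<alpha>(2)], rule frac_diff_Lp(1)[OF g p \<alpha>(2)])
  have "AE z in lebesgue. frac_diff \<alpha>1 (h1, 0) (frac_diff \<alpha>2 (0, h2) (\<lambda>z. f z + g z)) z
      = frac_diff \<alpha>1 (h1, 0) (\<lambda>z. frac_diff \<alpha>2 (0, h2) f z + frac_diff \<alpha>2 (0, h2) g z) z"
    by (rule frac_diff_cong_AE[OF frac_diff_add_AE[OF f g p \<alpha>(2)]])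
  moreover have "AE z in lebesgue. frac_diff \<alpha>1 (h1, 0) (\<lambda>z. frac_diff \<alpha>2 (0, h2) f z + frac_diff \<alpha>2 (0, h2) g z) z
      = frac_diff \<alpha>1 (h1, 0) (frac_diff \<alpha>2 (0, h2) f) z + frac_diff \<alpha>1 (h1, 0) (frac_diff \<alpha>2 (0, h2) g) z"
    by (rule frac_diff_add_AE[OF L p \<alpha>(1)])
  ultimately have ae: "AE z in lebesgue. mixed_diff \<alpha>1 \<alpha>2 h1 h2 (\<lambda>z. f z + g z) z
      = mixed_diff \<alpha>1 \<alpha>2 h1 h2 f z + mixed_diff \<alpha>1 \<alpha>2 h1 h2 g z"
    unfolding mixed_diff_def diff1_frac_diff diff2_frac_diff by eventually_elim simp
  have Lf: "mixed_diff \<alpha>1 \<alpha>2 h1 h2 f \<in> Lp p" by (rule mixed_diff_Lp(1)[OF f p \<alpha>])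
  have Lg: "mixed_diff \<alpha>1 \<alpha>2 h1 h2 g \<in> Lp p" by (rule mixed_diff_Lp(1)[OF g p \<alpha>])
  have p0: "0 \<le> p" using p by simp
  have Lfg: "mixed_diff \<alpha>1 \<alpha>2 h1 h2 (\<lambda>z. f z + g z) \<in> Lp p"
    by (rule mixed_diff_Lp(1)[OF Lp_add[OF f g p0] p \<alpha>])
  have "Lp_norm p (mixed_diff \<alpha>1 \<alpha>2 h1 h2 (\<lambda>z. f z + g z))
      = Lp_norm p (\<lambda>z. mixed_diff \<alpha>1 \<alpha>2 h1 h2 f z + mixed_diff \<alpha>1 \<alpha>2 h1 h2 g z)"
    by (rule Lp_norm_cong_AE[OF AE_T2[OF ae] borel_measurable_T2[OF Lp_measurable[OF Lfg]]
          borel_measurable_T2[OF Lp_measurable[OF Lp_add[OF Lf Lg p0]]]])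
  also have "\<dots> \<le> Lp_norm p (mixed_diff \<alpha>1 \<alpha>2 h1 h2 f) + Lp_norm p (mixed_diff \<alpha>1 \<alpha>2 h1 h2 g)"
    by (rule Lp_norm_triangle[OF Lf Lg p])
  finally show ?thesis .
qed

text \<open>Continuity of the mixed difference, uniformly in both steps, in the form used to pass
  from Fejer means to the function itself.\<close>

lemma mixed_diff_perturb:
  assumes f: "f \<in> Lp p" and g: "g \<in> Lp p" and p: "1 \<le> p" and \<alpha>: "0 < \<alpha>1" "0 < \<alpha>2"
  shows "Lp_norm p (mixed_diff \<alpha>1 \<alpha>2 h1 h2 f)
    \<le> Lp_norm p (mixed_diff \<alpha>1 \<alpha>2 h1 h2 g) + diff_coeff_norm \<alpha>1 * diff_coeff_norm \<alpha>2 * Lp_norm p (\<lambda>z. f z - g z)"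
proof -
  have d: "(\<lambda>z. f z - g z) \<in> Lp p" using f g p by (intro Lp_diff) auto
  have "Lp_norm p (mixed_diff \<alpha>1 \<alpha>2 h1 h2 (\<lambda>z. g z + (f z - g z)))
    \<le> Lp_norm p (mixed_diff \<alpha>1 \<alpha>2 h1 h2 g) + Lp_norm p (mixed_diff \<alpha>1 \<alpha>2 h1 h2 (\<lambda>z. f z - g z))"
    by (rule mixed_diff_add_le[OF g d p \<alpha>])
  also have "\<dots> \<le> Lp_norm p (mixed_diff \<alpha>1 \<alpha>2 h1 h2 g) + diff_coeff_norm \<alpha>1 * diff_coeff_norm \<alpha>2 * Lp_norm p (\<lambda>z. f z - g z)"
    by (intro add_left_mono mixed_diff_Lp(2)[OF d p \<alpha>])
  finally show ?thesis by simp
qed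

lemma mixed_diff_trig_poly:
  assumes "0 < \<alpha>1" "0 < \<alpha>2"
  shows "mixed_diff \<alpha>1 \<alpha>2 h1 h2 (trig_poly A a) = trig_poly A (\<lambda>k. diff_symbol \<alpha>1 h1 (fst k) * (diff_symbol \<alpha>2 h2 (snd k) * a k))"
  using assms by (simp add: mixed_diff_def diff1_trig_poly diff2_trig_poly)

lemma fejer_mean_Lp: "1 \<le> p \<Longrightarrow> fejer_mean N f \<in> Lp p"
  unfolding fejer_mean_def by (simp add: trig_poly_Lp)

text \<open>Turns an identity between Fourier coefficients into a norm inequality. Both sides of the
  identity are multiplied by the Fejer weight, the bound for Fejer means is applied, and N tends to
  infinity.\<close>

lemma mixed_diff_multiplier_bound:
  assumes p: "1 \<le> p" and \<alpha>: "0 < \<alpha>1" "0 < \<alpha>2" and G: "G \<in> Lp p" "G' \<in> Lp p"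
    and m: "multiplier p C m"
    and eq: "\<And>k. diff_symbol \<alpha>1 h1 (fst k) * (diff_symbol \<alpha>2 h2 (snd k) * fcoeff G k) = m k * fcoeff G' k"
  shows "Lp_norm p (mixed_diff \<alpha>1 \<alpha>2 h1 h2 G) \<le> C * Lp_norm p G'"
proof (rule tendsto_lowerbound)
  have "(\<lambda>N. C * Lp_norm p G' + diff_coeff_norm \<alpha>1 * diff_coeff_norm \<alpha>2 * Lp_norm p (\<lambda>z. G z - fejer_mean N G z)) \<longlonglongrightarrow> C * Lp_norm p G' + diff_coeff_norm \<alpha>1 * diff_coeff_norm \<alpha>2 * 0"
    by (intro tendsto_intros fejer_mean_tendsto p G)
  then show "(\<lambda>N. C * Lp_norm p G' + diff_coeff_norm \<alpha>1 * diff_coeff_norm \<alpha>2 * Lp_norm p (\<lambda>z. G z - fejer_mean N G z)) \<longlonglongrightarrow> C * Lp_norm p G'"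
    by simp
  show "\<forall>\<^sub>F N in sequentially. Lp_norm p (mixed_diff \<alpha>1 \<alpha>2 h1 h2 G)
     \<le> C * Lp_norm p G' + diff_coeff_norm \<alpha>1 * diff_coeff_norm \<alpha>2 * Lp_norm p (\<lambda>z. G z - fejer_mean N G z)"
    using eventually_gt_at_top[of 0]
  proof eventually_elim
    case (elim N)
    have *: "diff_symbol \<alpha>1 h1 (fst k) * (diff_symbol \<alpha>2 h2 (snd k) * (fejer2 N k * fcoeff G k)) = m k * (fejer2 N k * fcoeff G' k)" for k
    proof -
      have "diff_symbol \<alpha>1 h1 (fst k) * (diff_symbol \<alpha>2 h2 (snd k) * (fejer2 N k * fcoeff G k)) = fejer2 N k * (diff_symbol \<alpha>1 h1 (fst k) * (diff_symbol \<alpha>2 h2 (snd k) * fcoeff G k))"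
        by (simp only: mult_ac)
      then show ?thesis unfolding eq by (simp only: mult_ac)
    qed
    have "mixed_diff \<alpha>1 \<alpha>2 h1 h2 (fejer_mean N G) = trig_poly (freq_box N) (\<lambda>k. m k * (fejer2 N k * fcoeff G' k))"
      unfolding fejer_mean_def mixed_diff_trig_poly[OF \<alpha>] by (rule trig_poly_cong) (rule *)
    then have "Lp_norm p (mixed_diff \<alpha>1 \<alpha>2 h1 h2 (fejer_mean N G)) \<le> C * Lp_norm p G'"
      using multiplier_fejer_mean[OF p elim m G(2)] by simp
    then show ?case
      using mixed_diff_perturb[OF G(1) fejer_mean_Lp[OF p, of N G] p \<alpha>, of h1 h2] by linarith
  qed
qed simp

section \<open>Working with the supremum and the infimum in the two definitions\<close>

lemma mixed_modulus_upper:
  assumes "f \<in> Lp p" "1 \<le> p" "0 < \<alpha>1" "0 < \<alpha>2" "\<bar>h1\<bar> \<le> \<delta>1" "\<bar>h2\<bar> \<le> \<delta>2"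
  shows "Lp_norm p (mixed_diff \<alpha>1 \<alpha>2 h1 h2 f) \<le> mixed_modulus \<alpha>1 \<alpha>2 f \<delta>1 \<delta>2 p"
proof -
  define F where "F = (\<lambda>(h1, h2). Lp_norm p (diff1 \<alpha>1 h1 (diff2 \<alpha>2 h2 f)))"
  have "bdd_above (F ` ({h1. \<bar>h1\<bar> \<le> \<delta>1} \<times> {h2. \<bar>h2\<bar> \<le> \<delta>2}))"
    using mixed_diff_Lp(2)[OF assms(1-4)]
    by (intro bdd_aboveI2[of _ _ "diff_coeff_norm \<alpha>1 * diff_coeff_norm \<alpha>2 * Lp_norm p f"]) (auto simp: F_def mixed_diff_def)
  from cSUP_upper[OF _ this, of "(h1, h2)"] show ?thesis
    using assms by (simp add: mixed_modulus_def F_def mixed_diff_def)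
qed

lemma mixed_modulus_least:
  assumes "\<And>h1 h2. \<bar>h1\<bar> \<le> \<delta>1 \<Longrightarrow> \<bar>h2\<bar> \<le> \<delta>2 \<Longrightarrow> Lp_norm p (mixed_diff \<alpha>1 \<alpha>2 h1 h2 f) \<le> W"
    and "0 \<le> \<delta>1" "0 \<le> \<delta>2"
  shows "mixed_modulus \<alpha>1 \<alpha>2 f \<delta>1 \<delta>2 p \<le> W"
  unfolding mixed_modulus_def
proof (rule cSUP_least)
  have "(0, 0) \<in> {h1. \<bar>h1\<bar> \<le> \<delta>1} \<times> {h2. \<bar>h2\<bar> \<le> \<delta>2}" using assms by simp
  then show "{h1. \<bar>h1\<bar> \<le> \<delta>1} \<times> {h2. \<bar>h2\<bar> \<le> \<delta>2} \<noteq> {}" by blast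
qed (use assms in \<open>auto simp: mixed_diff_def\<close>)

lemma K_functional_lower:
  assumes "g1 \<in> weyl_class p \<alpha>1 0" "g2 \<in> weyl_class p 0 \<alpha>2" "g \<in> weyl_class p \<alpha>1 \<alpha>2"
  shows "K_functional f t1 t2 \<alpha>1 \<alpha>2 p \<le> Lp_norm p (\<lambda>z. f z - g1 z - g2 z - g z)
        + t1 powr \<alpha>1 * Lp_norm p (weyl_deriv \<alpha>1 0 g1)
        + t2 powr \<alpha>2 * Lp_norm p (weyl_deriv 0 \<alpha>2 g2)
        + t1 powr \<alpha>1 * t2 powr \<alpha>2 * Lp_norm p (weyl_deriv \<alpha>1 \<alpha>2 g)"
proof -
  define F where "F = (\<lambda>(g1, g2, g). Lp_norm p (\<lambda>z. f z - g1 z - g2 z - g z)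
        + t1 powr \<alpha>1 * Lp_norm p (weyl_deriv \<alpha>1 0 g1)
        + t2 powr \<alpha>2 * Lp_norm p (weyl_deriv 0 \<alpha>2 g2)
        + t1 powr \<alpha>1 * t2 powr \<alpha>2 * Lp_norm p (weyl_deriv \<alpha>1 \<alpha>2 g))"
  have "bdd_below (F ` (weyl_class p \<alpha>1 0 \<times> weyl_class p 0 \<alpha>2 \<times> weyl_class p \<alpha>1 \<alpha>2))"
    by (intro bdd_belowI2[of _ 0]) (auto simp: F_def)
  from cINF_lower[OF this, of "(g1, g2, g)"] show ?thesis
    using assms by (simp add: K_functional_def F_def)
qed

text \<open>The zero polynomial lies in all three Weyl classes, so the infimum is over a nonempty
  set.\<close>

lemma K_functional_greatest:
  assumes p: "1 \<le> p"
    and "\<And>g1 g2 g. g1 \<in> weyl_class p \<alpha>1 0 \<Longrightarrow> g2 \<in> weyl_class p 0 \<alpha>2 \<Longrightarrow> g \<in> weyl_class p \<alpha>1 \<alpha>2 \<Longrightarrow>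
      W \<le> Lp_norm p (\<lambda>z. f z - g1 z - g2 z - g z)
        + t1 powr \<alpha>1 * Lp_norm p (weyl_deriv \<alpha>1 0 g1)
        + t2 powr \<alpha>2 * Lp_norm p (weyl_deriv 0 \<alpha>2 g2)
        + t1 powr \<alpha>1 * t2 powr \<alpha>2 * Lp_norm p (weyl_deriv \<alpha>1 \<alpha>2 g)"
  shows "W \<le> K_functional f t1 t2 \<alpha>1 \<alpha>2 p"
  unfolding K_functional_def
proof (rule cINF_greatest)
  have "trig_poly {} (\<lambda>_. 0) \<in> weyl_class p \<rho>1 \<rho>2" for \<rho>1 \<rho>2
    using p by (intro weyl_deriv_trig_poly(1)) auto
  then show "weyl_class p \<alpha>1 0 \<times> weyl_class p 0 \<alpha>2 \<times> weyl_class p \<alpha>1 \<alpha>2 \<noteq> {}" by blast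
qed (use assms(2) in auto)

lemma ipow_0: "n \<noteq> 0 \<Longrightarrow> ipow n 0 = 1"
  by (simp add: ipow_cis)

text \<open>For an arbitrary decomposition the mixed difference of each of the four parts is
  estimated by the matching term: in a variable in which the part is differentiated the difference
  costs the power of the step times the derivative, in the other it is merely bounded.\<close>

theorem mixed_modulus_le_K_functional:
  assumes p: "1 < p" and \<alpha>: "0 < \<alpha>1" "0 < \<alpha>2"
  shows "\<exists>C\<ge>0. \<forall>f \<in> Lp p. \<forall>\<delta>1 \<delta>2. 0 < \<delta>1 \<longrightarrow> 0 < \<delta>2 \<longrightarrow>
    mixed_modulus \<alpha>1 \<alpha>2 f \<delta>1 \<delta>2 p \<le> C * K_functional f \<delta>1 \<delta>2 \<alpha>1 \<alpha>2 p"
proof -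
  have p1: "1 \<le> p" and p0: "0 < p" using p by auto
  obtain C1 where C1: "\<And>h. \<exists>m. multiplier p C1 (\<lambda>k. m (fst k)) \<and> (\<forall>n. diff_symbol \<alpha>1 h n = of_real (\<bar>h\<bar> powr \<alpha>1) * m n * ipow n \<alpha>1)"
    using diff_symbol_ipow_factor[OF p \<alpha>(1)] by blast
  obtain C2 where C2: "\<And>h. \<exists>m. multiplier p C2 (\<lambda>k. m (fst k)) \<and> (\<forall>n. diff_symbol \<alpha>2 h n = of_real (\<bar>h\<bar> powr \<alpha>2) * m n * ipow n \<alpha>2)"
    using diff_symbol_ipow_factor[OF p \<alpha>(2)] by blast
  have C0: "0 \<le> C1" "0 \<le> C2" using C1 C2 multiplier_nonneg by blast+
  define B1 where "B1 = diff_coeff_norm \<alpha>1"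
  define B2 where "B2 = diff_coeff_norm \<alpha>2"
  have B0: "0 \<le> B1" "0 \<le> B2" by (simp_all add: B1_def B2_def diff_coeff_norm_nonneg \<alpha>)
  \<comment> \<open>Multiplied out, this contains the constants of all four parts as
    summands.\<close>
  define C where "C = (B1 + C1) * (B2 + C2)"
  have C: "0 \<le> C" "B1 * B2 \<le> C" "C1 * B2 \<le> C" "B1 * C2 \<le> C" "C1 * C2 \<le> C"
    using B0 C0 by (auto simp: C_def algebra_simps add_nonneg_nonneg add_increasing add_increasing2)
  show ?thesis
  proof (intro exI[of _ "C + 1"] conjI ballI allI impI)
    fix f and \<delta>1 \<delta>2 :: real assume f: "f \<in> Lp p" and \<delta>: "0 < \<delta>1" "0 < \<delta>2"
    have "mixed_modulus \<alpha>1 \<alpha>2 f \<delta>1 \<delta>2 p / (C + 1) \<le> K_functional f \<delta>1 \<delta>2 \<alpha>1 \<alpha>2 p"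
    proof (rule K_functional_greatest[OF p1])
      fix g1 g2 g assume g1: "g1 \<in> weyl_class p \<alpha>1 0" and g2: "g2 \<in> weyl_class p 0 \<alpha>2" and g: "g \<in> weyl_class p \<alpha>1 \<alpha>2"
      define d1 where "d1 = weyl_deriv \<alpha>1 0 g1"
      define d2 where "d2 = weyl_deriv 0 \<alpha>2 g2"
      define d where "d = weyl_deriv \<alpha>1 \<alpha>2 g"
      define r where "r = (\<lambda>z. f z - g1 z - g2 z - g z)"
      note L = weyl_classD(1)[OF g1] weyl_classD(1)[OF g2] weyl_classD(1)[OF g]
        weyl_classD(2)[OF g1, folded d1_def] weyl_classD(2)[OF g2, folded d2_def] weyl_classD(2)[OF g, folded d_def]
      have rL: "r \<in> Lp p" unfolding r_def using p by (intro Lp_diff f L) auto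
      define V where "V = Lp_norm p r + \<delta>1 powr \<alpha>1 * Lp_norm p d1 + \<delta>2 powr \<alpha>2 * Lp_norm p d2 + \<delta>1 powr \<alpha>1 * \<delta>2 powr \<alpha>2 * Lp_norm p d"
      have V0: "0 \<le> V" by (simp add: V_def)
      have "mixed_modulus \<alpha>1 \<alpha>2 f \<delta>1 \<delta>2 p \<le> C * V"
      proof (rule mixed_modulus_least)
        fix h1 h2 assume h: "\<bar>h1\<bar> \<le> \<delta>1" "\<bar>h2\<bar> \<le> \<delta>2"
        obtain m1 where m1: "multiplier p C1 (\<lambda>k. m1 (fst k))" "\<And>n. diff_symbol \<alpha>1 h1 n = of_real (\<bar>h1\<bar> powr \<alpha>1) * m1 n * ipow n \<alpha>1"
          using C1[of h1] by blast
        obtain m2 where m2': "multiplier p C2 (\<lambda>k. m2 (fst k))" "\<And>n. diff_symbol \<alpha>2 h2 n = of_real (\<bar>h2\<bar> powr \<alpha>2) * m2 n * ipow n \<alpha>2"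
          using C2[of h2] by blast
        have m2: "multiplier p C2 (\<lambda>k. m2 (snd k))" using multiplier_swap[OF m2'(1) p0] by simp
        have D1: "multiplier p B1 (\<lambda>k. diff_symbol \<alpha>1 h1 (fst k))" unfolding B1_def by (rule multiplier_diff_symbol[OF p1 \<alpha>(1)])
        have D2: "multiplier p B2 (\<lambda>k. diff_symbol \<alpha>2 h2 (snd k))"
          unfolding B2_def using multiplier_swap[OF multiplier_diff_symbol[OF p1 \<alpha>(2)] p0] by simp
        define a1 where "a1 = \<bar>h1\<bar> powr \<alpha>1"
        define a2 where "a2 = \<bar>h2\<bar> powr \<alpha>2"
        have a: "0 \<le> a1" "0 \<le> a2" "a1 \<le> \<delta>1 powr \<alpha>1" "a2 \<le> \<delta>2 powr \<alpha>2"
          using h \<alpha> by (auto simp: a1_def a2_def intro!: powr_mono2)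
        have z: "ipow 0 \<alpha>1 = 0" "ipow 0 \<alpha>2 = 0" by (simp_all add: ipow_cis)
        \<comment> \<open>Where a frequency component is zero, the coefficient of the Weyl
          derivative is zero by definition and the difference symbols vanish too, so the coefficient
          identity holds for all frequencies.\<close>
        have n1: "Lp_norm p (mixed_diff \<alpha>1 \<alpha>2 h1 h2 g1) \<le> norm (complex_of_real a1) * (C1 * B2) * Lp_norm p d1"
          by (rule mixed_diff_multiplier_bound[OF p1 \<alpha> L(1,4) multiplier_cmult[OF p0 multiplier_prod[OF m1(1) D2]]])
             (use z diff_symbol_eq_0[OF \<alpha>(2), of 0 h2] in \<open>auto simp: d1_def weyl_classD(3)[OF g1] m1(2) ipow_0 a1_def\<close>)
        have n2: "Lp_norm p (mixed_diff \<alpha>1 \<alpha>2 h1 h2 g2) \<le> norm (complex_of_real a2) * (B1 * C2) * Lp_norm p d2"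
          by (rule mixed_diff_multiplier_bound[OF p1 \<alpha> L(2,5) multiplier_cmult[OF p0 multiplier_prod[OF D1 m2]]])
             (use z diff_symbol_eq_0[OF \<alpha>(1), of 0 h1] in \<open>auto simp: d2_def weyl_classD(3)[OF g2] m2'(2) ipow_0 a2_def\<close>)
        have n3: "Lp_norm p (mixed_diff \<alpha>1 \<alpha>2 h1 h2 g) \<le> norm (complex_of_real (a1 * a2)) * (C1 * C2) * Lp_norm p d"
          by (rule mixed_diff_multiplier_bound[OF p1 \<alpha> L(3,6) multiplier_cmult[OF p0 multiplier_prod[OF m1(1) m2]]])
             (use z in \<open>auto simp: d_def weyl_classD(3)[OF g] m1(2) m2'(2) a1_def a2_def\<close>)
        have n0: "Lp_norm p (mixed_diff \<alpha>1 \<alpha>2 h1 h2 r) \<le> B1 * B2 * Lp_norm p r"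
          unfolding B1_def B2_def by (rule mixed_diff_Lp(2)[OF rL p1 \<alpha>])
        have pp: "0 \<le> p" using p by simp
        have f_eq: "f = (\<lambda>z. (r z + g1 z) + (g2 z + g z))" by (simp add: r_def fun_eq_iff)
        have "Lp_norm p (mixed_diff \<alpha>1 \<alpha>2 h1 h2 f) \<le> Lp_norm p (mixed_diff \<alpha>1 \<alpha>2 h1 h2 (\<lambda>z. r z + g1 z)) + Lp_norm p (mixed_diff \<alpha>1 \<alpha>2 h1 h2 (\<lambda>z. g2 z + g z))"
          by (subst f_eq) (rule mixed_diff_add_le[OF Lp_add[OF rL L(1) pp] Lp_add[OF L(2,3) pp] p1 \<alpha>])
        also have "\<dots> \<le> (Lp_norm p (mixed_diff \<alpha>1 \<alpha>2 h1 h2 r) + Lp_norm p (mixed_diff \<alpha>1 \<alpha>2 h1 h2 g1))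
            + (Lp_norm p (mixed_diff \<alpha>1 \<alpha>2 h1 h2 g2) + Lp_norm p (mixed_diff \<alpha>1 \<alpha>2 h1 h2 g))"
          by (intro add_mono mixed_diff_add_le[OF rL L(1) p1 \<alpha>] mixed_diff_add_le[OF L(2,3) p1 \<alpha>])
        also have "\<dots> \<le> (B1 * B2 * Lp_norm p r + norm (complex_of_real a1) * (C1 * B2) * Lp_norm p d1)
            + (norm (complex_of_real a2) * (B1 * C2) * Lp_norm p d2 + norm (complex_of_real (a1 * a2)) * (C1 * C2) * Lp_norm p d)"
          by (intro add_mono n0 n1 n2 n3)
        also have "\<dots> \<le> (C * Lp_norm p r + (\<delta>1 powr \<alpha>1) * C * Lp_norm p d1)
            + ((\<delta>2 powr \<alpha>2) * C * Lp_norm p d2 + (\<delta>1 powr \<alpha>1 * \<delta>2 powr \<alpha>2) * C * Lp_norm p d)"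
        proof -
          have "norm (complex_of_real a1) = a1" "norm (complex_of_real a2) = a2" "norm (complex_of_real (a1 * a2)) = a1 * a2"
            using a by (simp_all add: norm_mult)
          moreover have "a1 * a2 \<le> \<delta>1 powr \<alpha>1 * \<delta>2 powr \<alpha>2" using a by (intro mult_mono) auto
          ultimately show ?thesis
            using a C B0 C0 by (intro add_mono mult_right_mono mult_mono) auto
        qed
        also have "\<dots> = C * V" by (simp add: V_def algebra_simps)
        finally show "Lp_norm p (mixed_diff \<alpha>1 \<alpha>2 h1 h2 f) \<le> C * V" .
      qed (use \<delta> in auto)
      also have "\<dots> \<le> (C + 1) * V" using V0 by (simp add: algebra_simps)
      finally have "mixed_modulus \<alpha>1 \<alpha>2 f \<delta>1 \<delta>2 p / (C + 1) \<le> V"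
        using C(1) by (simp add: pos_divide_le_eq mult.commute)
      then show "mixed_modulus \<alpha>1 \<alpha>2 f \<delta>1 \<delta>2 p / (C + 1) \<le> Lp_norm p (\<lambda>z. f z - g1 z - g2 z - g z)
        + \<delta>1 powr \<alpha>1 * Lp_norm p (weyl_deriv \<alpha>1 0 g1)
        + \<delta>2 powr \<alpha>2 * Lp_norm p (weyl_deriv 0 \<alpha>2 g2)
        + \<delta>1 powr \<alpha>1 * \<delta>2 powr \<alpha>2 * Lp_norm p (weyl_deriv \<alpha>1 \<alpha>2 g)"
        unfolding V_def r_def d1_def d2_def d_def .
    qed
    then show "mixed_modulus \<alpha>1 \<alpha>2 f \<delta>1 \<delta>2 p \<le> (C + 1) * K_functional f \<delta>1 \<delta>2 \<alpha>1 \<alpha>2 p"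
      using C(1) by (simp add: pos_divide_le_eq mult.commute)
  qed (use C(1) in simp)
qed

lemma Lp_norm_trig_poly_swap_index:
  assumes "0 < p"
  shows "Lp_norm p (trig_poly (prod.swap ` A) (\<lambda>k. a (prod.swap k))) = Lp_norm p (trig_poly A a)"
proof -
  have "trig_poly A a = (\<lambda>z. trig_poly (prod.swap ` A) (\<lambda>k. a (prod.swap k)) (prod.swap z))"
    by (subst trig_poly_image) (auto simp: trig_poly_def character_def fun_eq_iff add.commute)
  then show ?thesis using Lp_norm_trig_poly_swap[OF assms, of "prod.swap ` A" "\<lambda>k. a (prod.swap k)"] by simp
qed

text \<open>Transferred from the first variable by relabelling the frequencies, since exchanging the
  variables preserves the norm.\<close>

lemma high_frequency_bound_snd:
  assumes p: "1 < p" and \<alpha>: "0 < \<alpha>"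
  shows "\<exists>C. 0 \<le> C \<and> (\<forall>\<delta> A c W. 0 < \<delta> \<and> \<delta> \<le> pi \<and> finite A \<and>
     (\<forall>h. \<bar>h\<bar> \<le> \<delta> \<longrightarrow> Lp_norm p (trig_poly A (\<lambda>k. diff_symbol \<alpha> h (snd k) * c k)) \<le> W) \<longrightarrow>
     Lp_norm p (trig_poly A (\<lambda>k. (if \<bar>of_int (snd k)\<bar> * \<delta> \<le> 3 then 0 else 1) * c k)) \<le> C * W)"
proof -
  have p0: "0 < p" using p by simp
  obtain C where C: "0 \<le> C" "\<And>\<delta> A c W. 0 < \<delta> \<and> \<delta> \<le> pi \<and> finite A \<and>
     (\<forall>h. \<bar>h\<bar> \<le> \<delta> \<longrightarrow> Lp_norm p (trig_poly A (\<lambda>k. diff_symbol \<alpha> h (fst k) * c k)) \<le> W) \<Longrightarrow>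
     Lp_norm p (trig_poly A (\<lambda>k. (if \<bar>of_int (fst k)\<bar> * \<delta> \<le> 3 then 0 else 1) * c k)) \<le> C * W"
    using high_frequency_bound[OF p \<alpha>] by blast
  show ?thesis
  proof (intro exI[of _ C] conjI allI impI C(1))
    fix \<delta> A c W
    assume *: "0 < \<delta> \<and> \<delta> \<le> pi \<and> finite A \<and> (\<forall>h. \<bar>h\<bar> \<le> \<delta> \<longrightarrow> Lp_norm p (trig_poly A (\<lambda>k. diff_symbol \<alpha> h (snd k) * c k)) \<le> W)"
    have "Lp_norm p (trig_poly (prod.swap ` A) (\<lambda>k. (if \<bar>of_int (fst k)\<bar> * \<delta> \<le> 3 then 0 else 1) * c (prod.swap k))) \<le> C * W"
    proof (rule C(2), intro conjI allI impI)
      fix h assume "\<bar>h\<bar> \<le> \<delta>"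
      then show "Lp_norm p (trig_poly (prod.swap ` A) (\<lambda>k. diff_symbol \<alpha> h (fst k) * c (prod.swap k))) \<le> W"
        using * Lp_norm_trig_poly_swap_index[OF p0, of A "\<lambda>k. diff_symbol \<alpha> h (snd k) * c k"] by simp
    qed (use * in auto)
    then show "Lp_norm p (trig_poly A (\<lambda>k. (if \<bar>of_int (snd k)\<bar> * \<delta> \<le> 3 then 0 else 1) * c k)) \<le> C * W"
      using Lp_norm_trig_poly_swap_index[OF p0, of A "\<lambda>k. (if \<bar>of_int (snd k)\<bar> * \<delta> \<le> 3 then 0 else 1) * c k"] by simp
  qed
qed

text \<open>With \<open>A\<^sub>i\<close> the sharp cutoff to frequencies \<open>\<bar>n\<^sub>i\<bar> \<delta>\<^sub>i \<le> 3\<close>, the near-optimal decomposition is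
  \<open>g\<^sub>1 = A\<^sub>1 (1 - A\<^sub>2) f\<close>, \<open>g\<^sub>2 = (1 - A\<^sub>1) A\<^sub>2 f\<close>, \<open>g = A\<^sub>1 A\<^sub>2 f\<close>.\<close>

lemma trig_poly_decomposition:
  assumes p: "1 < p" and \<alpha>: "0 < \<alpha>1" "0 < \<alpha>2"
  shows "\<exists>C\<ge>0. \<forall>\<delta>1 \<delta>2 A a W. 0 < \<delta>1 \<and> \<delta>1 \<le> pi \<and> 0 < \<delta>2 \<and> \<delta>2 \<le> pi \<and> finite A \<and>
    (\<forall>k\<in>A. fst k \<noteq> 0 \<and> snd k \<noteq> 0) \<and>
    (\<forall>h1 h2. \<bar>h1\<bar> \<le> \<delta>1 \<longrightarrow> \<bar>h2\<bar> \<le> \<delta>2 \<longrightarrow> Lp_norm p (mixed_diff \<alpha>1 \<alpha>2 h1 h2 (trig_poly A a)) \<le> W) \<longrightarrow>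
    (\<exists>g1\<in>weyl_class p \<alpha>1 0. \<exists>g2\<in>weyl_class p 0 \<alpha>2. \<exists>g\<in>weyl_class p \<alpha>1 \<alpha>2.
       Lp_norm p (\<lambda>z. trig_poly A a z - g1 z - g2 z - g z)
        + \<delta>1 powr \<alpha>1 * Lp_norm p (weyl_deriv \<alpha>1 0 g1)
        + \<delta>2 powr \<alpha>2 * Lp_norm p (weyl_deriv 0 \<alpha>2 g2)
        + \<delta>1 powr \<alpha>1 * \<delta>2 powr \<alpha>2 * Lp_norm p (weyl_deriv \<alpha>1 \<alpha>2 g) \<le> C * W)"
proof -
  have p1: "1 \<le> p" and p0: "0 < p" using p by auto
  obtain C1 where C1: "0 \<le> C1" "\<And>\<delta> A c W. 0 < \<delta> \<and> \<delta> \<le> pi \<and> finite A \<and>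
     (\<forall>h. \<bar>h\<bar> \<le> \<delta> \<longrightarrow> Lp_norm p (trig_poly A (\<lambda>k. diff_symbol \<alpha>1 h (fst k) * c k)) \<le> W) \<Longrightarrow>
     Lp_norm p (trig_poly A (\<lambda>k. (if \<bar>of_int (fst k)\<bar> * \<delta> \<le> 3 then 0 else 1) * c k)) \<le> C1 * W"
    using high_frequency_bound[OF p \<alpha>(1)] by blast
  obtain C2 where C2: "0 \<le> C2" "\<And>\<delta> A c W. 0 < \<delta> \<and> \<delta> \<le> pi \<and> finite A \<and>
     (\<forall>h. \<bar>h\<bar> \<le> \<delta> \<longrightarrow> Lp_norm p (trig_poly A (\<lambda>k. diff_symbol \<alpha>2 h (snd k) * c k)) \<le> W) \<Longrightarrow>
     Lp_norm p (trig_poly A (\<lambda>k. (if \<bar>of_int (snd k)\<bar> * \<delta> \<le> 3 then 0 else 1) * c k)) \<le> C2 * W"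
    using high_frequency_bound_snd[OF p \<alpha>(2)] by blast
  obtain E1 where E1: "\<And>\<delta>. 0 < \<delta> \<Longrightarrow> \<exists>e. multiplier p E1 (\<lambda>k. e (fst k)) \<and>
    (\<forall>n. (if \<bar>of_int n\<bar> * \<delta> \<le> 3 then ipow n \<alpha>1 else 0) = of_real (\<delta> powr (- \<alpha>1)) * e n * diff_symbol \<alpha>1 \<delta> n)"
    using ipow_low_factor[OF p \<alpha>(1)] by blast
  obtain E2 where E2: "\<And>\<delta>. 0 < \<delta> \<Longrightarrow> \<exists>e. multiplier p E2 (\<lambda>k. e (fst k)) \<and>
    (\<forall>n. (if \<bar>of_int n\<bar> * \<delta> \<le> 3 then ipow n \<alpha>2 else 0) = of_real (\<delta> powr (- \<alpha>2)) * e n * diff_symbol \<alpha>2 \<delta> n)"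
    using ipow_low_factor[OF p \<alpha>(2)] by blast
  have E0: "0 \<le> E1" "0 \<le> E2" using E1[of 1] E2[of 1] multiplier_nonneg by force+
  show ?thesis
  proof (intro exI[of _ "C1 * C2 + E1 * C2 + E2 * C1 + E1 * E2"] conjI allI impI)
    show "0 \<le> C1 * C2 + E1 * C2 + E2 * C1 + E1 * E2" using C1(1) C2(1) E0 by simp
    fix \<delta>1 \<delta>2 A a W
    assume *: "0 < \<delta>1 \<and> \<delta>1 \<le> pi \<and> 0 < \<delta>2 \<and> \<delta>2 \<le> pi \<and> finite A \<and>
      (\<forall>k\<in>A. fst k \<noteq> 0 \<and> snd k \<noteq> 0) \<and>
      (\<forall>h1 h2. \<bar>h1\<bar> \<le> \<delta>1 \<longrightarrow> \<bar>h2\<bar> \<le> \<delta>2 \<longrightarrow> Lp_norm p (mixed_diff \<alpha>1 \<alpha>2 h1 h2 (trig_poly A a)) \<le> W)"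
    then have \<delta>: "0 < \<delta>1" "\<delta>1 \<le> pi" "0 < \<delta>2" "\<delta>2 \<le> pi" and A: "finite A" "\<And>k. k \<in> A \<Longrightarrow> fst k \<noteq> 0 \<and> snd k \<noteq> 0"
      and W: "\<And>h1 h2. \<bar>h1\<bar> \<le> \<delta>1 \<Longrightarrow> \<bar>h2\<bar> \<le> \<delta>2 \<Longrightarrow>
        Lp_norm p (trig_poly A (\<lambda>k. diff_symbol \<alpha>1 h1 (fst k) * (diff_symbol \<alpha>2 h2 (snd k) * a k))) \<le> W"
      by (auto simp: mixed_diff_trig_poly[OF \<alpha>])
    \<comment> \<open>\<open>s1\<close> and \<open>s2\<close> are the complementary, high-frequency
      cutoffs, so \<open>1 - s1\<close> and \<open>1 - s2\<close> represent the low-frequency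
      projections of the decomposition.\<close>
    define s1 where "s1 = (\<lambda>k::int\<times>int. if \<bar>of_int (fst k)\<bar> * \<delta>1 \<le> 3 then 0 else 1 :: complex)"
    define s2 where "s2 = (\<lambda>k::int\<times>int. if \<bar>of_int (snd k)\<bar> * \<delta>2 \<le> 3 then 0 else 1 :: complex)"
    obtain e1 where e1: "multiplier p E1 (\<lambda>k. e1 (fst k))"
      "\<And>n. (if \<bar>of_int n\<bar> * \<delta>1 \<le> 3 then ipow n \<alpha>1 else 0) = of_real (\<delta>1 powr (- \<alpha>1)) * e1 n * diff_symbol \<alpha>1 \<delta>1 n"
      using E1[OF \<delta>(1)] by blast
    obtain e2' where e2': "multiplier p E2 (\<lambda>k. e2' (fst k))"
      "\<And>n. (if \<bar>of_int n\<bar> * \<delta>2 \<le> 3 then ipow n \<alpha>2 else 0) = of_real (\<delta>2 powr (- \<alpha>2)) * e2' n * diff_symbol \<alpha>2 \<delta>2 n"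
      using E2[OF \<delta>(3)] by blast
    have e2m: "multiplier p E2 (\<lambda>k. e2' (snd k))" using multiplier_swap[OF e2'(1) p0] by simp
    define w1 where "w1 = \<delta>1 powr \<alpha>1"
    define w2 where "w2 = \<delta>2 powr \<alpha>2"
    have w: "0 < w1" "0 < w2" "\<delta>1 powr (- \<alpha>1) = 1 / w1" "\<delta>2 powr (- \<alpha>2) = 1 / w2"
      using \<delta> by (simp_all add: w1_def w2_def powr_minus inverse_eq_divide)
    \<comment> \<open>A low-frequency derivative is the weight 1/w1 times a bounded multiplier times
      the difference with step \<delta>1; the weight cancels against the power of \<delta>1 in the
      K-functional.\<close>
    have i1: "ipow (fst k) \<alpha>1 * (1 - s1 k) = of_real (1 / w1) * (e1 (fst k) * diff_symbol \<alpha>1 \<delta>1 (fst k))" for k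
      using e1(2)[of "fst k"] by (simp add: s1_def w(3) mult.assoc split: if_splits)
    have i2: "ipow (snd k) \<alpha>2 * (1 - s2 k) = of_real (1 / w2) * (e2' (snd k) * diff_symbol \<alpha>2 \<delta>2 (snd k))" for k
      using e2'(2)[of "snd k"] by (simp add: s2_def w(4) mult.assoc split: if_splits)
    \<comment> \<open>The step h in the first variable is kept fixed and its symbol counts as part
      of the coefficients; the high-frequency bound in the second variable then uses all steps
      there.\<close>
    have H2: "Lp_norm p (trig_poly A (\<lambda>k. diff_symbol \<alpha>1 h (fst k) * (s2 k * a k))) \<le> C2 * W" if "\<bar>h\<bar> \<le> \<delta>1" for h
    proof -
      have "Lp_norm p (trig_poly A (\<lambda>k. s2 k * (diff_symbol \<alpha>1 h (fst k) * a k))) \<le> C2 * W"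
        unfolding s2_def by (rule C2(2)) (use \<delta> A W[OF that] in \<open>auto simp: mult.left_commute[of "diff_symbol \<alpha>2 _ _"]\<close>)
      then show ?thesis by (simp add: mult.left_commute[of "s2 _"])
    qed
    have H1: "Lp_norm p (trig_poly A (\<lambda>k. diff_symbol \<alpha>2 h (snd k) * (s1 k * a k))) \<le> C1 * W" if "\<bar>h\<bar> \<le> \<delta>2" for h
    proof -
      have "Lp_norm p (trig_poly A (\<lambda>k. s1 k * (diff_symbol \<alpha>2 h (snd k) * a k))) \<le> C1 * W"
        unfolding s1_def by (rule C1(2)) (use \<delta> A W[OF _ that] in auto)
      then show ?thesis by (simp add: mult.left_commute[of "s1 _"])
    qed
    define b1 where "b1 = (\<lambda>k. (1 - s1 k) * (s2 k * a k))"
    define b2 where "b2 = (\<lambda>k. (1 - s2 k) * (s1 k * a k))"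
    define b where "b = (\<lambda>k. (1 - s1 k) * ((1 - s2 k) * a k))"
    have scale: "Lp_norm p (trig_poly A (\<lambda>k. of_real (1 / v) * c k)) = Lp_norm p (trig_poly A c) / v" if "0 < v" for v c
    proof -
      have "trig_poly A (\<lambda>k. of_real (1 / v) * c k) = (\<lambda>z. of_real (1 / v) * trig_poly A c z)" by (rule ext) (rule trig_poly_cmult)
      then have "Lp_norm p (trig_poly A (\<lambda>k. of_real (1 / v) * c k)) = norm (complex_of_real (1 / v)) * Lp_norm p (trig_poly A c)"
        by (simp only: Lp_norm_cmult[OF p0])
      also have "norm (complex_of_real (1 / v)) = 1 / v" using that by (simp only: norm_of_real) simp
      finally show ?thesis by simp
    qed
    \<comment> \<open>The remainder has high frequencies in both variables. \<open>H2\<close> holds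
      for every admissible first step, and exactly this family of bounds is the hypothesis of the
      high-frequency bound in the first variable.\<close>
    have r0: "Lp_norm p (\<lambda>z. trig_poly A a z - trig_poly A b1 z - trig_poly A b2 z - trig_poly A b z) \<le> C1 * C2 * W"
    proof -
      have "trig_poly A a z - trig_poly A b1 z - trig_poly A b2 z - trig_poly A b z = trig_poly A (\<lambda>k. s1 k * (s2 k * a k)) z" for z
        unfolding trig_poly_diff[symmetric] by (rule fun_cong[OF trig_poly_cong]) (simp add: b1_def b2_def b_def algebra_simps)
      moreover have "Lp_norm p (trig_poly A (\<lambda>k. s1 k * (s2 k * a k))) \<le> C1 * (C2 * W)"
        unfolding s1_def by (rule C1(2)) (use \<delta> A H2 in auto)
      ultimately show ?thesis by (simp add: mult.assoc)
    qed
    have r1: "w1 * Lp_norm p (weyl_deriv \<alpha>1 0 (trig_poly A b1)) \<le> E1 * C2 * W"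
    proof -
      have "trig_poly A (\<lambda>k. ipow (fst k) \<alpha>1 * ipow (snd k) 0 * b1 k) = trig_poly A (\<lambda>k. of_real (1 / w1) * (e1 (fst k) * (diff_symbol \<alpha>1 \<delta>1 (fst k) * (s2 k * a k))))"
      proof (rule trig_poly_cong)
        fix k assume "k \<in> A"
        then have "ipow (fst k) \<alpha>1 * ipow (snd k) 0 * b1 k = (ipow (fst k) \<alpha>1 * (1 - s1 k)) * (s2 k * a k)"
          using A(2) by (simp add: ipow_0 b1_def mult.assoc)
        also have "\<dots> = of_real (1 / w1) * (e1 (fst k) * (diff_symbol \<alpha>1 \<delta>1 (fst k) * (s2 k * a k)))"
          unfolding i1 by (simp only: mult.assoc)
        finally show "ipow (fst k) \<alpha>1 * ipow (snd k) 0 * b1 k = of_real (1 / w1) * (e1 (fst k) * (diff_symbol \<alpha>1 \<delta>1 (fst k) * (s2 k * a k)))" .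
      qed
      then have "w1 * Lp_norm p (weyl_deriv \<alpha>1 0 (trig_poly A b1)) = Lp_norm p (trig_poly A (\<lambda>k. e1 (fst k) * (diff_symbol \<alpha>1 \<delta>1 (fst k) * (s2 k * a k))))"
        using w(1) by (simp only: weyl_deriv_trig_poly(2)[OF A p1] scale[OF w(1)]) simp
      also have "\<dots> \<le> E1 * Lp_norm p (trig_poly A (\<lambda>k. diff_symbol \<alpha>1 \<delta>1 (fst k) * (s2 k * a k)))"
        by (rule multiplierD[OF e1(1) A(1)])
      also have "\<dots> \<le> E1 * (C2 * W)" using \<delta> by (intro mult_left_mono H2 E0) auto
      finally show ?thesis by (simp add: mult.assoc)
    qed
    have r2: "w2 * Lp_norm p (weyl_deriv 0 \<alpha>2 (trig_poly A b2)) \<le> E2 * C1 * W"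
    proof -
      have "trig_poly A (\<lambda>k. ipow (fst k) 0 * ipow (snd k) \<alpha>2 * b2 k) = trig_poly A (\<lambda>k. of_real (1 / w2) * (e2' (snd k) * (diff_symbol \<alpha>2 \<delta>2 (snd k) * (s1 k * a k))))"
      proof (rule trig_poly_cong)
        fix k assume "k \<in> A"
        then have "ipow (fst k) 0 * ipow (snd k) \<alpha>2 * b2 k = (ipow (snd k) \<alpha>2 * (1 - s2 k)) * (s1 k * a k)"
          using A(2) by (simp add: ipow_0 b2_def mult.assoc)
        also have "\<dots> = of_real (1 / w2) * (e2' (snd k) * (diff_symbol \<alpha>2 \<delta>2 (snd k) * (s1 k * a k)))"
          unfolding i2 by (simp only: mult.assoc)
        finally show "ipow (fst k) 0 * ipow (snd k) \<alpha>2 * b2 k = of_real (1 / w2) * (e2' (snd k) * (diff_symbol \<alpha>2 \<delta>2 (snd k) * (s1 k * a k)))" .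
      qed
      then have "w2 * Lp_norm p (weyl_deriv 0 \<alpha>2 (trig_poly A b2)) = Lp_norm p (trig_poly A (\<lambda>k. e2' (snd k) * (diff_symbol \<alpha>2 \<delta>2 (snd k) * (s1 k * a k))))"
        using w(2) by (simp only: weyl_deriv_trig_poly(2)[OF A p1] scale[OF w(2)]) simp
      also have "\<dots> \<le> E2 * Lp_norm p (trig_poly A (\<lambda>k. diff_symbol \<alpha>2 \<delta>2 (snd k) * (s1 k * a k)))"
        by (rule multiplierD[OF e2m A(1)])
      also have "\<dots> \<le> E2 * (C1 * W)" using \<delta> by (intro mult_left_mono H1 E0) auto
      finally show ?thesis by (simp add: mult.assoc)
    qed
    have r3: "w1 * w2 * Lp_norm p (weyl_deriv \<alpha>1 \<alpha>2 (trig_poly A b)) \<le> E1 * E2 * W"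
    proof -
      have "trig_poly A (\<lambda>k. ipow (fst k) \<alpha>1 * ipow (snd k) \<alpha>2 * b k) = trig_poly A (\<lambda>k. of_real (1 / (w1 * w2)) * (e1 (fst k) * (e2' (snd k) * (diff_symbol \<alpha>1 \<delta>1 (fst k) * (diff_symbol \<alpha>2 \<delta>2 (snd k) * a k)))))"
      proof (rule trig_poly_cong)
        fix k
        have "ipow (fst k) \<alpha>1 * ipow (snd k) \<alpha>2 * b k = (ipow (fst k) \<alpha>1 * (1 - s1 k)) * ((ipow (snd k) \<alpha>2 * (1 - s2 k)) * a k)"
          by (simp add: b_def mult_ac)
        also have "\<dots> = of_real (1 / (w1 * w2)) * (e1 (fst k) * (e2' (snd k) * (diff_symbol \<alpha>1 \<delta>1 (fst k) * (diff_symbol \<alpha>2 \<delta>2 (snd k) * a k))))"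
          unfolding i1 i2 by (simp add: mult_ac)
        finally show "ipow (fst k) \<alpha>1 * ipow (snd k) \<alpha>2 * b k = of_real (1 / (w1 * w2)) * (e1 (fst k) * (e2' (snd k) * (diff_symbol \<alpha>1 \<delta>1 (fst k) * (diff_symbol \<alpha>2 \<delta>2 (snd k) * a k))))" .
      qed
      then have "w1 * w2 * Lp_norm p (weyl_deriv \<alpha>1 \<alpha>2 (trig_poly A b)) = Lp_norm p (trig_poly A (\<lambda>k. e1 (fst k) * (e2' (snd k) * (diff_symbol \<alpha>1 \<delta>1 (fst k) * (diff_symbol \<alpha>2 \<delta>2 (snd k) * a k)))))"
        using w(1,2) by (simp only: weyl_deriv_trig_poly(2)[OF A p1] scale[OF mult_pos_pos[OF w(1,2)]]) simp
      also have "\<dots> \<le> E1 * Lp_norm p (trig_poly A (\<lambda>k. e2' (snd k) * (diff_symbol \<alpha>1 \<delta>1 (fst k) * (diff_symbol \<alpha>2 \<delta>2 (snd k) * a k))))"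
        by (rule multiplierD[OF e1(1) A(1)])
      also have "\<dots> \<le> E1 * (E2 * Lp_norm p (trig_poly A (\<lambda>k. diff_symbol \<alpha>1 \<delta>1 (fst k) * (diff_symbol \<alpha>2 \<delta>2 (snd k) * a k))))"
        by (intro mult_left_mono multiplierD[OF e2m A(1)] E0)
      also have "\<dots> \<le> E1 * (E2 * W)" using \<delta> by (intro mult_left_mono W E0) auto
      finally show ?thesis by (simp add: mult.assoc)
    qed
    show "\<exists>g1\<in>weyl_class p \<alpha>1 0. \<exists>g2\<in>weyl_class p 0 \<alpha>2. \<exists>g\<in>weyl_class p \<alpha>1 \<alpha>2.
       Lp_norm p (\<lambda>z. trig_poly A a z - g1 z - g2 z - g z)
        + \<delta>1 powr \<alpha>1 * Lp_norm p (weyl_deriv \<alpha>1 0 g1)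
        + \<delta>2 powr \<alpha>2 * Lp_norm p (weyl_deriv 0 \<alpha>2 g2)
        + \<delta>1 powr \<alpha>1 * \<delta>2 powr \<alpha>2 * Lp_norm p (weyl_deriv \<alpha>1 \<alpha>2 g) \<le> (C1 * C2 + E1 * C2 + E2 * C1 + E1 * E2) * W"
    proof (intro bexI)
      show "Lp_norm p (\<lambda>z. trig_poly A a z - trig_poly A b1 z - trig_poly A b2 z - trig_poly A b z)
        + \<delta>1 powr \<alpha>1 * Lp_norm p (weyl_deriv \<alpha>1 0 (trig_poly A b1))
        + \<delta>2 powr \<alpha>2 * Lp_norm p (weyl_deriv 0 \<alpha>2 (trig_poly A b2))
        + \<delta>1 powr \<alpha>1 * \<delta>2 powr \<alpha>2 * Lp_norm p (weyl_deriv \<alpha>1 \<alpha>2 (trig_poly A b)) \<le> (C1 * C2 + E1 * C2 + E2 * C1 + E1 * E2) * W"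
        using r0 r1 r2 r3 unfolding w1_def w2_def by (simp add: distrib_right)
    qed (rule weyl_deriv_trig_poly(1)[OF A p1], assumption)+
  qed
qed

text \<open>The decomposition is built for each Fejer mean and serves as a competitor for f itself.
  It varies with N and is not claimed to converge; only the resulting bounds for the infimum pass to
  the limit.\<close>

theorem K_functional_le_mixed_modulus:
  assumes p: "1 < p" and \<alpha>: "0 < \<alpha>1" "0 < \<alpha>2"
  shows "\<exists>C\<ge>0. \<forall>f \<in> Lp0 p. \<forall>\<delta>1 \<delta>2. 0 < \<delta>1 \<and> \<delta>1 \<le> pi \<and> 0 < \<delta>2 \<and> \<delta>2 \<le> pi \<longrightarrow>
    K_functional f \<delta>1 \<delta>2 \<alpha>1 \<alpha>2 p \<le> C * mixed_modulus \<alpha>1 \<alpha>2 f \<delta>1 \<delta>2 p"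
proof -
  have p1: "1 \<le> p" and p0: "0 \<le> p" using p by auto
  obtain C where C: "0 \<le> C" "\<And>\<delta>1 \<delta>2 A a W. 0 < \<delta>1 \<and> \<delta>1 \<le> pi \<and> 0 < \<delta>2 \<and> \<delta>2 \<le> pi \<and> finite A \<and>
    (\<forall>k\<in>A. fst k \<noteq> 0 \<and> snd k \<noteq> 0) \<and>
    (\<forall>h1 h2. \<bar>h1\<bar> \<le> \<delta>1 \<longrightarrow> \<bar>h2\<bar> \<le> \<delta>2 \<longrightarrow> Lp_norm p (mixed_diff \<alpha>1 \<alpha>2 h1 h2 (trig_poly A a)) \<le> W) \<Longrightarrow>
    (\<exists>g1\<in>weyl_class p \<alpha>1 0. \<exists>g2\<in>weyl_class p 0 \<alpha>2. \<exists>g\<in>weyl_class p \<alpha>1 \<alpha>2.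
       Lp_norm p (\<lambda>z. trig_poly A a z - g1 z - g2 z - g z)
        + \<delta>1 powr \<alpha>1 * Lp_norm p (weyl_deriv \<alpha>1 0 g1)
        + \<delta>2 powr \<alpha>2 * Lp_norm p (weyl_deriv 0 \<alpha>2 g2)
        + \<delta>1 powr \<alpha>1 * \<delta>2 powr \<alpha>2 * Lp_norm p (weyl_deriv \<alpha>1 \<alpha>2 g) \<le> C * W)"
    using trig_poly_decomposition[OF p \<alpha>] by blast
  show ?thesis
  proof (intro exI[of _ C] conjI ballI allI impI C(1))
    fix f \<delta>1 \<delta>2 assume f0: "f \<in> Lp0 p" and \<delta>: "0 < \<delta>1 \<and> \<delta>1 \<le> pi \<and> 0 < \<delta>2 \<and> \<delta>2 \<le> pi"
    have f: "f \<in> Lp p" using f0 by (simp add: Lp0_def)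
    define \<omega> where "\<omega> = mixed_modulus \<alpha>1 \<alpha>2 f \<delta>1 \<delta>2 p"
    define B where "B = diff_coeff_norm \<alpha>1 * diff_coeff_norm \<alpha>2"
    define \<epsilon> where "\<epsilon> = (\<lambda>N. Lp_norm p (\<lambda>z. f z - fejer_mean N f z))"
    have lim: "\<epsilon> \<longlonglongrightarrow> 0" unfolding \<epsilon>_def by (rule fejer_mean_tendsto[OF p1 f])
    have "K_functional f \<delta>1 \<delta>2 \<alpha>1 \<alpha>2 p \<le> \<epsilon> N + C * (\<omega> + B * \<epsilon> N)" for N
    proof -
      \<comment> \<open>The zero-mean condition removes all coefficients with a vanishing frequency
        component, so that the polynomial and its parts lie in the Weyl classes.\<close>
      define A where "A = {k \<in> freq_box N. fst k \<noteq> 0 \<and> snd k \<noteq> 0}"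
      define a where "a = (\<lambda>k. fejer2 N k * fcoeff f k)"
      have P: "fejer_mean N f = trig_poly A a"
        unfolding fejer_mean_def a_def[symmetric]
        by (rule trig_poly_mono_neutral[symmetric]) (auto simp: A_def a_def fcoeff_Lp0_eq_0[OF f0 p1])
      have PL: "trig_poly A a \<in> Lp p" using p by (simp add: trig_poly_Lp)
      have W: "Lp_norm p (mixed_diff \<alpha>1 \<alpha>2 h1 h2 (trig_poly A a)) \<le> \<omega> + B * \<epsilon> N" if "\<bar>h1\<bar> \<le> \<delta>1" "\<bar>h2\<bar> \<le> \<delta>2" for h1 h2
      proof -
        have "Lp_norm p (\<lambda>z. trig_poly A a z - f z) = \<epsilon> N"
          by (simp add: \<epsilon>_def P Lp_norm_def norm_minus_commute)
        then show ?thesis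
          using mixed_diff_perturb[OF PL f p1 \<alpha>, of h1 h2] mixed_modulus_upper[OF f p1 \<alpha> that]
          by (simp add: \<omega>_def B_def)
      qed
      obtain g1 g2 g where g: "g1 \<in> weyl_class p \<alpha>1 0" "g2 \<in> weyl_class p 0 \<alpha>2" "g \<in> weyl_class p \<alpha>1 \<alpha>2"
        and le: "Lp_norm p (\<lambda>z. trig_poly A a z - g1 z - g2 z - g z)
        + \<delta>1 powr \<alpha>1 * Lp_norm p (weyl_deriv \<alpha>1 0 g1)
        + \<delta>2 powr \<alpha>2 * Lp_norm p (weyl_deriv 0 \<alpha>2 g2)
        + \<delta>1 powr \<alpha>1 * \<delta>2 powr \<alpha>2 * Lp_norm p (weyl_deriv \<alpha>1 \<alpha>2 g) \<le> C * (\<omega> + B * \<epsilon> N)"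
        using C(2)[of \<delta>1 \<delta>2 A a "\<omega> + B * \<epsilon> N"] \<delta> W by (auto simp: A_def)
      have "Lp_norm p (\<lambda>z. (f z - trig_poly A a z) + (trig_poly A a z - g1 z - g2 z - g z))
        \<le> Lp_norm p (\<lambda>z. f z - trig_poly A a z) + Lp_norm p (\<lambda>z. trig_poly A a z - g1 z - g2 z - g z)"
        by (intro Lp_norm_triangle Lp_diff f PL weyl_classD(1)[OF g(1)] weyl_classD(1)[OF g(2)] weyl_classD(1)[OF g(3)] p1 p0)
      then have "Lp_norm p (\<lambda>z. f z - g1 z - g2 z - g z) \<le> \<epsilon> N + Lp_norm p (\<lambda>z. trig_poly A a z - g1 z - g2 z - g z)"
        by (simp add: \<epsilon>_def P algebra_simps)
      then show ?thesis
        using K_functional_lower[OF g, of f \<delta>1 \<delta>2] le by linarith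
    qed
    moreover have "(\<lambda>N. \<epsilon> N + C * (\<omega> + B * \<epsilon> N)) \<longlonglongrightarrow> 0 + C * (\<omega> + B * 0)"
      by (intro tendsto_intros lim)
    ultimately have "K_functional f \<delta>1 \<delta>2 \<alpha>1 \<alpha>2 p \<le> 0 + C * (\<omega> + B * 0)"
      by (intro LIMSEQ_le_const) auto
    then show "K_functional f \<delta>1 \<delta>2 \<alpha>1 \<alpha>2 p \<le> C * mixed_modulus \<alpha>1 \<alpha>2 f \<delta>1 \<delta>2 p"
      by (simp add: \<omega>_def)
  qed
qed

theorem theorem6p1:
  fixes p \<alpha>1 \<alpha>2 :: real
  assumes "1 < p" and "0 < \<alpha>1" and "0 < \<alpha>2"
  shows "\<exists>C>0. \<forall>f \<in> Lp0 p. \<forall>\<delta>1 \<delta>2 :: real.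
           0 < \<delta>1 \<and> \<delta>1 \<le> pi \<and> 0 < \<delta>2 \<and> \<delta>2 \<le> pi \<longrightarrow>
             K_functional f \<delta>1 \<delta>2 \<alpha>1 \<alpha>2 p / C \<le> mixed_modulus \<alpha>1 \<alpha>2 f \<delta>1 \<delta>2 p \<and>
             mixed_modulus \<alpha>1 \<alpha>2 f \<delta>1 \<delta>2 p \<le> C * K_functional f \<delta>1 \<delta>2 \<alpha>1 \<alpha>2 p"
proof -
  obtain C1 where C1: "0 \<le> C1" "\<And>f \<delta>1 \<delta>2. f \<in> Lp p \<Longrightarrow> 0 < \<delta>1 \<Longrightarrow> 0 < \<delta>2 \<Longrightarrow>
      mixed_modulus \<alpha>1 \<alpha>2 f \<delta>1 \<delta>2 p \<le> C1 * K_functional f \<delta>1 \<delta>2 \<alpha>1 \<alpha>2 p"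
    using mixed_modulus_le_K_functional[OF assms] by blast
  obtain C2 where C2: "0 \<le> C2" "\<And>f \<delta>1 \<delta>2. f \<in> Lp0 p \<Longrightarrow> 0 < \<delta>1 \<and> \<delta>1 \<le> pi \<and> 0 < \<delta>2 \<and> \<delta>2 \<le> pi \<Longrightarrow>
      K_functional f \<delta>1 \<delta>2 \<alpha>1 \<alpha>2 p \<le> C2 * mixed_modulus \<alpha>1 \<alpha>2 f \<delta>1 \<delta>2 p"
    using K_functional_le_mixed_modulus[OF assms] by blast
  show ?thesis
  proof (intro exI[of _ "C1 + C2 + 1"] conjI ballI allI impI)
    show "0 < C1 + C2 + 1" using C1(1) C2(1) by simp
    fix f \<delta>1 \<delta>2 assume f: "f \<in> Lp0 p" and \<delta>: "0 < \<delta>1 \<and> \<delta>1 \<le> pi \<and> 0 < \<delta>2 \<and> \<delta>2 \<le> pi"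
    have fL: "f \<in> Lp p" using f by (simp add: Lp0_def)
    define K where "K = K_functional f \<delta>1 \<delta>2 \<alpha>1 \<alpha>2 p"
    define \<omega> where "\<omega> = mixed_modulus \<alpha>1 \<alpha>2 f \<delta>1 \<delta>2 p"
    \<comment> \<open>Nonnegativity of both quantities lets the two constants be enlarged to a
      common positive one.\<close>
    have "0 \<le> K" unfolding K_def using assms by (intro K_functional_greatest) auto
    have "0 \<le> \<omega>"
      unfolding \<omega>_def
      by (rule order_trans[OF Lp_norm_nonneg mixed_modulus_upper[OF fL _ assms(2,3), of 0 _ 0]]) (use assms \<delta> in auto)
    have "K \<le> C2 * \<omega>" unfolding K_def \<omega>_def by (rule C2(2)[OF f \<delta>])
    also have "\<dots> \<le> (C1 + C2 + 1) * \<omega>" using C1(1) \<open>0 \<le> \<omega>\<close> by (intro mult_right_mono) auto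
    finally show "K_functional f \<delta>1 \<delta>2 \<alpha>1 \<alpha>2 p / (C1 + C2 + 1) \<le> mixed_modulus \<alpha>1 \<alpha>2 f \<delta>1 \<delta>2 p"
      using C1(1) C2(1) unfolding K_def[symmetric] \<omega>_def[symmetric] by (simp add: pos_divide_le_eq mult.commute)
    have "\<omega> \<le> C1 * K" unfolding K_def \<omega>_def using \<delta> by (intro C1(2) fL) auto
    also have "\<dots> \<le> (C1 + C2 + 1) * K" using C2(1) \<open>0 \<le> K\<close> by (intro mult_right_mono) auto
    finally show "mixed_modulus \<alpha>1 \<alpha>2 f \<delta>1 \<delta>2 p \<le> (C1 + C2 + 1) * K_functional f \<delta>1 \<delta>2 \<alpha>1 \<alpha>2 p"
      unfolding K_def \<omega>_def .
  qed
qed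

end
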